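(* Let $X_1,X_2,\dots$ be iid real random variables with cdf $F$ and quantile function $Q=F^{-1}$. Assume that $Q$ is locally absolutely continuous on $(0,1)$ and satisfies $$\int_0^1\sqrt{u(1-u)}\,\mathrm{d}Q(u)<\infty .$$ Let $q:(0,1)\to\mathbb R$ be a density for $Q$, and let $B$ be a Brownian bridge. For each $n$ let $F_n$ and $Q_n=F_n^{-1}$ be the empirical cdf and the empirical quantile function of $X_1,\dots,X_n$, and let $Q_n^\ast=(F_n^{\ast})^{-1}$ be the Efron bootstrap counterpart to $Q_n$. Then: 1. $\sqrt{n}(Q_n-Q)\rightsquigarrow -qB$ in $L^1(0,1)$; 2. $\left\Vert\sqrt{n}(Q_n-Q)+q\cdot\sqrt{n}(F_n\circ Q-F\circ Q)\right\Vert_1\to0$ in probability; 3. $\sqrt{n}(Q_n^\ast-Q_n)\rightsquigarrow -qB$ in $L^1(0,1)$ conditionally on the data in probability.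
   Context: $L^1(0,1)$ is the space of Lebesgue integrable functions $f:(0,1)\to\mathbb R$ (functions equal off a Lebesgue null set are identified) with norm $\lVert f\rVert_1=\int_0^1|f(u)|\,\mathrm{d}u$. Quantile functions: for a cdf $G:\mathbb R\to[0,1]$, its quantile function (generalized inverse) is $G^{-1}:(0,1)\to\mathbb R$, $G^{-1}(u)=\inf\{x\in\mathbb R:G(x)\ge u\}$. It is nondecreasing and left-continuous. Integrals $\int\cdot\,\mathrm{d}Q$ are Lebesgue--Stieltjes integrals with respect to the unique Radon measure $\mu_Q$ on $(0,1)$ with $\mu_Q([a,b))=Q(b)-Q(a)$ for $0<a<b<1$; $\int_0^1\cdot\,\mathrm{d}Q$ is over the open interval $(0,1)$. $Q$ is locally absolutely continuous if its restriction to each compact subinterval of $(0,1)$ is absolutely continuous. In that case a density for $Q$ is a nonnegative locally integrable function $q:(0,1)\to\mathbb R$ with $Q(b)-Q(a)=\int_a^b q(u)\,\mathrm{d}u$ for $0<a<b<1$; it is unique up to null sets. Sampling and bootstrap: $(X_n)$ is an iid sequence on a probability space $(\Omega,\mathcal F,\mathbb P)$, and $F_n(x)=n^{-1}\sum_{i=1}^n\mathbf 1(X_i\le x)$. A second probability space $(\Omega',\mathcal F',\mathbb P')$ carries, for each $n$, bootstrap weights $(W_{n,1},\dots,W_{n,n})$ having the multinomial distribution based on $n$ draws from the categories $1,\dots,n$ with equal probabilities $1/n$. On the product probability space $(\Omega\times\Omega',\mathcal F\otimes\mathcal F',\mathbb P\otimes\mathbb P')$ (so the weights are independent of the data) define $F_n^\ast(x)=n^{-1}\sum_{i=1}^n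 W_{n,i}\mathbf 1(X_i\le x)$ and $Q_n^\ast=(F_n^\ast)^{-1}$. A Brownian bridge $B$ is a centered Gaussian process on $[0,1]$ with covariance $\min(s,t)-st$ and continuous sample paths vanishing at $0$ and $1$. Under the condition $\int_0^1\sqrt{u(1-u)}\,\mathrm{d}Q(u)<\infty$ with $Q$ locally absolutely continuous, $Q\in L^1(0,1)$ and, with probability one, $qB\in L^1(0,1)$; $qB$ denotes the $L^1(0,1)$-valued random variable $u\mapsto q(u)B(u)$ (defined arbitrarily on a probability-zero event). The symbol $\rightsquigarrow$ denotes convergence in distribution in the indicated metric space. For an $L^1(0,1)$-valued random variable $T$, "$Z_n\rightsquigarrow T$ in $L^1(0,1)$ conditionally on the data in probability" means $$\sup_{\psi\in \mathrm{BL}_1}\left|\mathbb E'\,\psi(Z_n)-\mathbb E\,\psi(T)\right|\to0\quad\text{in (outer) probability},$$ where $\mathbb E'$ denotes expectation over the bootstrap weights only (with the data $X_1,\dots,X_n$ held fixed) and $\mathrm{BL}_1$ is the set of functions $\psi:L^1(0,1)\to[-1,1]$ with $|\psi(f)-\psi(g)|\le\lVert f-g\rVert_1$ for all $f,g$. *)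

theory Defs
  imports "HOL-Probability.Probability"
begin

section \<open>The normed space \<open>L\<^sup>1(0,1)\<close>\<close>

text \<open>Functions on \<open>(0,1)\<close> are represented by total functions whose values elsewhere are irrelevant.\<close>

abbreviation unit_leb :: "real measure" where
  "unit_leb \<equiv> lebesgue_on {0<..<1}"

definition L1_rel :: "(real \<Rightarrow> real) \<Rightarrow> (real \<Rightarrow> real) \<Rightarrow> bool" where
  "L1_rel f g \<longleftrightarrow> integrable unit_leb f \<and> integrable unit_leb g \<and> (AE u in unit_leb. f u = g u)"

lemma part_equivp_L1_rel: "part_equivp L1_rel"
proof (rule part_equivpI)
  show "\<exists>f. L1_rel f f" by (rule exI[of _ "\<lambda>_. 0"]) (simp add: L1_rel_def)
  show "symp L1_rel" by (rule sympI) (auto simp: L1_rel_def)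
  show "transp L1_rel" by (rule transpI) (auto simp: L1_rel_def)
qed

quotient_type l1 = "real \<Rightarrow> real" / partial: L1_rel
  by (rule part_equivp_L1_rel)

instantiation l1 :: real_vector
begin

lift_definition zero_l1 :: l1 is "\<lambda>_. 0" by (simp add: L1_rel_def)
lift_definition plus_l1 :: "l1 \<Rightarrow> l1 \<Rightarrow> l1" is "\<lambda>f g u. f u + g u" by (auto simp: L1_rel_def)
lift_definition minus_l1 :: "l1 \<Rightarrow> l1 \<Rightarrow> l1" is "\<lambda>f g u. f u - g u" by (auto simp: L1_rel_def)
lift_definition uminus_l1 :: "l1 \<Rightarrow> l1" is "\<lambda>f u. - f u" by (auto simp: L1_rel_def)
lift_definition scaleR_l1 :: "real \<Rightarrow> l1 \<Rightarrow> l1" is "\<lambda>c f u. c * f u" by (auto simp: L1_rel_def)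

instance
proof
  fix a b c :: l1 and r s :: real
  show "a + b + c = a + (b + c)" by transfer (auto simp: L1_rel_def)
  show "a + b = b + a" by transfer (auto simp: L1_rel_def)
  show "0 + a = a" by transfer (auto simp: L1_rel_def)
  show "- a + a = 0" by transfer (auto simp: L1_rel_def)
  show "a - b = a + - b" by transfer (auto simp: L1_rel_def)
  show "r *\<^sub>R (a + b) = r *\<^sub>R a + r *\<^sub>R b" by transfer (auto simp: L1_rel_def algebra_simps)
  show "(r + s) *\<^sub>R a = r *\<^sub>R a + s *\<^sub>R a" by transfer (auto simp: L1_rel_def algebra_simps)
  show "r *\<^sub>R s *\<^sub>R a = (r * s) *\<^sub>R a" by transfer (auto simp: L1_rel_def algebra_simps)
  show "1 *\<^sub>R a = a" by transfer (auto simp: L1_rel_def)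
qed

end

instantiation l1 :: real_normed_vector
begin

lift_definition norm_l1 :: "l1 \<Rightarrow> real" is "\<lambda>f. \<integral>u. \<bar>f u\<bar> \<partial>unit_leb"
  unfolding L1_rel_def by (intro integral_cong_AE) auto

definition dist_l1 :: "l1 \<Rightarrow> l1 \<Rightarrow> real" where "dist_l1 f g = norm (f - g)"
definition sgn_l1 :: "l1 \<Rightarrow> l1" where "sgn_l1 f = f /\<^sub>R norm f"
definition uniformity_l1 :: "(l1 \<times> l1) filter" where
  "uniformity_l1 = (INF e\<in>{0 <..}. principal {(x, y). dist x y < e})"
definition open_l1 :: "l1 set \<Rightarrow> bool" where
  "open_l1 S = (\<forall>x\<in>S. \<forall>\<^sub>F (x', y) in uniformity. x' = x \<longrightarrow> y \<in> S)"

instance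
proof
  fix a b :: l1 and r :: real and S :: "l1 set"
  show "dist a b = norm (a - b)" by (rule dist_l1_def)
  show "sgn a = a /\<^sub>R norm a" by (rule sgn_l1_def)
  show "uniformity = (INF e\<in>{0 <..}. principal {(x, y :: l1). dist x y < e})" by (rule uniformity_l1_def)
  show "open S = (\<forall>x\<in>S. \<forall>\<^sub>F (x', y) in uniformity. x' = x \<longrightarrow> y \<in> S)" by (rule open_l1_def)
  show "(norm a = 0) = (a = 0)"
    by transfer (auto simp: L1_rel_def integral_nonneg_eq_0_iff_AE)
  show "norm (a + b) \<le> norm a + norm b"
  proof transfer
    fix f g assume "L1_rel f f" "L1_rel g g"
    then have f: "integrable unit_leb f" and g: "integrable unit_leb g" by (auto simp: L1_rel_def)
    have "(\<integral>u. \<bar>f u + g u\<bar> \<partial>unit_leb) \<le> (\<integral>u. \<bar>f u\<bar> + \<bar>g u\<bar> \<partial>unit_leb)"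
      using f g by (intro integral_mono) auto
    also have "\<dots> = (\<integral>u. \<bar>f u\<bar> \<partial>unit_leb) + (\<integral>u. \<bar>g u\<bar> \<partial>unit_leb)"
      using f g by simp
    finally show "(\<integral>u. \<bar>f u + g u\<bar> \<partial>unit_leb) \<le> (\<integral>u. \<bar>f u\<bar> \<partial>unit_leb) + (\<integral>u. \<bar>g u\<bar> \<partial>unit_leb)" .
  qed
  show "norm (r *\<^sub>R a) = \<bar>r\<bar> * norm a" by transfer (simp add: abs_mult)
qed

end

text \<open>The class of a function; non-integrable functions are sent to \<open>0\<close>.\<close>

lift_definition L1_of :: "(real \<Rightarrow> real) \<Rightarrow> l1"
  is "\<lambda>f. if integrable unit_leb f then f else (\<lambda>_. 0)"
  by (simp add: L1_rel_def)

lemma norm_L1_of: "integrable unit_leb f \<Longrightarrow> norm (L1_of f) = (\<integral>u. \<bar>f u\<bar> \<partial>unit_leb)"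
  by transfer simp

lemma L1_of_eq_iff:
  "integrable unit_leb f \<Longrightarrow> integrable unit_leb g \<Longrightarrow>
    L1_of f = L1_of g \<longleftrightarrow> (AE u in unit_leb. f u = g u)"
  by transfer (simp add: L1_rel_def)

lemma L1_of_surj: "\<exists>f. integrable unit_leb f \<and> x = L1_of f"
  by transfer (auto simp: L1_rel_def)


section \<open>Modes of convergence\<close>

text \<open>The outer measure is the measure whenever the event is measurable.\<close>

definition tendsto_0_in_prob :: "'a measure \<Rightarrow> (nat \<Rightarrow> 'a \<Rightarrow> ennreal) \<Rightarrow> bool" where
  "tendsto_0_in_prob M Y \<longleftrightarrow>
    (\<forall>e::real. e > 0 \<longrightarrow>
      (\<lambda>n. outer_measure_of M {x \<in> space M. Y n x > ennreal e}) \<longlonglongrightarrow> 0)"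

definition conv_in_distr ::
    "'a measure \<Rightarrow> (nat \<Rightarrow> 'a \<Rightarrow> 's::metric_space) \<Rightarrow> 'c measure \<Rightarrow> ('c \<Rightarrow> 's) \<Rightarrow> bool" where
  "conv_in_distr M Z N T \<longleftrightarrow>
    (\<forall>n. Z n \<in> borel_measurable M) \<and> T \<in> borel_measurable N \<and>
    (\<forall>\<phi>::'s \<Rightarrow> real. continuous_on UNIV \<phi> \<and> bounded (range \<phi>) \<longrightarrow>
      (\<lambda>n. \<integral>x. \<phi> (Z n x) \<partial>M) \<longlonglongrightarrow> (\<integral>y. \<phi> (T y) \<partial>N))"

definition BL1 :: "('s::metric_space \<Rightarrow> real) set" where
  "BL1 = {\<psi>. (\<forall>x. \<psi> x \<in> {-1..1}) \<and> (\<forall>x y. \<bar>\<psi> x - \<psi> y\<bar> \<le> dist x y)}"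

text \<open>The data live on \<open>M\<close>, the bootstrap weights on \<open>M'\<close>; the inner integral over \<open>M'\<close> is
  the expectation over the weights with the data held fixed.\<close>

definition cond_conv_in_prob ::
    "'a measure \<Rightarrow> 'b measure \<Rightarrow> (nat \<Rightarrow> 'a \<times> 'b \<Rightarrow> 's::metric_space) \<Rightarrow>
      'c measure \<Rightarrow> ('c \<Rightarrow> 's) \<Rightarrow> bool" where
  "cond_conv_in_prob M M' Z N T \<longleftrightarrow>
    (\<forall>n. Z n \<in> borel_measurable (M \<Otimes>\<^sub>M M')) \<and> T \<in> borel_measurable N \<and>
    tendsto_0_in_prob M
      (\<lambda>n x. SUP \<psi>\<in>BL1. ennreal \<bar>(\<integral>x'. \<psi> (Z n (x, x')) \<partial>M') - (\<integral>y. \<psi> (T y) \<partial>N)\<bar>)"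

text \<open>For processes with paths in \<open>L\<^sup>1(0,1)\<close>: almost every path is integrable, so the
  value \<open>0\<close> that \<^const>\<open>L1_of\<close> assigns to non-integrable paths only matters on a null event.\<close>

definition conv_in_distr_L1 ::
    "'a measure \<Rightarrow> (nat \<Rightarrow> 'a \<Rightarrow> real \<Rightarrow> real) \<Rightarrow> 'c measure \<Rightarrow> ('c \<Rightarrow> real \<Rightarrow> real) \<Rightarrow> bool" where
  "conv_in_distr_L1 M Z N T \<longleftrightarrow>
    (\<forall>n. AE x in M. integrable unit_leb (Z n x)) \<and> (AE y in N. integrable unit_leb (T y)) \<and>
    conv_in_distr M (\<lambda>n x. L1_of (Z n x)) N (\<lambda>y. L1_of (T y))"

definition cond_conv_in_prob_L1 ::
    "'a measure \<Rightarrow> 'b measure \<Rightarrow> (nat \<Rightarrow> 'a \<times> 'b \<Rightarrow> real \<Rightarrow> real) \<Rightarrow>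
      'c measure \<Rightarrow> ('c \<Rightarrow> real \<Rightarrow> real) \<Rightarrow> bool" where
  "cond_conv_in_prob_L1 M M' Z N T \<longleftrightarrow>
    (\<forall>n. AE x in M \<Otimes>\<^sub>M M'. integrable unit_leb (Z n x)) \<and>
    (AE y in N. integrable unit_leb (T y)) \<and>
    cond_conv_in_prob M M' (\<lambda>n x. L1_of (Z n x)) N (\<lambda>y. L1_of (T y))"


section \<open>Quantile functions\<close>

definition quantile :: "(real \<Rightarrow> real) \<Rightarrow> real \<Rightarrow> real" where
  "quantile G u = Inf {x. G x \<ge> u}"

definition is_stieltjes_measure :: "(real \<Rightarrow> real) \<Rightarrow> real measure \<Rightarrow> bool" where
  "is_stieltjes_measure Q \<mu> \<longleftrightarrow>
    sets \<mu> = sets (restrict_space borel {0<..<1}) \<and>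
    (\<forall>a b. 0 < a \<and> a < b \<and> b < 1 \<longrightarrow> emeasure \<mu> {a..<b} = ennreal (Q b - Q a))"

text \<open>A Borel measure on \<open>(0,1)\<close> that is finite on all \<open>[a,b)\<close> is automatically Radon.
  Existence and uniqueness for quantile functions are proved below.\<close>

definition stieltjes_measure :: "(real \<Rightarrow> real) \<Rightarrow> real measure" where
  "stieltjes_measure Q = (THE \<mu>. is_stieltjes_measure Q \<mu>)"

lemma is_stieltjes_measure_unique:
  assumes "is_stieltjes_measure Q \<mu>" "is_stieltjes_measure Q \<nu>"
  shows "\<mu> = \<nu>"
proof -
  define E where "E = {{a..<b} | a b :: real. 0 < a \<and> a < b \<and> b < 1} \<union> {{}}"
  have E_sub: "E \<subseteq> Pow {0<..<1}" by (auto simp: E_def)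
  have gen: "sets (restrict_space borel {0<..<1::real}) = sigma_sets {0<..<1} E"
  proof
    have bor: "sets borel = sigma_sets UNIV (range (\<lambda>a::real. {a..}))"
      by (subst borel_Ici) simp
    have "{0<..<1::real} \<in> sigma_sets UNIV (range (\<lambda>a::real. {a..}))"
      unfolding bor[symmetric] by simp
    then have "sets (restrict_space borel {0<..<1::real}) =
        sigma_sets {0<..<1} ((\<inter>) {0<..<1} ` range (\<lambda>a::real. {a..}))"
      unfolding sets_restrict_space bor by (subst sigma_sets_Int) auto
    also have "\<dots> \<subseteq> sigma_sets {0<..<1} E"
    proof (rule sigma_sets_mono, rule subsetI)
      fix S assume "S \<in> (\<inter>) {0<..<1} ` range (\<lambda>a::real. {a..})"
      then obtain a where S: "S = {0<..<1} \<inter> {a..}" by auto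
      define I where "I = {(c::real, d::real). c \<in> \<rat> \<and> d \<in> \<rat> \<and> 0 < c \<and> d < 1}"
      have "countable I"
        by (rule countable_subset[of _ "\<rat> \<times> \<rat>"]) (auto simp: I_def countable_rat)
      moreover have "{max a c..<d} \<in> sigma_sets {0<..<1} E" if "(c, d) \<in> I" for c d
      proof (cases "max a c < d")
        case True
        with that have "{max a c..<d} \<in> E"
          unfolding E_def I_def by (intro UnI1 CollectI exI[of _ "max a c"] exI[of _ d]) auto
        then show ?thesis by (rule sigma_sets.Basic)
      next
        case False
        then have "{max a c..<d} = {}" by auto
        then show ?thesis by (simp only: sigma_sets.Empty)
      qed
      ultimately have "(\<Union>(c, d)\<in>I. {max a c..<d}) \<in> sigma_sets {0<..<1} E"
        by (intro sigma_sets_UNION) (auto intro!: countable_image)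
      moreover have "(\<Union>(c, d)\<in>I. {max a c..<d}) = S"
      proof (intro equalityI subsetI)
        fix x assume "x \<in> S"
        then have x: "0 < x" "x < 1" "a \<le> x" by (auto simp: S)
        obtain c where "c \<in> \<rat>" "0 < c" "c < x" using Rats_dense_in_real[OF x(1)] by auto
        moreover obtain d where "d \<in> \<rat>" "x < d" "d < 1" using Rats_dense_in_real[OF x(2)] by auto
        ultimately have "(c, d) \<in> I" "x \<in> {max a c..<d}" using x by (auto simp: I_def)
        then show "x \<in> (\<Union>(c, d)\<in>I. {max a c..<d})" by (intro UN_I[of "(c, d)"]) auto
      qed (auto simp: S I_def)
      ultimately show "S \<in> sigma_sets {0<..<1} E" by simp
    qed
    finally show "sets (restrict_space borel {0<..<1::real}) \<subseteq> sigma_sets {0<..<1} E" .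
    show "sigma_sets {0<..<1} E \<subseteq> sets (restrict_space borel {0<..<1::real})"
    proof (rule sets.sigma_sets_subset')
      show "E \<subseteq> sets (restrict_space borel {0<..<1})"
        by (auto simp: E_def sets_restrict_space_iff)
    qed (auto simp: sets_restrict_space_iff)
  qed
  define A :: "nat \<Rightarrow> real set" where "A i = {1 / (real i + 3)..<1 - 1 / (real i + 3)}" for i
  have A_pos: "0 < 1 / (real i + 3)" "1 / (real i + 3) < 1 - 1 / (real i + 3)"
    "1 - 1 / (real i + 3) < 1" for i
    by (auto simp: field_simps)
  have A_E: "A i \<in> E" for i
    unfolding E_def A_def using A_pos[of i] by blast
  show ?thesis
  proof (rule measure_eqI_generator_eq[where E=E and \<Omega>="{0<..<1}" and A=A])
    show "Int_stable E"
    proof (rule Int_stableI)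
      fix S T assume "S \<in> E" "T \<in> E"
      then consider "S \<inter> T = {}" | a b c d where "S = {a..<b}" "T = {c..<d}"
        "0 < a" "a < b" "b < 1" "0 < c" "c < d" "d < 1"
        by (auto simp: E_def)
      then show "S \<inter> T \<in> E"
      proof cases
        case 1
        then show ?thesis by (simp add: E_def)
      next
        case 2
        show ?thesis
        proof (cases "max a c < min b d")
          case True
          have "S \<inter> T = {max a c..<min b d}" using 2 by auto
          then show ?thesis
            unfolding E_def using True 2
            by (intro UnI1 CollectI exI[of _ "max a c"] exI[of _ "min b d"]) auto
        next
          case False
          then have "S \<inter> T = {}" using 2 by auto
          then show ?thesis by (simp add: E_def)
        qed
      qed
    qed
    show "E \<subseteq> Pow {0<..<1}" by (rule E_sub)
    show "emeasure \<mu> S = emeasure \<nu> S" if "S \<in> E" for S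
      using that assms by (auto simp: E_def is_stieltjes_measure_def)
    show "sets \<mu> = sigma_sets {0<..<1} E" "sets \<nu> = sigma_sets {0<..<1} E"
      using assms gen by (auto simp: is_stieltjes_measure_def)
    show "range A \<subseteq> E" using A_E by auto
    show "(\<Union>i. A i) = {0<..<1}"
    proof (intro equalityI subsetI)
      fix x assume "x \<in> (\<Union>i. A i)"
      then show "x \<in> {0<..<1}" using A_E E_sub by blast
    next
      fix x :: real assume "x \<in> {0<..<1}"
      then have "0 < min x (1 - x)" by auto
      then obtain n where n: "inverse (real (Suc n)) < min x (1 - x)"
        using reals_Archimedean by blast
      have "1 / (real n + 3) \<le> inverse (real (Suc n))" by (simp add: field_simps)
      with n have "x \<in> A n" by (auto simp: A_def)
      then show "x \<in> (\<Union>i. A i)" by blast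
    qed
    show "emeasure \<mu> (A i) \<noteq> \<infinity>" for i
      using assms(1) A_pos[of i] by (auto simp: is_stieltjes_measure_def A_def)
  qed
qed

lemma quantile_galois:
  assumes "real_distribution \<mu>" "0 < u" "u < 1"
  shows "quantile (cdf \<mu>) u \<le> x \<longleftrightarrow> u \<le> cdf \<mu> x"
proof -
  interpret real_distribution \<mu> by fact
  interpret right_continuous_mono "cdf \<mu>" 0 1
    by standard
      (auto simp: cdf_is_right_cont cdf_lim_at_bot cdf_lim_at_top_prob cdf_nondecreasing intro!: monoI)
  show ?thesis
    using pseudoinverse[OF assms(2,3), of x] by (simp add: quantile_def)
qed

lemma stieltjes_measure_quantile:
  assumes "real_distribution \<mu>"
  shows "is_stieltjes_measure (quantile (cdf \<mu>)) (stieltjes_measure (quantile (cdf \<mu>)))"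
proof -
  interpret real_distribution \<mu> by fact
  let ?Q = "quantile (cdf \<mu>)"
  let ?\<nu> = "restrict_space (distr lborel borel (cdf \<mu>)) {0<..<1}"
  have meas: "cdf \<mu> \<in> borel_measurable borel"
    by (intro borel_measurable_mono monoI cdf_nondecreasing)
  have "is_stieltjes_measure ?Q ?\<nu>"
    unfolding is_stieltjes_measure_def
  proof (intro conjI allI impI)
    show "sets ?\<nu> = sets (restrict_space borel {0<..<1})"
      by (simp add: sets_restrict_space)
    fix a b :: real assume ab: "0 < a \<and> a < b \<and> b < 1"
    have vim: "cdf \<mu> -` {a..<b} = {?Q a..<?Q b}"
    proof (rule set_eqI)
      fix x
      show "x \<in> cdf \<mu> -` {a..<b} \<longleftrightarrow> x \<in> {?Q a..<?Q b}"
        using ab quantile_galois[OF assms, of a x] quantile_galois[OF assms, of b x]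
        by (auto simp: not_le[symmetric])
    qed
    have "?Q a \<le> ?Q b"
      using ab quantile_galois[OF assms, of b "?Q b"] quantile_galois[OF assms, of a "?Q b"] by auto
    then show "emeasure ?\<nu> {a..<b} = ennreal (?Q b - ?Q a)"
      using ab meas vim by (subst emeasure_restrict_space) (auto simp: emeasure_distr)
  qed
  then show ?thesis
    unfolding stieltjes_measure_def by (metis is_stieltjes_measure_unique theI)
qed

definition abs_continuous_on :: "real set \<Rightarrow> (real \<Rightarrow> real) \<Rightarrow> bool" where
  "abs_continuous_on S f \<longleftrightarrow>
    (\<forall>e>0. \<exists>d>0. \<forall>(m::nat) a b.
      (\<forall>k<m. a k \<le> b k \<and> {a k..b k} \<subseteq> S) \<and>
      disjoint_family_on (\<lambda>k. {a k<..<b k}) {..<m} \<and> (\<Sum>k<m. b k - a k) < d \<longrightarrow>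
      (\<Sum>k<m. \<bar>f (b k) - f (a k)\<bar>) < e)"

definition locally_abs_continuous :: "(real \<Rightarrow> real) \<Rightarrow> bool" where
  "locally_abs_continuous Q \<longleftrightarrow> (\<forall>a b. 0 < a \<and> a < b \<and> b < 1 \<longrightarrow> abs_continuous_on {a..b} Q)"

definition is_density :: "(real \<Rightarrow> real) \<Rightarrow> (real \<Rightarrow> real) \<Rightarrow> bool" where
  "is_density Q q \<longleftrightarrow>
    (\<forall>u\<in>{0<..<1}. q u \<ge> 0) \<and>
    (\<forall>a b. 0 < a \<and> a < b \<and> b < 1 \<longrightarrow>
      set_integrable lebesgue {a..b} q \<and> Q b - Q a = (LINT u:{a..b}|lebesgue. q u))"


section \<open>Sampling and the bootstrap\<close>

definition iid_cdf :: "'a measure \<Rightarrow> (nat \<Rightarrow> 'a \<Rightarrow> real) \<Rightarrow> (real \<Rightarrow> real) \<Rightarrow> bool" where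
  "iid_cdf M X F \<longleftrightarrow>
    prob_space.indep_vars M (\<lambda>_. borel) X UNIV \<and>
    (\<forall>i j. distr M borel (X i) = distr M borel (X j)) \<and>
    (\<forall>i. cdf (distr M borel (X i)) = F)"

text \<open>The sample of size \<open>n\<close> is \<open>x 0, \<dots>, x (n - 1)\<close>.\<close>

definition emp_cdf :: "nat \<Rightarrow> (nat \<Rightarrow> real) \<Rightarrow> real \<Rightarrow> real" where
  "emp_cdf n x t = (\<Sum>i<n. indicator {x i..} t) / n"

definition boot_cdf :: "nat \<Rightarrow> (nat \<Rightarrow> nat) \<Rightarrow> (nat \<Rightarrow> real) \<Rightarrow> real \<Rightarrow> real" where
  "boot_cdf n w x t = (\<Sum>i<n. real (w i) * indicator {x i..} t) / n"

definition multinomial_mass :: "nat \<Rightarrow> 'i set \<Rightarrow> ('i \<Rightarrow> real) \<Rightarrow> ('i \<Rightarrow> nat) \<Rightarrow> real" where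
  "multinomial_mass m I p k =
    (if (\<Sum>i\<in>I. k i) = m then fact m / (\<Prod>i\<in>I. fact (k i)) * (\<Prod>i\<in>I. p i ^ k i) else 0)"

definition multinomial_distributed ::
    "'b measure \<Rightarrow> nat \<Rightarrow> 'i set \<Rightarrow> ('i \<Rightarrow> real) \<Rightarrow> ('i \<Rightarrow> 'b \<Rightarrow> nat) \<Rightarrow> bool" where
  "multinomial_distributed M m I p W \<longleftrightarrow>
    (\<forall>i\<in>I. W i \<in> measurable M (count_space UNIV)) \<and>
    (\<forall>k. measure M {x \<in> space M. \<forall>i\<in>I. W i x = k i} = multinomial_mass m I p k)"


section \<open>Brownian bridges\<close>

text \<open>Degenerate normal distributions are included.\<close>

definition gaussian_rv :: "'c measure \<Rightarrow> ('c \<Rightarrow> real) \<Rightarrow> bool" where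
  "gaussian_rv N Z \<longleftrightarrow> Z \<in> borel_measurable N \<and>
    (\<exists>\<mu>. (AE y in N. Z y = \<mu>) \<or> (\<exists>\<sigma>>0. distributed N lborel Z (normal_density \<mu> \<sigma>)))"

definition brownian_bridge :: "'c measure \<Rightarrow> ('c \<Rightarrow> real \<Rightarrow> real) \<Rightarrow> bool" where
  "brownian_bridge N B \<longleftrightarrow>
    (\<forall>J c. finite J \<and> J \<subseteq> {0..1} \<longrightarrow> gaussian_rv N (\<lambda>y. \<Sum>t\<in>J. c t * B y t)) \<and>
    (\<forall>t\<in>{0..1}. (\<integral>y. B y t \<partial>N) = 0) \<and>
    (\<forall>s\<in>{0..1}. \<forall>t\<in>{0..1}. (\<integral>y. B y s * B y t \<partial>N) = min s t - s * t) \<and>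
    (\<forall>y\<in>space N. continuous_on {0..1} (B y) \<and> B y 0 = 0 \<and> B y 1 = 0)"

end

theory Submission
  imports Defs "HOL-Combinatorics.Multiset_Permutations"
begin

text \<open>Write \<open>D = sqrt n (F_n - F)\<close>. The area between two quantile functions is the area between their
  cdfs, so \<open>sqrt n (Q_n - Q)\<close> has the same \<open>L\<^sup>1\<close> norm as \<open>D\<close> and, after the substitution \<open>x = Q u\<close>, as
  \<open>q (D o Q)\<close>. Inverting \<open>F_n\<close> locally, as Bahadur does, gives \<open>sqrt n (Q_n - Q) + q (D o Q) \<longlongrightarrow> 0\<close> in
  probability at almost every \<open>u\<close>; since the norms agree, a Scheffe type argument turns this into
  convergence of the expected \<open>L\<^sup>1\<close> distance. Only bounds on second moments are used, so the same holds
  for the bootstrap cdf.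

  It remains to treat \<open>- q (D o Q)\<close>. The integrability condition makes the error of sampling \<open>D o Q\<close> on
  a finite grid small in expectation, uniformly in \<open>n\<close>. Bounded Lipschitz functions of the finitely many
  remaining coordinates are uniformly close to combinations, with bounded coefficients, of one finite
  set of trigonometric polynomials, whose expectations are controlled by a quantitative central limit
  theorem for characteristic functions. Multinomial weights count the indices in \<open>n\<close> uniform draws, so
  given the data the bootstrap cdf is the empirical cdf of an iid sample.\<close>

section \<open>The space \<open>L\<^sup>1(0,1)\<close>\<close>

text \<open>Two features of the setting shape the development. The first is that \<open>F\<close>
  may jump and \<open>q\<close> may be unbounded. At a point \<open>u\<close> where \<open>Q\<close>
  is differentiable and \<open>F (Q u)\<close> differs from \<open>u\<close>, the derivative is
  zero; so once a factor \<open>q\<close> is present, the passage from \<open>u\<close> to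
  \<open>F (Q u)\<close> becomes invisible almost everywhere. The second is measurability.
  Separability of \<open>l1\<close> is never established: \<open>l1\<close>-valued maps are handled
  as limits of finite combinations of fixed vectors with real random coefficients. Fubini arguments
  run on \<open>unit_borel\<close>, which is why the given density is exchanged for a Borel version.
  The supremum over \<open>BL1\<close> need not be measurable, so it is bounded by one measurable
  function that does not depend on the test function. This is the reason for a finite family of
  trigonometric polynomials common to all Lipschitz functions, and for approximation errors of
  quadratic growth: such errors are absorbed by second moments.\<close>

abbreviation unit_borel :: "real measure" where
  "unit_borel \<equiv> restrict_space lborel {0<..<1}"

lemma prob_space_unit_borel: "prob_space unit_borel"
  by standard (simp add: emeasure_restrict_space space_restrict_space)

interpretation unit_borel: prob_space unit_borel
  by (rule prob_space_unit_borel)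

lemma space_unit_borel [simp]: "space unit_borel = {0<..<1}"
  by (simp add: space_restrict_space)

lemma measurable_unit_borelI [intro]: "f \<in> borel_measurable borel \<Longrightarrow> f \<in> borel_measurable unit_borel"
  by (rule measurable_restrict_space1) simp

lemma measurable_unit_borel_iff:
  fixes f :: "real \<Rightarrow> real"
  shows "f \<in> borel_measurable unit_borel \<longleftrightarrow> (\<lambda>x. indicator {0<..<1} x * f x) \<in> borel_measurable borel"
  by (subst borel_measurable_restrict_space_iff) auto

lemma measurable_unit_leb:
  fixes f :: "real \<Rightarrow> real"
  assumes "f \<in> borel_measurable unit_borel" shows "f \<in> borel_measurable unit_leb"
proof -
  have "(\<lambda>x. indicator {0<..<1} x * f x) \<in> borel_measurable lebesgue"
    using assms unfolding measurable_unit_borel_iff by (simp add: measurable_completion)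
  then show ?thesis
    by (subst borel_measurable_restrict_space_iff) auto
qed

lemma nn_integral_unit_leb:
  fixes f :: "real \<Rightarrow> ennreal"
  assumes "f \<in> borel_measurable unit_borel"
  shows "(\<integral>\<^sup>+u. f u \<partial>unit_leb) = (\<integral>\<^sup>+u. f u \<partial>unit_borel)"
proof -
  have m: "(\<lambda>x. f x * indicator {0<..<1} x) \<in> borel_measurable lborel"
    using assms by (subst (asm) borel_measurable_restrict_space_iff_ennreal) auto
  show ?thesis
    by (subst (1 2) nn_integral_restrict_space) (auto simp: nn_integral_completion)
qed

lemma integrable_unit_lebI:
  fixes f :: "real \<Rightarrow> real"
  assumes "f \<in> borel_measurable unit_borel" "(\<integral>\<^sup>+u. ennreal \<bar>f u\<bar> \<partial>unit_borel) < \<infinity>"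
  shows "integrable unit_leb f"
proof (rule integrableI_bounded)
  show "f \<in> borel_measurable unit_leb" using assms(1) by (rule measurable_unit_leb)
  have "(\<lambda>u. ennreal \<bar>f u\<bar>) \<in> borel_measurable unit_borel" using assms(1) by measurable
  then show "(\<integral>\<^sup>+u. ennreal (norm (f u)) \<partial>unit_leb) < \<infinity>"
    using assms(2) by (simp add: nn_integral_unit_leb)
qed

lemma integrable_unit_leb_iff:
  fixes f :: "real \<Rightarrow> real"
  assumes "f \<in> borel_measurable unit_borel"
  shows "integrable unit_leb f \<longleftrightarrow> (\<integral>\<^sup>+u. ennreal \<bar>f u\<bar> \<partial>unit_borel) < \<infinity>"
proof -
  have "(\<lambda>u. ennreal \<bar>f u\<bar>) \<in> borel_measurable unit_borel" using assms(1) by measurable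
  then show ?thesis
    using measurable_unit_leb[OF assms] by (auto simp: integrable_iff_bounded nn_integral_unit_leb)
qed

text \<open>Completeness of Lebesgue measure makes null-set modifications harmless; this is how the
  given density inherits measurability from its Borel version.\<close>

lemma unit_leb_measurable_AE:
  fixes f g :: "real \<Rightarrow> real"
  assumes f: "f \<in> borel_measurable unit_leb" and eq: "AE u in unit_leb. f u = g u"
  shows "g \<in> borel_measurable unit_leb"
proof -
  have "AE u in lebesgue. u \<in> {0<..<1} \<longrightarrow> f u = g u"
    using eq by (subst (asm) AE_restrict_space_iff) auto
  then have "AE u in lebesgue. indicator {0<..<1} u * f u = indicator {0<..<1} u * g u"
    by eventually_elim (auto simp: indicator_def)
  moreover have "(\<lambda>u. indicator {0<..<1} u * f u) \<in> borel_measurable lebesgue"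
    using f by (subst (asm) borel_measurable_restrict_space_iff) auto
  ultimately have "(\<lambda>u. indicator {0<..<1} u * g u) \<in> borel_measurable lebesgue"
    by (rule borel_measurable_AE[rotated])
  then show ?thesis by (subst borel_measurable_restrict_space_iff) auto
qed

lemma unit_const_integrable: "integrable unit_leb (\<lambda>u. c :: real)"
  by (rule integrable_unit_lebI) (use unit_borel.emeasure_space_1 in \<open>auto simp: ennreal_mult_less_top\<close>)

lemma L1_of_add:
  "integrable unit_leb f \<Longrightarrow> integrable unit_leb g \<Longrightarrow> L1_of (\<lambda>u. f u + g u) = L1_of f + L1_of g"
  by transfer (auto simp: L1_rel_def)

lemma L1_of_diff:
  "integrable unit_leb f \<Longrightarrow> integrable unit_leb g \<Longrightarrow> L1_of (\<lambda>u. f u - g u) = L1_of f - L1_of g"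
  by transfer (auto simp: L1_rel_def)

lemma L1_of_scale:
  "integrable unit_leb f \<Longrightarrow> L1_of (\<lambda>u. c * f u) = c *\<^sub>R L1_of f"
  by transfer (auto simp: L1_rel_def)

lemma L1_of_zero: "L1_of (\<lambda>u. 0) = 0"
  by transfer (auto simp: L1_rel_def)

lemma L1_of_not_integrable: "\<not> integrable unit_leb f \<Longrightarrow> L1_of f = 0"
  by transfer (auto simp: L1_rel_def)

text \<open>Both functions are integrable or neither is, so the default value 0 of
  \<open>L1_of\<close> is consistent as well.\<close>

lemma L1_of_cong_AE:
  assumes "AE u in unit_leb. f u = g u"
    and "f \<in> borel_measurable unit_leb" "g \<in> borel_measurable unit_leb"
  shows "L1_of f = L1_of g"
proof (cases "integrable unit_leb f")
  case True
  then have "integrable unit_leb g" using assms by (metis integrable_cong_AE)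
  with True show ?thesis using assms by (simp add: L1_of_eq_iff)
next
  case False
  then have "\<not> integrable unit_leb g" using assms by (metis integrable_cong_AE)
  with False show ?thesis by (simp add: L1_of_not_integrable)
qed

lemma L1_of_sum:
  assumes "finite J" "\<And>j. j \<in> J \<Longrightarrow> integrable unit_leb (f j)"
  shows "L1_of (\<lambda>u. \<Sum>j\<in>J. c j * f j u) = (\<Sum>j\<in>J. c j *\<^sub>R L1_of (f j))"
  using assms
proof (induction J rule: finite_induct)
  case empty
  then show ?case by (simp add: L1_of_zero)
next
  case (insert j J)
  then show ?case
    by (simp add: L1_of_add L1_of_scale)
qed

lemma dist_L1_of:
  assumes "integrable unit_leb f" "integrable unit_leb g"
  shows "dist (L1_of f) (L1_of g) = (\<integral>u. \<bar>f u - g u\<bar> \<partial>unit_leb)"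
  using assms by (simp add: dist_norm L1_of_diff[symmetric] norm_L1_of)

lemma ennreal_dist_L1_of:
  assumes "integrable unit_leb f" "integrable unit_leb g"
    and "f \<in> borel_measurable unit_borel" "g \<in> borel_measurable unit_borel"
  shows "ennreal (dist (L1_of f) (L1_of g)) = (\<integral>\<^sup>+u. ennreal \<bar>f u - g u\<bar> \<partial>unit_borel)"
proof -
  have "ennreal (dist (L1_of f) (L1_of g)) = (\<integral>\<^sup>+u. ennreal \<bar>f u - g u\<bar> \<partial>unit_leb)"
    using assms by (simp add: dist_L1_of nn_integral_eq_integral)
  also have "\<dots> = (\<integral>\<^sup>+u. ennreal \<bar>f u - g u\<bar> \<partial>unit_borel)"
    using assms(3,4)
    by (intro nn_integral_unit_leb measurable_compose[OF _ measurable_ennreal] borel_measurable_abs borel_measurable_diff)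
  finally show ?thesis .
qed

text \<open>The coefficients form a measurable map into a product of reals, and the combination is a
  continuous function of them; adding measurable vectors directly would call for a countable base of
  \<open>'b\<close>.\<close>

lemma measurable_finite_combination:
  fixes e :: "nat \<Rightarrow> 'b::real_normed_vector"
  assumes "\<And>j. j < m \<Longrightarrow> V j \<in> borel_measurable M"
  shows "(\<lambda>\<omega>. \<Sum>j<m. V j \<omega> *\<^sub>R e j) \<in> borel_measurable M"
proof -
  \<comment> \<open>Padding with zeros gives a map into all sequences, where the product
    sigma-algebra coincides with the Borel sets.\<close>
  define h where "h = (\<lambda>\<omega> j. if j < m then V j \<omega> else 0)"
  have "h \<in> measurable M (\<Pi>\<^sub>M j\<in>UNIV. borel)"
  proof (rule measurable_PiM_single')
    show "(\<lambda>\<omega>. h \<omega> j) \<in> borel_measurable M" for j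
      using assms by (cases "j < m") (auto simp: h_def)
  qed auto
  then have h: "h \<in> borel_measurable M"
    by (subst measurable_cong_sets[OF refl sets_PiM_equal_borel[symmetric]])
  have "continuous_on UNIV (\<lambda>x::nat\<Rightarrow>real. \<Sum>j<m. x j *\<^sub>R e j)"
    by (intro continuous_intros continuous_on_product_coordinates)
  then have "(\<lambda>x. \<Sum>j<m. x j *\<^sub>R e j) \<in> borel_measurable borel"
    by (rule borel_measurable_continuous_onI)
  from measurable_compose[OF h this] show ?thesis
    by (simp add: h_def)
qed

section \<open>Grids on the unit interval and left-continuous step approximations\<close>

definition grid :: "nat \<Rightarrow> real \<Rightarrow> real" where
  "grid k u = (of_int \<lceil>real (Suc k) * u\<rceil> - 1) / real (Suc k)"

definition inner_cells :: "nat \<Rightarrow> real set" where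
  "inner_cells k = {1 / real (Suc k)<..1 - 1 / real (Suc k)}"

text \<open>Left end of the \<open>j\<close>-th retained cell. The shift by one skips the first of
  the \<open>k + 1\<close> cells of equal length; the last is dropped too, so \<open>j\<close> runs
  over \<open>j < k - 1\<close>.\<close>

definition knot :: "nat \<Rightarrow> nat \<Rightarrow> real" where
  "knot k j = (real j + 1) / real (Suc k)"

definition cell :: "nat \<Rightarrow> nat \<Rightarrow> real set" where
  "cell k j = {knot k j<..knot k (Suc j)}"

text \<open>The two extreme cells get the value zero because \<open>q\<close> need not be integrable
  near 0 and 1: a nonzero constant there could leave \<open>L^1\<close> after multiplication by
  \<open>q\<close>.\<close>

definition discretize :: "nat \<Rightarrow> (real \<Rightarrow> real) \<Rightarrow> real \<Rightarrow> real" where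
  "discretize k h u = (if u \<in> inner_cells k then h (grid k u) else 0)"

text \<open>The ceiling puts the grid point strictly to the left of \<open>u\<close>, even when
  \<open>u\<close> is itself a grid point, so grid values converge under left continuity
  alone.\<close>

lemma grid_less: "grid k u < u"
proof -
  have "of_int \<lceil>real (Suc k) * u\<rceil> - 1 < real (Suc k) * u" by linarith
  then show ?thesis by (simp add: grid_def divide_less_eq mult.commute del: of_nat_Suc)
qed

lemma grid_ge: "u - 1 / real (Suc k) \<le> grid k u"
proof -
  have "real (Suc k) * u - 1 \<le> of_int \<lceil>real (Suc k) * u\<rceil> - 1" by linarith
  then have "(real (Suc k) * u - 1) / real (Suc k) \<le> grid k u"
    unfolding grid_def by (rule divide_right_mono) simp
  then show ?thesis by (simp add: diff_divide_distrib del: of_nat_Suc)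
qed

lemma knot_pos: "0 < knot k j"
  by (simp add: knot_def)

lemma knot_less_1: "j < k \<Longrightarrow> knot k j < 1"
  by (simp add: knot_def)

lemma cell_subset: "j < k - 1 \<Longrightarrow> cell k j \<subseteq> inner_cells k"
proof
  fix u assume j: "j < k - 1" and u: "u \<in> cell k j"
  have "1 / real (Suc k) \<le> knot k j" by (simp add: knot_def divide_right_mono)
  moreover have "knot k (Suc j) \<le> 1 - 1 / real (Suc k)"
  proof -
    have "real (Suc j) + 1 \<le> real (Suc k) - 1" using j by simp
    then have "(real (Suc j) + 1) / real (Suc k) \<le> (real (Suc k) - 1) / real (Suc k)"
      by (rule divide_right_mono) simp
    then show ?thesis by (simp add: knot_def diff_divide_distrib del: of_nat_Suc)
  qed
  ultimately show "u \<in> inner_cells k" using u by (auto simp: inner_cells_def cell_def)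
qed

lemma inner_cells_subset: "inner_cells k \<subseteq> {0<..<1}"
proof
  fix u assume u: "u \<in> inner_cells k"
  have "0 < 1 / real (Suc k)" by simp
  moreover have "1 / real (Suc k) < u" "u \<le> 1 - 1 / real (Suc k)" using u by (auto simp: inner_cells_def)
  ultimately have "0 < u" "u < 1" by linarith+
  then show "u \<in> {0<..<1}" by simp
qed

lemma grid_on_cell: "u \<in> cell k j \<Longrightarrow> grid k u = knot k j"
proof -
  assume u: "u \<in> cell k j"
  have "\<lceil>real (Suc k) * u\<rceil> = int j + 2"
  proof (rule ceiling_unique)
    show "of_int (int j + 2) - 1 < real (Suc k) * u"
      using u by (simp add: cell_def knot_def divide_less_eq mult.commute del: of_nat_Suc)
    show "real (Suc k) * u \<le> of_int (int j + 2)"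
      using u by (simp add: cell_def knot_def le_divide_eq mult.commute add.commute del: of_nat_Suc)
  qed
  then show ?thesis by (simp add: grid_def knot_def)
qed

lemma inner_cells_cases:
  assumes "u \<in> inner_cells k"
  obtains j where "j < k - 1" "u \<in> cell k j" "grid k u = knot k j"
proof -
  define i where "i = \<lceil>real (Suc k) * u\<rceil>"
  have 1: "1 < real (Suc k) * u" "real (Suc k) * u \<le> real k"
    using assms by (simp_all add: inner_cells_def field_simps)
  have i: "of_int i - 1 < real (Suc k) * u" "real (Suc k) * u \<le> of_int i"
    unfolding i_def by linarith+
  have i2: "2 \<le> i" "i \<le> int k" using 1 i by linarith+
  define j where "j = nat (i - 2)"
  have j: "real j = of_int i - 2" "j < k - 1" using i2 by (auto simp: j_def)
  have "u \<in> cell k j"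
    using i j(1) by (simp add: cell_def knot_def divide_less_eq le_divide_eq mult.commute del: of_nat_Suc)
  then show thesis using that j grid_on_cell by blast
qed

lemma disjoint_cells: "u \<in> cell k i \<Longrightarrow> u \<in> cell k j \<Longrightarrow> i = j"
  using grid_on_cell[of u k i] grid_on_cell[of u k j] by (simp add: knot_def)

text \<open>The cells are disjoint and exhaust the inner region, so a discretized path is a linear
  function of finitely many of its values. Measurability and the passage to finite dimensions both
  rest on this form.\<close>

lemma discretize_eq_sum:
  "discretize k h u = (\<Sum>j<k - 1. h (knot k j) * indicator (cell k j) u)"
proof (cases "u \<in> inner_cells k")
  case True
  then obtain j where j: "j < k - 1" "u \<in> cell k j" "grid k u = knot k j" by (rule inner_cells_cases)
  have "(\<Sum>i<k - 1. h (knot k i) * indicator (cell k i) u) = (\<Sum>i\<in>{j}. h (knot k i) * indicator (cell k i) u)"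
    using j by (intro sum.mono_neutral_right) (auto simp: indicator_def dest: disjoint_cells)
  then show ?thesis using True j by (simp add: discretize_def)
next
  case False
  then have "u \<notin> cell k j" if "j < k - 1" for j using cell_subset[OF that] by auto
  then show ?thesis using False by (simp add: discretize_def)
qed

lemma grid_in_unit: "u \<in> inner_cells k \<Longrightarrow> grid k u \<in> {0<..<1}"
  using inner_cells_cases[of u k] knot_pos knot_less_1
  by (metis greaterThanLessThan_iff less_diff_conv add_lessD1)

lemma eventually_inner_cells:
  assumes "u \<in> {0<..<1}" shows "\<forall>\<^sub>F k in sequentially. u \<in> inner_cells k"
proof -
  have "(\<lambda>k. 1 / real (Suc k)) \<longlonglongrightarrow> 0"
    by (rule LIMSEQ_Suc[OF lim_1_over_n])
  then have "\<forall>\<^sub>F k in sequentially. 1 / real (Suc k) < min u (1 - u)"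
    using assms by (intro order_tendstoD) auto
  then show ?thesis
    by eventually_elim (auto simp: inner_cells_def)
qed

lemma filterlim_grid: "filterlim (\<lambda>k. grid k u) (at_left u) sequentially"
  unfolding filterlim_at
proof (intro conjI)
  show "\<forall>\<^sub>F k in sequentially. grid k u \<in> {..<u} \<and> grid k u \<noteq> u"
    using grid_less by (auto simp: less_imp_neq)
  have "(\<lambda>k. u - 1 / real (Suc k)) \<longlonglongrightarrow> u - 0"
    by (intro tendsto_diff tendsto_const LIMSEQ_Suc[OF lim_1_over_n])
  then show "(\<lambda>k. grid k u) \<longlonglongrightarrow> u"
    using grid_ge[of u] grid_less[of _ u]
    by (intro tendsto_sandwich[of "\<lambda>k. u - 1 / real (Suc k)" "\<lambda>k. grid k u" sequentially "\<lambda>_. u"] always_eventually)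
      (auto simp: less_imp_le simp del: of_nat_Suc)
qed

lemma discretize_tendsto:
  assumes "u \<in> {0<..<1}" "(h \<longlongrightarrow> h u) (at_left u)"
  shows "(\<lambda>k. discretize k h u) \<longlonglongrightarrow> h u"
proof -
  have "(\<lambda>k. h (grid k u)) \<longlonglongrightarrow> h u"
    using filterlim_compose[OF assms(2) filterlim_grid] .
  moreover have "\<forall>\<^sub>F k in sequentially. h (grid k u) = discretize k h u"
    using eventually_inner_cells[OF assms(1)] by eventually_elim (simp add: discretize_def)
  ultimately show ?thesis by (rule Lim_transform_eventually)
qed

lemma cell_borel [measurable]: "cell k j \<in> sets borel"
  by (simp add: cell_def)

lemma discretize_measurable [measurable]: "discretize k h \<in> borel_measurable borel"
  unfolding discretize_eq_sum[abs_def] by measurable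

lemma discretize_abs_le:
  assumes "\<And>u. u \<in> {0<..<1} \<Longrightarrow> \<bar>h u\<bar> \<le> C"
  shows "0 \<le> C" "\<bar>discretize k h u\<bar> \<le> C"
proof -
  show "0 \<le> C" using assms[of "1/2"] by auto
  then show "\<bar>discretize k h u\<bar> \<le> C"
    using assms[OF grid_in_unit] by (auto simp: discretize_def)
qed

lemma left_continuous_measurable:
  fixes h :: "real \<Rightarrow> real"
  assumes "\<And>u. u \<in> {0<..<1} \<Longrightarrow> (h \<longlongrightarrow> h u) (at_left u)"
  shows "h \<in> borel_measurable unit_borel"
proof (rule borel_measurable_LIMSEQ_metric)
  show "discretize k h \<in> borel_measurable unit_borel" for k by (rule measurable_unit_borelI) measurable
  show "(\<lambda>k. discretize k h u) \<longlonglongrightarrow> h u" if "u \<in> space unit_borel" for u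
    using that assms by (auto intro: discretize_tendsto)
qed

text \<open>Step approximations are finite sums of a random variable times an indicator in
  \<open>u\<close>, hence jointly measurable; left continuity makes them converge at every point of
  the open interval.\<close>

lemma left_continuous_process_measurable:
  fixes Z :: "'a \<Rightarrow> real \<Rightarrow> real"
  assumes meas: "\<And>u. u \<in> {0<..<1} \<Longrightarrow> (\<lambda>\<omega>. Z \<omega> u) \<in> borel_measurable M"
    and left: "\<And>\<omega> u. \<omega> \<in> space M \<Longrightarrow> u \<in> {0<..<1} \<Longrightarrow> (Z \<omega> \<longlongrightarrow> Z \<omega> u) (at_left u)"
  shows "(\<lambda>(\<omega>, u). Z \<omega> u) \<in> borel_measurable (M \<Otimes>\<^sub>M unit_borel)"
proof (rule borel_measurable_LIMSEQ_metric)
  fix k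
  have [measurable]: "(\<lambda>\<omega>. Z \<omega> (knot k j)) \<in> borel_measurable M" if "j < k - 1" for j
    using that knot_pos knot_less_1 by (intro meas) auto
  have [measurable]: "(\<lambda>u. indicator (cell k j) u :: real) \<in> borel_measurable unit_borel" for j
    by (rule measurable_unit_borelI) measurable
  show "(\<lambda>(\<omega>, u). discretize k (Z \<omega>) u) \<in> borel_measurable (M \<Otimes>\<^sub>M unit_borel)"
    unfolding discretize_eq_sum case_prod_beta
    by (intro borel_measurable_sum borel_measurable_times) measurable
next
  fix p assume "p \<in> space (M \<Otimes>\<^sub>M unit_borel)"
  then show "(\<lambda>k. case p of (\<omega>, u) \<Rightarrow> discretize k (Z \<omega>) u) \<longlonglongrightarrow> (case p of (\<omega>, u) \<Rightarrow> Z \<omega> u)"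
    using left by (auto simp: space_pair_measure intro!: discretize_tendsto)
qed

lemma integrable_weighted_bounded:
  fixes w h :: "real \<Rightarrow> real"
  assumes w: "integrable unit_leb w" and h: "h \<in> borel_measurable unit_leb"
    and "\<And>u. u \<in> {0<..<1} \<Longrightarrow> \<bar>h u\<bar> \<le> C"
  shows "integrable unit_leb (\<lambda>u. w u * h u)"
proof (rule Bochner_Integration.integrable_bound)
  show "integrable unit_leb (\<lambda>u. C * \<bar>w u\<bar>)" using w by auto
  have "(\<lambda>u. w u * h u) \<in> borel_measurable unit_leb" using w h by measurable
  then show "(\<lambda>u. w u * h u) \<in> borel_measurable unit_leb" .
  have "\<bar>w u * h u\<bar> \<le> C * \<bar>w u\<bar>" if "u \<in> {0<..<1}" for u
    using assms(3)[OF that] by (simp add: abs_mult mult.commute mult_mono)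
  then show "AE u in unit_leb. norm (w u * h u) \<le> norm (C * \<bar>w u\<bar>)"
    by (intro AE_I2) (metis abs_ge_self order_trans real_norm_def space_restrict_space Int_iff)
qed

text \<open>The class of a weighted step path is a finite combination of fixed \<open>l1\<close>
  vectors. Boundedness of each path, with a bound that may vary with the path, lets dominated
  convergence turn pointwise convergence into norm convergence.\<close>

lemma measurable_L1_of_left_continuous:
  fixes Z :: "'a \<Rightarrow> real \<Rightarrow> real"
  assumes w: "integrable unit_leb w"
    and meas: "\<And>u. u \<in> {0<..<1} \<Longrightarrow> (\<lambda>\<omega>. Z \<omega> u) \<in> borel_measurable M"
    and left: "\<And>\<omega> u. \<omega> \<in> space M \<Longrightarrow> u \<in> {0<..<1} \<Longrightarrow> (Z \<omega> \<longlongrightarrow> Z \<omega> u) (at_left u)"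
    and bounded: "\<And>\<omega>. \<omega> \<in> space M \<Longrightarrow> \<exists>C. \<forall>u\<in>{0<..<1}. \<bar>Z \<omega> u\<bar> \<le> C"
  shows "(\<lambda>\<omega>. L1_of (\<lambda>u. w u * Z \<omega> u)) \<in> borel_measurable M"
proof (rule borel_measurable_LIMSEQ_metric)
  fix k
  have "integrable unit_leb (\<lambda>u. w u * indicator (cell k j) u)" for j
    by (rule integrable_weighted_bounded[where C=1, OF w measurable_unit_leb[OF measurable_unit_borelI]])
      (auto simp: indicator_def)
  moreover have "w u * discretize k (Z \<omega>) u = (\<Sum>j<k - 1. Z \<omega> (knot k j) * (w u * indicator (cell k j) u))" for \<omega> u
    by (simp only: discretize_eq_sum sum_distrib_left mult.left_commute)
  ultimately have "L1_of (\<lambda>u. w u * discretize k (Z \<omega>) u)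
      = (\<Sum>j<k - 1. Z \<omega> (knot k j) *\<^sub>R L1_of (\<lambda>u. w u * indicator (cell k j) u))" for \<omega>
    by (simp only: L1_of_sum[OF finite_lessThan])
  moreover have "(\<lambda>\<omega>. \<Sum>j<k - 1. Z \<omega> (knot k j) *\<^sub>R L1_of (\<lambda>u. w u * indicator (cell k j) u))
      \<in> borel_measurable M"
    using knot_pos knot_less_1 by (intro measurable_finite_combination meas) auto
  ultimately show "(\<lambda>\<omega>. L1_of (\<lambda>u. w u * discretize k (Z \<omega>) u)) \<in> borel_measurable M" by simp
next
  fix \<omega> assume \<omega>: "\<omega> \<in> space M"
  from bounded[OF \<omega>] obtain C where C: "\<And>u. u \<in> {0<..<1} \<Longrightarrow> \<bar>Z \<omega> u\<bar> \<le> C" by blast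
  have Zm: "Z \<omega> \<in> borel_measurable unit_leb"
    by (intro measurable_unit_leb left_continuous_measurable left \<omega>)
  have dm: "discretize k (Z \<omega>) \<in> borel_measurable unit_leb" for k
    by (intro measurable_unit_leb measurable_unit_borelI) measurable
  have wm: "w \<in> borel_measurable unit_leb" using w by auto
  have "(\<lambda>k. \<integral>u. \<bar>w u * discretize k (Z \<omega>) u - w u * Z \<omega> u\<bar> \<partial>unit_leb) \<longlonglongrightarrow> (\<integral>u. 0 \<partial>unit_leb)"
  proof (rule integral_dominated_convergence)
    show "(\<lambda>u. \<bar>w u * discretize k (Z \<omega>) u - w u * Z \<omega> u\<bar>) \<in> borel_measurable unit_leb" for k
      using Zm dm wm by measurable
    show "integrable unit_leb (\<lambda>u. 2 * C * \<bar>w u\<bar>)" using w by auto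
    have "(\<lambda>k. \<bar>w u * discretize k (Z \<omega>) u - w u * Z \<omega> u\<bar>) \<longlonglongrightarrow> \<bar>w u * Z \<omega> u - w u * Z \<omega> u\<bar>"
      if "u \<in> {0<..<1}" for u
      by (intro tendsto_intros discretize_tendsto left \<omega> that)
    then show "AE u in unit_leb. (\<lambda>k. \<bar>w u * discretize k (Z \<omega>) u - w u * Z \<omega> u\<bar>) \<longlonglongrightarrow> 0"
      by (intro AE_I2) (simp add: space_restrict_space)
    have "\<bar>w u * discretize k (Z \<omega>) u - w u * Z \<omega> u\<bar> \<le> 2 * C * \<bar>w u\<bar>" if "u \<in> {0<..<1}" for u k
    proof -
      have "\<bar>discretize k (Z \<omega>) u - Z \<omega> u\<bar> \<le> 2 * C"
        using C[OF that] discretize_abs_le(2)[of "Z \<omega>" C k u, OF C] by linarith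
      then have "\<bar>w u\<bar> * \<bar>discretize k (Z \<omega>) u - Z \<omega> u\<bar> \<le> \<bar>w u\<bar> * (2 * C)"
        by (intro mult_left_mono) auto
      then show ?thesis by (simp add: abs_mult[symmetric] right_diff_distrib mult_ac)
    qed
    then show "AE u in unit_leb. norm \<bar>w u * discretize k (Z \<omega>) u - w u * Z \<omega> u\<bar> \<le> 2 * C * \<bar>w u\<bar>" for k
      by (intro AE_I2) (simp add: space_restrict_space)
  qed simp
  then show "(\<lambda>k. L1_of (\<lambda>u. w u * discretize k (Z \<omega>) u)) \<longlonglongrightarrow> L1_of (\<lambda>u. w u * Z \<omega> u)"
    by (subst tendsto_dist_iff, subst dist_L1_of)
      (auto intro!: integrable_weighted_bounded[OF w dm discretize_abs_le(2)[OF C]]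
        integrable_weighted_bounded[OF w Zm C])
qed

section \<open>Quantile functions\<close>

text \<open>The Galois relation on the open interval, singled out as a property of its own so that
  \<open>F\<close>, empirical cdfs and resampled cdfs share the area identity and the local
  inversion.\<close>

definition quantile_adjoint :: "(real \<Rightarrow> real) \<Rightarrow> bool" where
  "quantile_adjoint G \<longleftrightarrow> (\<forall>u\<in>{0<..<1}. \<forall>x. quantile G u \<le> x \<longleftrightarrow> u \<le> G x)"

lemma quantile_le_iff: "quantile_adjoint G \<Longrightarrow> 0 < u \<Longrightarrow> u < 1 \<Longrightarrow> quantile G u \<le> x \<longleftrightarrow> u \<le> G x"
  by (simp add: quantile_adjoint_def)

lemma less_quantile_iff: "quantile_adjoint G \<Longrightarrow> 0 < u \<Longrightarrow> u < 1 \<Longrightarrow> x < quantile G u \<longleftrightarrow> G x < u"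
  using quantile_le_iff[of G u x] by (simp add: not_le[symmetric])

lemma quantile_mono:
  "quantile_adjoint G \<Longrightarrow> 0 < u \<Longrightarrow> u \<le> v \<Longrightarrow> v < 1 \<Longrightarrow> quantile G u \<le> quantile G v"
  using quantile_le_iff[of G u "quantile G v"] quantile_le_iff[of G v "quantile G v"] by auto

lemma quantile_adjoint_cdf: "real_distribution \<mu> \<Longrightarrow> quantile_adjoint (cdf \<mu>)"
  by (simp add: quantile_adjoint_def quantile_galois)

text \<open>A sample point with uniformly chosen index has the empirical cdf as its cdf, so the
  Galois relation for real distributions applies to it.\<close>

lemma emp_cdf_eq_cdf:
  assumes "n > 0"
  shows "emp_cdf n x = cdf (distr (measure_pmf (pmf_of_set {..<n})) borel x)"
proof
  fix t
  have "cdf (distr (measure_pmf (pmf_of_set {..<n})) borel x) t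
      = measure (measure_pmf (pmf_of_set {..<n})) {i. x i \<le> t}"
    by (simp add: cdf_def measure_distr vimage_def)
  also have "\<dots> = real (card ({..<n} \<inter> {i. x i \<le> t})) / n"
    using assms by (subst measure_pmf_of_set) (auto simp: lessThan_empty_iff)
  also have "\<dots> = emp_cdf n x t"
    by (simp add: emp_cdf_def indicator_def if_distrib sum.If_cases flip: Collect_conj_eq cong: if_cong)
  finally show "emp_cdf n x t = cdf (distr (measure_pmf (pmf_of_set {..<n})) borel x) t" ..
qed

lemma real_distribution_emp:
  "real_distribution (distr (measure_pmf p) borel x)"
  by (rule prob_space.real_distribution_distr[OF prob_space_measure_pmf]) simp

lemma emp_cdf_bounds: "0 \<le> emp_cdf n x t" "emp_cdf n x t \<le> 1"
proof -
  show "0 \<le> emp_cdf n x t" by (auto simp: emp_cdf_def intro!: divide_nonneg_nonneg sum_nonneg)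
  have "(\<Sum>i<n. indicator {x i..} t) \<le> (\<Sum>i<n. 1::real)" by (intro sum_mono) (auto split: split_indicator)
  then show "emp_cdf n x t \<le> 1" by (auto simp: emp_cdf_def divide_le_eq)
qed

lemma quantile_adjoint_emp_cdf: "n > 0 \<Longrightarrow> quantile_adjoint (emp_cdf n x)"
  unfolding emp_cdf_eq_cdf by (rule quantile_adjoint_cdf[OF real_distribution_emp])

lemma emp_cdf_measurable: "emp_cdf n x \<in> borel_measurable borel"
  unfolding emp_cdf_def[abs_def] by measurable

lemma finite_range_indicator_sum:
  fixes w :: "nat \<Rightarrow> real"
  shows "finite (range (\<lambda>t. (\<Sum>i<n. w i * indicator {x i..} t) / n))"
proof -
  have "(\<Sum>i<n. w i * indicator {x i..} t) / n \<in> (\<lambda>I. sum w I / n) ` Pow {..<n}" for t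
    by (intro image_eqI[of _ _ "{i\<in>{..<n}. x i \<le> t}"])
      (auto simp: indicator_def sum.inter_filter intro!: sum.cong)
  then have "range (\<lambda>t. (\<Sum>i<n. w i * indicator {x i..} t) / n) \<subseteq> (\<lambda>I. sum w I / n) ` Pow {..<n}"
    by auto
  then show ?thesis by (rule finite_subset) auto
qed

lemma finite_range_emp_cdf: "finite (range (emp_cdf n x))"
  using finite_range_indicator_sum[where w="\<lambda>_. 1" and n=n and x=x] by (simp add: emp_cdf_def[abs_def])

lemma finite_range_boot_cdf: "finite (range (boot_cdf n w x))"
  using finite_range_indicator_sum[where w="\<lambda>i. real (w i)" and n=n and x=x] by (simp add: boot_cdf_def[abs_def])

text \<open>Finitely many values leave a gap below \<open>u\<close>, and levels inside the gap have
  the same superlevel set as \<open>u\<close>. This also covers levels that are never reached, where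
  the quantile is the default \<open>Inf {}\<close>.\<close>

lemma quantile_left_continuous_finite_range:
  assumes "finite (range G)"
  shows "(quantile G \<longlongrightarrow> quantile G u) (at_left u)"
proof -
  \<comment> \<open>\<open>u - 1\<close> keeps the set nonempty when no value of \<open>G\<close>
    lies below \<open>u\<close>.\<close>
  define r where "r = Max (insert (u - 1) {v \<in> range G. v < u})"
  have fin: "finite (insert (u - 1) {v \<in> range G. v < u})" using assms by auto
  have "r < u" unfolding r_def using fin by (subst Max_less_iff) auto
  have r: "G x \<le> r" if "G x < u" for x
    unfolding r_def using fin that by (intro Max_ge) auto
  have "quantile G v = quantile G u" if "r < v" "v < u" for v
  proof -
    have "{x. v \<le> G x} = {x. u \<le> G x}"
      using that r by (force simp: not_le[symmetric])
    then show ?thesis by (simp add: quantile_def)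
  qed
  then have "\<forall>\<^sub>F v in at_left u. quantile G v = quantile G u"
    using \<open>r < u\<close> unfolding eventually_at_left_field by blast
  then show ?thesis by (rule tendsto_eventually)
qed

text \<open>The quantile at \<open>u\<close> is determined by which of the finitely many values of
  \<open>G\<close> are at least \<open>u\<close>, so it takes only finitely many values
  itself.\<close>

lemma quantile_bounded_finite_range:
  assumes "finite (range G)"
  shows "\<exists>C. \<forall>u. \<bar>quantile G u\<bar> \<le> C"
proof -
  have "range (quantile G) \<subseteq> (\<lambda>R. Inf {x. G x \<in> R}) ` Pow (range G)"
  proof safe
    fix u
    have "{x. G x \<ge> u} = {x. G x \<in> range G \<inter> {u..}}" by auto
    then show "quantile G u \<in> (\<lambda>R. Inf {x. G x \<in> R}) ` Pow (range G)"
      unfolding quantile_def by (intro image_eqI[of _ _ "range G \<inter> {u..}"]) auto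
  qed
  then have "finite (range (quantile G))" using assms by (auto dest: finite_subset)
  then have "bounded (range (quantile G))" by (rule finite_imp_bounded)
  then show ?thesis by (auto simp: bounded_iff)
qed

text \<open>A strict inequality for the infimum is witnessed by some \<open>t\<close>, and
  monotonicity moves the witness to a rational, which leaves a countable union.\<close>

lemma quantile_measurable:
  assumes mono: "\<And>\<omega>. \<omega> \<in> space M \<Longrightarrow> mono (G \<omega>)"
    and nonempty: "\<And>\<omega>. \<omega> \<in> space M \<Longrightarrow> {t. u \<le> G \<omega> t} \<noteq> {}"
    and bdd: "\<And>\<omega>. \<omega> \<in> space M \<Longrightarrow> bdd_below {t. u \<le> G \<omega> t}"
    and meas: "\<And>t. (\<lambda>\<omega>. G \<omega> t) \<in> borel_measurable M"
  shows "(\<lambda>\<omega>. quantile (G \<omega>) u) \<in> borel_measurable M"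
  unfolding borel_measurable_iff_less
proof
  fix y
  have "{\<omega> \<in> space M. quantile (G \<omega>) u < y} = {\<omega> \<in> space M. \<exists>t\<in>\<rat>. t < y \<and> u \<le> G \<omega> t}"
  proof (intro Collect_cong conj_cong refl)
    fix \<omega> assume \<omega>: "\<omega> \<in> space M"
    show "quantile (G \<omega>) u < y \<longleftrightarrow> (\<exists>t\<in>\<rat>. t < y \<and> u \<le> G \<omega> t)"
    proof
      assume "quantile (G \<omega>) u < y"
      then obtain t where t: "t < y" "u \<le> G \<omega> t"
        unfolding quantile_def using nonempty[OF \<omega>] bdd[OF \<omega>] by (auto simp: cInf_less_iff)
      obtain s where "s \<in> \<rat>" "t < s" "s < y" using Rats_dense_in_real[OF t(1)] by auto
      with t monoD[OF mono[OF \<omega>], of t s] show "\<exists>t\<in>\<rat>. t < y \<and> u \<le> G \<omega> t"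
        by (intro bexI[of _ s]) auto
    next
      assume "\<exists>t\<in>\<rat>. t < y \<and> u \<le> G \<omega> t"
      then show "quantile (G \<omega>) u < y"
        unfolding quantile_def using nonempty[OF \<omega>] bdd[OF \<omega>] by (auto simp: cInf_less_iff)
    qed
  qed
  also have "\<dots> = (\<Union>t\<in>\<rat> \<inter> {..<y}. {\<omega> \<in> space M. u \<le> G \<omega> t})" by auto
  also have "\<dots> \<in> sets M"
    using meas by (intro sets.countable_UN'' countable_Int1 countable_rat) measurable
  finally show "{\<omega> \<in> space M. quantile (G \<omega>) u < y} \<in> sets M" .
qed

lemma quantile_boot_cdf_measurable:
  assumes u: "0 < u" and X: "\<And>i. X i \<in> borel_measurable M"
  shows "(\<lambda>\<omega>. quantile (boot_cdf n w (\<lambda>i. X i \<omega>)) u) \<in> borel_measurable M"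
proof (cases "u \<le> (\<Sum>i<n. real (w i)) / n")
  case True
  show ?thesis
  proof (rule quantile_measurable)
    fix \<omega>
    show "mono (boot_cdf n w (\<lambda>i. X i \<omega>))"
      unfolding boot_cdf_def by (intro monoI divide_right_mono sum_mono) (auto split: split_indicator)
    define b where "b = Max ((\<lambda>i. X i \<omega>) ` {..<n})"
    have "X i \<omega> \<le> b" if "i < n" for i using that unfolding b_def by (intro Max_ge) auto
    then have "boot_cdf n w (\<lambda>i. X i \<omega>) b = (\<Sum>i<n. real (w i)) / n"
      by (simp add: boot_cdf_def)
    then have "u \<le> boot_cdf n w (\<lambda>i. X i \<omega>) b" using True by simp
    then show "{t. u \<le> boot_cdf n w (\<lambda>i. X i \<omega>) t} \<noteq> {}" by blast
    define a where "a = Min ((\<lambda>i. X i \<omega>) ` {..<n})"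
    have "a \<le> t" if "u \<le> boot_cdf n w (\<lambda>i. X i \<omega>) t" for t
    proof (rule ccontr)
      assume "\<not> a \<le> t"
      moreover have "a \<le> X i \<omega>" if "i < n" for i using that unfolding a_def by (intro Min_le) auto
      ultimately have "t < X i \<omega>" if "i < n" for i using that by force
      then have "boot_cdf n w (\<lambda>i. X i \<omega>) t = 0"
        unfolding boot_cdf_def by (intro divide_eq_0_iff[THEN iffD2] disjI1 sum.neutral) (force simp: indicator_def not_le[symmetric])
      with that u show False by simp
    qed
    then show "bdd_below {t. u \<le> boot_cdf n w (\<lambda>i. X i \<omega>) t}" by (intro bdd_belowI[of _ a]) auto
  next
    fix t
    have "(\<lambda>\<omega>. indicator {X i \<omega>..} t :: real) = (\<lambda>\<omega>. indicator {..t} (X i \<omega>))" for i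
      by (auto simp: indicator_def)
    then show "(\<lambda>\<omega>. boot_cdf n w (\<lambda>i. X i \<omega>) t) \<in> borel_measurable M"
      unfolding boot_cdf_def using X
      by (auto simp del: sum_mult_indicator intro!: borel_measurable_divide borel_measurable_sum borel_measurable_times)
  qed
next
  case False
  have "boot_cdf n w x t < u" for x t
  proof -
    have "boot_cdf n w x t \<le> (\<Sum>i<n. real (w i)) / n"
      unfolding boot_cdf_def by (intro divide_right_mono sum_mono) (auto split: split_indicator)
    with False show ?thesis by linarith
  qed
  then have "quantile (boot_cdf n w x) u = Inf {}" for x
    unfolding quantile_def by (intro arg_cong[where f=Inf]) (auto simp: not_le)
  then show ?thesis by simp
qed

lemma emp_cdf_eq_boot_cdf: "emp_cdf n x = boot_cdf n (\<lambda>_. 1) x"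
  by (simp add: emp_cdf_def boot_cdf_def fun_eq_iff)

lemma quantile_finite_range_measurable:
  assumes "finite (range G)" shows "quantile G \<in> borel_measurable unit_borel"
  by (intro left_continuous_measurable quantile_left_continuous_finite_range assms)

lemma quantile_finite_range_integrable:
  assumes "finite (range G)" shows "integrable unit_leb (quantile G)"
proof -
  obtain C where C: "\<And>u. \<bar>quantile G u\<bar> \<le> C" using quantile_bounded_finite_range[OF assms] by blast
  have "(\<integral>\<^sup>+u. ennreal \<bar>quantile G u\<bar> \<partial>unit_borel) \<le> (\<integral>\<^sup>+u. ennreal C \<partial>unit_borel)"
    using C by (intro nn_integral_mono ennreal_leI)
  also have "\<dots> < \<infinity>" using unit_borel.emeasure_space_1 by (simp add: ennreal_mult_less_top)
  finally show ?thesis by (rule integrable_unit_lebI[OF quantile_finite_range_measurable[OF assms]])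
qed

lemma emeasure_unit_borel_Ioc:
  assumes "0 \<le> p" "p \<le> q" "q \<le> 1"
  shows "emeasure unit_borel {u\<in>{0<..<1}. p < u \<and> u \<le> q} = ennreal (q - p)"
proof -
  have "{u\<in>{0<..<1}. p < u \<and> u \<le> q} = (if q < 1 then {p<..q} else {p<..<1})"
    using assms by auto
  moreover have "emeasure unit_borel A = emeasure lborel A" if "A \<subseteq> {0<..<1}" for A
    using that by (rule emeasure_restrict_space[rotated]) simp
  ultimately show ?thesis
    using assms by (cases "q < 1") (simp_all add: subset_iff)
qed

lemma nn_integral_abs_diff_quantile:
  assumes G: "quantile_adjoint G" "G \<in> borel_measurable borel" "\<And>x. 0 \<le> G x" "\<And>x. G x \<le> 1"
    and H: "quantile_adjoint H" "H \<in> borel_measurable borel" "\<And>x. 0 \<le> H x" "\<And>x. H x \<le> 1"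
  shows "(\<integral>\<^sup>+u. ennreal \<bar>quantile G u - quantile H u\<bar> \<partial>unit_borel) = (\<integral>\<^sup>+x. ennreal \<bar>G x - H x\<bar> \<partial>lborel)"
proof -
  interpret pair_sigma_finite unit_borel lborel
    by (intro pair_sigma_finite.intro unit_borel.sigma_finite_measure_axioms lborel.sigma_finite_measure_axioms)
  \<comment> \<open>Indicator of the region between the two graphs. By the Galois relation its
    section at \<open>u\<close> is the interval between the quantiles and its section at
    \<open>x\<close> the interval between the cdf values; Fubini equates the two areas.\<close>
  define f where "f u x = (indicator {u. (u \<le> G x) \<noteq> (u \<le> H x)} u :: ennreal)" for u x
  have id [measurable]: "(\<lambda>u. u) \<in> borel_measurable unit_borel" by (rule measurable_unit_borelI) measurable
  have [measurable]: "G \<in> borel_measurable lborel" "H \<in> borel_measurable lborel" using G H by auto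
  have m1: "(\<lambda>p. fst p) \<in> borel_measurable (unit_borel \<Otimes>\<^sub>M (lborel :: real measure))"
    using measurable_compose[OF measurable_fst id] by simp
  have "(\<lambda>p. if (fst p \<le> G (snd p)) \<noteq> (fst p \<le> H (snd p)) then 1 else (0::ennreal))
      \<in> borel_measurable (unit_borel \<Otimes>\<^sub>M lborel)"
    using m1 by measurable
  also have "(\<lambda>p. if (fst p \<le> G (snd p)) \<noteq> (fst p \<le> H (snd p)) then 1 else (0::ennreal)) = case_prod f"
    by (auto simp: f_def fun_eq_iff indicator_def)
  finally have f: "case_prod f \<in> borel_measurable (unit_borel \<Otimes>\<^sub>M lborel)" .
  have "(\<integral>\<^sup>+u. ennreal \<bar>quantile G u - quantile H u\<bar> \<partial>unit_borel) = (\<integral>\<^sup>+u. \<integral>\<^sup>+x. f u x \<partial>lborel \<partial>unit_borel)"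
  proof (rule nn_integral_cong)
    fix u assume "u \<in> space unit_borel"
    then have u: "0 < u" "u < 1" by auto
    let ?a = "quantile G u" and ?b = "quantile H u"
    have "(\<integral>\<^sup>+x. f u x \<partial>lborel) = (\<integral>\<^sup>+x. indicator {min ?a ?b..<max ?a ?b} x \<partial>lborel)"
      unfolding f_def
      by (intro nn_integral_cong)
        (auto simp: indicator_def min_le_iff_disj less_max_iff_disj less_quantile_iff[OF G(1) u]
          less_quantile_iff[OF H(1) u] quantile_le_iff[OF G(1) u] quantile_le_iff[OF H(1) u])
    also have "\<dots> = ennreal \<bar>?a - ?b\<bar>" by (simp add: abs_if min_def max_def)
    finally show "ennreal \<bar>?a - ?b\<bar> = (\<integral>\<^sup>+x. f u x \<partial>lborel)" ..
  qed
  also have "\<dots> = (\<integral>\<^sup>+x. \<integral>\<^sup>+u. f u x \<partial>unit_borel \<partial>lborel)"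
    by (rule Fubini'[OF f, symmetric])
  also have "\<dots> = (\<integral>\<^sup>+x. ennreal \<bar>G x - H x\<bar> \<partial>lborel)"
  proof (rule nn_integral_cong)
    fix x :: real
    have "(\<integral>\<^sup>+u. f u x \<partial>unit_borel)
        = (\<integral>\<^sup>+u. indicator {u\<in>{0<..<1}. min (G x) (H x) < u \<and> u \<le> max (G x) (H x)} u \<partial>unit_borel)"
      unfolding f_def by (intro nn_integral_cong) (auto simp: indicator_def)
    also have "\<dots> = emeasure unit_borel {u\<in>{0<..<1}. min (G x) (H x) < u \<and> u \<le> max (G x) (H x)}"
      by (intro nn_integral_indicator) (auto simp: sets_restrict_space_iff)
    also have "\<dots> = ennreal \<bar>G x - H x\<bar>"
      using G(3,4)[of x] H(3,4)[of x] by (subst emeasure_unit_borel_Ioc) (auto simp: abs_if min_def max_def)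
    finally show "(\<integral>\<^sup>+u. f u x \<partial>unit_borel) = ennreal \<bar>G x - H x\<bar>" .
  qed
  finally show ?thesis .
qed

section \<open>Quantile densities\<close>

text \<open>Lebesgue differentiation for the truncations \<open>f m\<close> of \<open>q\<close> to
  compact subintervals. The exceptional null sets are united over \<open>m\<close>, and near a given
  \<open>u\<close> some truncation agrees with \<open>q\<close>.\<close>

lemma AE_right_derivative:
  fixes Q q :: "real \<Rightarrow> real"
  assumes int: "\<And>a b. 0 < a \<Longrightarrow> a < b \<Longrightarrow> b < 1 \<Longrightarrow> q integrable_on {a..b}"
    and diff: "\<And>a b. 0 < a \<Longrightarrow> a < b \<Longrightarrow> b < 1 \<Longrightarrow> Q b - Q a = integral {a..b} q"
  shows "AE u in lborel. u \<in> {0<..<1} \<longrightarrow> (Q has_real_derivative q u) (at_right u)"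
proof -
  \<comment> \<open>Adding 3 makes \<open>l m\<close> less than one half, so the interval from
    \<open>l m\<close> to \<open>1 - l m\<close> is never degenerate.\<close>
  define l where "l m = 1 / (real m + 3)" for m :: nat
  have l: "0 < l m" "l m < 1 - l m" "1 - l m < 1" for m by (auto simp: l_def field_simps)
  define f where "f m x = (if x \<in> {l m..1 - l m} then q x else 0)" for m x
  have "f m integrable_on cbox a b" for m a b
  proof -
    have "f m integrable_on UNIV"
      unfolding f_def using int[OF l(1) l(2) l(3)] by (subst integrable_restrict_UNIV) auto
    then show ?thesis by (rule integrable_on_subcbox) simp
  qed
  then have "\<exists>N. negligible N \<and> (\<forall>x e. x \<notin> N \<longrightarrow> 0 < e \<longrightarrow>
      (\<exists>d>0. \<forall>h. 0 < h \<and> h < d \<longrightarrow> norm (integral (cbox x (x + h *\<^sub>R One)) (f m) /\<^sub>R h ^ DIM(real) - f m x) < e))" for m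
    by (rule integrable_ccontinuous_explicit[of "f m"]) blast
  then obtain N where N: "\<And>m. negligible (N m)"
    "\<And>m x e. x \<notin> N m \<Longrightarrow> 0 < e \<Longrightarrow>
      \<exists>d>0. \<forall>h. 0 < h \<and> h < d \<longrightarrow> norm (integral (cbox x (x + h *\<^sub>R One)) (f m) /\<^sub>R h ^ DIM(real) - f m x) < e"
    by metis
  have "AE u in lebesgue. \<forall>m. u \<notin> N m"
    using N(1) by (auto simp: AE_all_countable negligible_iff_null_sets intro: AE_not_in)
  then have "AE u in lborel. \<forall>m. u \<notin> N m" by (simp add: AE_completion_iff)
  then show ?thesis
  proof eventually_elim
    case (elim u)
    show ?case
    proof
      assume "u \<in> {0<..<1}"
      then have "0 < min u (1 - u)" by auto
      then obtain m where m: "inverse (real (Suc m)) < min u (1 - u)"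
        using reals_Archimedean by blast
      have "l m \<le> inverse (real (Suc m))" by (simp add: l_def field_simps)
      with m have u: "l m < u" "u < 1 - l m" by auto
      show "(Q has_real_derivative q u) (at_right u)"
        unfolding has_field_derivative_iff Lim_within
      proof (intro allI impI)
        fix e :: real assume "0 < e"
        from N(2)[OF elim[rule_format] this, of m] obtain d where d: "d > 0"
          "\<And>h. 0 < h \<Longrightarrow> h < d \<Longrightarrow> norm (integral (cbox u (u + h *\<^sub>R One)) (f m) /\<^sub>R h ^ DIM(real) - f m u) < e"
          by blast
        have "dist ((Q y - Q u) / (y - u)) (q u) < e" if "u < y" "y - u < min d (1 - l m - u)" for y
        proof -
          have "integral (cbox u y) (f m) = integral {u..y} q"
            using that u by (auto simp: f_def intro!: integral_cong)
          also have "\<dots> = Q y - Q u"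
            using that u l[of m] by (intro diff[symmetric]) auto
          finally show ?thesis
            using d(2)[of "y - u"] that u by (simp add: dist_real_def f_def divide_inverse mult.commute)
        qed
        then show "\<exists>d>0. \<forall>y\<in>{u<..}. 0 < dist y u \<and> dist y u < d \<longrightarrow> dist ((Q y - Q u) / (y - u)) (q u) < e"
          using d(1) u(2) by (intro exI[of _ "min d (1 - l m - u)"]) (auto simp: dist_real_def)
      qed
    qed
  qed
qed

text \<open>The left derivative of \<open>Q\<close> at \<open>u\<close> is the right derivative at
  \<open>1 - u\<close> of the function that sends \<open>v\<close> to \<open>- Q (1 - v)\<close>, so
  the one-sided result is used twice.\<close>

lemma AE_has_real_derivative:
  fixes Q q :: "real \<Rightarrow> real"
  assumes int: "\<And>a b. 0 < a \<Longrightarrow> a < b \<Longrightarrow> b < 1 \<Longrightarrow> q integrable_on {a..b}"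
    and diff: "\<And>a b. 0 < a \<Longrightarrow> a < b \<Longrightarrow> b < 1 \<Longrightarrow> Q b - Q a = integral {a..b} q"
  shows "AE u in lborel. u \<in> {0<..<1} \<longrightarrow> (Q has_real_derivative q u) (at u)"
proof -
  have hi: "((\<lambda>u. q (1 - u)) has_integral (Q (1 - a) - Q (1 - b))) {a..b}" if "0 < a" "a < b" "b < 1" for a b
  proof -
    have "(q has_integral (Q (1 - a) - Q (1 - b))) (cbox (1 - b) (1 - a))"
      using int[of "1 - b" "1 - a"] diff[of "1 - b" "1 - a"] that by (simp add: has_integral_integral)
    from has_integral_affinity[OF this, of "-1" 1]
    have "((\<lambda>u. q (1 - u)) has_integral (Q (1 - a) - Q (1 - b))) ((\<lambda>x. 1 - x) ` {1 - b..1 - a})"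
      by simp
    moreover have "(\<lambda>x. 1 - x) ` {1 - b..1 - a} = {a..b}"
      by (auto intro!: image_eqI[of _ _ "1 - x" for x])
    ultimately show ?thesis by simp
  qed
  have "AE u in lborel. u \<in> {0<..<1} \<longrightarrow> ((\<lambda>u. - Q (1 - u)) has_real_derivative q (1 - u)) (at_right u)"
    using hi by (intro AE_right_derivative) (auto simp: has_integral_iff)
  \<comment> \<open>The exceptional set of the reflected function lives in the reflected variable;
    invariance of Lebesgue measure under translation and negation carries it back to
    \<open>u\<close>.\<close>
  then have "AE u in distr lborel borel ((+) 1). u \<in> {0<..<1} \<longrightarrow>
      ((\<lambda>u. - Q (1 - u)) has_real_derivative q (1 - u)) (at_right u)"
    by (simp only: lborel_distr_plus)
  from AE_distrD[OF _ this]
  have "AE u in lborel. 1 + u \<in> {0<..<1} \<longrightarrow>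
      ((\<lambda>u. - Q (1 - u)) has_real_derivative q (1 - (1 + u))) (at_right (1 + u))" by simp
  then have "AE u in distr lborel borel uminus. 1 + u \<in> {0<..<1} \<longrightarrow>
      ((\<lambda>u. - Q (1 - u)) has_real_derivative q (1 - (1 + u))) (at_right (1 + u))"
    by (simp only: lborel_distr_uminus)
  from AE_distrD[OF _ this]
  have "AE u in lborel. u \<in> {0<..<1} \<longrightarrow>
      ((\<lambda>u. - Q (1 - u)) has_real_derivative q u) (at_right (1 - u))" by (simp add: conj_commute)
  moreover have "AE u in lborel. u \<in> {0<..<1} \<longrightarrow> (Q has_real_derivative q u) (at_right u)"
    by (rule AE_right_derivative[OF int diff])
  ultimately show ?thesis
  proof eventually_elim
    case (elim u)
    show ?case
    proof
      assume u: "u \<in> {0<..<1}"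
      have img: "(\<lambda>x. 1 - x) ` {..<u} = {1 - u<..}"
        by (auto intro!: image_eqI[of _ _ "1 - x" for x])
      have "((\<lambda>x. 1 - x) has_real_derivative - 1) (at u within {..<u})"
        by (auto intro!: derivative_eq_intros)
      moreover have "((\<lambda>x. - Q (1 - x)) has_real_derivative q u) (at (1 - u) within (\<lambda>x. 1 - x) ` {..<u})"
        using elim u unfolding img by blast
      ultimately have "(((\<lambda>x. - Q (1 - x)) \<circ> (\<lambda>x. 1 - x)) has_real_derivative q u * - 1) (at u within {..<u})"
        by (intro DERIV_image_chain)
      then have "((\<lambda>x. - Q x) has_real_derivative - q u) (at u within {..<u})" by (simp add: o_def)
      from DERIV_minus[OF this] have "(Q has_real_derivative q u) (at_left u)" by simp
      then show "(Q has_real_derivative q u) (at u)"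
        using elim u by (simp add: has_field_derivative_iff filterlim_at_split)
    qed
  qed
qed

lemma is_density_AE_derivative:
  assumes "is_density Q q"
  shows "AE u in unit_borel. (Q has_real_derivative q u) (at u)"
proof -
  have "AE u in lborel. u \<in> {0<..<1} \<longrightarrow> (Q has_real_derivative q u) (at u)"
    using assms set_lebesgue_integral_eq_integral[of _ q]
    by (intro AE_has_real_derivative) (auto simp: is_density_def)
  then show ?thesis by (subst AE_restrict_space_iff) auto
qed

lemma is_density_cong_AE:
  assumes q: "is_density Q q" and eq: "AE u in unit_leb. q u = q' u"
    and nonneg: "\<And>u. u \<in> {0<..<1} \<Longrightarrow> 0 \<le> q' u" and meas: "q' \<in> borel_measurable borel"
  shows "is_density Q q'"
  unfolding is_density_def
proof (intro conjI allI ballI impI nonneg)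
  fix a b :: real assume ab: "0 < a \<and> a < b \<and> b < 1"
  have "AE u in lebesgue. u \<in> {0<..<1} \<longrightarrow> q u = q' u"
    using eq by (subst (asm) AE_restrict_space_iff) auto
  then have AE: "AE u in lebesgue. indicator {a..b} u *\<^sub>R q u = indicator {a..b} u *\<^sub>R q' u"
    by eventually_elim (use ab in \<open>auto simp: indicator_def\<close>)
  have m: "(\<lambda>u. indicator {a..b} u *\<^sub>R q' u) \<in> borel_measurable lebesgue"
    using meas by (intro measurable_completion) simp
  have i: "integrable lebesgue (\<lambda>u. indicator {a..b} u *\<^sub>R q u)"
    using q ab by (auto simp: is_density_def set_integrable_def)
  show "set_integrable lebesgue {a..b} q'"
    unfolding set_integrable_def using i m AE by (metis integrable_cong_AE_imp)
  have "(LINT u:{a..b}|lebesgue. q u) = (LINT u:{a..b}|lebesgue. q' u)"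
    unfolding set_lebesgue_integral_def using i m AE by (intro integral_cong_AE) auto
  then show "Q b - Q a = (LINT u:{a..b}|lebesgue. q' u)"
    using q ab by (simp add: is_density_def)
qed

text \<open>A density is Lebesgue measurable as a limit of its truncations to compact intervals.
  Joint measurability on product spaces calls for a Borel version, made nonnegative everywhere by
  taking the maximum with 0.\<close>

lemma is_density_borel:
  assumes "is_density Q q"
  obtains q' where "q' \<in> borel_measurable borel" "\<And>u. 0 \<le> q' u" "AE u in unit_leb. q u = q' u" "is_density Q q'"
proof -
  have "(\<lambda>u. indicator {0<..<1} u * q u) \<in> borel_measurable lebesgue"
  proof (rule borel_measurable_LIMSEQ_metric)
    fix k
    have "set_integrable lebesgue {1 / (real k + 3)..1 - 1 / (real k + 3)} q"
      using assms by (auto simp: is_density_def field_simps)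
    then show "(\<lambda>u. indicator {1 / (real k + 3)..1 - 1 / (real k + 3)} u *\<^sub>R q u) \<in> borel_measurable lebesgue"
      unfolding set_integrable_def by auto
  next
    fix u :: real
    have "(\<lambda>k. 1 / (real k + 3)) \<longlonglongrightarrow> 0" by real_asymp
    then have "\<forall>\<^sub>F k in sequentially. 1 / (real k + 3) < min u (1 - u)" if "u \<in> {0<..<1}"
      using that by (intro order_tendstoD) auto
    note this_ev = this
    have "\<forall>\<^sub>F k in sequentially. indicator {1 / (real k + 3)..1 - 1 / (real k + 3)} u *\<^sub>R q u = indicator {0<..<1} u * q u"
    proof (cases "u \<in> {0<..<1}")
      case False
      have "u \<notin> {1 / (real k + 3)..1 - 1 / (real k + 3)}" for k
      proof
        assume "u \<in> {1 / (real k + 3)..1 - 1 / (real k + 3)}"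
        moreover have "0 < 1 / (real k + 3)" by simp
        ultimately have "0 < u" "u < 1" unfolding atLeastAtMost_iff by linarith+
        with False show False by simp
      qed
      with False show ?thesis by simp
    next
      case True
      from this_ev[OF True] show ?thesis
        by (rule eventually_mono) (use True in \<open>auto simp: indicator_def\<close>)
    qed
    then show "(\<lambda>k. indicator {1 / (real k + 3)..1 - 1 / (real k + 3)} u *\<^sub>R q u) \<longlonglongrightarrow> indicator {0<..<1} u * q u"
      by (rule tendsto_eventually)
  qed
  then obtain g where g: "g \<in> borel_measurable lborel" "AE u in lborel. indicator {0<..<1} u * q u = g u"
    using completion_ex_borel_measurable_real by blast
  define q' where "q' u = max 0 (g u)" for u
  have "AE u in lebesgue. indicator {0<..<1} u * q u = g u" using g(2) by (rule AE_completion)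
  then have "AE u in lebesgue. u \<in> {0<..<1} \<longrightarrow> q u = q' u"
  proof eventually_elim
    case (elim u)
    moreover have "u \<in> {0<..<1} \<Longrightarrow> 0 \<le> q u" using assms by (auto simp: is_density_def)
    ultimately show ?case by (auto simp: q'_def)
  qed
  then have ae: "AE u in unit_leb. q u = q' u" by (subst AE_restrict_space_iff) auto
  have m: "q' \<in> borel_measurable borel" using g(1) unfolding q'_def[abs_def] by simp
  show thesis
    using m ae is_density_cong_AE[OF assms ae _ m] by (intro that) (auto simp: q'_def)
qed

section \<open>Locally absolutely continuous quantile functions and change of variables\<close>

locale smooth_quantile =
  fixes \<mu> :: "real measure" and Q q :: "real \<Rightarrow> real"
  assumes \<mu>: "real_distribution \<mu>" and Q_def: "Q = quantile (cdf \<mu>)"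
    and locally_abs_continuous: "locally_abs_continuous Q"
    and density: "is_density Q q"
    and q_measurable [measurable]: "q \<in> borel_measurable borel"
    and q_nonneg: "\<And>u. 0 \<le> q u"
begin

sublocale real_distribution \<mu> by (rule \<mu>)

abbreviation F where "F \<equiv> cdf \<mu>"

lemma F_bounds [simp]: "0 \<le> F x" "F x \<le> 1"
  by (auto simp: cdf_nonneg cdf_bounded_prob)

lemma F_measurable [measurable]: "F \<in> borel_measurable borel"
  by (intro borel_measurable_mono monoI cdf_nondecreasing)

lemma Q_le_iff: "0 < u \<Longrightarrow> u < 1 \<Longrightarrow> Q u \<le> x \<longleftrightarrow> u \<le> F x"
  by (simp add: Q_def quantile_galois[OF \<mu>])

lemma less_Q_iff: "0 < u \<Longrightarrow> u < 1 \<Longrightarrow> x < Q u \<longleftrightarrow> F x < u"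
  using Q_le_iff[of u x] by (simp add: not_le[symmetric])

lemma le_F_Q: "0 < u \<Longrightarrow> u < 1 \<Longrightarrow> u \<le> F (Q u)"
  using Q_le_iff[of u "Q u"] by simp

lemma Q_mono: "0 < u \<Longrightarrow> u \<le> v \<Longrightarrow> v < 1 \<Longrightarrow> Q u \<le> Q v"
  using le_F_Q[of v] by (simp add: Q_le_iff)

text \<open>Absolute continuity is tested on families of one single interval, inside a compact
  neighbourhood of \<open>u\<close>.\<close>

lemma isCont_Q:
  assumes u: "0 < u" "u < 1" shows "isCont Q u"
proof -
  define a b where "a = u / 2" and "b = (u + 1) / 2"
  have ab: "0 < a" "a < u" "u < b" "b < 1" using u by (auto simp: a_def b_def)
  have ac: "abs_continuous_on {a..b} Q"
    using locally_abs_continuous ab by (auto simp: locally_abs_continuous_def)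
  have *: "\<exists>d>0. \<forall>s t. s \<in> {a..b} \<and> t \<in> {a..b} \<and> s \<le> t \<and> t - s < d \<longrightarrow> \<bar>Q t - Q s\<bar> < e" if "0 < e" for e
  proof -
    obtain d where "d > 0" and d: "\<forall>(m::nat) l r. (\<forall>k<m. l k \<le> r k \<and> {l k..r k} \<subseteq> {a..b}) \<and>
        disjoint_family_on (\<lambda>k. {l k<..<r k}) {..<m} \<and> (\<Sum>k<m. r k - l k) < d \<longrightarrow>
        (\<Sum>k<m. \<bar>Q (r k) - Q (l k)\<bar>) < e"
      using ac \<open>0 < e\<close> unfolding abs_continuous_on_def by blast
    have "\<bar>Q t - Q s\<bar> < e" if "s \<in> {a..b}" "t \<in> {a..b}" "s \<le> t" "t - s < d" for s t
      using d[rule_format, of 1 "\<lambda>_. s" "\<lambda>_. t"] that by (auto simp: disjoint_family_on_def)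
    then show ?thesis using \<open>d > 0\<close> by blast
  qed
  show ?thesis
    unfolding continuous_at_eps_delta
  proof (intro allI impI)
    fix e :: real assume "e > 0"
    with * obtain d where d: "d > 0"
      "\<And>s t. s \<in> {a..b} \<Longrightarrow> t \<in> {a..b} \<Longrightarrow> s \<le> t \<Longrightarrow> t - s < d \<Longrightarrow> \<bar>Q t - Q s\<bar> < e" by meson
    have "\<bar>Q y - Q u\<bar> < e" if "\<bar>y - u\<bar> < min d (min (u - a) (b - u))" for y
    proof (cases "y \<le> u")
      case True
      then have "\<bar>Q u - Q y\<bar> < e" using that ab by (intro d(2)) auto
      then show ?thesis by (simp add: abs_minus_commute)
    next
      case False
      then show ?thesis using that ab by (intro d(2)) auto
    qed
    then show "\<exists>d>0. \<forall>x'. dist x' u < d \<longrightarrow> dist (Q x') (Q u) < e"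
      using d(1) ab by (intro exI[of _ "min d (min (u - a) (b - u))"]) (auto simp: dist_real_def)
  qed
qed

lemma Q_measurable: "Q \<in> borel_measurable unit_borel"
  using isCont_Q by (intro left_continuous_measurable) (auto simp: isCont_def intro: filterlim_at_split[THEN iffD1, THEN conjunct1])

text \<open>Continuity of \<open>Q\<close> excludes flat stretches of \<open>F\<close> strictly
  between the levels 0 and 1: \<open>x < Q v\<close> for every \<open>v > F x\<close> below 1, and
  \<open>v\<close> may decrease to \<open>F x\<close>.\<close>

lemma Q_F:
  assumes "0 < F x" "F x < 1" shows "Q (F x) = x"
proof (rule antisym)
  show "Q (F x) \<le> x" using assms by (simp add: Q_le_iff)
  show "x \<le> Q (F x)"
  proof (rule tendsto_lowerbound)
    show "(Q \<longlongrightarrow> Q (F x)) (at_right (F x))"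
      using isCont_Q[OF assms] by (auto simp: isCont_def filterlim_at_split)
    have "\<forall>\<^sub>F v in at_right (F x). v < 1"
      using assms(2) by (rule eventually_at_right_field[THEN iffD2, OF exI[of _ 1], OF conjI]) auto
    then show "\<forall>\<^sub>F v in at_right (F x). x \<le> Q v"
      using eventually_at_right_less[of "F x"]
      by eventually_elim (use assms(1) less_Q_iff[of _ x] in \<open>auto simp: less_imp_le\<close>)
  qed simp
qed

lemma AE_derivative: "AE u in unit_borel. (Q has_real_derivative q u) (at u)"
  using density by (rule is_density_AE_derivative)

text \<open>If \<open>F\<close> jumps past \<open>u\<close> at \<open>Q u\<close>, then
  \<open>Q\<close> is constant just to the right of \<open>u\<close>, so the right difference
  quotients vanish.\<close>

lemma flat_derivative:
  assumes u: "0 < u" "u < 1" and d: "(Q has_real_derivative D) (at u)" and ne: "F (Q u) \<noteq> u"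
  shows "D = 0"
proof -
  have "u < min 1 (F (Q u))" using le_F_Q[OF u] ne u(2) by simp
  then have "\<forall>\<^sub>F v in at_right u. u < v \<and> v < min 1 (F (Q u))"
    by (intro eventually_conj eventually_at_right_less) (auto simp: eventually_at_right_field)
  then have "\<forall>\<^sub>F v in at_right u. (Q v - Q u) / (v - u) = 0"
  proof eventually_elim
    case (elim v)
    then have v: "u < v" "v < F (Q u)" "v < 1" unfolding min_less_iff_conj by auto
    then have "Q v \<le> Q u" using u F_bounds(2)[of "Q u"] by (intro Q_le_iff[THEN iffD2]) linarith+
    moreover have "Q u \<le> Q v" using v u by (intro Q_mono) auto
    ultimately show ?case by simp
  qed
  then have "((\<lambda>v. (Q v - Q u) / (v - u)) \<longlongrightarrow> 0) (at_right u)" by (rule tendsto_eventually)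
  moreover have "((\<lambda>v. (Q v - Q u) / (v - u)) \<longlongrightarrow> D) (at_right u)"
    using d by (simp add: has_field_derivative_iff filterlim_at_split)
  ultimately show ?thesis by (rule tendsto_unique[OF trivial_limit_at_right_real, rotated])
qed

text \<open>In an integrand with factor \<open>q u\<close> this allows \<open>F (Q u)\<close> and
  \<open>u\<close> to be exchanged almost everywhere, although \<open>F\<close> may jump.\<close>

lemma AE_flat: "AE u in unit_borel. q u = 0 \<or> F (Q u) = u"
  using AE_derivative AE_space
  by eventually_elim (auto dest: flat_derivative[rotated 2])

lemma stieltjes_eq_density: "stieltjes_measure Q = density unit_borel (\<lambda>u. ennreal (q u))"
proof -
  have "is_stieltjes_measure Q (density unit_borel (\<lambda>u. ennreal (q u)))"
    unfolding is_stieltjes_measure_def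
  proof (intro conjI allI impI)
    show "sets (density unit_borel (\<lambda>u. ennreal (q u))) = sets (restrict_space borel {0<..<1})"
      by (simp add: sets_restrict_space)
    fix a b :: real assume ab: "0 < a \<and> a < b \<and> b < 1"
    have i: "set_integrable lebesgue {a..b} q" and eq: "Q b - Q a = (LINT u:{a..b}|lebesgue. q u)"
      using density ab by (auto simp: is_density_def)
    have qm: "(\<lambda>u. ennreal (q u)) \<in> borel_measurable unit_borel" by (rule measurable_restrict_space1) simp
    have "emeasure (density unit_borel (\<lambda>u. ennreal (q u))) {a..<b} = (\<integral>\<^sup>+u. ennreal (q u) * indicator {a..<b} u \<partial>unit_borel)"
      using ab by (intro emeasure_density[OF qm]) (auto simp: sets_restrict_space_iff)
    also have "\<dots> = (\<integral>\<^sup>+u. ennreal (q u) * indicator {a..<b} u * indicator {0<..<1} u \<partial>lborel)"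
      by (rule nn_integral_restrict_space) simp
    also have "\<dots> = (\<integral>\<^sup>+u. ennreal (indicator {a..b} u *\<^sub>R q u) \<partial>lborel)"
    proof (rule nn_integral_cong_AE)
      show "AE u in lborel. ennreal (q u) * indicator {a..<b} u * indicator {0<..<1} u = ennreal (indicator {a..b} u *\<^sub>R q u)"
        \<comment> \<open>The half-open and the closed interval differ only in \<open>b\<close>, a
          null set.\<close>
        using AE_lborel_singleton[of b] by eventually_elim (use ab in \<open>auto simp: indicator_def\<close>)
    qed
    also have "\<dots> = (\<integral>\<^sup>+u. ennreal (indicator {a..b} u *\<^sub>R q u) \<partial>lebesgue)"
      by (rule nn_integral_completion[symmetric])
    also have "\<dots> = ennreal (Q b - Q a)"
      unfolding eq set_lebesgue_integral_def using i q_nonneg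
      by (intro nn_integral_eq_integral) (auto simp: set_integrable_def indicator_def)
    finally show "emeasure (density unit_borel (\<lambda>u. ennreal (q u))) {a..<b} = ennreal (Q b - Q a)" .
  qed
  moreover have "is_stieltjes_measure Q (stieltjes_measure Q)"
    using stieltjes_measure_quantile[OF \<mu>] by (simp add: Q_def)
  ultimately show ?thesis by (metis is_stieltjes_measure_unique)
qed

text \<open>A second description of the same measure, as the image of length under \<open>F\<close>.
  Equating it with the description by the density \<open>q\<close> yields the change of variables
  between \<open>u\<close> and \<open>x\<close>.\<close>

lemma stieltjes_eq_image: "stieltjes_measure Q = restrict_space (distr lborel borel F) {0<..<1}"
proof -
  have "is_stieltjes_measure Q (restrict_space (distr lborel borel F) {0<..<1})"
    unfolding is_stieltjes_measure_def
  proof (intro conjI allI impI)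
    show "sets (restrict_space (distr lborel borel F) {0<..<1}) = sets (restrict_space borel {0<..<1})"
      by (simp add: sets_restrict_space)
    fix a b :: real assume ab: "0 < a \<and> a < b \<and> b < 1"
    have "F -` {a..<b} = {Q a..<Q b}"
      using ab Q_le_iff[of a] less_Q_iff[of b] by auto
    then show "emeasure (restrict_space (distr lborel borel F) {0<..<1}) {a..<b} = ennreal (Q b - Q a)"
      using ab Q_mono[of a b] by (subst emeasure_restrict_space) (auto simp: emeasure_distr)
  qed
  moreover have "is_stieltjes_measure Q (stieltjes_measure Q)"
    using stieltjes_measure_quantile[OF \<mu>] by (simp add: Q_def)
  ultimately show ?thesis by (metis is_stieltjes_measure_unique)
qed

lemma nn_integral_stieltjes:
  assumes "h \<in> borel_measurable unit_borel"
  shows "(\<integral>\<^sup>+u. h u \<partial>stieltjes_measure Q) = (\<integral>\<^sup>+u. ennreal (q u) * h u \<partial>unit_borel)"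
  unfolding stieltjes_eq_density
  by (rule nn_integral_density[OF measurable_restrict_space1 assms]) simp

lemma nn_integral_density_F:
  assumes [measurable]: "h \<in> borel_measurable borel"
  shows "(\<integral>\<^sup>+u. ennreal (q u) * h u \<partial>unit_borel) = (\<integral>\<^sup>+x. h (F x) * indicator {0<..<1} (F x) \<partial>lborel)"
proof -
  have h: "h \<in> borel_measurable unit_borel" by (rule measurable_restrict_space1) simp
  have "(\<integral>\<^sup>+u. ennreal (q u) * h u \<partial>unit_borel) = (\<integral>\<^sup>+u. h u \<partial>restrict_space (distr lborel borel F) {0<..<1})"
    by (simp only: nn_integral_stieltjes[OF h, symmetric] stieltjes_eq_image)
  also have "\<dots> = (\<integral>\<^sup>+u. h u * indicator {0<..<1} u \<partial>distr lborel borel F)"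
    by (rule nn_integral_restrict_space) simp
  also have "\<dots> = (\<integral>\<^sup>+x. h (F x) * indicator {0<..<1} (F x) \<partial>lborel)"
    by (rule nn_integral_distr) measurable
  finally show ?thesis .
qed

end

section \<open>Normalized sums of independent variables\<close>

context prob_space
begin

lemma integrable_bounded_rv:
  fixes Y :: "'a \<Rightarrow> real"
  assumes "Y \<in> borel_measurable M" "\<And>\<omega>. \<omega> \<in> space M \<Longrightarrow> \<bar>Y \<omega>\<bar> \<le> A"
  shows "integrable M Y"
  using assms by (intro integrable_const_bound[of Y A]) auto

lemma second_moment_indep_sum:
  fixes Y :: "nat \<Rightarrow> 'a \<Rightarrow> real"
  assumes "indep_vars (\<lambda>_. borel) Y {..<n}"
    and "\<And>i \<omega>. i < n \<Longrightarrow> \<omega> \<in> space M \<Longrightarrow> \<bar>Y i \<omega>\<bar> \<le> A"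
    and "\<And>i. i < n \<Longrightarrow> expectation (Y i) = 0"
    and "\<And>i. i < n \<Longrightarrow> expectation (\<lambda>\<omega>. (Y i \<omega>)\<^sup>2) = v"
  shows "expectation (\<lambda>\<omega>. (\<Sum>i<n. Y i \<omega>)\<^sup>2) = n * v"
  using assms
proof (induction n)
  case (Suc n)
  have meas [measurable]: "Y i \<in> borel_measurable M" if "i \<le> n" for i
    using Suc.prems(1) that by (auto simp: indep_vars_def)
  define S where "S = (\<lambda>\<omega>. \<Sum>i<n. Y i \<omega>)"
  have [measurable]: "S \<in> borel_measurable M" unfolding S_def by measurable
  have Sb: "\<bar>S \<omega>\<bar> \<le> n * A" if "\<omega> \<in> space M" for \<omega>
    unfolding S_def using Suc.prems(2) that by (intro order.trans[OF sum_abs] sum_bounded_above[of "{..<n}", simplified]) auto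
  have A: "\<bar>Y n \<omega>\<bar> \<le> A" "0 \<le> A" if "\<omega> \<in> space M" for \<omega>
    using Suc.prems(2)[of n \<omega>] that by auto
  have iS: "integrable M S" and iY: "integrable M (Y n)"
    by (rule integrable_bounded_rv[OF _ Sb] integrable_bounded_rv[OF _ A(1)]; simp)+
  have iS2: "integrable M (\<lambda>\<omega>. (S \<omega>)\<^sup>2)"
    by (rule integrable_bounded_rv[where A="(n * A)\<^sup>2"])
      (use Sb A(2) in \<open>auto simp: abs_le_square_iff[symmetric] abs_mult\<close>)
  have iY2: "integrable M (\<lambda>\<omega>. (Y n \<omega>)\<^sup>2)"
    by (rule integrable_bounded_rv[where A="A\<^sup>2"])
      (use A in \<open>auto simp: abs_le_square_iff[symmetric]\<close>)
  have ind: "indep_var borel (Y n) borel S"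
    unfolding S_def using Suc.prems(1) by (intro indep_vars_sum) (auto simp: lessThan_Suc)
  have iYS: "integrable M (\<lambda>\<omega>. Y n \<omega> * S \<omega>)"
    by (rule indep_var_integrable[OF ind iY iS])
  have "expectation (\<lambda>\<omega>. Y n \<omega> * S \<omega>) = 0"
    using indep_var_lebesgue_integral[OF ind iY iS] Suc.prems(3)[of n] by simp
  moreover have "expectation (\<lambda>\<omega>. (S \<omega>)\<^sup>2) = n * v"
    unfolding S_def using Suc.prems by (intro Suc.IH) (auto intro: indep_vars_subset)
  moreover have "(\<Sum>i<Suc n. Y i \<omega>)\<^sup>2 = (S \<omega>)\<^sup>2 + (Y n \<omega>)\<^sup>2 + 2 * (Y n \<omega> * S \<omega>)" for \<omega>
    by (simp add: S_def power2_sum algebra_simps)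
  ultimately show ?case
    using iS2 iY2 iYS Suc.prems(4)[of n]
    by (simp only: Bochner_Integration.integral_add Bochner_Integration.integrable_add
      integrable_mult_right integral_mult_right_zero) (simp add: algebra_simps)
qed simp

text \<open>Taylor expansion puts each factor within \<open>A ^ 3 / (n * sqrt n)\<close> of
  \<open>1 - v / (2 * n)\<close>, and factors of modulus at most 1 make product errors additive. The
  target variance \<open>v'\<close> is separate from \<open>v\<close> because in the bootstrap the
  actual variance is random and the limit is not.\<close>

lemma char_normalized_sum:
  fixes Y :: "nat \<Rightarrow> 'a \<Rightarrow> real"
  assumes indep: "indep_vars (\<lambda>_. borel) Y {..<n}" and n: "n > 0" "A\<^sup>2 \<le> n"
    and bound: "\<And>i \<omega>. i < n \<Longrightarrow> \<omega> \<in> space M \<Longrightarrow> \<bar>Y i \<omega>\<bar> \<le> A"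
    and mean: "\<And>i. i < n \<Longrightarrow> expectation (Y i) = 0"
    and var: "\<And>i. i < n \<Longrightarrow> expectation (\<lambda>\<omega>. (Y i \<omega>)\<^sup>2) = v"
    and v': "0 \<le> v'" "v' \<le> A\<^sup>2"
  shows "cmod (expectation (\<lambda>\<omega>. iexp ((\<Sum>i<n. Y i \<omega>) / sqrt n)) - of_real (exp (- v' / 2)))
    \<le> A ^ 3 / sqrt n + \<bar>v - v'\<bar> / 2 + \<bar>(1 - v' / (2 * n)) ^ n - exp (- v' / 2)\<bar>"
proof -
  define t where "t = 1 / sqrt n"
  have t: "t > 0" "t\<^sup>2 = 1 / n" using n by (auto simp: t_def power_divide)
  have meas [measurable]: "Y i \<in> borel_measurable M" if "i < n" for i
    using indep that by (auto simp: indep_vars_def)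
  obtain \<omega>0 where "\<omega>0 \<in> space M" using not_empty by auto
  then have A: "0 \<le> A" using bound[OF n(1)] by (meson abs_ge_zero order_trans)
  have sq: "integrable M (\<lambda>\<omega>. (Y i \<omega>)\<^sup>2)" if "i < n" for i
    by (rule integrable_bounded_rv[where A="A\<^sup>2"])
      (use bound[OF that] that A in \<open>auto simp: abs_le_square_iff[symmetric]\<close>)
  have v: "0 \<le> v" "v \<le> A\<^sup>2"
  proof -
    have "0 \<le> expectation (\<lambda>\<omega>. (Y 0 \<omega>)\<^sup>2)" by (rule Bochner_Integration.integral_nonneg) simp
    then show "0 \<le> v" using var[OF n(1)] by simp
    have "expectation (\<lambda>\<omega>. (Y 0 \<omega>)\<^sup>2) \<le> expectation (\<lambda>_. A\<^sup>2)"
      using sq[OF n(1)] bound[OF n(1)] A by (intro integral_mono) (auto simp: abs_le_square_iff[symmetric])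
    then show "v \<le> A\<^sup>2" using var[OF n(1)] by (simp add: prob_space)
  qed
  \<comment> \<open>Here \<open>A\<^sup>2 \<le> n\<close> enters: it keeps the approximating factors
    at absolute value at most 1.\<close>
  have small: "\<bar>1 - x / (2 * n)\<bar> \<le> 1" if "0 \<le> x" "x \<le> A\<^sup>2" for x
    using that n by (simp add: abs_le_iff divide_le_eq)
  have each: "cmod (char (distr M borel (Y i)) t - (1 - v / (2 * n))) \<le> A ^ 3 / (n * sqrt n)" if i: "i < n" for i
  proof -
    have "cmod (char (distr M borel (Y i)) t - (1 - t\<^sup>2 * v / 2))
        \<le> t\<^sup>2 / 6 * expectation (\<lambda>x. min (6 * (Y i x)\<^sup>2) (\<bar>t\<bar> * \<bar>Y i x\<bar> ^ 3))"
    proof (rule char_approx3')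
      show "integrable M (Y i)" using bound[OF i] i by (intro integrable_bounded_rv) auto
      show "variance (Y i) = v" using mean[OF i] var[OF i] by simp
    qed (use i sq mean in auto)
    also have "\<dots> \<le> t\<^sup>2 / 6 * expectation (\<lambda>x. t * A ^ 3)"
    proof (intro mult_left_mono integral_mono)
      show "integrable M (\<lambda>x. min (6 * (Y i x)\<^sup>2) (\<bar>t\<bar> * \<bar>Y i x\<bar> ^ 3))"
      proof (rule Bochner_Integration.integrable_bound)
        show "integrable M (\<lambda>x. 6 * (Y i x)\<^sup>2)" using sq[OF i] by simp
      qed (use i in auto)
      \<comment> \<open>For bounded variables the cubic branch of the minimum is the useful
        one.\<close>
      show "min (6 * (Y i x)\<^sup>2) (\<bar>t\<bar> * \<bar>Y i x\<bar> ^ 3) \<le> t * A ^ 3" if "x \<in> space M" for x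
        using t bound[OF i that] by (intro min.coboundedI2 mult_mono power_mono) auto
    qed auto
    also have "\<dots> = t\<^sup>2 / 6 * (t * A ^ 3)" by (simp add: prob_space)
    also have "\<dots> = A ^ 3 / (n * sqrt n) / 6" using t by (simp add: t_def)
    also have "\<dots> \<le> A ^ 3 / (n * sqrt n)"
    proof -
      have "x / 6 \<le> x" if "0 \<le> x" for x :: real using that by simp
      then show ?thesis by this (use A in simp)
    qed
    finally show ?thesis using t by (simp add: mult.commute)
  qed
  have "expectation (\<lambda>\<omega>. iexp ((\<Sum>i<n. Y i \<omega>) / sqrt n)) = char (distr M borel (\<lambda>\<omega>. \<Sum>i<n. Y i \<omega>)) t"
    by (simp add: char_def integral_distr t_def)
  also have "\<dots> = (\<Prod>i<n. char (distr M borel (Y i)) t)"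
    by (rule char_distr_sum[OF indep])
  finally have eq: "expectation (\<lambda>\<omega>. iexp ((\<Sum>i<n. Y i \<omega>) / sqrt n)) = (\<Prod>i<n. char (distr M borel (Y i)) t)" .
  have "cmod ((\<Prod>i<n. char (distr M borel (Y i)) t) - (\<Prod>i<n. of_real (1 - v / (2 * n))))
      \<le> (\<Sum>i<n. cmod (char (distr M borel (Y i)) t - of_real (1 - v / (2 * n))))"
    using small[OF v] by (intro norm_prod_diff)
      (auto intro!: real_distribution.cmod_char_le_1 real_distribution_distr simp: simp del: of_real_diff)
  also have "\<dots> \<le> (\<Sum>i<n. A ^ 3 / (n * sqrt n))"
    using each by (intro sum_mono) auto
  also have "\<dots> = A ^ 3 / sqrt n" using n by simp
  finally have 1: "cmod ((\<Prod>i<n. char (distr M borel (Y i)) t) - of_real ((1 - v / (2 * n)) ^ n)) \<le> A ^ 3 / sqrt n"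
    by simp
  have "\<bar>(1 - v / (2 * n)) ^ n - (1 - v' / (2 * n)) ^ n\<bar> \<le> n * \<bar>(1 - v / (2 * n)) - (1 - v' / (2 * n))\<bar>"
    using norm_power_diff[of "1 - v / (2 * n)" "1 - v' / (2 * n)" n] small[OF v] small[OF v'] by simp
  also have "(1 - v / (2 * n)) - (1 - v' / (2 * n)) = (v' - v) / (2 * n)" by (simp add: diff_divide_distrib)
  also have "n * \<bar>(v' - v) / (2 * n)\<bar> = \<bar>v - v'\<bar> / 2" using n by (simp add: abs_divide abs_minus_commute)
  finally have 2: "\<bar>(1 - v / (2 * n)) ^ n - (1 - v' / (2 * n)) ^ n\<bar> \<le> \<bar>v - v'\<bar> / 2" .
  let ?P = "\<Prod>i<n. char (distr M borel (Y i)) t"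
  let ?a = "(1 - v / (2 * n)) ^ n" and ?b = "(1 - v' / (2 * n)) ^ n"
  have "?P - of_real (exp (- v' / 2)) = (?P - of_real ?a) + (of_real (?a - ?b) + of_real (?b - exp (- v' / 2)))"
    by simp
  also have "cmod \<dots> \<le> cmod (?P - of_real ?a) + (cmod (of_real (?a - ?b)) + cmod (of_real (?b - exp (- v' / 2))))"
    by (intro norm_triangle_mono order_refl)
  also have "\<dots> \<le> A ^ 3 / sqrt n + (\<bar>v - v'\<bar> / 2 + \<bar>?b - exp (- v' / 2)\<bar>)"
    using 1 2 unfolding norm_of_real by (intro add_mono order_refl) simp_all
  finally show ?thesis unfolding eq by (simp only: add.assoc of_nat_mult of_nat_numeral)
qed

end

lemma expectation_cos_shift:
  assumes "prob_space M" and [measurable]: "Y \<in> borel_measurable M"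
  shows "(\<integral>\<omega>. cos (Y \<omega> + \<theta>) \<partial>M) = Re (iexp \<theta> * (\<integral>\<omega>. iexp (Y \<omega>) \<partial>M))"
proof -
  interpret prob_space M by fact
  have i: "integrable M (\<lambda>\<omega>. iexp (Y \<omega>))" by (rule integrable_iexp) simp_all
  have "Re (iexp \<theta> * (\<integral>\<omega>. iexp (Y \<omega>) \<partial>M)) = (\<integral>\<omega>. Re (iexp \<theta> * iexp (Y \<omega>)) \<partial>M)"
    using i by simp
  also have "(\<lambda>\<omega>. Re (iexp \<theta> * iexp (Y \<omega>))) = (\<lambda>\<omega>. cos (Y \<omega> + \<theta>))"
    by (simp add: Re_exp Im_exp cos_add mult.commute)
  finally show ?thesis ..
qed

lemma expectation_cos_diff_le:
  assumes "prob_space M" "Y \<in> borel_measurable M"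
  shows "\<bar>(\<integral>\<omega>. cos (Y \<omega> + \<theta>) \<partial>M) - r * cos \<theta>\<bar> \<le> cmod ((\<integral>\<omega>. iexp (Y \<omega>) \<partial>M) - of_real r)"
proof -
  have "(\<integral>\<omega>. cos (Y \<omega> + \<theta>) \<partial>M) - r * cos \<theta> = Re (iexp \<theta> * ((\<integral>\<omega>. iexp (Y \<omega>) \<partial>M) - of_real r))"
    unfolding expectation_cos_shift[OF assms]
    by (simp add: right_diff_distrib Re_exp)
  also have "\<bar>\<dots>\<bar> \<le> cmod (iexp \<theta> * ((\<integral>\<omega>. iexp (Y \<omega>) \<partial>M) - of_real r))" by (rule abs_Re_le_cmod)
  also have "\<dots> = cmod ((\<integral>\<omega>. iexp (Y \<omega>) \<partial>M) - of_real r)" by (simp add: norm_mult)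
  finally show ?thesis .
qed

text \<open>Mean and variance pin down the parameters of the normal law. A degenerate variable must
  vanish almost surely, and then both sides are 1.\<close>

lemma gaussian_iexp:
  assumes "prob_space N" and Z: "gaussian_rv N Z"
    and mean: "(\<integral>y. Z y \<partial>N) = 0" and var: "(\<integral>y. (Z y)\<^sup>2 \<partial>N) = v"
  shows "(\<integral>y. iexp (Z y) \<partial>N) = of_real (exp (- v / 2))"
proof -
  interpret prob_space N by fact
  have [measurable]: "Z \<in> borel_measurable N" using Z by (simp add: gaussian_rv_def)
  from Z consider m where "AE y in N. Z y = m"
    | m s where "s > 0" "distributed N lborel Z (normal_density m s)"
    by (auto simp: gaussian_rv_def)
  then show ?thesis
  proof cases
    case 1
    have "(\<integral>y. Z y \<partial>N) = (\<integral>y. m \<partial>N)" using 1 by (intro integral_cong_AE) auto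
    then have "m = 0" using mean by (simp add: prob_space)
    then have 0: "AE y in N. Z y = 0" using 1 by simp
    then have "(\<integral>y. (Z y)\<^sup>2 \<partial>N) = (\<integral>y. 0 \<partial>N)" by (intro integral_cong_AE) auto
    then have "v = 0" using var by simp
    moreover have "(\<integral>y. iexp (Z y) \<partial>N) = (\<integral>y. 1 \<partial>N)" using 0 by (intro integral_cong_AE) auto
    ultimately show ?thesis by (simp add: prob_space)
  next
    case 2
    have "m = 0" using normal_distributed_expectation[OF 2] mean by simp
    have "v = s\<^sup>2"
      using normal_distributed_variance[OF 2] mean var by simp
    have "distributed N lborel (\<lambda>y. (Z y - 0) / s) std_normal_density"
      using 2 \<open>m = 0\<close> normal_standard_normal_convert[OF 2(1), of Z 0] by simp
    then have d: "distr N lborel (\<lambda>y. Z y / s) = std_normal_distribution"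
      by (simp add: distributed_def)
    have "(\<integral>y. iexp (Z y) \<partial>N) = (\<integral>y. iexp (s * (Z y / s)) \<partial>N)" using 2(1) by simp
    also have "\<dots> = (\<integral>x. iexp (s * x) \<partial>distr N lborel (\<lambda>y. Z y / s))"
      by (subst integral_distr) auto
    also have "\<dots> = char std_normal_distribution s" by (simp add: d char_def)
    also have "\<dots> = of_real (exp (- v / 2))"
      by (simp add: char_std_normal_distribution \<open>v = s\<^sup>2\<close>)
    finally show ?thesis .
  qed
qed


section \<open>Uniform approximation of Lipschitz functions by trigonometric polynomials\<close>

text \<open>Cosines with a phase suffice: frequency zero gives constants, a quarter period gives
  sines, and products return to sums of cosines. Expectations of such functions are governed by
  characteristic functions.\<close>

inductive_set trig_span :: "nat \<Rightarrow> ((nat \<Rightarrow> real) \<Rightarrow> real) set" for m where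
  cos: "(\<lambda>x. cos ((\<Sum>j<m. c j * x j) + \<theta>)) \<in> trig_span m"
| add: "f \<in> trig_span m \<Longrightarrow> g \<in> trig_span m \<Longrightarrow> (\<lambda>x. f x + g x) \<in> trig_span m"
| scale: "f \<in> trig_span m \<Longrightarrow> (\<lambda>x. r * f x) \<in> trig_span m"

lemma trig_span_const: "(\<lambda>_. r) \<in> trig_span m"
  using trig_span.scale[OF trig_span.cos[where m=m and c="\<lambda>_. 0" and \<theta>=0], of r] by simp

lemma trig_span_sin: "j < m \<Longrightarrow> (\<lambda>x. sin (c * x j)) \<in> trig_span m"
proof -
  assume "j < m"
  then have "(\<Sum>i<m. (if i = j then c else 0) * x i) = c * x j" for x :: "nat \<Rightarrow> real"
    by (simp add: if_distrib[of "\<lambda>a. a * _"] sum.delta cong: if_cong)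
  then show ?thesis
    using trig_span.cos[where m=m and c="\<lambda>i. if i = j then c else 0" and \<theta>="- (pi / 2)"]
    by (simp add: cos_diff)
qed

lemma trig_span_mult:
  assumes "f \<in> trig_span m" "g \<in> trig_span m"
  shows "(\<lambda>x. f x * g x) \<in> trig_span m"
  using assms(1)
proof induction
  case (cos c \<theta>)
  show ?case using assms(2)
  proof induction
    case (cos d \<eta>)
    have "cos ((\<Sum>j<m. c j * x j) + \<theta>) * cos ((\<Sum>j<m. d j * x j) + \<eta>) =
        1 / 2 * cos ((\<Sum>j<m. (c j - d j) * x j) + (\<theta> - \<eta>)) + 1 / 2 * cos ((\<Sum>j<m. (c j + d j) * x j) + (\<theta> + \<eta>))" for x
    proof -
      have "(\<Sum>j<m. (c j - d j) * x j) + (\<theta> - \<eta>) = ((\<Sum>j<m. c j * x j) + \<theta>) - ((\<Sum>j<m. d j * x j) + \<eta>)"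
        "(\<Sum>j<m. (c j + d j) * x j) + (\<theta> + \<eta>) = ((\<Sum>j<m. c j * x j) + \<theta>) + ((\<Sum>j<m. d j * x j) + \<eta>)"
        by (simp_all add: left_diff_distrib distrib_right sum_subtractf sum.distrib)
      then show ?thesis by (simp only: cos_times_cos) simp
    qed
    then show ?case by (simp only:) (intro trig_span.intros)
  qed (auto simp: distrib_left mult.left_commute intro: trig_span.intros)
qed (auto simp: distrib_right mult.assoc intro: trig_span.intros)

lemma trig_span_power: "f \<in> trig_span m \<Longrightarrow> (\<lambda>x. f x ^ k) \<in> trig_span m"
  by (induction k) (auto intro: trig_span_const trig_span_mult)

lemma trig_span_Suc: "f \<in> trig_span m \<Longrightarrow> f \<in> trig_span (Suc m)"
proof (induction rule: trig_span.induct)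
  case (cos c \<theta>)
  show ?case using trig_span.cos[where m="Suc m" and c="c(m := 0)" and \<theta>=\<theta>] by simp
qed (auto intro: trig_span.intros)

text \<open>The left side is the mean absolute deviation of a binomial proportion, whose variance is
  \<open>s * (1 - s) / N\<close>. Young's inequality with parameter \<open>d\<close> passes from the
  square to the absolute value.\<close>

lemma Bernstein_abs_deviation:
  assumes s: "0 \<le> s" "s \<le> 1" and N: "N > 0" and d: "d > 0" "1 / (real N) \<le> d\<^sup>2"
  shows "(\<Sum>k\<le>N. Bernstein N k s * \<bar>s - k / N\<bar>) \<le> d"
proof -
  have "(\<Sum>k\<le>N. Bernstein N k s * (s - k / N)\<^sup>2)
      = (\<Sum>k\<le>N. s\<^sup>2 * Bernstein N k s - (2 * s / N) * (k * Bernstein N k s)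
          + (1 / N\<^sup>2) * (k * (real k - 1) * Bernstein N k s) + (1 / N\<^sup>2) * (k * Bernstein N k s))"
    using N by (intro sum.cong) (auto simp: power2_eq_square field_simps)
  also have "\<dots> = s\<^sup>2 - (2 * s / N) * (N * s) + (1 / N\<^sup>2) * (real N * (real N - 1) * s\<^sup>2) + (1 / N\<^sup>2) * (N * s)"
    by (simp only: sum.distrib sum_subtractf sum_distrib_left[symmetric] sum_Bernstein sum_k_Bernstein sum_kk_Bernstein mult_1_right)
  also have "\<dots> = s * (1 - s) / N" using N by (simp add: power2_eq_square field_simps)
  also have "\<dots> \<le> 1 / N" using s N by (intro divide_right_mono mult_le_one) auto
  also have "\<dots> \<le> d\<^sup>2" by fact
  finally have var: "(\<Sum>k\<le>N. Bernstein N k s * (s - k / N)\<^sup>2) \<le> d\<^sup>2" .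
  have "\<bar>y\<bar> \<le> d / 2 + y\<^sup>2 / (2 * d)" for y :: real
  proof -
    have "0 \<le> (d - \<bar>y\<bar>)\<^sup>2" by simp
    then have "2 * d * \<bar>y\<bar> \<le> d\<^sup>2 + y\<^sup>2" by (simp add: power2_diff)
    then have "2 * d * \<bar>y\<bar> / (2 * d) \<le> (d\<^sup>2 + y\<^sup>2) / (2 * d)" using d by (intro divide_right_mono) auto
    then show ?thesis using d by (simp add: add_divide_distrib power2_eq_square)
  qed
  then have "(\<Sum>k\<le>N. Bernstein N k s * \<bar>s - k / N\<bar>) \<le> (\<Sum>k\<le>N. Bernstein N k s * (d / 2 + (s - k / N)\<^sup>2 / (2 * d)))"
    using s by (intro sum_mono mult_left_mono Bernstein_nonneg)
  also have "\<dots> = (\<Sum>k\<le>N. Bernstein N k s) * (d / 2) + (\<Sum>k\<le>N. Bernstein N k s * (s - k / N)\<^sup>2) / (2 * d)"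
    by (simp only: distrib_left sum.distrib sum_distrib_right sum_divide_distrib times_divide_eq_right)
  also have "\<dots> \<le> 1 * (d / 2) + d\<^sup>2 / (2 * d)"
    using var d by (intro add_mono divide_right_mono) auto
  also have "\<dots> = d" using d by (simp add: power2_eq_square)
  finally show ?thesis .
qed

text \<open>Bernstein weights evaluated at \<open>(1 + sin (x / l)) / 2\<close>: they are trigonometric in \<open>x\<close>, and
  \<open>l * sin (x / l)\<close> is close to \<open>x\<close> when \<open>l\<close> is large.\<close>

lemma trigonometric_weights:
  fixes L \<epsilon> :: real
  assumes L: "0 \<le> L" and \<epsilon>: "0 < \<epsilon>"
  shows "\<exists>(N::nat) (\<xi>::nat \<Rightarrow> real) w. (\<forall>k x. 0 \<le> w k x) \<and> (\<forall>x. (\<Sum>k\<le>N. w k x) = 1) \<and>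
    (\<forall>x. (\<Sum>k\<le>N. w k x * (L * \<bar>x - \<xi> k\<bar>)) \<le> \<epsilon> * (1 + x\<^sup>2)) \<and>
    (\<forall>k j m. j < m \<longrightarrow> (\<lambda>x. w k (x j)) \<in> trig_span m)"
proof -
  \<comment> \<open>Large \<open>l\<close> keeps the error of replacing \<open>x\<close> by
    \<open>l * sin (x / l)\<close>, which is at most \<open>x\<^sup>2 / (2 * l)\<close>, within
    \<open>\<epsilon> * x\<^sup>2\<close> after multiplication by \<open>L\<close>.\<close>
  define l where "l = max 1 (L / (2 * \<epsilon>))"
  have l: "l > 0" "L / (2 * l) \<le> \<epsilon>"
  proof -
    show "l > 0" by (simp add: l_def)
    have "L / (2 * \<epsilon>) \<le> l" by (simp add: l_def)
    then show "L / (2 * l) \<le> \<epsilon>" using \<epsilon> \<open>l > 0\<close> by (simp add: field_simps)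
  qed
  \<comment> \<open>Allowance for the Bernstein deviation, which is scaled by
    \<open>2 * l * L\<close>; adding 1 to the denominator covers \<open>L = 0\<close>.\<close>
  define d where "d = \<epsilon> / (2 * l * L + 1)"
  have d: "d > 0" "2 * l * L * d \<le> \<epsilon>"
    using L \<epsilon> l by (auto simp: d_def field_simps add_pos_nonneg divide_le_eq)
  obtain N :: nat where N: "1 / d\<^sup>2 < N" using reals_Archimedean2 by blast
  have N0: "N > 0" using N d by (metis gr0I of_nat_0 not_less zero_le_divide_1_iff zero_le_power2)
  have N1: "1 / real N \<le> d\<^sup>2" using N d N0 by (simp add: field_simps)
  define s where "s x = (1 + sin (x / l)) / 2" for x
  have s: "0 \<le> s x" "s x \<le> 1" for x
    using sin_ge_minus_one[of "x / l"] sin_le_one[of "x / l"] unfolding s_def by (simp_all add: field_simps del: sin_ge_minus_one sin_le_one)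
  \<comment> \<open>Solving \<open>s x = (1 + sin (x / l)) / 2\<close> for
    \<open>l * sin (x / l)\<close> at the value \<open>k / N\<close> gives the node.\<close>
  define \<xi> where "\<xi> k = l * (2 * (k / N) - 1)" for k :: nat
  define w where "w k x = Bernstein N k (s x)" for k x
  show ?thesis
  proof (intro exI[of _ N] exI[of _ \<xi>] exI[of _ w] conjI allI impI)
    show "0 \<le> w k x" for k x using s by (simp add: w_def Bernstein_nonneg)
    show "(\<Sum>k\<le>N. w k x) = 1" for x by (simp add: w_def)
    show "(\<Sum>k\<le>N. w k x * (L * \<bar>x - \<xi> k\<bar>)) \<le> \<epsilon> * (1 + x\<^sup>2)" for x
    proof -
      have sin: "\<bar>x - l * sin (x / l)\<bar> \<le> x\<^sup>2 / (2 * l)"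
      proof -
        \<comment> \<open>The quadratic remainder is used, not the cubic one, since only second
          moments will be available.\<close>
        have "\<bar>sin (x / l) - x / l\<bar> \<le> (x / l)\<^sup>2 / 2"
          using Maclaurin_sin_bound[of "x / l" 2]
          by (simp add: sin_coeff_def numeral_2_eq_2 power2_abs)
        then have "l * \<bar>sin (x / l) - x / l\<bar> \<le> l * ((x / l)\<^sup>2 / 2)" using l by (intro mult_left_mono) auto
        also have "l * ((x / l)\<^sup>2 / 2) = x\<^sup>2 / (2 * l)" using l by (simp add: power2_eq_square)
        also have "l * \<bar>sin (x / l) - x / l\<bar> = \<bar>l * (sin (x / l) - x / l)\<bar>" using l by (simp add: abs_mult)
        also have "l * (sin (x / l) - x / l) = l * sin (x / l) - x" using l by (simp add: right_diff_distrib)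
        finally show ?thesis by (simp add: abs_minus_commute)
      qed
      have eq: "x - \<xi> k = (x - l * sin (x / l)) + 2 * l * (s x - k / N)" for k
        by (simp add: \<xi>_def s_def algebra_simps)
      then have pt: "\<bar>x - \<xi> k\<bar> \<le> x\<^sup>2 / (2 * l) + 2 * l * \<bar>s x - k / N\<bar>" for k
      proof -
        have "\<bar>x - \<xi> k\<bar> \<le> \<bar>x - l * sin (x / l)\<bar> + \<bar>2 * l * (s x - k / N)\<bar>"
          unfolding eq by (rule abs_triangle_ineq)
        also have "\<bar>2 * l * (s x - k / N)\<bar> = 2 * l * \<bar>s x - k / N\<bar>"
          using l by (simp add: abs_mult)
        finally show ?thesis using sin by linarith
      qed
      have "(\<Sum>k\<le>N. w k x * (L * \<bar>x - \<xi> k\<bar>))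
          \<le> (\<Sum>k\<le>N. w k x * (L * (x\<^sup>2 / (2 * l) + 2 * l * \<bar>s x - k / N\<bar>)))"
        using L s pt by (intro sum_mono mult_left_mono) (auto simp: w_def Bernstein_nonneg)
      also have "\<dots> = (\<Sum>k\<le>N. (L * (x\<^sup>2 / (2 * l))) * Bernstein N k (s x)
          + (2 * l * L) * (Bernstein N k (s x) * \<bar>s x - k / N\<bar>))"
        unfolding w_def by (intro sum.cong) (auto simp: algebra_simps)
      also have "\<dots> = L * (x\<^sup>2 / (2 * l)) + 2 * l * L * (\<Sum>k\<le>N. Bernstein N k (s x) * \<bar>s x - k / N\<bar>)"
        by (simp only: sum.distrib sum_distrib_left[symmetric] sum_Bernstein mult_1_right)
      also have "\<dots> \<le> L * (x\<^sup>2 / (2 * l)) + 2 * l * L * d"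
        using L l s N0 d N1 by (intro add_left_mono mult_left_mono Bernstein_abs_deviation) auto
      also have "\<dots> \<le> \<epsilon> * x\<^sup>2 + \<epsilon>"
        using d mult_right_mono[OF l(2), of "x\<^sup>2"] by (intro add_mono) (auto simp: field_simps)
      finally show ?thesis by (simp add: algebra_simps)
    qed
    show "(\<lambda>x. w k (x j)) \<in> trig_span m" if "j < m" for k j m
    proof -
      have 1: "(\<lambda>x. s (x j)) \<in> trig_span m"
        using trig_span.scale[OF trig_span.add[OF trig_span_const[of 1] trig_span_sin[OF that, of "1 / l"]], of "1 / 2"]
        by (simp add: s_def)
      have 2: "(\<lambda>x. 1 - s (x j)) \<in> trig_span m"
        using trig_span.add[OF trig_span_const[of 1] trig_span.scale[OF 1, of "- 1"]] by simp
      show ?thesis unfolding w_def Bernstein_def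
        by (intro trig_span_mult trig_span_power trig_span_const 1 2)
    qed
  qed
qed

text \<open>The Lipschitz bound makes \<open>f\<close> ignore all coordinates from \<open>m\<close>
  on; whole sequences are used as arguments so that one type serves every \<open>m\<close>.\<close>

definition coordinate_lipschitz :: "nat \<Rightarrow> real \<Rightarrow> ((nat \<Rightarrow> real) \<Rightarrow> real) set" where
  "coordinate_lipschitz m L =
    {f. (\<forall>x. \<bar>f x\<bar> \<le> 1) \<and> (\<forall>x y. \<bar>f x - f y\<bar> \<le> L * (\<Sum>j<m. \<bar>x j - y j\<bar>))}"

text \<open>The finitely many functions \<open>g i\<close> do not depend on \<open>f\<close>; this is what makes the convergence
  of expectations uniform over Lipschitz functions.\<close>

lemma uniform_trig_approximation:
  assumes L: "0 \<le> L" and \<epsilon>: "0 < \<epsilon>"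
  shows "\<exists>(I :: nat list set) g. finite I \<and> (\<forall>i\<in>I. g i \<in> trig_span m) \<and>
    (\<forall>f\<in>coordinate_lipschitz m L. \<exists>a. (\<forall>i\<in>I. \<bar>a i\<bar> \<le> 1) \<and>
      (\<forall>x. \<bar>f x - (\<Sum>i\<in>I. a i * g i x)\<bar> \<le> \<epsilon> * (1 + (\<Sum>j<m. (x j)\<^sup>2))))"
  using \<epsilon>
proof (induction m arbitrary: \<epsilon>)
  case 0
  have "\<exists>a. \<bar>a []\<bar> \<le> 1 \<and> (\<forall>x. \<bar>f x - a [] * 1\<bar> \<le> \<epsilon>)" if "f \<in> coordinate_lipschitz 0 L" for f
  proof (intro exI[of _ "\<lambda>_. f (\<lambda>_. 0)"] conjI allI)
    show "\<bar>f (\<lambda>_. 0)\<bar> \<le> 1" using that by (simp add: coordinate_lipschitz_def)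
    have "\<bar>f x - f (\<lambda>_. 0)\<bar> \<le> 0" for x using that by (auto simp: coordinate_lipschitz_def)
    then show "\<bar>f x - f (\<lambda>_. 0) * 1\<bar> \<le> \<epsilon>" for x
      using 0 by (metis less_imp_le mult_1_right order_trans)
  qed
  then show ?case
    by (intro exI[of _ "{[]}"] exI[of _ "\<lambda>_ _. 1"]) (auto simp: trig_span_const)
next
  case (Suc m)
  obtain I :: "nat list set" and g where I: "finite I" "\<And>i. i \<in> I \<Longrightarrow> g i \<in> trig_span m"
    and approx: "\<And>f. f \<in> coordinate_lipschitz m L \<Longrightarrow> \<exists>a. (\<forall>i\<in>I. \<bar>a i\<bar> \<le> 1) \<and>
      (\<forall>x. \<bar>f x - (\<Sum>i\<in>I. a i * g i x)\<bar> \<le> (\<epsilon> / 2) * (1 + (\<Sum>j<m. (x j)\<^sup>2)))"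
    using Suc.IH[OF half_gt_zero[OF Suc.prems]] by blast
  obtain N :: nat and \<xi> w where w: "\<And>k x. 0 \<le> w k x" "\<And>x. (\<Sum>k\<le>N. w k x) = 1"
    "\<And>x. (\<Sum>k\<le>N. w k x * (L * \<bar>x - \<xi> k\<bar>)) \<le> (\<epsilon> / 2) * (1 + x\<^sup>2)"
    "\<And>k j m. j < m \<Longrightarrow> (\<lambda>x. w k (x j)) \<in> trig_span m"
    using trigonometric_weights[OF L half_gt_zero[OF Suc.prems]] by blast
  \<comment> \<open>Indices are lists of node numbers, one entry per coordinate, so the index type
    stays the same through the induction.\<close>
  define J where "J = (\<lambda>(k, i). k # i) ` ({..N} \<times> I)"
  define h where "h = (\<lambda>i x. w (hd i) (x m) * g (tl i) x)"
  show ?case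
  proof (rule exI[of _ J], rule exI[of _ h], intro conjI ballI)
    show "finite J" using I by (simp add: J_def)
    show "h i \<in> trig_span (Suc m)" if "i \<in> J" for i
      using that I unfolding h_def J_def by (auto intro!: trig_span_mult w(4) intro: trig_span_Suc)
    fix f assume f: "f \<in> coordinate_lipschitz (Suc m) L"
    then have fb: "\<bar>f x\<bar> \<le> 1" and fl: "\<bar>f x - f y\<bar> \<le> L * (\<Sum>j<Suc m. \<bar>x j - y j\<bar>)" for x y
      by (auto simp: coordinate_lipschitz_def)
    \<comment> \<open>The last coordinate is frozen at a node. The result is Lipschitz in the first
      \<open>m\<close> coordinates, so the induction hypothesis gives its coefficients; the weights
      in \<open>x m\<close> then interpolate between the nodes.\<close>
    define F where "F k x = f (x(m := \<xi> k))" for k x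
    have "F k \<in> coordinate_lipschitz m L" for k
      unfolding coordinate_lipschitz_def
    proof (intro CollectI conjI allI)
      show "\<bar>F k x\<bar> \<le> 1" for x unfolding F_def by (rule fb)
      show "\<bar>F k x - F k y\<bar> \<le> L * (\<Sum>j<m. \<bar>x j - y j\<bar>)" for x y
        using fl[of "x(m := \<xi> k)" "y(m := \<xi> k)"] by (simp add: F_def)
    qed
    then have "\<exists>a. (\<forall>i\<in>I. \<bar>a i\<bar> \<le> 1) \<and>
      (\<forall>x. \<bar>F k x - (\<Sum>i\<in>I. a i * g i x)\<bar> \<le> (\<epsilon> / 2) * (1 + (\<Sum>j<m. (x j)\<^sup>2)))" for k
      by (rule approx)
    then obtain a where a: "\<And>k i. i \<in> I \<Longrightarrow> \<bar>a k i\<bar> \<le> 1"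
      "\<And>k x. \<bar>F k x - (\<Sum>i\<in>I. a k i * g i x)\<bar> \<le> (\<epsilon> / 2) * (1 + (\<Sum>j<m. (x j)\<^sup>2))"
      by metis
    show "\<exists>a. (\<forall>i\<in>J. \<bar>a i\<bar> \<le> 1) \<and>
        (\<forall>x. \<bar>f x - (\<Sum>i\<in>J. a i * h i x)\<bar> \<le> \<epsilon> * (1 + (\<Sum>j<Suc m. (x j)\<^sup>2)))"
    proof (intro exI[of _ "\<lambda>i. a (hd i) (tl i)"] conjI ballI allI)
      show "\<bar>a (hd i) (tl i)\<bar> \<le> 1" if "i \<in> J" for i using that a(1) by (auto simp: J_def)
      fix x
      have "(\<Sum>i\<in>J. a (hd i) (tl i) * h i x) = (\<Sum>(k, i)\<in>{..N} \<times> I. a k i * (w k (x m) * g i x))"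
        unfolding J_def h_def by (subst sum.reindex) (auto simp: inj_on_def intro!: sum.cong)
      also have "\<dots> = (\<Sum>k\<le>N. w k (x m) * (\<Sum>i\<in>I. a k i * g i x))"
        by (subst sum.cartesian_product[symmetric]) (simp add: sum_distrib_left mult_ac)
      finally have S: "(\<Sum>i\<in>J. a (hd i) (tl i) * h i x) = (\<Sum>k\<le>N. w k (x m) * (\<Sum>i\<in>I. a k i * g i x))" .
      have "f x = (\<Sum>k\<le>N. w k (x m) * f x)" by (simp add: sum_distrib_right[symmetric] w(2))
      then have "f x - (\<Sum>i\<in>J. a (hd i) (tl i) * h i x)
          = (\<Sum>k\<le>N. w k (x m) * (f x - F k x)) + (\<Sum>k\<le>N. w k (x m) * (F k x - (\<Sum>i\<in>I. a k i * g i x)))"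
        unfolding S by (simp add: right_diff_distrib sum_subtractf)
      then have "\<bar>f x - (\<Sum>i\<in>J. a (hd i) (tl i) * h i x)\<bar> =
          \<bar>(\<Sum>k\<le>N. w k (x m) * (f x - F k x)) + (\<Sum>k\<le>N. w k (x m) * (F k x - (\<Sum>i\<in>I. a k i * g i x)))\<bar>" (is "?l = _")
        by (rule arg_cong)
      also have "\<dots> \<le> (\<Sum>k\<le>N. w k (x m) * \<bar>f x - F k x\<bar>) + (\<Sum>k\<le>N. w k (x m) * \<bar>F k x - (\<Sum>i\<in>I. a k i * g i x)\<bar>)"
        by (intro order.trans[OF abs_triangle_ineq] add_mono order.trans[OF sum_abs] sum_mono)
          (simp_all add: abs_mult w(1))
      also have "\<dots> \<le> (\<Sum>k\<le>N. w k (x m) * (L * \<bar>x m - \<xi> k\<bar>))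
          + (\<Sum>k\<le>N. w k (x m) * ((\<epsilon> / 2) * (1 + (\<Sum>j<m. (x j)\<^sup>2))))"
      proof (intro add_mono sum_mono mult_left_mono w(1) a(2))
        show "\<bar>f x - F k x\<bar> \<le> L * \<bar>x m - \<xi> k\<bar>" for k
          using fl[of x "x(m := \<xi> k)"] by (simp add: F_def)
      qed
      also have "\<dots> \<le> (\<epsilon> / 2) * (1 + (x m)\<^sup>2) + (\<epsilon> / 2) * (1 + (\<Sum>j<m. (x j)\<^sup>2))"
        using w(3)[of "x m"] by (simp only: sum_distrib_right[symmetric] w(2) mult_1 add_right_mono)
      finally have "?l \<le> (\<epsilon> / 2) * (1 + (x m)\<^sup>2) + (\<epsilon> / 2) * (1 + (\<Sum>j<m. (x j)\<^sup>2))" .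
      moreover have "(\<epsilon> / 2) * (1 + (x m)\<^sup>2) + (\<epsilon> / 2) * (1 + (\<Sum>j<m. (x j)\<^sup>2))
          = \<epsilon> * (1 + (\<Sum>j<Suc m. (x j)\<^sup>2)) - (\<epsilon> / 2) * (\<Sum>j<Suc m. (x j)\<^sup>2)"
        by (simp add: field_simps)
      moreover have "0 \<le> (\<epsilon> / 2) * (\<Sum>j<Suc m. (x j)\<^sup>2)"
        using Suc.prems by (intro mult_nonneg_nonneg sum_nonneg) auto
      ultimately show "?l \<le> \<epsilon> * (1 + (\<Sum>j<Suc m. (x j)\<^sup>2))" by linarith
    qed
  qed
qed

section \<open>Linearization of quantile processes\<close>

lemma (in prob_space) chebyshev_nn_integral:
  assumes [measurable]: "X \<in> borel_measurable M"
    and c: "(\<integral>\<^sup>+\<omega>. ennreal ((X \<omega>)\<^sup>2) \<partial>M) \<le> ennreal c" "0 \<le> c" and a: "0 < a"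
  shows "prob {\<omega> \<in> space M. a \<le> \<bar>X \<omega>\<bar>} \<le> c / a\<^sup>2"
proof -
  have "{\<omega> \<in> space M. a \<le> \<bar>X \<omega>\<bar>} = {\<omega> \<in> space M. 1 \<le> ennreal (1 / a\<^sup>2) * ennreal ((X \<omega>)\<^sup>2)}"
    using a by (auto simp: ennreal_mult[symmetric] ennreal_1[symmetric] abs_le_square_iff[symmetric]
        simp del: ennreal_1)
  then have "emeasure M {\<omega> \<in> space M. a \<le> \<bar>X \<omega>\<bar>} \<le> ennreal (1 / a\<^sup>2) * (\<integral>\<^sup>+\<omega>. ennreal ((X \<omega>)\<^sup>2) * indicator (space M) \<omega> \<partial>M)"
    using nn_integral_Markov_inequality[where u="\<lambda>\<omega>. ennreal ((X \<omega>)\<^sup>2)" and A="space M" and c="ennreal (1 / a\<^sup>2)" and M=M] by simp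
  also have "(\<integral>\<^sup>+\<omega>. ennreal ((X \<omega>)\<^sup>2) * indicator (space M) \<omega> \<partial>M) = (\<integral>\<^sup>+\<omega>. ennreal ((X \<omega>)\<^sup>2) \<partial>M)"
    by (intro nn_integral_cong) simp
  also have "ennreal (1 / a\<^sup>2) * \<dots> \<le> ennreal (1 / a\<^sup>2) * ennreal c" by (intro mult_left_mono c) simp
  also have "\<dots> = ennreal (c / a\<^sup>2)" using a c by (simp add: ennreal_mult[symmetric])
  finally show ?thesis
    using c a by (simp add: emeasure_eq_measure)
qed

text \<open>Young's inequality with parameter \<open>d\<close> plays the role of Cauchy-Schwarz and
  works directly with extended integrals.\<close>

lemma (in prob_space) nn_integral_abs_le_second_moment:
  assumes [measurable]: "X \<in> borel_measurable M"
    and c: "(\<integral>\<^sup>+\<omega>. ennreal ((X \<omega>)\<^sup>2) \<partial>M) \<le> ennreal (c\<^sup>2)" "0 \<le> c"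
  shows "(\<integral>\<^sup>+\<omega>. ennreal \<bar>X \<omega>\<bar> \<partial>M) \<le> ennreal c"
proof -
  have *: "(\<integral>\<^sup>+\<omega>. ennreal \<bar>X \<omega>\<bar> \<partial>M) \<le> ennreal d" if d: "c \<le> d" "0 < d" for d
  proof -
    have "(\<integral>\<^sup>+\<omega>. ennreal \<bar>X \<omega>\<bar> \<partial>M) \<le> (\<integral>\<^sup>+\<omega>. ennreal (1 / (2 * d)) * ennreal ((X \<omega>)\<^sup>2) + ennreal (d / 2) \<partial>M)"
    proof (rule nn_integral_mono)
      fix \<omega>
      have "0 \<le> (\<bar>X \<omega>\<bar> - d)\<^sup>2" by simp
      then have "2 * d * \<bar>X \<omega>\<bar> \<le> (X \<omega>)\<^sup>2 + d\<^sup>2" by (simp add: power2_diff mult_ac)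
      then have "\<bar>X \<omega>\<bar> \<le> 1 / (2 * d) * (X \<omega>)\<^sup>2 + d / 2" using d by (simp add: field_simps power2_eq_square)
      then show "ennreal \<bar>X \<omega>\<bar> \<le> ennreal (1 / (2 * d)) * ennreal ((X \<omega>)\<^sup>2) + ennreal (d / 2)"
        using d by (simp add: ennreal_mult[symmetric] ennreal_plus[symmetric] del: ennreal_plus)
    qed
    also have "\<dots> = ennreal (1 / (2 * d)) * (\<integral>\<^sup>+\<omega>. ennreal ((X \<omega>)\<^sup>2) \<partial>M) + ennreal (d / 2)"
      by (simp add: nn_integral_add nn_integral_cmult emeasure_space_1)
    also have "\<dots> \<le> ennreal (1 / (2 * d)) * ennreal (d\<^sup>2) + ennreal (d / 2)"
      using c d by (intro add_mono mult_left_mono order_refl order.trans[OF c(1)] ennreal_leI power_mono) auto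
    also have "\<dots> = ennreal d"
      using d by (simp add: ennreal_mult[symmetric] ennreal_plus[symmetric] power2_eq_square del: ennreal_plus)
    finally show ?thesis .
  qed
  show ?thesis
  \<comment> \<open>The parameter must be positive, so \<open>c = 0\<close> is reached through
    arbitrarily small \<open>d\<close>.\<close>
  proof (cases "c = 0")
    case True
    show ?thesis
    proof (rule ennreal_le_epsilon)
      fix e :: real assume "0 < e"
      then show "(\<integral>\<^sup>+\<omega>. ennreal \<bar>X \<omega>\<bar> \<partial>M) \<le> ennreal c + ennreal e" using * True by simp
    qed
  next
    case False
    then show ?thesis using * c by simp
  qed
qed

text \<open>A variant of Scheffe's lemma: domination of the norms in expectation turns convergence in
  probability at almost every point into convergence of the expected distances, because
  \<open>\<bar>a - b\<bar> + \<bar>b\<bar> \<le> \<bar>a\<bar> + 2 * min \<bar>a - b\<bar> \<bar>b\<bar>\<close>.\<close>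

lemma scheffe_processes:
  fixes P :: "nat \<Rightarrow> 'p measure" and a b :: "nat \<Rightarrow> 'p \<Rightarrow> real \<Rightarrow> real" and H :: "real \<Rightarrow> real"
  assumes P: "\<And>n. prob_space (P n)"
    and a: "\<And>n. case_prod (a n) \<in> borel_measurable (P n \<Otimes>\<^sub>M unit_borel)"
    and b: "\<And>n. case_prod (b n) \<in> borel_measurable (P n \<Otimes>\<^sub>M unit_borel)"
    and norms: "\<And>n. (\<integral>\<^sup>+\<omega>. \<integral>\<^sup>+u. ennreal \<bar>a n \<omega> u\<bar> \<partial>unit_borel \<partial>P n)
      \<le> (\<integral>\<^sup>+\<omega>. \<integral>\<^sup>+u. ennreal \<bar>b n \<omega> u\<bar> \<partial>unit_borel \<partial>P n)"
    and conv: "AE u in unit_borel. \<forall>e>0. (\<lambda>n. measure (P n) {\<omega> \<in> space (P n). e < \<bar>a n \<omega> u - b n \<omega> u\<bar>}) \<longlonglongrightarrow> 0"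
    and H: "H \<in> borel_measurable unit_borel" "\<And>u. 0 \<le> H u" "(\<integral>\<^sup>+u. ennreal (H u) \<partial>unit_borel) < \<infinity>"
    and moments: "\<And>n. AE u in unit_borel. (\<integral>\<^sup>+\<omega>. ennreal ((b n \<omega> u)\<^sup>2) \<partial>P n) \<le> ennreal ((H u)\<^sup>2)"
  shows "(\<lambda>n. \<integral>\<^sup>+\<omega>. \<integral>\<^sup>+u. ennreal \<bar>a n \<omega> u - b n \<omega> u\<bar> \<partial>unit_borel \<partial>P n) \<longlonglongrightarrow> 0"
proof -
  have swap: "(\<integral>\<^sup>+\<omega>. \<integral>\<^sup>+u. f \<omega> u \<partial>unit_borel \<partial>P n) = (\<integral>\<^sup>+u. \<integral>\<^sup>+\<omega>. f \<omega> u \<partial>P n \<partial>unit_borel)"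
    if "case_prod f \<in> borel_measurable (P n \<Otimes>\<^sub>M unit_borel)" for f :: "'p \<Rightarrow> real \<Rightarrow> ennreal" and n
  proof -
    interpret P: prob_space "P n" by (rule P)
    interpret pair_sigma_finite "P n" unit_borel ..
    show ?thesis using Fubini'[OF that] ..
  qed
  have ab [measurable]: "(\<lambda>p. a n (fst p) (snd p)) \<in> borel_measurable (P n \<Otimes>\<^sub>M unit_borel)"
    "(\<lambda>p. b n (fst p) (snd p)) \<in> borel_measurable (P n \<Otimes>\<^sub>M unit_borel)" for n
    using a[of n] b[of n] by (simp_all add: case_prod_beta')
  have sec: "(\<lambda>u. a n \<omega> u) \<in> borel_measurable unit_borel" "(\<lambda>u. b n \<omega> u) \<in> borel_measurable unit_borel"
    if "\<omega> \<in> space (P n)" for n \<omega>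
    using measurable_Pair2[OF a that] measurable_Pair2[OF b that] by simp_all
  have sec2: "(\<lambda>\<omega>. a n \<omega> u) \<in> borel_measurable (P n)" "(\<lambda>\<omega>. b n \<omega> u) \<in> borel_measurable (P n)"
    if "u \<in> {0<..<1}" for n u
    using measurable_Pair1[OF a, of u n] measurable_Pair1[OF b, of u n] that by simp_all
  \<comment> \<open>\<open>m\<close> is bounded by \<open>\<bar>b\<bar>\<close>, which
    \<open>H\<close> dominates after expectation, and by \<open>\<bar>a - b\<bar>\<close>, which
    tends to zero in probability.\<close>
  define m where "m n \<omega> u = min \<bar>a n \<omega> u - b n \<omega> u\<bar> \<bar>b n \<omega> u\<bar>" for n \<omega> u
  have m: "(\<lambda>(\<omega>, u). ennreal (m n \<omega> u)) \<in> borel_measurable (P n \<Otimes>\<^sub>M unit_borel)" for n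
    unfolding m_def case_prod_beta' by measurable
  define B where "B n = (\<integral>\<^sup>+\<omega>. \<integral>\<^sup>+u. ennreal \<bar>b n \<omega> u\<bar> \<partial>unit_borel \<partial>P n)" for n
  have mb: "(\<integral>\<^sup>+\<omega>. ennreal \<bar>b n \<omega> u\<bar> \<partial>P n) \<le> ennreal (H u)"
    if "u \<in> {0<..<1}" "(\<integral>\<^sup>+\<omega>. ennreal ((b n \<omega> u)\<^sup>2) \<partial>P n) \<le> ennreal ((H u)\<^sup>2)" for n u
    using prob_space.nn_integral_abs_le_second_moment[OF P sec2(2)] that H(2) by blast
  have AE_unit: "AE u in unit_borel. u \<in> {0<..<1}" using AE_space[of unit_borel] by simp
  have B: "B n < \<infinity>" for n
  proof -
    have "B n = (\<integral>\<^sup>+u. \<integral>\<^sup>+\<omega>. ennreal \<bar>b n \<omega> u\<bar> \<partial>P n \<partial>unit_borel)"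
      unfolding B_def by (rule swap) (unfold case_prod_beta', measurable)
    also have "\<dots> \<le> (\<integral>\<^sup>+u. ennreal (H u) \<partial>unit_borel)"
    proof (rule nn_integral_mono_AE)
      show "AE u in unit_borel. (\<integral>\<^sup>+\<omega>. ennreal \<bar>b n \<omega> u\<bar> \<partial>P n) \<le> ennreal (H u)"
        using moments[of n] AE_unit by eventually_elim (rule mb)
    qed
    also have "\<dots> < \<infinity>" by fact
    finally show ?thesis .
  qed
  have main: "(\<integral>\<^sup>+\<omega>. \<integral>\<^sup>+u. ennreal \<bar>a n \<omega> u - b n \<omega> u\<bar> \<partial>unit_borel \<partial>P n)
      \<le> 2 * (\<integral>\<^sup>+u. \<integral>\<^sup>+\<omega>. ennreal (m n \<omega> u) \<partial>P n \<partial>unit_borel)" (is "?I n \<le> 2 * ?J n") for n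
  proof -
    have "?I n + B n = (\<integral>\<^sup>+\<omega>. \<integral>\<^sup>+u. ennreal \<bar>a n \<omega> u - b n \<omega> u\<bar> + ennreal \<bar>b n \<omega> u\<bar> \<partial>unit_borel \<partial>P n)"
      unfolding B_def using sec[of _ n]
      by (subst nn_integral_add[symmetric])
        (auto intro!: nn_integral_cong nn_integral_add[symmetric] unit_borel.borel_measurable_nn_integral
           simp: case_prod_beta')
    also have "\<dots> \<le> (\<integral>\<^sup>+\<omega>. \<integral>\<^sup>+u. ennreal \<bar>a n \<omega> u\<bar> + 2 * ennreal (m n \<omega> u) \<partial>unit_borel \<partial>P n)"
    proof (intro nn_integral_mono)
      fix \<omega> u
      have "\<bar>a n \<omega> u - b n \<omega> u\<bar> + \<bar>b n \<omega> u\<bar> \<le> \<bar>a n \<omega> u\<bar> + 2 * m n \<omega> u"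
        unfolding m_def by (auto simp: min_def)
      then show "ennreal \<bar>a n \<omega> u - b n \<omega> u\<bar> + ennreal \<bar>b n \<omega> u\<bar> \<le> ennreal \<bar>a n \<omega> u\<bar> + 2 * ennreal (m n \<omega> u)"
        by (simp add: ennreal_plus[symmetric] ennreal_mult[symmetric] m_def ennreal_numeral[symmetric]
          del: ennreal_plus ennreal_numeral)
    qed
    also have "\<dots> = (\<integral>\<^sup>+\<omega>. \<integral>\<^sup>+u. ennreal \<bar>a n \<omega> u\<bar> \<partial>unit_borel \<partial>P n) + 2 * (\<integral>\<^sup>+\<omega>. \<integral>\<^sup>+u. ennreal (m n \<omega> u) \<partial>unit_borel \<partial>P n)"
    proof -
      have [measurable]: "(\<lambda>u. ennreal (m n \<omega> u)) \<in> borel_measurable unit_borel" if "\<omega> \<in> space (P n)" for \<omega>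
        using measurable_Pair2[OF m that] by simp
      have "(\<integral>\<^sup>+\<omega>. \<integral>\<^sup>+u. ennreal \<bar>a n \<omega> u\<bar> + 2 * ennreal (m n \<omega> u) \<partial>unit_borel \<partial>P n)
        = (\<integral>\<^sup>+\<omega>. (\<integral>\<^sup>+u. ennreal \<bar>a n \<omega> u\<bar> \<partial>unit_borel) + 2 * (\<integral>\<^sup>+u. ennreal (m n \<omega> u) \<partial>unit_borel) \<partial>P n)"
        using sec(1)[of _ n] by (intro nn_integral_cong) (simp add: nn_integral_add nn_integral_cmult)
      also have "\<dots> = (\<integral>\<^sup>+\<omega>. \<integral>\<^sup>+u. ennreal \<bar>a n \<omega> u\<bar> \<partial>unit_borel \<partial>P n) + (\<integral>\<^sup>+\<omega>. 2 * (\<integral>\<^sup>+u. ennreal (m n \<omega> u) \<partial>unit_borel) \<partial>P n)"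
        using m[of n] by (intro nn_integral_add)
          (auto intro!: unit_borel.borel_measurable_nn_integral borel_measurable_times simp: case_prod_beta')
      also have "(\<integral>\<^sup>+\<omega>. 2 * (\<integral>\<^sup>+u. ennreal (m n \<omega> u) \<partial>unit_borel) \<partial>P n) = 2 * (\<integral>\<^sup>+\<omega>. \<integral>\<^sup>+u. ennreal (m n \<omega> u) \<partial>unit_borel \<partial>P n)"
        using m[of n] by (intro nn_integral_cmult unit_borel.borel_measurable_nn_integral)
      finally show ?thesis .
    qed
    also have "\<dots> \<le> B n + 2 * ?J n"
      using norms[of n] unfolding B_def swap[OF m] by (intro add_mono) auto
    finally have "B n + ?I n \<le> B n + 2 * ?J n" by (simp add: add.commute)
    \<comment> \<open>Cancelling \<open>B n\<close> is legitimate because it is finite.\<close>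
    then show ?thesis using B[of n] by (auto simp: ennreal_add_left_cancel_le)
  qed
  have "?J \<longlonglongrightarrow> (\<integral>\<^sup>+u. 0 \<partial>unit_borel)"
  proof (rule nn_integral_dominated_convergence)
    show "(\<lambda>u. \<integral>\<^sup>+\<omega>. ennreal (m n \<omega> u) \<partial>P n) \<in> borel_measurable unit_borel" for n
    proof -
      interpret P: prob_space "P n" by (rule P)
      have "(\<lambda>(u, \<omega>). ennreal (m n \<omega> u)) \<in> borel_measurable (unit_borel \<Otimes>\<^sub>M P n)"
        using measurable_pair_swap[OF m[of n]] by (simp add: case_prod_beta')
      then show ?thesis by (rule P.borel_measurable_nn_integral)
    qed
    show "(\<lambda>u. ennreal (H u)) \<in> borel_measurable unit_borel" using H(1) by measurable
    show "AE u in unit_borel. (\<integral>\<^sup>+\<omega>. ennreal (m n \<omega> u) \<partial>P n) \<le> ennreal (H u)" for n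
      using moments[of n] AE_unit
    proof eventually_elim
      case (elim u)
      have "(\<integral>\<^sup>+\<omega>. ennreal (m n \<omega> u) \<partial>P n) \<le> (\<integral>\<^sup>+\<omega>. ennreal \<bar>b n \<omega> u\<bar> \<partial>P n)"
        by (intro nn_integral_mono ennreal_leI) (simp add: m_def)
      also have "\<dots> \<le> ennreal (H u)" using elim by (intro mb)
      finally show ?case .
    qed
    have "AE u in unit_borel. \<forall>n. (\<integral>\<^sup>+\<omega>. ennreal ((b n \<omega> u)\<^sup>2) \<partial>P n) \<le> ennreal ((H u)\<^sup>2)"
      using moments by (simp add: AE_all_countable)
    then show "AE u in unit_borel. (\<lambda>n. \<integral>\<^sup>+\<omega>. ennreal (m n \<omega> u) \<partial>P n) \<longlonglongrightarrow> 0"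
      using conv AE_unit
    proof eventually_elim
      case (elim u)
      note sec2[OF elim(3), measurable]
      show ?case
      proof (rule order_tendstoI)
        fix e :: ennreal assume "0 < e"
        then obtain e' :: real where e': "0 < e'" "ennreal e' < e"
          by (metis ennreal_cases ennreal_less_zero_iff ennreal_zero_less_top dense less_ennreal.abs_eq
            ennreal_enn2real enn2real_positive_iff less_top order_less_trans top.not_eq_extremum)
        define d where "d = e' / 3"
        \<comment> \<open>Adding 1 covers \<open>H u = 0\<close>. The three terms below, namely a
          threshold, a second moment and a probability, are each allowed \<open>d\<close>.\<close>
        define \<eta> where "\<eta> = 2 * (d / ((H u)\<^sup>2 + 1))"
        have pos: "0 < d" "0 < \<eta>" using e' by (auto simp: d_def \<eta>_def add_nonneg_pos)
        have \<eta>H: "\<eta> / 2 * (H u)\<^sup>2 \<le> d"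
        proof -
          have "\<eta> / 2 = d / ((H u)\<^sup>2 + 1)" unfolding \<eta>_def by (rule nonzero_mult_div_cancel_left) simp
          then have "\<eta> / 2 * (H u)\<^sup>2 = d * ((H u)\<^sup>2 / ((H u)\<^sup>2 + 1))"
            by (simp only: times_divide_eq_left times_divide_eq_right)
          also have "\<dots> \<le> d * 1"
            using pos by (intro mult_left_mono) (auto simp: divide_le_eq add_nonneg_pos)
          finally show ?thesis by simp
        qed
        have "\<forall>\<^sub>F n in sequentially. measure (P n) {\<omega> \<in> space (P n). d < \<bar>a n \<omega> u - b n \<omega> u\<bar>} < 2 * \<eta> * d"
          using elim(2) pos by (intro order_tendstoD) auto
        then show "\<forall>\<^sub>F n in sequentially. (\<integral>\<^sup>+\<omega>. ennreal (m n \<omega> u) \<partial>P n) < e"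
        proof eventually_elim
          case less: (elim n)
          interpret P: prob_space "P n" by (rule P)
          let ?A = "{\<omega> \<in> space (P n). d < \<bar>a n \<omega> u - b n \<omega> u\<bar>}"
          have "(\<integral>\<^sup>+\<omega>. ennreal (m n \<omega> u) \<partial>P n)
              \<le> (\<integral>\<^sup>+\<omega>. ennreal d + (ennreal (\<eta> / 2) * ennreal ((b n \<omega> u)\<^sup>2) + ennreal (1 / (2 * \<eta>)) * indicator ?A \<omega>) \<partial>P n)"
          proof (rule nn_integral_mono)
            fix \<omega> assume \<omega>: "\<omega> \<in> space (P n)"
            show "ennreal (m n \<omega> u) \<le> ennreal d + (ennreal (\<eta> / 2) * ennreal ((b n \<omega> u)\<^sup>2) + ennreal (1 / (2 * \<eta>)) * indicator ?A \<omega>)"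
            proof (cases "\<omega> \<in> ?A")
              case True
              \<comment> \<open>On the exceptional event \<open>\<bar>b\<bar>\<close> is split by
                Young's inequality, so that its second moment is charged with the small factor
                \<open>\<eta> / 2\<close>.\<close>
              have "0 \<le> (\<eta> * \<bar>b n \<omega> u\<bar> - 1)\<^sup>2" by simp
              then have "2 * \<eta> * \<bar>b n \<omega> u\<bar> \<le> \<eta>\<^sup>2 * (b n \<omega> u)\<^sup>2 + 1" by (simp add: power2_diff power_mult_distrib)
              then have "\<bar>b n \<omega> u\<bar> \<le> \<eta> / 2 * (b n \<omega> u)\<^sup>2 + 1 / (2 * \<eta>)"
                using pos by (simp add: field_simps power2_eq_square)
              then have "m n \<omega> u \<le> d + (\<eta> / 2 * (b n \<omega> u)\<^sup>2 + 1 / (2 * \<eta>))" using pos by (simp add: m_def)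
              then show ?thesis using True pos
                by (simp add: ennreal_plus[symmetric] ennreal_mult[symmetric] del: ennreal_plus)
            next
              case False
              then have "m n \<omega> u \<le> d" using \<omega> by (simp add: m_def)
              then have "ennreal (m n \<omega> u) \<le> ennreal d + 0" by (simp add: ennreal_leI)
              also have "\<dots> \<le> ennreal d + (ennreal (\<eta> / 2) * ennreal ((b n \<omega> u)\<^sup>2) + ennreal (1 / (2 * \<eta>)) * indicator ?A \<omega>)"
                by (intro add_left_mono) simp
              finally show ?thesis .
            qed
          qed
          also have "\<dots> = ennreal d + (ennreal (\<eta> / 2) * (\<integral>\<^sup>+\<omega>. ennreal ((b n \<omega> u)\<^sup>2) \<partial>P n) + ennreal (1 / (2 * \<eta>)) * emeasure (P n) ?A)"
            by (simp add: nn_integral_add nn_integral_cmult P.emeasure_space_1)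
          also have "\<dots> \<le> ennreal d + (ennreal (\<eta> / 2) * ennreal ((H u)\<^sup>2) + ennreal (1 / (2 * \<eta>)) * ennreal (2 * \<eta> * d))"
            using elim(1) less by (intro add_mono mult_left_mono order_refl) (auto simp: P.emeasure_eq_measure ennreal_leI)
          also have "\<dots> = ennreal (d + (\<eta> / 2 * (H u)\<^sup>2 + d))"
            using pos by (simp add: ennreal_plus[symmetric] ennreal_mult[symmetric] del: ennreal_plus)
          also have "\<dots> \<le> ennreal e'" using \<eta>H by (intro ennreal_leI) (simp add: d_def)
          finally show ?case using e'(2) by simp
        qed
      qed simp
    qed
  qed (use H in auto)
  then have "(\<lambda>n. 2 * ?J n) \<longlonglongrightarrow> 2 * 0"
    by (intro ennreal_tendsto_cmult) auto
  then show ?thesis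
    by (intro tendsto_sandwich[of "\<lambda>_. 0" ?I sequentially "\<lambda>n. 2 * ?J n" 0] always_eventually allI main) auto
qed


section \<open>Local inversion of approximating cdfs\<close>

lemma tendsto_divide_sqrt: "(\<lambda>n. s / sqrt (real n)) \<longlonglongrightarrow> 0"
  by (intro tendsto_divide_0[OF tendsto_const] filterlim_at_top_imp_at_infinity
    filterlim_compose[OF sqrt_at_top filterlim_real_sequentially])

text \<open>By the Galois relation a sublevel set of the quantile is the set where \<open>u\<close>
  is at most \<open>G\<close> at a fixed point, and this is measurable jointly in the sample point
  and \<open>u\<close>.\<close>

lemma quantile_adjoint_measurable:
  assumes adj: "\<And>\<omega>. \<omega> \<in> space M \<Longrightarrow> quantile_adjoint (G \<omega>)"
    and G: "case_prod G \<in> borel_measurable (M \<Otimes>\<^sub>M borel)"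
  shows "(\<lambda>(\<omega>, u). quantile (G \<omega>) u) \<in> borel_measurable (M \<Otimes>\<^sub>M unit_borel)"
  unfolding borel_measurable_iff_le
proof
  fix x
  have Gx: "(\<lambda>\<omega>. G \<omega> x) \<in> borel_measurable M"
    using measurable_Pair1[OF G, of x] by simp
  have [measurable]: "(\<lambda>p. G (fst p) x) \<in> borel_measurable (M \<Otimes>\<^sub>M unit_borel)"
    using measurable_compose[OF measurable_fst[of M unit_borel] Gx] .
  have "(\<lambda>u. u) \<in> borel_measurable unit_borel" by (rule measurable_unit_borelI) simp
  from measurable_compose[OF measurable_snd this]
  have [measurable]: "(\<lambda>p. snd p) \<in> borel_measurable (M \<Otimes>\<^sub>M unit_borel)" .
  have "{p \<in> space (M \<Otimes>\<^sub>M unit_borel). (case p of (\<omega>, u) \<Rightarrow> quantile (G \<omega>) u) \<le> x}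
      = {p \<in> space (M \<Otimes>\<^sub>M unit_borel). snd p \<le> G (fst p) x}"
    using adj by (auto simp: space_pair_measure quantile_le_iff)
  also have "\<dots> \<in> sets (M \<Otimes>\<^sub>M unit_borel)" by measurable
  finally show "{p \<in> space (M \<Otimes>\<^sub>M unit_borel). (case p of (\<omega>, u) \<Rightarrow> quantile (G \<omega>) u) \<le> x}
      \<in> sets (M \<Otimes>\<^sub>M unit_borel)" .
qed

text \<open>Common ground of sampling and resampling: up to \<open>C\<close>, the moment bounds are
  those of a Brownian bridge at \<open>F x\<close> and of its increments. The space may vary with
  \<open>n\<close>, as that of the index draws does. The case \<open>n = 0\<close> is left out
  because \<open>emp_cdf 0\<close> vanishes and lacks the Galois relation.\<close>

definition approximates_cdf ::
    "(real \<Rightarrow> real) \<Rightarrow> real \<Rightarrow> (nat \<Rightarrow> 'p measure) \<Rightarrow> (nat \<Rightarrow> 'p \<Rightarrow> real \<Rightarrow> real) \<Rightarrow> bool" where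
  "approximates_cdf F C P G \<longleftrightarrow> (\<forall>n>0.
    (\<forall>\<omega>\<in>space (P n). quantile_adjoint (G n \<omega>) \<and> (\<forall>x. 0 \<le> G n \<omega> x \<and> G n \<omega> x \<le> 1)) \<and>
    case_prod (G n) \<in> borel_measurable (P n \<Otimes>\<^sub>M borel) \<and>
    (\<forall>x. (\<integral>\<^sup>+\<omega>. ennreal ((sqrt n * (G n \<omega> x - F x))\<^sup>2) \<partial>P n) \<le> ennreal (C * (F x * (1 - F x)))) \<and>
    (\<forall>x y. (\<integral>\<^sup>+\<omega>. ennreal ((sqrt n * (G n \<omega> x - F x) - sqrt n * (G n \<omega> y - F y))\<^sup>2) \<partial>P n)
      \<le> ennreal (C * \<bar>F x - F y\<bar>)))"

lemma approximates_cdfD: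
  assumes "approximates_cdf F C P G" "n > 0"
  shows "\<omega> \<in> space (P n) \<Longrightarrow> quantile_adjoint (G n \<omega>)"
    and "\<omega> \<in> space (P n) \<Longrightarrow> 0 \<le> G n \<omega> x"
    and "\<omega> \<in> space (P n) \<Longrightarrow> G n \<omega> x \<le> 1"
    and "case_prod (G n) \<in> borel_measurable (P n \<Otimes>\<^sub>M borel)"
    and "(\<lambda>\<omega>. G n \<omega> x) \<in> borel_measurable (P n)"
    and "\<omega> \<in> space (P n) \<Longrightarrow> G n \<omega> \<in> borel_measurable borel"
    and "(\<integral>\<^sup>+\<omega>. ennreal ((sqrt n * (G n \<omega> x - F x))\<^sup>2) \<partial>P n) \<le> ennreal (C * (F x * (1 - F x)))"
    and "(\<integral>\<^sup>+\<omega>. ennreal ((sqrt n * (G n \<omega> x - F x) - sqrt n * (G n \<omega> y - F y))\<^sup>2) \<partial>P n)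
      \<le> ennreal (C * \<bar>F x - F y\<bar>)"
proof -
  show G: "case_prod (G n) \<in> borel_measurable (P n \<Otimes>\<^sub>M borel)"
    using assms by (simp add: approximates_cdf_def)
  show "(\<lambda>\<omega>. G n \<omega> x) \<in> borel_measurable (P n)" using measurable_Pair1[OF G, of x] by simp
  show "G n \<omega> \<in> borel_measurable borel" if "\<omega> \<in> space (P n)"
    using measurable_Pair2[OF G that] by simp
qed (use assms in \<open>auto simp: approximates_cdf_def\<close>)

context smooth_quantile
begin

lemma nn_integral_density_Q:
  assumes [measurable]: "h \<in> borel_measurable borel"
  shows "(\<integral>\<^sup>+u. ennreal (q u) * h (Q u) \<partial>unit_borel) = (\<integral>\<^sup>+x. h x * indicator {0<..<1} (F x) \<partial>lborel)"
proof -
  \<comment> \<open>Measurability of \<open>Q\<close> is known on the open interval; cutting it off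
    gives a Borel function on the line.\<close>
  define R where "R u = indicator {0<..<1} u * Q u" for u
  have [measurable]: "R \<in> borel_measurable borel"
    using Q_measurable unfolding measurable_unit_borel_iff R_def[abs_def] .
  have "(\<integral>\<^sup>+u. ennreal (q u) * h (Q u) \<partial>unit_borel) = (\<integral>\<^sup>+u. ennreal (q u) * h (R u) \<partial>unit_borel)"
    by (intro nn_integral_cong) (simp add: R_def)
  also have "\<dots> = (\<integral>\<^sup>+x. h (R (F x)) * indicator {0<..<1} (F x) \<partial>lborel)"
    by (rule nn_integral_density_F) measurable
  also have "\<dots> = (\<integral>\<^sup>+x. h x * indicator {0<..<1} (F x) \<partial>lborel)"
    by (intro nn_integral_cong) (auto simp: R_def Q_F indicator_def)
  finally show ?thesis .
qed

lemma scaled_increment_tendsto: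
  assumes d: "(Q has_real_derivative D) (at u)"
  shows "(\<lambda>n. sqrt n * (Q (u + s / sqrt n) - Q u)) \<longlonglongrightarrow> s * D"
proof (cases "s = 0")
  case False
  have l: "(\<lambda>n::nat. s / sqrt n) \<longlonglongrightarrow> 0"
    by (rule tendsto_divide_sqrt)
  have "filterlim (\<lambda>n::nat. s / sqrt n) (at 0) sequentially"
    unfolding filterlim_at using l False eventually_gt_at_top[of 0] by (auto elim!: eventually_mono)
  then have "(\<lambda>n::nat. (Q (u + s / sqrt n) - Q u) / (s / sqrt n)) \<longlonglongrightarrow> D"
    using d unfolding DERIV_def by (rule filterlim_compose[rotated])
  then have "(\<lambda>n::nat. s * ((Q (u + s / sqrt n) - Q u) / (s / sqrt n))) \<longlonglongrightarrow> s * D"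
    by (rule tendsto_mult_left)
  moreover have "\<forall>\<^sub>F n in sequentially. s * ((Q (u + s / sqrt n) - Q u) / (s / sqrt n)) = sqrt n * (Q (u + s / sqrt n) - Q u)"
    using eventually_gt_at_top[of 0] by eventually_elim (use False in \<open>simp add: field_simps\<close>)
  ultimately show ?thesis by (rule Lim_transform_eventually)
qed simp

lemma eventually_in_unit:
  assumes "0 < u" "u < 1"
  shows "\<forall>\<^sub>F n in sequentially. 0 < u + s / sqrt (real n) \<and> u + s / sqrt (real n) < 1"
proof -
  have "(\<lambda>n::nat. u + s / sqrt n) \<longlonglongrightarrow> u + 0"
    by (intro tendsto_add tendsto_const tendsto_divide_sqrt)
  then show ?thesis
    using assms by (intro eventually_conj order_tendstoD) auto
qed

text \<open>Differentiability of \<open>Q\<close>, moved through the Galois relation, gives a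
  one-sided bound on the local growth of \<open>F\<close>. The strict inequality
  \<open>s * D < t\<close> leaves room for the error and keeps the case \<open>D = 0\<close>
  meaningful.\<close>

lemma eventually_F_ge:
  assumes u: "0 < u" "u < 1" and d: "(Q has_real_derivative D) (at u)" and s: "s * D < t"
  shows "\<forall>\<^sub>F n in sequentially. s \<le> sqrt n * (F (Q u + t / sqrt n) - u)"
proof -
  have "\<forall>\<^sub>F n::nat in sequentially. sqrt n * (Q (u + s / sqrt n) - Q u) < t"
    using scaled_increment_tendsto[OF d] s by (rule order_tendstoD)
  then show ?thesis
    using eventually_in_unit[OF u, of s] eventually_gt_at_top[of 0]
  proof eventually_elim
    case (elim n)
    then have "Q (u + s / sqrt n) \<le> Q u + t / sqrt n" by (simp add: field_simps)
    then have "u + s / sqrt n \<le> F (Q u + t / sqrt n)" using elim by (subst (asm) Q_le_iff) auto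
    then show ?case using elim(3) by (simp add: field_simps)
  qed
qed

lemma eventually_F_less:
  assumes u: "0 < u" "u < 1" and d: "(Q has_real_derivative D) (at u)" and s: "t < s * D"
  shows "\<forall>\<^sub>F n in sequentially. sqrt n * (F (Q u + t / sqrt n) - u) < s"
proof -
  have "\<forall>\<^sub>F n::nat in sequentially. t < sqrt n * (Q (u + s / sqrt n) - Q u)"
    using scaled_increment_tendsto[OF d] s by (rule order_tendstoD)
  then show ?thesis
    using eventually_in_unit[OF u, of s] eventually_gt_at_top[of 0]
  proof eventually_elim
    case (elim n)
    then have "Q u + t / sqrt n < Q (u + s / sqrt n)" by (simp add: field_simps)
    then have "F (Q u + t / sqrt n) < u + s / sqrt n" using elim by (subst (asm) less_Q_iff) auto
    then show ?case using elim(3) by (simp add: field_simps)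
  qed
qed

text \<open>Inverting the empirical cdf at \<open>Q u + t / sqrt n\<close>: the event that the quantile deviation
  exceeds \<open>t\<close> is an event about \<open>G\<close> near \<open>Q u\<close>, where its fluctuation differs little from that
  at \<open>Q u\<close>.\<close>

lemma bahadur:
  fixes P :: "nat \<Rightarrow> 'p measure"
  assumes P: "\<And>n. prob_space (P n)" and G: "approximates_cdf F C P G" and C: "0 \<le> C"
    and u: "0 < u" "u < 1" and d: "(Q has_real_derivative D) (at u)" and D: "0 \<le> D" and e: "0 < e"
  shows "(\<lambda>n. measure (P n) {\<omega> \<in> space (P n). e <
    \<bar>sqrt n * (quantile (G n \<omega>) u - Q u) + D * (sqrt n * (G n \<omega> (Q u) - F (Q u)))\<bar>}) \<longlonglongrightarrow> 0"
proof (rule LIMSEQ_I)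
  define Dn where "Dn n \<omega> x = sqrt n * (G n \<omega> x - F x)" for n \<omega> x
  define A where "A n \<omega> = sqrt n * (quantile (G n \<omega>) u - Q u)" for n \<omega>
  define X where "X n t = Q u + t / sqrt n" for n :: nat and t
  let ?E = "\<lambda>n. {\<omega> \<in> space (P n). e < \<bar>A n \<omega> + D * Dn n \<omega> (Q u)\<bar>}"
  note G' = approximates_cdfD[OF G]
  have meas [measurable]: "(\<lambda>\<omega>. Dn n \<omega> x) \<in> borel_measurable (P n)" if "n > 0" for n x
    unfolding Dn_def using G'(5)[OF that] by measurable
  have Dn_var: "measure (P n) {\<omega> \<in> space (P n). a \<le> \<bar>Dn n \<omega> x\<bar>} \<le> C / a\<^sup>2" if "n > 0" "0 < a" for n a x
  proof -
    have "F x * (1 - F x) \<le> 1" by (intro mult_le_one) auto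
    then have "C * (F x * (1 - F x)) \<le> C * 1" using C by (intro mult_left_mono) auto
    then have "(\<integral>\<^sup>+\<omega>. ennreal ((Dn n \<omega> x)\<^sup>2) \<partial>P n) \<le> ennreal C"
      using G'(7)[OF that(1), of x] unfolding Dn_def by (simp add: order.trans[OF _ ennreal_leI])
    then show ?thesis using that C by (intro prob_space.chebyshev_nn_integral[OF P]) auto
  qed
  have Dn_inc: "measure (P n) {\<omega> \<in> space (P n). a \<le> \<bar>Dn n \<omega> x - Dn n \<omega> y\<bar>} \<le> C * \<bar>F x - F y\<bar> / a\<^sup>2"
    if "n > 0" "0 < a" for n a x y
    using that C G'(8)[OF that(1), of x y] unfolding Dn_def[symmetric]
    by (intro prob_space.chebyshev_nn_integral[OF P] borel_measurable_diff meas) auto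
  \<comment> \<open>\<open>X n t\<close> lies at offset \<open>t / sqrt n\<close> from
    \<open>Q u\<close>; the scaled quantile deviation exceeds \<open>t\<close> exactly when
    \<open>G\<close> is still below \<open>u\<close> there.\<close>
  have gt: "sqrt n * (F (X n t) - u) < - Dn n \<omega> (X n t)" if "n > 0" "\<omega> \<in> space (P n)" "t < A n \<omega>" for n \<omega> t
  proof -
    have "X n t < quantile (G n \<omega>) u" using that by (simp add: X_def A_def field_simps)
    then have "G n \<omega> (X n t) < u" using less_quantile_iff[OF G'(1)[OF that(1,2)] u] by simp
    then have "sqrt n * G n \<omega> (X n t) < sqrt n * u" using that by simp
    then show ?thesis by (simp add: Dn_def algebra_simps)
  qed
  have le: "- Dn n \<omega> (X n t) \<le> sqrt n * (F (X n t) - u)" if "n > 0" "\<omega> \<in> space (P n)" "A n \<omega> \<le> t" for n \<omega> t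
  proof -
    have "quantile (G n \<omega>) u \<le> X n t" using that by (simp add: X_def A_def field_simps)
    then have "u \<le> G n \<omega> (X n t)" using quantile_le_iff[OF G'(1)[OF that(1,2)] u] by simp
    then have "sqrt n * u \<le> sqrt n * G n \<omega> (X n t)" using that by simp
    then show ?thesis by (simp add: Dn_def algebra_simps)
  qed
  fix r :: real assume r: "0 < r"
  have "\<forall>\<^sub>F n in sequentially. measure (P n) (?E n) < r"
  proof (cases "D = 0")
    case True
    \<comment> \<open>With \<open>D = 0\<close> the drift of \<open>F\<close> at \<open>Q u\<close>
      plus or minus \<open>e / sqrt n\<close> eventually exceeds every \<open>s\<close> in size, so
      a large quantile deviation forces a fluctuation of size \<open>s\<close>. This
      \<open>s\<close> makes both Chebyshev bounds less than \<open>r / 2\<close>.\<close>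
    define s where "s = sqrt (4 * C / r) + 1"
    have s: "0 < s" "C / s\<^sup>2 < r / 2"
    proof -
      have "0 \<le> 4 * C / r" using C r by simp
      then show "0 < s" by (simp add: s_def add_nonneg_pos)
      have "4 * C / r = (sqrt (4 * C / r))\<^sup>2" using \<open>0 \<le> 4 * C / r\<close> by simp
      also have "\<dots> < s\<^sup>2" unfolding s_def using \<open>0 \<le> 4 * C / r\<close> by (intro power_strict_mono) auto
      finally have "4 * C < r * s\<^sup>2" using r by (simp add: field_simps)
      moreover have "0 \<le> C" by fact
      ultimately show "C / s\<^sup>2 < r / 2" using \<open>0 < s\<close> by (simp add: divide_less_eq)
    qed
    have "\<forall>\<^sub>F n in sequentially. s \<le> sqrt n * (F (X n e) - u)"
      unfolding X_def using True e by (intro eventually_F_ge[OF u d]) auto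
    moreover have "\<forall>\<^sub>F n in sequentially. sqrt n * (F (X n (- e)) - u) < - s"
      unfolding X_def using True e by (intro eventually_F_less[OF u d]) auto
    ultimately show ?thesis
      using eventually_gt_at_top[of 0]
    proof eventually_elim
      case (elim n)
      interpret P: prob_space "P n" by (rule P)
      note [measurable] = meas[OF elim(3)]
      have "?E n \<subseteq> {\<omega> \<in> space (P n). s \<le> \<bar>Dn n \<omega> (X n e)\<bar>} \<union> {\<omega> \<in> space (P n). s \<le> \<bar>Dn n \<omega> (X n (- e))\<bar>}"
      proof
        fix \<omega> assume "\<omega> \<in> ?E n"
        then have \<omega>: "\<omega> \<in> space (P n)" and "e < \<bar>A n \<omega>\<bar>" using True by auto
        then consider "e < A n \<omega>" | "A n \<omega> \<le> - e" by linarith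
        then show "\<omega> \<in> {\<omega> \<in> space (P n). s \<le> \<bar>Dn n \<omega> (X n e)\<bar>} \<union> {\<omega> \<in> space (P n). s \<le> \<bar>Dn n \<omega> (X n (- e))\<bar>}"
        proof cases
          case 1
          then show ?thesis using gt[OF elim(3) \<omega> 1] elim(1) \<omega> by auto
        next
          case 2
          then show ?thesis using le[OF elim(3) \<omega> 2] elim(2) \<omega> by auto
        qed
      qed
      then have "P.prob (?E n) \<le> P.prob ({\<omega> \<in> space (P n). s \<le> \<bar>Dn n \<omega> (X n e)\<bar>} \<union> {\<omega> \<in> space (P n). s \<le> \<bar>Dn n \<omega> (X n (- e))\<bar>})"
        by (intro P.finite_measure_mono) auto
      also have "\<dots> \<le> P.prob {\<omega> \<in> space (P n). s \<le> \<bar>Dn n \<omega> (X n e)\<bar>} + P.prob {\<omega> \<in> space (P n). s \<le> \<bar>Dn n \<omega> (X n (- e))\<bar>}"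
        by (intro measure_Un_le) auto
      also have "\<dots> \<le> C / s\<^sup>2 + C / s\<^sup>2" using elim(3) s by (intro add_mono Dn_var) auto
      also have "\<dots> < r" using s(2) by linarith
      finally show ?case .
    qed
  next
    case False
    with D have D: "0 < D" by simp
    have FQ: "F (Q u) = u" using flat_derivative[OF u d] False by auto
    \<comment> \<open>Off an event of probability less than \<open>r / 2\<close> the fluctuation at
      \<open>Q u\<close> is below \<open>K\<close>, which confines the relevant thresholds to a
      compact range.\<close>
    define K where "K = sqrt (2 * C / r) + 1"
    have K: "0 < K" "C / K\<^sup>2 < r / 2"
    proof -
      have "0 \<le> 2 * C / r" using C r by simp
      then show "0 < K" by (simp add: K_def add_nonneg_pos)
      have "2 * C / r = (sqrt (2 * C / r))\<^sup>2" using \<open>0 \<le> 2 * C / r\<close> by simp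
      also have "\<dots> < K\<^sup>2" unfolding K_def using \<open>0 \<le> 2 * C / r\<close> by (intro power_strict_mono) auto
      finally have "2 * C < r * K\<^sup>2" using r by (simp add: field_simps)
      then show "C / K\<^sup>2 < r / 2" using \<open>0 < K\<close> by (simp add: divide_less_eq)
    qed
    define w where "w = e / 2"
    define m where "m = \<lceil>(D * K + e) / w\<rceil>"
    have w: "0 < w" using e by (simp add: w_def)
    define I where "I = {-m..m}"
    \<comment> \<open>The natural threshold is random, near \<open>- (D * \<beta>)\<close>, where
      \<open>\<beta>\<close> is the fluctuation at \<open>Q u\<close>. A deterministic mesh of width
      \<open>e / 2\<close> supplies one of finitely many substitutes, so that a union bound is
      possible.\<close>
    have grid: "\<exists>i\<in>I. y \<le> of_int i * w \<and> of_int i * w < y + w" if "\<bar>y\<bar> \<le> D * K + e" for y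
    proof (intro bexI[of _ "\<lceil>y / w\<rceil>"] conjI)
      have "y / w \<le> of_int \<lceil>y / w\<rceil>" by linarith
      then show "y \<le> of_int \<lceil>y / w\<rceil> * w" by (simp only: pos_divide_le_eq[OF w])
      have "of_int \<lceil>y / w\<rceil> < y / w + 1" by linarith
      then have "of_int \<lceil>y / w\<rceil> * w < (y / w + 1) * w" using w by (rule mult_strict_right_mono)
      then show "of_int \<lceil>y / w\<rceil> * w < y + w" using w by (simp add: distrib_right)
      have "y / w \<le> (D * K + e) / w" using that w e by (intro divide_right_mono) auto
      then have "\<lceil>y / w\<rceil> \<le> m" unfolding m_def by (rule ceiling_mono)
      moreover have "- m \<le> \<lceil>y / w\<rceil>"
      proof -
        have "- (D * K + e) \<le> y" using that by linarith
        then have "- (D * K + e) / w \<le> y / w" using w by (intro divide_right_mono) auto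
        then have "- ((D * K + e) / w) \<le> y / w" by (simp only: minus_divide_left)
        moreover have "(D * K + e) / w \<le> of_int m" by (simp add: m_def)
        ultimately show ?thesis by linarith
      qed
      ultimately show "\<lceil>y / w\<rceil> \<in> I" by (simp add: I_def)
    qed
    \<comment> \<open>The chosen mesh point will keep at least \<open>e / 4\<close> from
      \<open>- (D * \<beta>)\<close>. Divided by \<open>D\<close> this is \<open>2 * c\<close>: half
      pays for the error in \<open>F\<close>, half remains as a genuine increment of the
      fluctuation.\<close>
    define c where "c = e / (8 * D)"
    have c: "0 < c" "c * D = e / 8" using D e by (auto simp: c_def)
    define t where "t i = of_int i * w" for i
    have "\<forall>\<^sub>F n in sequentially. \<forall>i\<in>I. t i / D - c \<le> sqrt n * (F (X n (t i)) - u) \<and> sqrt n * (F (X n (t i)) - u) < t i / D + c"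
      unfolding X_def I_def
      using D c e by (intro eventually_ball_finite ballI eventually_conj eventually_F_ge[OF u d] eventually_F_less[OF u d])
        (auto simp: left_diff_distrib distrib_right)
    \<comment> \<open>The second moment of an increment is of the order of the difference of
      \<open>F\<close> at \<open>X n (t i)\<close> and at \<open>Q u\<close>, which is of order
      \<open>1 / sqrt n\<close>; so the finite sum of Chebyshev bounds vanishes.\<close>
    moreover have "(\<lambda>n. \<Sum>i\<in>I. C * ((\<bar>t i\<bar> / D + c) / sqrt (real n)) / c\<^sup>2) \<longlonglongrightarrow> (\<Sum>i\<in>I. C * 0 / c\<^sup>2)"
      using c by (intro tendsto_sum tendsto_divide tendsto_mult tendsto_const tendsto_divide_sqrt) auto
    then have "\<forall>\<^sub>F n in sequentially. (\<Sum>i\<in>I. C * ((\<bar>t i\<bar> / D + c) / sqrt (real n)) / c\<^sup>2) < r / 2"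
      using r by (intro order_tendstoD) auto
    ultimately show ?thesis
      using eventually_gt_at_top[of 0]
    proof eventually_elim
      case (elim n)
      interpret P: prob_space "P n" by (rule P)
      note [measurable] = meas[OF elim(3)]
      let ?B = "{\<omega> \<in> space (P n). K \<le> \<bar>Dn n \<omega> (Q u)\<bar>}"
      let ?U = "\<lambda>i. {\<omega> \<in> space (P n). c \<le> \<bar>Dn n \<omega> (X n (t i)) - Dn n \<omega> (Q u)\<bar>}"
      have "?E n \<subseteq> ?B \<union> (\<Union>i\<in>I. ?U i)"
      proof
        fix \<omega> assume "\<omega> \<in> ?E n"
        then have \<omega>: "\<omega> \<in> space (P n)" and big: "e < \<bar>A n \<omega> + D * Dn n \<omega> (Q u)\<bar>" by auto
        define \<beta> where "\<beta> = Dn n \<omega> (Q u)"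
        show "\<omega> \<in> ?B \<union> (\<Union>i\<in>I. ?U i)"
        proof (cases "K \<le> \<bar>\<beta>\<bar>")
          case False
          then have bound: "\<bar>D * \<beta>\<bar> \<le> D * K" using D by (simp add: abs_mult)
          from big consider "e < A n \<omega> + D * \<beta>" | "A n \<omega> + D * \<beta> < - e"
            unfolding \<beta>_def[symmetric] by linarith
          then show ?thesis
          proof cases
            case 1
            have "\<bar>- (D * \<beta>) + e / 4\<bar> \<le> D * K + e" using bound e by linarith
            from grid[OF this] obtain i where i: "i \<in> I" "- (D * \<beta>) + e / 4 \<le> t i" "t i < - (D * \<beta>) + e / 4 + e / 2"
              by (auto simp: t_def w_def)
            have "t i < A n \<omega>" using i 1 e by linarith
            from gt[OF elim(3) \<omega> this] elim(1) i(1)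
            have "t i / D - c < - Dn n \<omega> (X n (t i))" by force
            moreover have "- \<beta> + 2 * c \<le> t i / D"
            proof -
              have "(- (D * \<beta>) + e / 4) / D \<le> t i / D" using i(2) D by (intro divide_right_mono) auto
              moreover have "(- (D * \<beta>) + e / 4) / D = - \<beta> + 2 * c" using D by (simp add: c_def field_simps)
              ultimately show ?thesis by simp
            qed
            ultimately have "c \<le> \<bar>Dn n \<omega> (X n (t i)) - \<beta>\<bar>" by linarith
            then show ?thesis using \<omega> i(1) by (auto simp: \<beta>_def)
          next
            case 2
            have "\<bar>- (D * \<beta>) - 3 * e / 4\<bar> \<le> D * K + e" using bound e by linarith
            from grid[OF this] obtain i where i: "i \<in> I" "- (D * \<beta>) - 3 * e / 4 \<le> t i" "t i < - (D * \<beta>) - 3 * e / 4 + e / 2"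
              by (auto simp: t_def w_def)
            have "A n \<omega> \<le> t i" using i 2 e by linarith
            from le[OF elim(3) \<omega> this] elim(1) i(1)
            have "- Dn n \<omega> (X n (t i)) < t i / D + c" by force
            moreover have "t i / D \<le> - \<beta> - 2 * c"
            proof -
              have "t i / D \<le> (- (D * \<beta>) - e / 4) / D" using i(3) D by (intro divide_right_mono) auto
              moreover have "(- (D * \<beta>) - e / 4) / D = - \<beta> - 2 * c" using D by (simp add: c_def field_simps)
              ultimately show ?thesis by simp
            qed
            ultimately have "c \<le> \<bar>Dn n \<omega> (X n (t i)) - \<beta>\<bar>" by linarith
            then show ?thesis using \<omega> i(1) by (auto simp: \<beta>_def)
          qed
        qed (use \<omega> in \<open>auto simp: \<beta>_def\<close>)
      qed
      then have "P.prob (?E n) \<le> P.prob (?B \<union> (\<Union>i\<in>I. ?U i))"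
        by (intro P.finite_measure_mono) (auto simp: I_def)
      also have "\<dots> \<le> P.prob ?B + P.prob (\<Union>i\<in>I. ?U i)"
        by (intro measure_Un_le) (auto simp: I_def)
      also have "\<dots> \<le> C / K\<^sup>2 + (\<Sum>i\<in>I. P.prob (?U i))"
        using elim(3) K by (intro add_mono Dn_var P.finite_measure_subadditive_finite) (auto simp: I_def)
      also have "\<dots> \<le> C / K\<^sup>2 + (\<Sum>i\<in>I. C * ((\<bar>t i\<bar> / D + c) / sqrt n) / c\<^sup>2)"
      proof (intro add_left_mono sum_mono)
        fix i assume i: "i \<in> I"
        have "P.prob (?U i) \<le> C * \<bar>F (X n (t i)) - F (Q u)\<bar> / c\<^sup>2"
          using elim(3) c by (intro Dn_inc) auto
        also have "\<dots> \<le> C * ((\<bar>t i\<bar> / D + c) / sqrt n) / c\<^sup>2"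
        proof (intro divide_right_mono mult_left_mono C)
          have "\<bar>t i / D\<bar> = \<bar>t i\<bar> / D" using D by (simp add: abs_divide)
          then have "\<bar>sqrt n * (F (X n (t i)) - u)\<bar> \<le> \<bar>t i\<bar> / D + c"
            using bspec[OF elim(1) i] by linarith
          then show "\<bar>F (X n (t i)) - F (Q u)\<bar> \<le> (\<bar>t i\<bar> / D + c) / sqrt n"
            using elim(3) unfolding abs_mult FQ by (simp add: pos_le_divide_eq mult.commute)
        qed simp
        finally show "P.prob (?U i) \<le> C * ((\<bar>t i\<bar> / D + c) / sqrt n) / c\<^sup>2" .
      qed
      also have "\<dots> < r" using K(2) elim(2) by linarith
      finally show ?case .
    qed
  qed
  then show "\<exists>n0. \<forall>n\<ge>n0. norm (measure (P n) {\<omega> \<in> space (P n). e <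
      \<bar>sqrt n * (quantile (G n \<omega>) u - Q u) + D * (sqrt n * (G n \<omega> (Q u) - F (Q u)))\<bar>} - 0) < r"
    unfolding A_def Dn_def eventually_sequentially by simp
qed

lemma nn_integral_abs_diff_density:
  assumes [measurable]: "G \<in> borel_measurable borel" "H \<in> borel_measurable borel" and c: "0 \<le> c"
  shows "(\<integral>\<^sup>+u. ennreal \<bar>q u * (c * (G (Q u) - H (Q u)))\<bar> \<partial>unit_borel)
    = (\<integral>\<^sup>+x. ennreal \<bar>c * (G x - H x)\<bar> * indicator {0<..<1} (F x) \<partial>lborel)"
proof -
  have "(\<integral>\<^sup>+u. ennreal \<bar>q u * (c * (G (Q u) - H (Q u)))\<bar> \<partial>unit_borel)
      = (\<integral>\<^sup>+u. ennreal (q u) * ennreal \<bar>c * (G (Q u) - H (Q u))\<bar> \<partial>unit_borel)"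
    using q_nonneg by (intro nn_integral_cong) (simp add: ennreal_mult[symmetric] abs_mult)
  also have "\<dots> = (\<integral>\<^sup>+x. ennreal \<bar>c * (G x - H x)\<bar> * indicator {0<..<1} (F x) \<partial>lborel)"
    by (rule nn_integral_density_Q) measurable
  finally show ?thesis .
qed

lemma nn_integral_scaled_quantile_diff:
  assumes "quantile_adjoint G" "G \<in> borel_measurable borel" "\<And>x. 0 \<le> G x" "\<And>x. G x \<le> 1"
    and "quantile_adjoint H" "H \<in> borel_measurable borel" "\<And>x. 0 \<le> H x" "\<And>x. H x \<le> 1"
    and c: "0 \<le> c"
  shows "(\<integral>\<^sup>+u. ennreal \<bar>c * (quantile G u - quantile H u)\<bar> \<partial>unit_borel) = (\<integral>\<^sup>+x. ennreal \<bar>c * (G x - H x)\<bar> \<partial>lborel)"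
proof -
  have mono: "mono_on {0<..<1} (quantile G)" if "quantile_adjoint G" for G
    using quantile_mono[OF that] by (auto intro!: mono_onI)
  have meas: "quantile G \<in> borel_measurable unit_borel" if "quantile_adjoint G" for G
  proof -
    have "quantile G \<in> borel_measurable (restrict_space borel {0<..<1})"
      by (rule borel_measurable_mono_on_fnc[OF mono[OF that]])
    then show ?thesis by (simp cong: measurable_cong_sets add: sets_restrict_space)
  qed
  have m: "(\<lambda>u. ennreal \<bar>quantile G u - quantile H u\<bar>) \<in> borel_measurable unit_borel"
    using meas[OF assms(1)] meas[OF assms(5)] by (intro measurable_compose[OF _ measurable_ennreal] borel_measurable_abs borel_measurable_diff)
  have "(\<integral>\<^sup>+u. ennreal \<bar>c * (quantile G u - quantile H u)\<bar> \<partial>unit_borel) = ennreal c * (\<integral>\<^sup>+x. ennreal \<bar>G x - H x\<bar> \<partial>lborel)"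
    using c m by (simp add: abs_mult ennreal_mult nn_integral_cmult nn_integral_abs_diff_quantile[OF assms(1-8)])
  also have "\<dots> = (\<integral>\<^sup>+x. ennreal \<bar>c * (G x - H x)\<bar> \<partial>lborel)"
    using c assms(2,6) by (simp add: abs_mult ennreal_mult nn_integral_cmult)
  finally show ?thesis .
qed

end

locale integrable_quantile = smooth_quantile +
  assumes tail: "(\<integral>\<^sup>+u. ennreal (sqrt (u * (1 - u))) \<partial>stieltjes_measure Q) < \<infinity>"
begin

lemma tail_density: "(\<integral>\<^sup>+u. ennreal (q u * sqrt (u * (1 - u))) \<partial>unit_borel) < \<infinity>"
proof -
  have "(\<lambda>u::real. ennreal (sqrt (u * (1 - u)))) \<in> borel_measurable unit_borel"
    by (rule measurable_restrict_space1) simp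
  from nn_integral_stieltjes[OF this] tail
  show ?thesis using q_nonneg by (simp add: ennreal_mult'' flip: ennreal_mult')
qed

text \<open>The tail condition in the variable \<open>x\<close>: the integrand vanishes unless
  \<open>F x\<close> is strictly between 0 and 1, so the change of variables applies. It is used to
  show that \<open>Q\<close> is integrable.\<close>

lemma tail_cdf: "(\<integral>\<^sup>+x. ennreal (sqrt (F x * (1 - F x))) \<partial>lborel) < \<infinity>"
proof -
  have "(\<integral>\<^sup>+x. ennreal (sqrt (F x * (1 - F x))) \<partial>lborel)
      = (\<integral>\<^sup>+x. ennreal (sqrt (F x * (1 - F x))) * indicator {0<..<1} (F x) \<partial>lborel)"
    by (intro nn_integral_cong) (auto simp: indicator_def not_less antisym dest!: antisym[OF F_bounds(2)] antisym[OF _ F_bounds(1)])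
  also have "\<dots> = (\<integral>\<^sup>+u. ennreal (q u) * ennreal (sqrt (u * (1 - u))) \<partial>unit_borel)"
    by (rule nn_integral_density_F[symmetric]) measurable
  also have "\<dots> < \<infinity>" using tail_density q_nonneg by (simp add: ennreal_mult')
  finally show ?thesis .
qed

text \<open>Comparing two approximations \<open>G\<close> and \<open>H\<close> serves two purposes:
  the sample against \<open>F\<close> itself, and the resample against the sample. The Bahadur
  statement is applied to each, and \<open>Q\<close> and \<open>F\<close> cancel in the
  difference.\<close>

lemma linearization:
  fixes P :: "nat \<Rightarrow> 'p measure"
  assumes P: "\<And>n. prob_space (P n)" and G: "approximates_cdf F C P G" and H: "approximates_cdf F C P H"
    and C: "0 \<le> C"
  shows "(\<lambda>n. \<integral>\<^sup>+\<omega>. \<integral>\<^sup>+u. ennreal \<bar>sqrt n * (quantile (G n \<omega>) u - quantile (H n \<omega>) u)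
      + q u * (sqrt n * (G n \<omega> (Q u) - H n \<omega> (Q u)))\<bar> \<partial>unit_borel \<partial>P n) \<longlonglongrightarrow> 0"
proof -
  \<comment> \<open>The index is shifted because the approximation property speaks only of
    \<open>n > 0\<close>.\<close>
  define a where "a n \<omega> u = sqrt (Suc n) * (quantile (G (Suc n) \<omega>) u - quantile (H (Suc n) \<omega>) u)" for n \<omega> u
  define b where "b n \<omega> u = - (q u * (sqrt (Suc n) * (G (Suc n) \<omega> (Q u) - H (Suc n) \<omega> (Q u))))" for n \<omega> u
  define R where "R n = P (Suc n)" for n
  note G' = approximates_cdfD[OF G zero_less_Suc] and H' = approximates_cdfD[OF H zero_less_Suc]
  have R: "prob_space (R n)" for n unfolding R_def by (rule P)
  have mom: "(\<integral>\<^sup>+\<omega>. ennreal ((sqrt (Suc n) * (G (Suc n) \<omega> x - H (Suc n) \<omega> x))\<^sup>2) \<partial>R n) \<le> ennreal (4 * C * (F x * (1 - F x)))" for n x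
  proof -
    have [measurable]: "(\<lambda>\<omega>. G (Suc n) \<omega> x) \<in> borel_measurable (R n)" "(\<lambda>\<omega>. H (Suc n) \<omega> x) \<in> borel_measurable (R n)"
      unfolding R_def by (rule G'(5) H'(5))+
    let ?g = "\<lambda>\<omega>. sqrt (Suc n) * (G (Suc n) \<omega> x - F x)" and ?h = "\<lambda>\<omega>. sqrt (Suc n) * (H (Suc n) \<omega> x - F x)"
    have "(\<integral>\<^sup>+\<omega>. ennreal ((sqrt (Suc n) * (G (Suc n) \<omega> x - H (Suc n) \<omega> x))\<^sup>2) \<partial>R n)
        \<le> (\<integral>\<^sup>+\<omega>. 2 * ennreal ((?g \<omega>)\<^sup>2) + 2 * ennreal ((?h \<omega>)\<^sup>2) \<partial>R n)"
    proof (intro nn_integral_mono)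
      fix \<omega>
      have "sqrt (Suc n) * (G (Suc n) \<omega> x - H (Suc n) \<omega> x) = ?g \<omega> - ?h \<omega>" by (simp only: right_diff_distrib)
      moreover have "(s - t)\<^sup>2 \<le> 2 * s\<^sup>2 + 2 * t\<^sup>2" for s t :: real
        using sum_squares_ge_zero[of "s + t" 0] by (simp add: power2_eq_square algebra_simps)
      ultimately have "(sqrt (Suc n) * (G (Suc n) \<omega> x - H (Suc n) \<omega> x))\<^sup>2 \<le> 2 * (?g \<omega>)\<^sup>2 + 2 * (?h \<omega>)\<^sup>2" by metis
      from ennreal_leI[OF this]
      show "ennreal ((sqrt (Suc n) * (G (Suc n) \<omega> x - H (Suc n) \<omega> x))\<^sup>2) \<le> 2 * ennreal ((?g \<omega>)\<^sup>2) + 2 * ennreal ((?h \<omega>)\<^sup>2)"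
        by (simp add: ennreal_mult)
    qed
    also have "\<dots> = 2 * (\<integral>\<^sup>+\<omega>. ennreal ((?g \<omega>)\<^sup>2) \<partial>R n) + 2 * (\<integral>\<^sup>+\<omega>. ennreal ((?h \<omega>)\<^sup>2) \<partial>R n)"
      by (simp add: nn_integral_add nn_integral_cmult)
    also have "\<dots> \<le> 2 * ennreal (C * (F x * (1 - F x))) + 2 * ennreal (C * (F x * (1 - F x)))"
      using G'(7)[of n x] H'(7)[of n x] unfolding R_def by (intro add_mono mult_left_mono) auto
    also have "\<dots> = ennreal (4 * C * (F x * (1 - F x)))"
    proof -
      have "0 \<le> C * (F x * (1 - F x))" using C by simp
      then show ?thesis by (simp add: ennreal_mult[symmetric] ennreal_plus[symmetric] ennreal_numeral[symmetric] del: ennreal_plus ennreal_numeral)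
    qed
    finally show ?thesis .
  qed
  have idm: "(\<lambda>p. fst p) \<in> measurable (R n \<Otimes>\<^sub>M unit_borel) (R n)" for n by simp
  have Qm: "(\<lambda>p. (fst p, Q (snd p))) \<in> measurable (R n \<Otimes>\<^sub>M unit_borel) (R n \<Otimes>\<^sub>M borel)" for n
    using measurable_compose[OF measurable_snd[of "R n" unit_borel] Q_measurable] by (intro measurable_Pair idm)
  have GQ [measurable]: "(\<lambda>p. G (Suc n) (fst p) (Q (snd p))) \<in> borel_measurable (R n \<Otimes>\<^sub>M unit_borel)"
    "(\<lambda>p. H (Suc n) (fst p) (Q (snd p))) \<in> borel_measurable (R n \<Otimes>\<^sub>M unit_borel)" for n
    using measurable_compose[OF Qm G'(4)[of n, folded R_def]] measurable_compose[OF Qm H'(4)[of n, folded R_def]] by simp_all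
  have qm [measurable]: "(\<lambda>p. q (snd p)) \<in> borel_measurable (R n \<Otimes>\<^sub>M unit_borel)" for n
    using measurable_compose[OF measurable_snd[of "R n" unit_borel] measurable_unit_borelI[OF q_measurable]] .
  have quant [measurable]: "(\<lambda>p. quantile (G (Suc n) (fst p)) (snd p)) \<in> borel_measurable (R n \<Otimes>\<^sub>M unit_borel)"
    "(\<lambda>p. quantile (H (Suc n) (fst p)) (snd p)) \<in> borel_measurable (R n \<Otimes>\<^sub>M unit_borel)" for n
    using quantile_adjoint_measurable[OF G'(1) G'(4)] quantile_adjoint_measurable[OF H'(1) H'(4)]
    unfolding R_def case_prod_beta' by simp_all
  \<comment> \<open>Dominating function for the Scheffe argument: the factor 4 comes from splitting
    the square of a difference, and the tail condition makes the function integrable.\<close>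
  define K where "K u = sqrt (4 * C) * (q u * sqrt (u * (1 - u)))" for u
  have K0: "0 \<le> indicator {0<..<1} u * K u" for u
    using C q_nonneg by (auto simp: K_def indicator_def)
  have "(\<lambda>n. \<integral>\<^sup>+\<omega>. \<integral>\<^sup>+u. ennreal \<bar>a n \<omega> u - b n \<omega> u\<bar> \<partial>unit_borel \<partial>R n) \<longlonglongrightarrow> 0"
  proof (rule scheffe_processes[where H="\<lambda>u. indicator {0<..<1} u * K u"])
    show "prob_space (R n)" for n by (rule R)
    show "case_prod (a n) \<in> borel_measurable (R n \<Otimes>\<^sub>M unit_borel)"
      "case_prod (b n) \<in> borel_measurable (R n \<Otimes>\<^sub>M unit_borel)" for n
      unfolding a_def b_def case_prod_beta' by measurable
    have K: "K \<in> borel_measurable unit_borel" unfolding K_def by (rule measurable_unit_borelI) measurable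
    then show "(\<lambda>u. indicator {0<..<1} u * K u) \<in> borel_measurable unit_borel"
      by (intro borel_measurable_times[OF _ K] measurable_unit_borelI) auto
    have "(\<integral>\<^sup>+u. ennreal (indicator {0<..<1} u * K u) \<partial>unit_borel)
        = (\<integral>\<^sup>+u. ennreal (sqrt (4 * C)) * ennreal (q u * sqrt (u * (1 - u))) \<partial>unit_borel)"
      using C q_nonneg by (intro nn_integral_cong) (simp add: K_def ennreal_mult)
    also have "\<dots> = ennreal (sqrt (4 * C)) * (\<integral>\<^sup>+u. ennreal (q u * sqrt (u * (1 - u))) \<partial>unit_borel)"
      by (rule nn_integral_cmult, rule measurable_restrict_space1) simp
    also have "\<dots> < \<infinity>" using tail_density by (simp add: ennreal_mult_less_top)
    finally show "(\<integral>\<^sup>+u. ennreal (indicator {0<..<1} u * K u) \<partial>unit_borel) < \<infinity>" .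
    show "(\<integral>\<^sup>+\<omega>. \<integral>\<^sup>+u. ennreal \<bar>a n \<omega> u\<bar> \<partial>unit_borel \<partial>R n) \<le> (\<integral>\<^sup>+\<omega>. \<integral>\<^sup>+u. ennreal \<bar>b n \<omega> u\<bar> \<partial>unit_borel \<partial>R n)" for n
    proof -
      interpret R: prob_space "R n" by (rule R)
      interpret pair_sigma_finite "R n" "lborel :: real measure" ..
      let ?D = "\<lambda>\<omega> x. ennreal \<bar>sqrt (Suc n) * (G (Suc n) \<omega> x - H (Suc n) \<omega> x)\<bar>"
      have "(\<lambda>p. G (Suc n) (fst p) (snd p)) \<in> borel_measurable (R n \<Otimes>\<^sub>M borel)"
        "(\<lambda>p. H (Suc n) (fst p) (snd p)) \<in> borel_measurable (R n \<Otimes>\<^sub>M borel)"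
        using G'(4)[of n] H'(4)[of n] by (simp_all add: R_def case_prod_beta')
      then have [measurable]: "(\<lambda>p. G (Suc n) (fst p) (snd p)) \<in> borel_measurable (R n \<Otimes>\<^sub>M lborel)"
        "(\<lambda>p. H (Suc n) (fst p) (snd p)) \<in> borel_measurable (R n \<Otimes>\<^sub>M lborel)"
        by (simp_all cong: measurable_cong_sets sets_pair_measure_cong)
      have "(\<integral>\<^sup>+\<omega>. \<integral>\<^sup>+u. ennreal \<bar>a n \<omega> u\<bar> \<partial>unit_borel \<partial>R n) = (\<integral>\<^sup>+\<omega>. \<integral>\<^sup>+x. ?D \<omega> x \<partial>lborel \<partial>R n)"
        unfolding a_def R_def using G' H'
        by (intro nn_integral_cong nn_integral_scaled_quantile_diff) auto
      also have "\<dots> = (\<integral>\<^sup>+x. \<integral>\<^sup>+\<omega>. ?D \<omega> x \<partial>R n \<partial>lborel)"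
        by (rule Fubini'[symmetric]) (unfold case_prod_beta', measurable)
      also have "\<dots> = (\<integral>\<^sup>+x. \<integral>\<^sup>+\<omega>. ?D \<omega> x * indicator {0<..<1} (F x) \<partial>R n \<partial>lborel)"
      proof (rule nn_integral_cong)
        fix x
        show "(\<integral>\<^sup>+\<omega>. ?D \<omega> x \<partial>R n) = (\<integral>\<^sup>+\<omega>. ?D \<omega> x * indicator {0<..<1} (F x) \<partial>R n)"
        proof (cases "F x \<in> {0<..<1}")
          \<comment> \<open>The area identity integrates over all \<open>x\<close>, the substitution
            by \<open>q\<close> only over levels strictly between 0 and 1. At the remaining
            \<open>x\<close> the second moment is zero, so the deviation vanishes almost
            surely.\<close>
          case False
          then have "F x = 0 \<or> F x = 1" using F_bounds[of x] by auto
          then have z: "F x * (1 - F x) = 0" by auto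
          then have "(\<integral>\<^sup>+\<omega>. ennreal ((sqrt (Suc n) * (G (Suc n) \<omega> x - H (Suc n) \<omega> x))\<^sup>2) \<partial>R n) \<le> ennreal (0\<^sup>2)"
            using mom[of n x] unfolding z by simp
          then have "(\<integral>\<^sup>+\<omega>. ?D \<omega> x \<partial>R n) \<le> ennreal 0"
            using G'(5)[of n x] H'(5)[of n x] unfolding R_def[symmetric]
            by (intro R.nn_integral_abs_le_second_moment) auto
          then show ?thesis using False by simp
        qed simp
      qed
      also have "\<dots> = (\<integral>\<^sup>+\<omega>. \<integral>\<^sup>+x. ?D \<omega> x * indicator {0<..<1} (F x) \<partial>lborel \<partial>R n)"
        by (rule Fubini') (unfold case_prod_beta', measurable)
      also have "\<dots> = (\<integral>\<^sup>+\<omega>. \<integral>\<^sup>+u. ennreal \<bar>b n \<omega> u\<bar> \<partial>unit_borel \<partial>R n)"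
        unfolding b_def abs_minus_cancel using G'(6)[of _ n] H'(6)[of _ n]
        by (intro nn_integral_cong nn_integral_abs_diff_density[symmetric]) (auto simp: R_def)
      finally show ?thesis by simp
    qed
    show "AE u in unit_borel. \<forall>e>0. (\<lambda>n. measure (R n) {\<omega> \<in> space (R n). e < \<bar>a n \<omega> u - b n \<omega> u\<bar>}) \<longlonglongrightarrow> 0"
      using AE_derivative AE_space
    proof eventually_elim
      case (elim u)
      then have u: "0 < u" "u < 1" by auto
      show ?case
      proof (intro allI impI)
        fix e :: real assume e: "0 < e"
        let ?L = "\<lambda>(G :: nat \<Rightarrow> 'p \<Rightarrow> real \<Rightarrow> real) n \<omega>. sqrt (real n) * (quantile (G n \<omega>) u - Q u) + q u * (sqrt (real n) * (G n \<omega> (Q u) - F (Q u)))"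
        let ?E = "\<lambda>(G :: nat \<Rightarrow> 'p \<Rightarrow> real \<Rightarrow> real) n. {\<omega> \<in> space (P n). e / 2 < \<bar>?L G n \<omega>\<bar>}"
        have lim: "(\<lambda>n. measure (P (Suc n)) (?E G (Suc n)) + measure (P (Suc n)) (?E H (Suc n))) \<longlonglongrightarrow> 0 + 0"
          using e by (intro tendsto_add LIMSEQ_Suc bahadur[OF P _ C u elim(1) q_nonneg] G H) auto
        show "(\<lambda>n. measure (R n) {\<omega> \<in> space (R n). e < \<bar>a n \<omega> u - b n \<omega> u\<bar>}) \<longlonglongrightarrow> 0"
        proof (rule tendsto_sandwich[OF _ _ tendsto_const lim[unfolded add_0]]; intro always_eventually allI)
          fix n
          interpret R: prob_space "P (Suc n)" by (rule P)
          have [measurable]: "(\<lambda>\<omega>. G (Suc n) \<omega> x) \<in> borel_measurable (P (Suc n))" "(\<lambda>\<omega>. H (Suc n) \<omega> x) \<in> borel_measurable (P (Suc n))" for x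
            by (rule G'(5) H'(5))+
          have [measurable]: "(\<lambda>\<omega>. quantile (G (Suc n) \<omega>) u) \<in> borel_measurable (P (Suc n))"
            "(\<lambda>\<omega>. quantile (H (Suc n) \<omega>) u) \<in> borel_measurable (P (Suc n))"
            using measurable_Pair1[OF quantile_adjoint_measurable[OF G'(1) G'(4)] elim(2)]
              measurable_Pair1[OF quantile_adjoint_measurable[OF H'(1) H'(4)] elim(2)] by simp_all
          have "{\<omega> \<in> space (R n). e < \<bar>a n \<omega> u - b n \<omega> u\<bar>} \<subseteq> ?E G (Suc n) \<union> ?E H (Suc n)"
          proof
            fix \<omega> assume "\<omega> \<in> {\<omega> \<in> space (R n). e < \<bar>a n \<omega> u - b n \<omega> u\<bar>}"
            then have \<omega>: "\<omega> \<in> space (P (Suc n))" and big: "e < \<bar>a n \<omega> u - b n \<omega> u\<bar>" by (auto simp: R_def)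
            have "a n \<omega> u - b n \<omega> u = ?L G (Suc n) \<omega> - ?L H (Suc n) \<omega>"
              by (simp add: a_def b_def algebra_simps)
            then have "e / 2 < \<bar>?L G (Suc n) \<omega>\<bar> \<or> e / 2 < \<bar>?L H (Suc n) \<omega>\<bar>" using big by linarith
            then show "\<omega> \<in> ?E G (Suc n) \<union> ?E H (Suc n)" using \<omega> by auto
          qed
          then have "measure (R n) {\<omega> \<in> space (R n). e < \<bar>a n \<omega> u - b n \<omega> u\<bar>} \<le> measure (P (Suc n)) (?E G (Suc n) \<union> ?E H (Suc n))"
            unfolding R_def by (intro R.finite_measure_mono) auto
          also have "\<dots> \<le> measure (P (Suc n)) (?E G (Suc n)) + measure (P (Suc n)) (?E H (Suc n))"
            by (intro measure_Un_le) auto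
          finally show "measure (R n) {\<omega> \<in> space (R n). e < \<bar>a n \<omega> u - b n \<omega> u\<bar>}
              \<le> measure (P (Suc n)) (?E G (Suc n)) + measure (P (Suc n)) (?E H (Suc n))" .
        qed simp
      qed
    qed
    show "AE u in unit_borel. (\<integral>\<^sup>+\<omega>. ennreal ((b n \<omega> u)\<^sup>2) \<partial>R n) \<le> ennreal ((indicator {0<..<1} u * K u)\<^sup>2)" for n
      using AE_flat AE_space
    proof eventually_elim
      case (elim u)
      then have u: "0 < u" "u < 1" by auto
      have [measurable]: "(\<lambda>\<omega>. G (Suc n) \<omega> x) \<in> borel_measurable (R n)" "(\<lambda>\<omega>. H (Suc n) \<omega> x) \<in> borel_measurable (R n)" for x
        unfolding R_def by (rule G'(5) H'(5))+
      have "(\<integral>\<^sup>+\<omega>. ennreal ((b n \<omega> u)\<^sup>2) \<partial>R n)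
          = ennreal ((q u)\<^sup>2) * (\<integral>\<^sup>+\<omega>. ennreal ((sqrt (Suc n) * (G (Suc n) \<omega> (Q u) - H (Suc n) \<omega> (Q u)))\<^sup>2) \<partial>R n)"
        by (subst nn_integral_cmult[symmetric]) (auto simp: b_def power_mult_distrib ennreal_mult)
      also have "\<dots> \<le> ennreal ((q u)\<^sup>2) * ennreal (4 * C * (F (Q u) * (1 - F (Q u))))"
        by (intro mult_left_mono mom) simp
      also have "\<dots> = ennreal ((q u)\<^sup>2 * (4 * C * (F (Q u) * (1 - F (Q u)))))"
        using C by (simp add: ennreal_mult)
      also have "(q u)\<^sup>2 * (4 * C * (F (Q u) * (1 - F (Q u)))) = (indicator {0<..<1} u * K u)\<^sup>2"
        using elim u C by (auto simp: K_def power_mult_distrib)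
      finally show ?case .
    qed
  qed (use K0 in simp)
  then have "(\<lambda>n. \<integral>\<^sup>+\<omega>. \<integral>\<^sup>+u. ennreal \<bar>sqrt (Suc n) * (quantile (G (Suc n) \<omega>) u - quantile (H (Suc n) \<omega>) u)
      + q u * (sqrt (Suc n) * (G (Suc n) \<omega> (Q u) - H (Suc n) \<omega> (Q u)))\<bar> \<partial>unit_borel \<partial>P (Suc n)) \<longlonglongrightarrow> 0"
    by (simp add: a_def b_def R_def)
  then show ?thesis by (rule LIMSEQ_imp_Suc)
qed

end

section \<open>Sampling\<close>

definition sample_mean :: "nat \<Rightarrow> (nat \<Rightarrow> real) \<Rightarrow> real" where
  "sample_mean n y = (\<Sum>i<n. y i) / n"

text \<open>The sample space \<open>S\<close> is left general so that \<open>U\<close> can be either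
  the data or the drawn indices. Centering doubles the bound, hence \<open>2 * A\<close>.\<close>

lemma (in prob_space) iid_normalized_sum:
  fixes U :: "nat \<Rightarrow> 'a \<Rightarrow> 's" and g :: "'s \<Rightarrow> real"
  assumes indep: "indep_vars (\<lambda>_. S) U {..<n}" and law: "\<And>i. i < n \<Longrightarrow> distr M S (U i) = \<nu>"
    and g [measurable]: "g \<in> borel_measurable S" and bound: "\<And>s. s \<in> space S \<Longrightarrow> \<bar>g s\<bar> \<le> A" and n: "n > 0"
  defines "m \<equiv> \<integral>s. g s \<partial>\<nu>" and "v \<equiv> \<integral>s. (g s - (\<integral>s. g s \<partial>\<nu>))\<^sup>2 \<partial>\<nu>"
  shows "(\<integral>\<^sup>+\<omega>. ennreal ((sqrt n * (sample_mean n (\<lambda>i. g (U i \<omega>)) - m))\<^sup>2) \<partial>M) = ennreal v"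
    and "(2 * A)\<^sup>2 \<le> n \<Longrightarrow> 0 \<le> v' \<Longrightarrow> v' \<le> (2 * A)\<^sup>2 \<Longrightarrow>
      cmod (expectation (\<lambda>\<omega>. iexp (sqrt n * (sample_mean n (\<lambda>i. g (U i \<omega>)) - m))) - of_real (exp (- v' / 2)))
        \<le> (2 * A) ^ 3 / sqrt n + \<bar>v - v'\<bar> / 2 + \<bar>(1 - v' / (2 * real n)) ^ n - exp (- v' / 2)\<bar>"
proof -
  have U [measurable]: "U i \<in> measurable M S" if "i < n" for i
    using indep that by (auto simp: indep_vars_def)
  have \<nu>: "prob_space \<nu>" "sets \<nu> = sets S"
    unfolding law[OF n, symmetric] by (rule prob_space_distr[OF U[OF n]], rule sets_distr)
  interpret \<nu>: prob_space \<nu> by (rule \<nu>)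
  have gb: "\<bar>g s\<bar> \<le> A" if "s \<in> space \<nu>" for s using bound that sets_eq_imp_space_eq[OF \<nu>(2)] by simp
  have g\<nu> [measurable]: "g \<in> borel_measurable \<nu>" using g by (simp add: measurable_cong_sets[OF \<nu>(2) refl])
  have ig: "integrable \<nu> g" by (rule \<nu>.integrable_bounded_rv[OF _ gb]) auto
  have mA: "\<bar>m\<bar> \<le> A"
  proof -
    have "\<bar>m\<bar> \<le> (\<integral>s. \<bar>g s\<bar> \<partial>\<nu>)" unfolding m_def by (rule integral_abs_bound)
    also have "\<dots> \<le> (\<integral>s. A \<partial>\<nu>)" using ig gb by (intro integral_mono) auto
    finally show ?thesis by (simp add: \<nu>.prob_space)
  qed
  define Y where "Y = (\<lambda>i \<omega>. g (U i \<omega>) - m)"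
  have Yi: "indep_vars (\<lambda>_. borel) Y {..<n}"
    unfolding Y_def by (rule indep_vars_compose2[OF indep]) auto
  have Y [measurable]: "Y i \<in> borel_measurable M" if "i < n" for i
    using that unfolding Y_def by measurable
  have Yb: "\<bar>Y i \<omega>\<bar> \<le> 2 * A" if "i < n" "\<omega> \<in> space M" for i \<omega>
    using bound[OF measurable_space[OF U[OF that(1)] that(2)]] mA unfolding Y_def by linarith
  have mean: "expectation (Y i) = 0" if "i < n" for i
  proof -
    have "expectation (\<lambda>\<omega>. g (U i \<omega>)) = m"
      unfolding m_def law[OF that, symmetric] using that by (subst integral_distr) auto
    moreover have "integrable M (\<lambda>\<omega>. g (U i \<omega>))"
      using that bound measurable_space[OF U[OF that]] by (intro integrable_bounded_rv[where A=A]) auto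
    ultimately show ?thesis unfolding Y_def by (simp add: prob_space)
  qed
  have var: "expectation (\<lambda>\<omega>. (Y i \<omega>)\<^sup>2) = v" if "i < n" for i
    unfolding v_def Y_def m_def law[OF that, symmetric] using that by (subst integral_distr) auto
  have sum: "sqrt n * (sample_mean n (\<lambda>i. g (U i \<omega>)) - m) = (\<Sum>i<n. Y i \<omega>) / sqrt n" for \<omega>
  proof -
    have "sample_mean n (\<lambda>i. g (U i \<omega>)) - m = (\<Sum>i<n. Y i \<omega>) / n"
      using n by (simp add: sample_mean_def Y_def sum_subtractf diff_divide_distrib)
    then have "sqrt n * (sample_mean n (\<lambda>i. g (U i \<omega>)) - m) = (sqrt n / n) * (\<Sum>i<n. Y i \<omega>)" by simp
    also have "sqrt n / n = 1 / sqrt n" using n by (simp add: frac_eq_eq)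
    finally show ?thesis by simp
  qed
  show "(\<integral>\<^sup>+\<omega>. ennreal ((sqrt n * (sample_mean n (\<lambda>i. g (U i \<omega>)) - m))\<^sup>2) \<partial>M) = ennreal v"
  proof -
    have Sb: "\<bar>\<Sum>i<n. Y i \<omega>\<bar> \<le> n * (2 * A)" if "\<omega> \<in> space M" for \<omega>
      using Yb that by (intro order.trans[OF sum_abs] sum_bounded_above[of "{..<n}", simplified]) auto
    have int: "integrable M (\<lambda>\<omega>. (\<Sum>i<n. Y i \<omega>)\<^sup>2)"
    proof (rule integrable_bounded_rv[where A="(n * (2 * A))\<^sup>2"])
      show "\<bar>(\<Sum>i<n. Y i \<omega>)\<^sup>2\<bar> \<le> (n * (2 * A))\<^sup>2" if "\<omega> \<in> space M" for \<omega>
        using Sb[OF that] by (simp add: abs_le_square_iff[symmetric])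
    qed simp
    have "(\<integral>\<^sup>+\<omega>. ennreal ((sqrt n * (sample_mean n (\<lambda>i. g (U i \<omega>)) - m))\<^sup>2) \<partial>M)
        = (\<integral>\<^sup>+\<omega>. ennreal ((\<Sum>i<n. Y i \<omega>)\<^sup>2 / n) \<partial>M)"
      unfolding sum by (simp add: power_divide)
    also have "\<dots> = ennreal (expectation (\<lambda>\<omega>. (\<Sum>i<n. Y i \<omega>)\<^sup>2 / n))"
      using int by (intro nn_integral_eq_integral) auto
    also have "expectation (\<lambda>\<omega>. (\<Sum>i<n. Y i \<omega>)\<^sup>2 / n) = v"
      using second_moment_indep_sum[OF Yi Yb mean var] n by simp
    finally show ?thesis .
  qed
  show "cmod (expectation (\<lambda>\<omega>. iexp (sqrt n * (sample_mean n (\<lambda>i. g (U i \<omega>)) - m))) - of_real (exp (- v' / 2)))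
        \<le> (2 * A) ^ 3 / sqrt n + \<bar>v - v'\<bar> / 2 + \<bar>(1 - v' / (2 * real n)) ^ n - exp (- v' / 2)\<bar>"
    if "(2 * A)\<^sup>2 \<le> n" "0 \<le> v'" "v' \<le> (2 * A)\<^sup>2"
    unfolding sum using that n Yb mean var by (intro char_normalized_sum[OF Yi]) auto
qed

lemma emp_cdf_eq_sample_mean: "emp_cdf n x t = sample_mean n (\<lambda>i. indicator {..t} (x i))"
  by (simp add: emp_cdf_def sample_mean_def indicator_def)

lemma sample_mean_diff: "sample_mean n (\<lambda>i. y i - z i) = sample_mean n y - sample_mean n z"
  by (simp add: sample_mean_def sum_subtractf diff_divide_distrib)

lemma iid_cdfD:
  assumes M: "prob_space M" and X: "iid_cdf M X F"
  shows "real_distribution (distr M borel (X i))" "distr M borel (X i) = distr M borel (X 0)"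
    "F = cdf (distr M borel (X i))" "X i \<in> borel_measurable M"
    "prob_space.indep_vars M (\<lambda>_. borel) X {..<n}"
proof -
  interpret prob_space M by (rule M)
  have ind: "indep_vars (\<lambda>_. borel) X UNIV" using X by (simp add: iid_cdf_def)
  show Xm: "X i \<in> borel_measurable M" for i using ind by (auto simp: indep_vars_def)
  show "indep_vars (\<lambda>_. borel) X {..<n}" by (rule indep_vars_subset[OF ind]) simp
  show "real_distribution (distr M borel (X i))" using Xm by (rule real_distribution_distr)
  show "F = cdf (distr M borel (X i))" using X by (simp add: iid_cdf_def)
  show "distr M borel (X i) = distr M borel (X 0)" using X by (simp add: iid_cdf_def)
qed

lemma emp_cdf_joint_measurable:
  assumes X: "\<And>i. X i \<in> borel_measurable M"
  shows "(\<lambda>(\<omega>, t). emp_cdf n (\<lambda>i. X i \<omega>) t) \<in> borel_measurable (M \<Otimes>\<^sub>M borel)"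
proof -
  have [measurable]: "(\<lambda>p. X i (fst p)) \<in> borel_measurable (M \<Otimes>\<^sub>M (borel :: real measure))" for i
    by (rule measurable_compose[OF measurable_fst X])
  have "(\<lambda>p. (indicator {X i (fst p)..} (snd p) :: real)) = (\<lambda>p. if X i (fst p) \<le> snd p then 1 else 0)" for i
    by (auto simp: indicator_def)
  then have "(\<lambda>p. (indicator {X i (fst p)..} (snd p) :: real)) \<in> borel_measurable (M \<Otimes>\<^sub>M borel)" for i
    by simp
  then show ?thesis unfolding emp_cdf_def case_prod_beta' by measurable
qed

text \<open>The second moments of the deviations \<open>G - F\<close> and of their increments are those of linear statistics.\<close>

lemma approximates_cdfI:
  assumes \<mu>: "real_distribution \<mu>" and C: "0 \<le> C"
    and adj: "\<And>n \<omega>. n > 0 \<Longrightarrow> \<omega> \<in> space (P n) \<Longrightarrow> G n \<omega> = emp_cdf n (Y n \<omega>)"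
    and meas: "\<And>n. n > 0 \<Longrightarrow> case_prod (G n) \<in> borel_measurable (P n \<Otimes>\<^sub>M borel)"
    and mom: "\<And>n g. n > 0 \<Longrightarrow> g \<in> borel_measurable borel \<Longrightarrow> (\<And>s. \<bar>g s\<bar> \<le> 1) \<Longrightarrow>
      (\<integral>\<^sup>+\<omega>. ennreal ((sqrt n * (sample_mean n (\<lambda>i. g (Y n \<omega> i)) - (\<integral>s. g s \<partial>\<mu>)))\<^sup>2) \<partial>P n)
        \<le> ennreal (C * (\<integral>s. (g s - (\<integral>s. g s \<partial>\<mu>))\<^sup>2 \<partial>\<mu>))"
  shows "approximates_cdf (cdf \<mu>) C P G"
  unfolding approximates_cdf_def
proof (intro allI impI conjI ballI meas)
  interpret real_distribution \<mu> by (rule \<mu>)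
  have ind: "expectation (indicator {..x}) = cdf \<mu> x" for x
    by (simp add: cdf_def)
  have iind: "integrable \<mu> (indicator {..x} :: real \<Rightarrow> real)" for x
    by (simp add: emeasure_eq_measure)
  fix n :: nat assume n: "n > 0"
  show "quantile_adjoint (G n \<omega>)" "0 \<le> G n \<omega> x" "G n \<omega> x \<le> 1" if "\<omega> \<in> space (P n)" for \<omega> x
    using quantile_adjoint_emp_cdf[OF n] emp_cdf_bounds that n by (simp_all add: adj)
  show "(\<integral>\<^sup>+\<omega>. ennreal ((sqrt n * (G n \<omega> x - cdf \<mu> x))\<^sup>2) \<partial>P n) \<le> ennreal (C * (cdf \<mu> x * (1 - cdf \<mu> x)))" for x
  proof -
    have "(indicator {..x} s - cdf \<mu> x)\<^sup>2 = (1 - 2 * cdf \<mu> x) * indicator {..x} s + (cdf \<mu> x)\<^sup>2" for s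
      by (auto simp: indicator_def power2_eq_square algebra_simps)
    then have v: "expectation (\<lambda>s. (indicator {..x} s - cdf \<mu> x)\<^sup>2) = cdf \<mu> x * (1 - cdf \<mu> x)"
      using iind[of x] ind[of x] prob_space by (simp only: Bochner_Integration.integral_add integrable_const
        integrable_mult_right integral_mult_right_zero) (simp add: power2_eq_square algebra_simps)
    have "(\<integral>\<^sup>+\<omega>. ennreal ((sqrt n * (G n \<omega> x - cdf \<mu> x))\<^sup>2) \<partial>P n)
        = (\<integral>\<^sup>+\<omega>. ennreal ((sqrt n * (sample_mean n (\<lambda>i. indicator {..x} (Y n \<omega> i)) - cdf \<mu> x))\<^sup>2) \<partial>P n)"
      using n by (intro nn_integral_cong) (simp add: adj emp_cdf_eq_sample_mean)
    also have "\<dots> \<le> ennreal (C * (cdf \<mu> x * (1 - cdf \<mu> x)))"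
      by (rule mom[OF n, of "indicator {..x}", unfolded ind v]) auto
    finally show ?thesis .
  qed
  show "(\<integral>\<^sup>+\<omega>. ennreal ((sqrt n * (G n \<omega> x - cdf \<mu> x) - sqrt n * (G n \<omega> y - cdf \<mu> y))\<^sup>2) \<partial>P n)
      \<le> ennreal (C * \<bar>cdf \<mu> x - cdf \<mu> y\<bar>)" for x y
  proof -
    define g :: "real \<Rightarrow> real" where "g s = indicator {..x} s - indicator {..y} s" for s
    have g [measurable]: "g \<in> borel_measurable borel" unfolding g_def[abs_def] by measurable
    have g1: "\<bar>g s\<bar> \<le> 1" for s by (auto simp: g_def indicator_def)
    have ig: "integrable \<mu> g" unfolding g_def[abs_def] using iind by (intro Bochner_Integration.integrable_diff)
    have m: "expectation g = cdf \<mu> x - cdf \<mu> y" unfolding g_def[abs_def] using iind by (simp only: Bochner_Integration.integral_diff ind)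
    \<comment> \<open>A difference of two half-line indicators has constant sign, so squaring it
      amounts to taking its absolute value; this makes the second moment linear in
      \<open>F\<close>.\<close>
    have g2: "(g s)\<^sup>2 = (if x \<le> y then - g s else g s)" for s by (auto simp: g_def indicator_def)
    have ig2: "integrable \<mu> (\<lambda>s. (g s)\<^sup>2)" unfolding g2 using ig by (cases "x \<le> y") auto
    have "expectation (\<lambda>s. (g s)\<^sup>2) = (if x \<le> y then - expectation g else expectation g)"
      unfolding g2 by (cases "x \<le> y") auto
    also have "\<dots> \<le> \<bar>cdf \<mu> x - cdf \<mu> y\<bar>" by (auto simp: m)
    finally have "expectation (\<lambda>s. (g s)\<^sup>2) \<le> \<bar>cdf \<mu> x - cdf \<mu> y\<bar>" .
    moreover have "expectation (\<lambda>s. (g s - expectation g)\<^sup>2) = expectation (\<lambda>s. (g s)\<^sup>2) - (expectation g)\<^sup>2"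
      by (rule variance_eq[OF ig ig2])
    ultimately have v: "expectation (\<lambda>s. (g s - expectation g)\<^sup>2) \<le> \<bar>cdf \<mu> x - cdf \<mu> y\<bar>"
      using zero_le_power2[of "expectation g"] by linarith
    have "sqrt n * (G n \<omega> x - cdf \<mu> x) - sqrt n * (G n \<omega> y - cdf \<mu> y)
        = sqrt n * (sample_mean n (\<lambda>i. g (Y n \<omega> i)) - expectation g)" if "\<omega> \<in> space (P n)" for \<omega>
      using that n by (simp add: adj emp_cdf_eq_sample_mean g_def[abs_def] sample_mean_diff m[unfolded g_def[abs_def]] algebra_simps)
    then have "(\<integral>\<^sup>+\<omega>. ennreal ((sqrt n * (G n \<omega> x - cdf \<mu> x) - sqrt n * (G n \<omega> y - cdf \<mu> y))\<^sup>2) \<partial>P n)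
        = (\<integral>\<^sup>+\<omega>. ennreal ((sqrt n * (sample_mean n (\<lambda>i. g (Y n \<omega> i)) - expectation g))\<^sup>2) \<partial>P n)"
      by (intro nn_integral_cong) simp
    also have "\<dots> \<le> ennreal (C * expectation (\<lambda>s. (g s - expectation g)\<^sup>2))" by (rule mom[OF n g g1])
    also have "\<dots> \<le> ennreal (C * \<bar>cdf \<mu> x - cdf \<mu> y\<bar>)" using v C by (intro ennreal_leI mult_left_mono)
    finally show ?thesis .
  qed
qed

lemma sampling_second_moment:
  assumes M: "prob_space M" and X: "iid_cdf M X F" and n: "n > 0"
    and g: "g \<in> borel_measurable borel" "\<And>s. \<bar>g s\<bar> \<le> A"
  defines "\<mu> \<equiv> distr M borel (X 0)"
  shows "(\<integral>\<^sup>+\<omega>. ennreal ((sqrt n * (sample_mean n (\<lambda>i. g (X i \<omega>)) - (\<integral>s. g s \<partial>\<mu>)))\<^sup>2) \<partial>M)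
    = ennreal (\<integral>s. (g s - (\<integral>s. g s \<partial>\<mu>))\<^sup>2 \<partial>\<mu>)"
  unfolding \<mu>_def
  by (rule prob_space.iid_normalized_sum(1)[OF M iid_cdfD(5)[OF M X] iid_cdfD(2)[OF M X] g n])

lemma approximates_cdf_emp:
  assumes M: "prob_space M" and X: "iid_cdf M X F"
  shows "approximates_cdf F 1 (\<lambda>_. M) (\<lambda>n \<omega>. emp_cdf n (\<lambda>i. X i \<omega>))"
  unfolding iid_cdfD(3)[OF M X, of 0]
proof (rule approximates_cdfI[where Y="\<lambda>n \<omega> i. X i \<omega>"])
  show "real_distribution (distr M borel (X 0))" by (rule iid_cdfD(1)[OF M X])
  show "(\<lambda>(\<omega>, t). emp_cdf n (\<lambda>i. X i \<omega>) t) \<in> borel_measurable (M \<Otimes>\<^sub>M borel)" for n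
    by (rule emp_cdf_joint_measurable[OF iid_cdfD(4)[OF M X]])
next
  fix n :: nat and g :: "real \<Rightarrow> real"
  assume n: "n > 0" and g: "g \<in> borel_measurable borel" "\<And>s. \<bar>g s\<bar> \<le> 1"
  show "(\<integral>\<^sup>+\<omega>. ennreal ((sqrt n * (sample_mean n (\<lambda>i. g (X i \<omega>)) - (\<integral>s. g s \<partial>distr M borel (X 0))))\<^sup>2) \<partial>M)
      \<le> ennreal (1 * (\<integral>s. (g s - (\<integral>s. g s \<partial>distr M borel (X 0)))\<^sup>2 \<partial>distr M borel (X 0)))"
    using sampling_second_moment[OF M X n g] by simp
qed simp_all


section \<open>The bootstrap\<close>

definition resampling :: "nat \<Rightarrow> (nat \<Rightarrow> nat) pmf" where
  "resampling n = Pi_pmf {..<n} 0 (\<lambda>_. pmf_of_set {..<n})"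

text \<open>Set to zero beyond \<open>n\<close>, so that equality of weight vectors becomes equality
  of functions on all naturals.\<close>

definition draw_counts :: "nat \<Rightarrow> (nat \<Rightarrow> nat) \<Rightarrow> nat \<Rightarrow> nat" where
  "draw_counts n J i = (if i < n then card {j. j < n \<and> J j = i} else 0)"

lemma resampling_eq: "n > 0 \<Longrightarrow> resampling n = pmf_of_set (PiE_dflt {..<n} 0 (\<lambda>_. {..<n}))"
  unfolding resampling_def by (rule Pi_pmf_of_set) (auto simp: lessThan_empty_iff)

lemma set_pmf_resampling: "n > 0 \<Longrightarrow> set_pmf (resampling n) = PiE_dflt {..<n} 0 (\<lambda>_. {..<n})"
  unfolding resampling_eq by (rule set_pmf_of_set) (auto simp: lessThan_empty_iff)

lemma resampling_less: "n > 0 \<Longrightarrow> J \<in> set_pmf (resampling n) \<Longrightarrow> j < n \<Longrightarrow> J j < n"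
  by (auto simp: set_pmf_resampling PiE_dflt_def)

text \<open>The draws are regrouped by their index; every draw must hit an index below
  \<open>n\<close>, as otherwise mass would be lost.\<close>

lemma boot_cdf_draw_counts:
  assumes "\<And>j. j < n \<Longrightarrow> J j < n"
  shows "boot_cdf n (draw_counts n J) x = emp_cdf n (\<lambda>j. x (J j))"
proof
  fix t
  have "(\<Sum>i<n. real (draw_counts n J i) * indicator {x i..} t) = (\<Sum>i<n. \<Sum>j\<in>{j\<in>{..<n}. J j = i}. indicator {x (J j)..} t)"
    by (intro sum.cong) (auto simp: draw_counts_def)
  also have "\<dots> = (\<Sum>j<n. indicator {x (J j)..} t)"
    using assms by (intro sum.group) auto
  finally show "boot_cdf n (draw_counts n J) x t = emp_cdf n (\<lambda>j. x (J j)) t"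
    by (simp add: boot_cdf_def emp_cdf_def)
qed

text \<open>Draws with prescribed counts correspond to the orderings of the multiset with
  \<open>k i\<close> copies of \<open>i\<close>, whose number is the multinomial
  coefficient.\<close>

lemma card_draws_with_counts:
  assumes k: "\<And>i. i \<ge> n \<Longrightarrow> k i = 0" "(\<Sum>i<n. k i) = n"
  shows "card {J \<in> PiE_dflt {..<n} 0 (\<lambda>_. {..<n}). draw_counts n J = k} * (\<Prod>i<n. fact (k i)) = fact n"
proof -
  define A where "A = (\<Sum>i<n. replicate_mset (k i) i)"
  have count: "count A i = k i" for i
  proof -
    have "count A i = (\<Sum>j<n. if j = i then k j else 0)"
      unfolding A_def by (auto simp: count_sum intro!: sum.cong)
    also have "\<dots> = k i" using k(1)[of i] by simp
    finally show ?thesis .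
  qed
  have size: "size A = n" unfolding A_def using k(2) by (simp add: size_multiset_sum)
  have "bij_betw (\<lambda>J. map J [0..<n]) {J \<in> PiE_dflt {..<n} 0 (\<lambda>_. {..<n}). draw_counts n J = k} (permutations_of_multiset A)"
  proof (rule bij_betw_byWitness[where f'="\<lambda>xs i. if i < n then xs ! i else 0"])
    show "\<forall>J\<in>{J \<in> PiE_dflt {..<n} 0 (\<lambda>_. {..<n}). draw_counts n J = k}.
        (\<lambda>i. if i < n then map J [0..<n] ! i else 0) = J"
      by (auto simp: PiE_dflt_def fun_eq_iff)
    show "\<forall>xs\<in>permutations_of_multiset A. map (\<lambda>i. if i < n then xs ! i else 0) [0..<n] = xs"
      using size by (auto simp: permutations_of_multiset_def intro!: nth_equalityI)
    have cnt: "count (mset (map J [0..<n])) i = card {j. j < n \<and> J j = i}" for J :: "nat \<Rightarrow> nat" and i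
    proof -
      have "count (mset (map J [0..<n])) i = length (filter (\<lambda>j. i = J j) [0..<n])"
        by (simp only: count_mset count_list_eq_length_filter filter_map length_map o_def)
      also have "\<dots> = card {j. j < n \<and> J j = i}"
        unfolding length_filter_conv_card by (intro arg_cong[where f=card]) auto
      finally show ?thesis .
    qed
    show "(\<lambda>J. map J [0..<n]) ` {J \<in> PiE_dflt {..<n} 0 (\<lambda>_. {..<n}). draw_counts n J = k} \<subseteq> permutations_of_multiset A"
    proof safe
      fix J assume J: "J \<in> PiE_dflt {..<n} 0 (\<lambda>_. {..<n})" and keq: "k = draw_counts n J"
      have "mset (map J [0..<n]) = A"
      proof (rule multiset_eqI)
        fix i
        have "{j. j < n \<and> J j = i} = {}" if "\<not> i < n"
          using J that by (auto simp: PiE_dflt_def)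
        then show "count (mset (map J [0..<n])) i = count A i"
          unfolding count cnt by (auto simp: keq draw_counts_def)
      qed
      then show "map J [0..<n] \<in> permutations_of_multiset A" by (simp add: permutations_of_multiset_def)
    qed
    show "(\<lambda>xs i. if i < n then xs ! i else 0) ` permutations_of_multiset A
        \<subseteq> {J \<in> PiE_dflt {..<n} 0 (\<lambda>_. {..<n}). draw_counts n J = k}"
    proof safe
      fix xs assume "xs \<in> permutations_of_multiset A"
      then have xs: "mset xs = A" by (simp add: permutations_of_multiset_def)
      then have len: "length xs = n" using size by (metis size_mset)
      let ?J = "\<lambda>i. if i < n then xs ! i else 0"
      have "xs ! i < n" if "i < n" for i
      proof (rule ccontr)
        assume "\<not> xs ! i < n"
        then have "count A (xs ! i) = 0" using k(1) count by simp
        moreover have "xs ! i \<in># A" using that len xs by (metis nth_mem set_mset_mset)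
        ultimately show False by (metis count_eq_zero_iff)
      qed
      then show "?J \<in> PiE_dflt {..<n} 0 (\<lambda>_. {..<n})" by (auto simp: PiE_dflt_def)
      have "map ?J [0..<n] = xs" using len by (intro nth_equalityI) auto
      then have "card {j. j < n \<and> ?J j = i} = k i" for i
        using cnt[of ?J i] xs count by simp
      then show "draw_counts n ?J = k" using k(1) by (auto simp: draw_counts_def fun_eq_iff)
    qed
  qed
  then have "card {J \<in> PiE_dflt {..<n} 0 (\<lambda>_. {..<n}). draw_counts n J = k} = card (permutations_of_multiset A)"
    by (rule bij_betw_same_card)
  moreover have "(\<Prod>i<n. fact (k i)) = (\<Prod>i\<in>set_mset A. fact (count A i) :: nat)"
  proof -
    have "set_mset A \<subseteq> {..<n}" using k(1) count by (metis count_eq_zero_iff lessThan_iff not_le subsetI)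
    then show ?thesis using count by (intro prod.mono_neutral_cong_right) (auto simp: not_in_iff)
  qed
  ultimately show ?thesis using card_permutations_of_multiset_aux[of A] size by simp
qed

lemma measure_resampling_counts:
  assumes n: "n > 0" and k: "\<And>i. i \<ge> n \<Longrightarrow> k i = 0" "(\<Sum>i<n. k i) = n"
  shows "measure (resampling n) {J. draw_counts n J = k} = multinomial_mass n {..<n} (\<lambda>_. 1 / real n) k"
proof -
  let ?S = "PiE_dflt {..<n} 0 (\<lambda>_. {..<n})"
  have fin: "finite ?S" and ne: "?S \<noteq> {}" using n by (auto simp: lessThan_empty_iff)
  have card: "card ?S = n ^ n" by (subst card_PiE_dflt) auto
  have "measure (resampling n) {J. draw_counts n J = k} = real (card (?S \<inter> {J. draw_counts n J = k})) / card ?S"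
    unfolding resampling_eq[OF n] by (rule measure_pmf_of_set[OF ne fin])
  also have "?S \<inter> {J. draw_counts n J = k} = {J \<in> ?S. draw_counts n J = k}" by auto
  also have "real (card {J \<in> ?S. draw_counts n J = k}) = fact n / (\<Prod>i<n. fact (k i))"
  proof -
    have "real (card {J \<in> ?S. draw_counts n J = k}) * (\<Prod>i<n. fact (k i)) = fact n"
      using arg_cong[OF card_draws_with_counts[OF k], of real] by (simp add: of_nat_prod)
    moreover have "(\<Prod>i<n. fact (k i) :: real) \<noteq> 0" by simp
    ultimately show ?thesis by (simp add: eq_divide_eq)
  qed
  also have "fact n / (\<Prod>i<n. fact (k i)) / real (card ?S) = multinomial_mass n {..<n} (\<lambda>_. 1 / real n) k"
  proof -
    have "(\<Prod>i<n. (1 / real n) ^ k i) = 1 / real (n ^ n)"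
      by (simp only: power_sum[symmetric] k(2)) (simp add: power_one_over)
    then show ?thesis using k(2) unfolding card multinomial_mass_def by simp
  qed
  finally show ?thesis .
qed

text \<open>A list packs the first \<open>n\<close> weights into one variable with values in a
  countable type, where measurability is a matter of singletons.\<close>

lemma measurable_map_upt:
  fixes W :: "nat \<Rightarrow> 'a \<Rightarrow> nat"
  assumes W: "\<And>i. i < n \<Longrightarrow> W i \<in> measurable M (count_space UNIV)"
  shows "(\<lambda>x. map (\<lambda>i. W i x) [0..<n]) \<in> measurable M (count_space UNIV)"
proof (subst measurable_count_space_eq2_countable, intro conjI ballI)
  fix xs :: "nat list"
  have "(\<lambda>x. map (\<lambda>i. W i x) [0..<n]) -` {xs} \<inter> space M =
      (if length xs = n then {x \<in> space M. \<forall>i\<in>{..<n}. W i x = xs ! i} else {})"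
  proof -
    have "map f [0..<n] = xs \<longleftrightarrow> length xs = n \<and> (\<forall>i<n. f i = xs ! i)" for f
      by (auto intro!: nth_equalityI)
    then show ?thesis by auto
  qed
  also have "\<dots> \<in> sets M"
  proof -
    have [measurable]: "W i \<in> measurable M (count_space UNIV)" if "i \<in> {..<n}" for i using W that by simp
    show ?thesis by simp
  qed
  finally show "(\<lambda>x. map (\<lambda>i. W i x) [0..<n]) -` {xs} \<inter> space M \<in> sets M" .
qed auto

text \<open>\<open>h\<close> looks only at the first \<open>n\<close> weights, which almost surely
  lie in the finite set \<open>K\<close>; on \<open>K\<close> the multinomial masses are the
  probabilities of the draw counts, so both expectations are the same finite sum.\<close>

lemma multinomial_expectation:
  fixes h :: "(nat \<Rightarrow> nat) \<Rightarrow> real"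
  assumes M': "prob_space M'" and n: "n > 0" and W: "multinomial_distributed M' n {..<n} (\<lambda>_. 1 / real n) W"
    and h: "\<And>k l. (\<And>i. i < n \<Longrightarrow> k i = l i) \<Longrightarrow> h k = h l"
  shows "(\<integral>x. h (\<lambda>i. W i x) \<partial>M') = (\<integral>J. h (draw_counts n J) \<partial>resampling n)"
proof -
  interpret M': prob_space M' by (rule M')
  define K where "K = {k. (\<forall>i\<ge>n. k i = (0::nat)) \<and> (\<Sum>i<n. k i) = n}"
  have "finite K"
  proof (rule finite_subset)
    show "K \<subseteq> PiE_dflt {..<n} 0 (\<lambda>_. {..n})"
    proof
      fix k assume k: "k \<in> K"
      have "k i \<le> n" if "i < n" for i
        using member_le_sum[of i "{..<n}" k] that k by (auto simp: K_def)
      then show "k \<in> PiE_dflt {..<n} 0 (\<lambda>_. {..n})" using k by (auto simp: PiE_dflt_def K_def)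
    qed
  qed auto
  define V where "V x = (\<lambda>i. if i < n then W i x else 0)" for x
  have Wm [measurable]: "W i \<in> measurable M' (count_space UNIV)" if "i < n" for i
    using W that by (simp add: multinomial_distributed_def)
  have set: "{x \<in> space M'. V x = k} = {x \<in> space M'. \<forall>i\<in>{..<n}. W i x = k i}" if "k \<in> K" for k
    using that by (auto simp: V_def K_def fun_eq_iff)
  have sets [measurable]: "{x \<in> space M'. V x = k} \<in> sets M'" if "k \<in> K" for k
    unfolding set[OF that] by measurable
  have mass: "measure M' {x \<in> space M'. V x = k} = measure (resampling n) {J. draw_counts n J = k}" if "k \<in> K" for k
    using W n that unfolding set[OF that] by (subst measure_resampling_counts) (auto simp: K_def multinomial_distributed_def)
  have inK: "draw_counts n J \<in> K" if "J \<in> set_pmf (resampling n)" for J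
  proof -
    have "(\<Sum>i<n. draw_counts n J i) = (\<Sum>i<n. \<Sum>j\<in>{j\<in>{..<n}. J j = i}. 1)"
      by (intro sum.cong) (auto simp: draw_counts_def)
    also have "\<dots> = (\<Sum>j<n. 1)" using resampling_less[OF n that] by (intro sum.group) auto
    finally show ?thesis by (simp add: K_def draw_counts_def)
  qed
  \<comment> \<open>That the masses sum to 1 is read off the resampling law; through
    \<open>mass\<close> it forces the given weights into \<open>K\<close> almost surely.\<close>
  have tot: "(\<Sum>k\<in>K. measure (resampling n) {J. draw_counts n J = k}) = 1"
  proof -
    have "(\<Sum>k\<in>K. measure (resampling n) {J. draw_counts n J = k}) = measure (resampling n) (\<Union>k\<in>K. {J. draw_counts n J = k})"
      using \<open>finite K\<close> by (intro measure_pmf.finite_measure_finite_Union[symmetric]) (auto simp: disjoint_family_on_def)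
    also have "\<dots> = 1" using inK by (subst measure_pmf.prob_eq_1) (auto simp: AE_measure_pmf_iff)
    finally show ?thesis .
  qed
  have "M'.prob (\<Union>k\<in>K. {x \<in> space M'. V x = k}) = (\<Sum>k\<in>K. M'.prob {x \<in> space M'. V x = k})"
    using \<open>finite K\<close> sets by (intro M'.finite_measure_finite_Union) (auto simp: disjoint_family_on_def)
  also have "\<dots> = 1" using tot by (simp add: mass)
  finally have "AE x in M'. x \<in> (\<Union>k\<in>K. {x \<in> space M'. V x = k})"
    using sets \<open>finite K\<close> by (subst (asm) M'.prob_eq_1) auto
  then have AE: "AE x in M'. h (\<lambda>i. W i x) = (\<Sum>k\<in>K. h k * indicator {x \<in> space M'. V x = k} x)"
  proof eventually_elim
    case (elim x)
    then have x: "x \<in> space M'" and VK: "V x \<in> K" by auto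
    have "(\<Sum>k\<in>K. h k * indicator {x \<in> space M'. V x = k} x) = (\<Sum>k\<in>{V x}. h k * indicator {x \<in> space M'. V x = k} x)"
      using VK \<open>finite K\<close> by (intro sum.mono_neutral_right) auto
    also have "\<dots> = h (V x)" using x by simp
    also have "\<dots> = h (\<lambda>i. W i x)" by (rule h) (simp add: V_def)
    finally show ?case ..
  qed
  have meas: "(\<lambda>x. h (\<lambda>i. W i x)) \<in> borel_measurable M'"
  proof -
    have "(\<lambda>xs. h (\<lambda>i. if i < n then xs ! i else 0)) \<in> measurable (count_space UNIV) borel" by simp
    from measurable_compose[OF measurable_map_upt[OF Wm] this]
    have "(\<lambda>x. h (\<lambda>i. if i < n then map (\<lambda>i. W i x) [0..<n] ! i else 0)) \<in> borel_measurable M'" by simp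
    also have "(\<lambda>x. h (\<lambda>i. if i < n then map (\<lambda>i. W i x) [0..<n] ! i else 0)) = (\<lambda>x. h (\<lambda>i. W i x))"
      by (intro ext h) simp
    finally show ?thesis .
  qed
  have "(\<integral>x. h (\<lambda>i. W i x) \<partial>M') = (\<integral>x. (\<Sum>k\<in>K. h k * indicator {x \<in> space M'. V x = k} x) \<partial>M')"
    using AE meas sets by (intro integral_cong_AE) auto
  also have "\<dots> = (\<Sum>k\<in>K. h k * M'.prob {x \<in> space M'. V x = k})"
    using sets by (subst Bochner_Integration.integral_sum) (auto simp: M'.emeasure_eq_measure)
  also have "\<dots> = (\<Sum>k\<in>K. h k * measure (resampling n) {J. draw_counts n J = k})"
    by (intro sum.cong) (simp_all add: mass)
  also have "\<dots> = (\<integral>J. (\<Sum>k\<in>K. h k * indicator {J. draw_counts n J = k} J) \<partial>resampling n)"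
    by (subst Bochner_Integration.integral_sum) (auto simp: measure_pmf.emeasure_eq_measure)
  also have "\<dots> = (\<integral>J. h (draw_counts n J) \<partial>resampling n)"
  proof (intro integral_cong_AE)
    show "AE J in resampling n. (\<Sum>k\<in>K. h k * indicator {J. draw_counts n J = k} J) = h (draw_counts n J)"
      unfolding AE_measure_pmf_iff
    proof
      fix J assume "J \<in> set_pmf (resampling n)"
      from inK[OF this] have "(\<Sum>k\<in>K. h k * indicator {J. draw_counts n J = k} J)
          = (\<Sum>k\<in>{draw_counts n J}. h k * indicator {J. draw_counts n J = k} J)"
        using \<open>finite K\<close> by (intro sum.mono_neutral_right) auto
      then show "(\<Sum>k\<in>K. h k * indicator {J. draw_counts n J = k} J) = h (draw_counts n J)" by simp
    qed
  qed auto
  finally show ?thesis .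
qed

section \<open>Sample moments and conditional characteristic functions\<close>

definition sample_var :: "nat \<Rightarrow> (nat \<Rightarrow> real) \<Rightarrow> real" where
  "sample_var n y = sample_mean n (\<lambda>i. (y i - sample_mean n y)\<^sup>2)"

lemma sample_mean_add: "sample_mean n (\<lambda>i. y i + z i) = sample_mean n y + sample_mean n z"
  by (simp add: sample_mean_def sum.distrib add_divide_distrib)

lemma sample_mean_cmult: "sample_mean n (\<lambda>i. c * y i) = c * sample_mean n y"
  by (simp add: sample_mean_def sum_distrib_left)

lemma sample_mean_const: "n > 0 \<Longrightarrow> sample_mean n (\<lambda>i. c) = c"
  by (simp add: sample_mean_def)

lemma sample_mean_sum: "sample_mean n (\<lambda>i. \<Sum>j\<in>J. y j i) = (\<Sum>j\<in>J. sample_mean n (y j))"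
  by (simp add: sample_mean_def sum.swap[of _ J] sum_divide_distrib)

lemma sample_mean_mono: "(\<And>i. y i \<le> z i) \<Longrightarrow> sample_mean n y \<le> sample_mean n z"
  by (simp add: sample_mean_def divide_right_mono sum_mono)

lemma sample_mean_abs_le: "n > 0 \<Longrightarrow> (\<And>i. \<bar>y i\<bar> \<le> A) \<Longrightarrow> \<bar>sample_mean n y\<bar> \<le> A"
  using sample_mean_mono[of y "\<lambda>_. A" n] sample_mean_mono[of "\<lambda>_. - A" y n]
  by (simp add: sample_mean_const abs_le_iff minus_le_iff)

lemma sample_var_shift:
  assumes "n > 0"
  shows "sample_mean n (\<lambda>i. (y i - c)\<^sup>2) = sample_var n y + (sample_mean n y - c)\<^sup>2"
proof -
  let ?m = "sample_mean n y"
  have "(y i - c)\<^sup>2 = (y i - ?m)\<^sup>2 + (2 * (?m - c) * y i + ((?m - c)\<^sup>2 - 2 * (?m - c) * ?m))" for i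
    by (simp add: power2_eq_square algebra_simps)
  then have "sample_mean n (\<lambda>i. (y i - c)\<^sup>2)
      = sample_mean n (\<lambda>i. (y i - ?m)\<^sup>2) + (2 * (?m - c) * ?m + ((?m - c)\<^sup>2 - 2 * (?m - c) * ?m))"
    by (simp only: sample_mean_add sample_mean_cmult sample_mean_const[OF assms])
  then show ?thesis by (simp add: sample_var_def)
qed

lemma sample_var_eq: "n > 0 \<Longrightarrow> sample_var n y = sample_mean n (\<lambda>i. (y i)\<^sup>2) - (sample_mean n y)\<^sup>2"
  using sample_var_shift[of n y 0] by simp

lemma resampling_indep: "prob_space.indep_vars (resampling n) (\<lambda>_. count_space UNIV) (\<lambda>j J. J j) {..<n}"
  unfolding resampling_def by (rule indep_vars_Pi_pmf) simp

lemma resampling_component: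
  assumes "j < n"
  shows "distr (measure_pmf (resampling n)) (count_space UNIV) (\<lambda>J. J j) = measure_pmf (pmf_of_set {..<n})"
  using assms by (simp add: map_pmf_rep_eq[symmetric] resampling_def Pi_pmf_component)

lemma integral_uniform_index:
  fixes y :: "nat \<Rightarrow> real"
  assumes "n > 0" shows "(\<integral>i. y i \<partial>measure_pmf (pmf_of_set {..<n})) = sample_mean n y"
  using assms by (subst integral_pmf_of_set) (auto simp: sample_mean_def lessThan_empty_iff)

text \<open>With the data fixed, \<open>g\<close> at the drawn indices is an iid sample whose mean
  and variance are the sample mean and the sample variance.\<close>

lemma resampling_moments:
  fixes x :: "nat \<Rightarrow> real" and g :: "real \<Rightarrow> real"
  assumes n: "n > 0" and g: "\<And>s. \<bar>g s\<bar> \<le> A"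
  shows "(\<integral>\<^sup>+J. ennreal ((sqrt n * (sample_mean n (\<lambda>j. g (x (J j))) - sample_mean n (\<lambda>i. g (x i))))\<^sup>2) \<partial>resampling n)
      = ennreal (sample_var n (\<lambda>i. g (x i)))"
    and "(2 * A)\<^sup>2 \<le> n \<Longrightarrow> 0 \<le> v' \<Longrightarrow> v' \<le> (2 * A)\<^sup>2 \<Longrightarrow>
      cmod ((\<integral>J. iexp (sqrt n * (sample_mean n (\<lambda>j. g (x (J j))) - sample_mean n (\<lambda>i. g (x i)))) \<partial>resampling n)
        - of_real (exp (- v' / 2)))
      \<le> (2 * A) ^ 3 / sqrt n + \<bar>sample_var n (\<lambda>i. g (x i)) - v'\<bar> / 2 + \<bar>(1 - v' / (2 * real n)) ^ n - exp (- v' / 2)\<bar>"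
proof -
  note * = prob_space.iid_normalized_sum[OF prob_space_measure_pmf resampling_indep[of n] resampling_component,
      where g="\<lambda>i. g (x i)" and A=A, unfolded integral_uniform_index[OF n], folded sample_var_def]
  show "(\<integral>\<^sup>+J. ennreal ((sqrt n * (sample_mean n (\<lambda>j. g (x (J j))) - sample_mean n (\<lambda>i. g (x i))))\<^sup>2) \<partial>resampling n)
      = ennreal (sample_var n (\<lambda>i. g (x i)))"
    by (rule *(1)) (use g n in auto)
  show "cmod ((\<integral>J. iexp (sqrt n * (sample_mean n (\<lambda>j. g (x (J j))) - sample_mean n (\<lambda>i. g (x i)))) \<partial>resampling n)
        - of_real (exp (- v' / 2)))
      \<le> (2 * A) ^ 3 / sqrt n + \<bar>sample_var n (\<lambda>i. g (x i)) - v'\<bar> / 2 + \<bar>(1 - v' / (2 * real n)) ^ n - exp (- v' / 2)\<bar>"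
    if "(2 * A)\<^sup>2 \<le> n" "0 \<le> v'" "v' \<le> (2 * A)\<^sup>2"
    by (rule *(2)) (use g n that in auto)
qed

context
  fixes M :: "'a measure" and X :: "nat \<Rightarrow> 'a \<Rightarrow> real" and F :: "real \<Rightarrow> real" and \<mu> :: "real measure"
    and g :: "real \<Rightarrow> real" and A m v :: real
  assumes M: "prob_space M" and X: "iid_cdf M X F" and g [measurable]: "g \<in> borel_measurable borel"
    and bound: "\<And>s. \<bar>g s\<bar> \<le> A"
  defines "\<mu> \<equiv> distr M borel (X 0)" and "m \<equiv> \<integral>s. g s \<partial>\<mu>" and "v \<equiv> \<integral>s. (g s - m)\<^sup>2 \<partial>\<mu>"
begin

interpretation M: prob_space M by (rule M)
interpretation \<mu>: real_distribution \<mu> unfolding \<mu>_def by (rule iid_cdfD(1)[OF M X])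

lemma X_measurable [measurable]: "X i \<in> borel_measurable M"
  by (rule iid_cdfD(4)[OF M X])

lemma mean_bound: "\<bar>m\<bar> \<le> A"
proof -
  have i: "integrable \<mu> g" by (rule \<mu>.integrable_bounded_rv[OF _ bound]) simp
  have "\<bar>m\<bar> \<le> (\<integral>s. \<bar>g s\<bar> \<partial>\<mu>)" unfolding m_def by (rule integral_abs_bound)
  also have "\<dots> \<le> (\<integral>s. A \<partial>\<mu>)" using i bound by (intro integral_mono) auto
  finally show ?thesis using \<mu>.prob_space by simp
qed

lemma variance_bounds: "0 \<le> v" "v \<le> (2 * A)\<^sup>2"
proof -
  show "0 \<le> v" unfolding v_def by (rule Bochner_Integration.integral_nonneg) simp
  have b: "(g s - m)\<^sup>2 \<le> (2 * A)\<^sup>2" for s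
    using bound[of s] mean_bound by (intro power2_le_iff_abs_le[THEN iffD2]) auto
  have i: "integrable \<mu> (\<lambda>s. (g s - m)\<^sup>2)" by (rule \<mu>.integrable_bounded_rv[where A="(2 * A)\<^sup>2"]) (use b in auto)
  have "v \<le> (\<integral>s. (2 * A)\<^sup>2 \<partial>\<mu>)" unfolding v_def using i b by (intro integral_mono) auto
  then show "v \<le> (2 * A)\<^sup>2" using \<mu>.prob_space by simp
qed

lemma char_error_tendsto: "(\<lambda>n. (2 * A) ^ 3 / sqrt (real n) + \<bar>(1 - v / (2 * real n)) ^ n - exp (- v / 2)\<bar>) \<longlonglongrightarrow> 0"
proof -
  have "(\<lambda>n. (1 + (- v / 2) / real n) ^ n) \<longlonglongrightarrow> exp (- v / 2)"
    by (rule tendsto_exp_limit_sequentially)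
  then have "(\<lambda>n. \<bar>(1 + (- v / 2) / real n) ^ n - exp (- v / 2)\<bar>) \<longlonglongrightarrow> 0"
    by (intro tendsto_rabs_zero) (simp add: LIM_zero)
  then have "(\<lambda>n. \<bar>(1 - v / (2 * real n)) ^ n - exp (- v / 2)\<bar>) \<longlonglongrightarrow> 0" by simp
  from tendsto_add[OF tendsto_divide_sqrt[of "(2 * A) ^ 3"] this] show ?thesis by simp
qed

lemma eventually_large: "\<forall>\<^sub>F n in sequentially. n > 0 \<and> (2 * A)\<^sup>2 \<le> real n"
  using eventually_gt_at_top[of 0] filterlim_real_sequentially[unfolded filterlim_at_top, rule_format, of "(2 * A)\<^sup>2"]
  by eventually_elim auto

lemma sampling_char_tendsto:
  "(\<lambda>n. cmod ((\<integral>\<omega>. iexp (sqrt n * (sample_mean n (\<lambda>i. g (X i \<omega>)) - m)) \<partial>M) - of_real (exp (- v / 2)))) \<longlonglongrightarrow> 0"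
proof (rule tendsto_sandwich[OF _ _ tendsto_const char_error_tendsto])
  show "\<forall>\<^sub>F n in sequentially. cmod ((\<integral>\<omega>. iexp (sqrt n * (sample_mean n (\<lambda>i. g (X i \<omega>)) - m)) \<partial>M) - of_real (exp (- v / 2)))
      \<le> (2 * A) ^ 3 / sqrt (real n) + \<bar>(1 - v / (2 * real n)) ^ n - exp (- v / 2)\<bar>"
    using eventually_large
  proof eventually_elim
    case (elim n)
    have "cmod ((\<integral>\<omega>. iexp (sqrt n * (sample_mean n (\<lambda>i. g (X i \<omega>)) - m)) \<partial>M) - of_real (exp (- v / 2)))
      \<le> (2 * A) ^ 3 / sqrt n + \<bar>v - v\<bar> / 2 + \<bar>(1 - v / (2 * real n)) ^ n - exp (- v / 2)\<bar>"
      using elim variance_bounds unfolding m_def v_def \<mu>_def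
      by (intro M.iid_normalized_sum(2)[OF iid_cdfD(5)[OF M X] iid_cdfD(2)[OF M X] g bound]) auto
    then show ?case by simp
  qed
qed simp

lemma sampling_mean_deviation:
  assumes n: "n > 0"
  shows "(\<integral>\<^sup>+\<omega>. ennreal \<bar>sample_mean n (\<lambda>i. g (X i \<omega>)) - m\<bar> \<partial>M) \<le> ennreal (2 * A / sqrt n)"
proof -
  have A: "0 \<le> A" using bound[of 0] by linarith
  have [measurable]: "(\<lambda>\<omega>. sample_mean n (\<lambda>i. g (X i \<omega>))) \<in> borel_measurable M"
    unfolding sample_mean_def by measurable
  have "(\<integral>\<^sup>+\<omega>. ennreal \<bar>sqrt n * (sample_mean n (\<lambda>i. g (X i \<omega>)) - m)\<bar> \<partial>M) \<le> ennreal (2 * A)"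
  proof (rule M.nn_integral_abs_le_second_moment)
    show "(\<integral>\<^sup>+\<omega>. ennreal ((sqrt n * (sample_mean n (\<lambda>i. g (X i \<omega>)) - m))\<^sup>2) \<partial>M) \<le> ennreal ((2 * A)\<^sup>2)"
      using sampling_second_moment[OF M X n g bound] variance_bounds(2)
      unfolding m_def v_def \<mu>_def by (simp add: ennreal_leI)
  qed (use A in auto)
  moreover have "(\<integral>\<^sup>+\<omega>. ennreal \<bar>sqrt n * (sample_mean n (\<lambda>i. g (X i \<omega>)) - m)\<bar> \<partial>M)
      = ennreal (sqrt n) * (\<integral>\<^sup>+\<omega>. ennreal \<bar>sample_mean n (\<lambda>i. g (X i \<omega>)) - m\<bar> \<partial>M)"
    by (subst nn_integral_cmult[symmetric]) (auto simp: abs_mult ennreal_mult)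
  ultimately have "ennreal (1 / sqrt n) * (ennreal (sqrt n) * (\<integral>\<^sup>+\<omega>. ennreal \<bar>sample_mean n (\<lambda>i. g (X i \<omega>)) - m\<bar> \<partial>M))
      \<le> ennreal (1 / sqrt n) * ennreal (2 * A)"
    by (intro mult_left_mono) auto
  then show ?thesis
    using n A by (simp add: mult.assoc[symmetric] ennreal_mult[symmetric])
qed

text \<open>The sample mean minimises the mean squared deviation, so passing to the true mean
  \<open>m\<close> only increases the expression.\<close>

lemma sampling_sample_var:
  assumes n: "n > 0"
  shows "(\<integral>\<^sup>+\<omega>. ennreal (sample_var n (\<lambda>i. g (X i \<omega>))) \<partial>M) \<le> ennreal v"
proof -
  have b: "(g s - m)\<^sup>2 \<le> (2 * A)\<^sup>2" for s
    using bound[of s] mean_bound by (intro power2_le_iff_abs_le[THEN iffD2]) auto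
  have i: "integrable M (\<lambda>\<omega>. (g (X j \<omega>) - m)\<^sup>2)" for j
    by (rule M.integrable_bounded_rv[where A="(2 * A)\<^sup>2"]) (use b in auto)
  have e: "M.expectation (\<lambda>\<omega>. (g (X j \<omega>) - m)\<^sup>2) = v" for j
    unfolding v_def m_def \<mu>_def iid_cdfD(2)[OF M X, of j, symmetric] by (subst integral_distr) auto
  have "(\<integral>\<^sup>+\<omega>. ennreal (sample_var n (\<lambda>i. g (X i \<omega>))) \<partial>M) \<le> (\<integral>\<^sup>+\<omega>. ennreal (sample_mean n (\<lambda>i. (g (X i \<omega>) - m)\<^sup>2)) \<partial>M)"
    using n by (intro nn_integral_mono ennreal_leI) (simp add: sample_var_shift)
  also have "\<dots> = ennreal (M.expectation (\<lambda>\<omega>. sample_mean n (\<lambda>i. (g (X i \<omega>) - m)\<^sup>2)))"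
    using i by (intro nn_integral_eq_integral) (auto simp: sample_mean_def intro!: sum_nonneg divide_nonneg_nonneg)
  also have "M.expectation (\<lambda>\<omega>. sample_mean n (\<lambda>i. (g (X i \<omega>) - m)\<^sup>2)) = v"
    using i n by (simp add: sample_mean_def e)
  finally show ?thesis .
qed

end

text \<open>The limit variance is inserted as \<open>v'\<close>, so the data enter the error bound
  only through the difference between sample variance and variance. That difference is controlled by
  the sample means of \<open>g\<close> and of its square, whose mean deviations are of order
  \<open>1 / sqrt n\<close>.\<close>

lemma resampling_char_tendsto:
  fixes M :: "'a measure" and X :: "nat \<Rightarrow> 'a \<Rightarrow> real" and g :: "real \<Rightarrow> real"
  assumes M: "prob_space M" and X: "iid_cdf M X F" and g [measurable]: "g \<in> borel_measurable borel"
    and bound: "\<And>s. \<bar>g s\<bar> \<le> A"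
  defines "\<mu> \<equiv> distr M borel (X 0)"
  defines "v \<equiv> \<integral>s. (g s - (\<integral>s. g s \<partial>\<mu>))\<^sup>2 \<partial>\<mu>"
  shows "(\<lambda>n. \<integral>\<^sup>+\<omega>. ennreal (cmod ((\<integral>J. iexp (sqrt n * (sample_mean n (\<lambda>j. g (X (J j) \<omega>)) - sample_mean n (\<lambda>i. g (X i \<omega>))))
      \<partial>resampling n) - of_real (exp (- v / 2)))) \<partial>M) \<longlonglongrightarrow> 0"
proof -
  interpret M: prob_space M by (rule M)
  interpret \<mu>: real_distribution \<mu> unfolding \<mu>_def by (rule iid_cdfD(1)[OF M X])
  have [measurable]: "X i \<in> borel_measurable M" for i by (rule iid_cdfD(4)[OF M X])
  have A: "0 \<le> A" using bound[of 0] by linarith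
  define m where "m = (\<integral>s. g s \<partial>\<mu>)"
  define m2 where "m2 = (\<integral>s. (g s)\<^sup>2 \<partial>\<mu>)"
  have g2: "(\<lambda>s. (g s)\<^sup>2) \<in> borel_measurable borel" "\<bar>(g s)\<^sup>2\<bar> \<le> A\<^sup>2" for s
    using bound[of s] A by (auto simp: abs_le_square_iff[symmetric])
  have mA: "\<bar>m\<bar> \<le> A" unfolding m_def \<mu>_def by (rule mean_bound[OF M X g bound])
  have v: "v = m2 - m\<^sup>2"
  proof -
    have "integrable \<mu> g" "integrable \<mu> (\<lambda>s. (g s)\<^sup>2)"
      by (rule \<mu>.integrable_bounded_rv[OF _ bound] \<mu>.integrable_bounded_rv[OF _ g2(2)]; simp)+
    then show ?thesis unfolding v_def m_def m2_def by (rule \<mu>.variance_eq)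
  qed
  note vb = variance_bounds[OF M X g bound, folded \<mu>_def, folded v_def]
  let ?r = "\<lambda>n. (2 * A) ^ 3 / sqrt (real n) + \<bar>(1 - v / (2 * real n)) ^ n - exp (- v / 2)\<bar>"
  let ?s = "\<lambda>n. A\<^sup>2 / sqrt (real n) + 2 * A * A / sqrt (real n)"
  show ?thesis
  proof (rule tendsto_sandwich[OF _ _ tendsto_const])
    show "(\<lambda>n. ennreal (?r n + ?s n)) \<longlonglongrightarrow> 0"
      using tendsto_ennrealI[OF tendsto_add[OF char_error_tendsto[OF M X g bound, folded \<mu>_def, folded v_def]
        tendsto_add[OF tendsto_divide_sqrt[of "A\<^sup>2"] tendsto_divide_sqrt[of "2 * A * A"]]]] by simp
    show "\<forall>\<^sub>F n in sequentially. (\<integral>\<^sup>+\<omega>. ennreal (cmod ((\<integral>J. iexp (sqrt n * (sample_mean n (\<lambda>j. g (X (J j) \<omega>)) - sample_mean n (\<lambda>i. g (X i \<omega>))))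
      \<partial>resampling n) - of_real (exp (- v / 2)))) \<partial>M) \<le> ennreal (?r n + ?s n)"
      using eventually_large[OF M X g bound]
    proof eventually_elim
      case (elim n)
      then have n: "n > 0" "(2 * A)\<^sup>2 \<le> real n" by auto
      let ?mean = "\<lambda>\<omega>. sample_mean n (\<lambda>i. g (X i \<omega>))" and ?mean2 = "\<lambda>\<omega>. sample_mean n (\<lambda>i. (g (X i \<omega>))\<^sup>2)"
      have [measurable]: "?mean \<in> borel_measurable M" "?mean2 \<in> borel_measurable M"
        unfolding sample_mean_def by measurable
      have pt: "cmod ((\<integral>J. iexp (sqrt n * (sample_mean n (\<lambda>j. g (X (J j) \<omega>)) - ?mean \<omega>)) \<partial>resampling n) - of_real (exp (- v / 2)))
          \<le> ?r n + (\<bar>?mean2 \<omega> - m2\<bar> / 2 + A * \<bar>?mean \<omega> - m\<bar>)" for \<omega>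
      proof -
        have mb: "\<bar>?mean \<omega>\<bar> \<le> A" using n bound by (intro sample_mean_abs_le) auto
        \<comment> \<open>Both variances are a second moment minus a squared mean; factoring the
          difference of squares leaves a factor bounded by \<open>2 * A\<close>.\<close>
        have "sample_var n (\<lambda>i. g (X i \<omega>)) - v = (?mean2 \<omega> - m2) - (?mean \<omega> + m) * (?mean \<omega> - m)"
          using n by (simp add: sample_var_eq v power2_eq_square algebra_simps)
        also have "\<bar>\<dots>\<bar> \<le> \<bar>?mean2 \<omega> - m2\<bar> + \<bar>?mean \<omega> + m\<bar> * \<bar>?mean \<omega> - m\<bar>"
          by (rule order.trans[OF abs_triangle_ineq4]) (simp add: abs_mult)
        also have "\<dots> \<le> \<bar>?mean2 \<omega> - m2\<bar> + (2 * A) * \<bar>?mean \<omega> - m\<bar>"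
          using mb mA by (intro add_left_mono mult_right_mono) auto
        finally have "\<bar>sample_var n (\<lambda>i. g (X i \<omega>)) - v\<bar> / 2 \<le> \<bar>?mean2 \<omega> - m2\<bar> / 2 + A * \<bar>?mean \<omega> - m\<bar>" by simp
        moreover have "cmod ((\<integral>J. iexp (sqrt n * (sample_mean n (\<lambda>j. g (X (J j) \<omega>)) - ?mean \<omega>)) \<partial>resampling n) - of_real (exp (- v / 2)))
          \<le> (2 * A) ^ 3 / sqrt n + \<bar>sample_var n (\<lambda>i. g (X i \<omega>)) - v\<bar> / 2 + \<bar>(1 - v / (2 * real n)) ^ n - exp (- v / 2)\<bar>"
          using resampling_moments(2)[where g=g and A=A, OF n(1) bound n(2) vb, where x="\<lambda>i. X i \<omega>"] .
        ultimately show ?thesis by linarith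
      qed
      have r0: "0 \<le> ?r n" using A by simp
      have split: "ennreal (a + (h * b + A * c)) = ennreal a + (ennreal h * ennreal b + ennreal A * ennreal c)"
        if "0 \<le> a" "0 \<le> b" "0 \<le> c" "0 \<le> h" for a b c h :: real
        using that A by (simp add: ennreal_mult)
      have "(\<integral>\<^sup>+\<omega>. ennreal (cmod ((\<integral>J. iexp (sqrt n * (sample_mean n (\<lambda>j. g (X (J j) \<omega>)) - ?mean \<omega>)) \<partial>resampling n) - of_real (exp (- v / 2)))) \<partial>M)
          \<le> (\<integral>\<^sup>+\<omega>. ennreal (?r n) + (ennreal (1 / 2) * ennreal \<bar>?mean2 \<omega> - m2\<bar> + ennreal A * ennreal \<bar>?mean \<omega> - m\<bar>) \<partial>M)"
      proof (rule nn_integral_mono)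
        fix \<omega>
        have "cmod ((\<integral>J. iexp (sqrt n * (sample_mean n (\<lambda>j. g (X (J j) \<omega>)) - ?mean \<omega>)) \<partial>resampling n) - of_real (exp (- v / 2)))
            \<le> ?r n + (1 / 2 * \<bar>?mean2 \<omega> - m2\<bar> + A * \<bar>?mean \<omega> - m\<bar>)"
          using pt[of \<omega>] by simp
        from ennreal_leI[OF this]
        show "ennreal (cmod ((\<integral>J. iexp (sqrt n * (sample_mean n (\<lambda>j. g (X (J j) \<omega>)) - ?mean \<omega>)) \<partial>resampling n) - of_real (exp (- v / 2))))
            \<le> ennreal (?r n) + (ennreal (1 / 2) * ennreal \<bar>?mean2 \<omega> - m2\<bar> + ennreal A * ennreal \<bar>?mean \<omega> - m\<bar>)"
          by (subst (asm) split) (use r0 in auto)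
      qed
      also have "\<dots> = ennreal (?r n) + (ennreal (1 / 2) * (\<integral>\<^sup>+\<omega>. ennreal \<bar>?mean2 \<omega> - m2\<bar> \<partial>M) + ennreal A * (\<integral>\<^sup>+\<omega>. ennreal \<bar>?mean \<omega> - m\<bar> \<partial>M))"
        by (simp add: nn_integral_add nn_integral_cmult M.emeasure_space_1)
      also have "\<dots> \<le> ennreal (?r n) + (ennreal (1 / 2) * ennreal (2 * A\<^sup>2 / sqrt n) + ennreal A * ennreal (2 * A / sqrt n))"
        using sampling_mean_deviation[OF M X g bound n(1)] sampling_mean_deviation[OF M X g2 n(1)]
        unfolding m_def m2_def \<mu>_def by (intro add_left_mono add_mono mult_left_mono) auto
      also have "\<dots> = ennreal (?r n + ?s n)"
      proof -
        have "0 \<le> 2 * A\<^sup>2 / sqrt n" "0 \<le> 2 * A / sqrt n" using A by auto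
        from split[OF r0 this, of "1 / 2", symmetric] show ?thesis
          by (simp only:) (simp add: mult_ac)
      qed
      finally show ?case .
    qed
  qed simp
qed

text \<open>The drawn index is random but countably valued, so the value is glued from the
  measurable maps \<open>X i\<close>.\<close>

lemma resampled_value_measurable:
  assumes "\<And>i. X i \<in> borel_measurable M"
  shows "(\<lambda>p. X (snd p j) (fst p)) \<in> borel_measurable (M \<Otimes>\<^sub>M measure_pmf (p' :: (nat \<Rightarrow> nat) pmf))"
proof (rule measurable_compose_countable[where f="\<lambda>i p. X i (fst p)" and g="\<lambda>p. snd p j"])
  show "(\<lambda>p. X i (fst p)) \<in> borel_measurable (M \<Otimes>\<^sub>M measure_pmf p')" for i
    by (rule measurable_compose[OF measurable_fst assms])
  have "(\<lambda>J. J j) \<in> measurable (measure_pmf p') (count_space UNIV)" by simp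
  from measurable_compose[OF measurable_snd this]
  show "(\<lambda>p. snd p j) \<in> measurable (M \<Otimes>\<^sub>M measure_pmf p') (count_space UNIV)" .
qed

text \<open>The sample cdf viewed on the space that also carries the draws. The free constant
  \<open>C\<close> allows it to be paired with the resampled cdf, whose constant is larger than
  1.\<close>

lemma approximates_cdf_pullback:
  assumes M: "prob_space M" and X: "iid_cdf M X F" and C: "1 \<le> C" and R: "\<And>n. prob_space (R n)"
  shows "approximates_cdf F C (\<lambda>n. M \<Otimes>\<^sub>M R n) (\<lambda>n p. emp_cdf n (\<lambda>i. X i (fst p)))"
  unfolding iid_cdfD(3)[OF M X, of 0]
proof (rule approximates_cdfI[where Y="\<lambda>n p i. X i (fst p)"])
  have Xm [measurable]: "X i \<in> borel_measurable M" for i by (rule iid_cdfD(4)[OF M X])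
  show "real_distribution (distr M borel (X 0))" by (rule iid_cdfD(1)[OF M X])
  show "(\<lambda>(p, t). emp_cdf n (\<lambda>i. X i (fst p)) t) \<in> borel_measurable ((M \<Otimes>\<^sub>M R n) \<Otimes>\<^sub>M borel)" for n
    by (rule emp_cdf_joint_measurable[where X="\<lambda>i p. X i (fst p)"]) measurable
  fix n :: nat and g :: "real \<Rightarrow> real"
  assume n: "n > 0" and g [measurable]: "g \<in> borel_measurable borel" and g1: "\<And>s. \<bar>g s\<bar> \<le> 1"
  interpret R: prob_space "R n" by (rule R)
  let ?m = "\<integral>s. g s \<partial>distr M borel (X 0)"
  have [measurable]: "(\<lambda>\<omega>. sample_mean n (\<lambda>i. g (X i \<omega>))) \<in> borel_measurable M"
    unfolding sample_mean_def by measurable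
  have "(\<integral>\<^sup>+p. ennreal ((sqrt n * (sample_mean n (\<lambda>i. g (X i (fst p))) - ?m))\<^sup>2) \<partial>(M \<Otimes>\<^sub>M R n))
      = (\<integral>\<^sup>+\<omega>. \<integral>\<^sup>+_. ennreal ((sqrt n * (sample_mean n (\<lambda>i. g (X i \<omega>)) - ?m))\<^sup>2) \<partial>R n \<partial>M)"
    by (subst R.nn_integral_fst[symmetric]) simp_all
  also have "\<dots> = ennreal (\<integral>s. (g s - ?m)\<^sup>2 \<partial>distr M borel (X 0))"
    using sampling_second_moment[OF M X n g g1] by (simp add: R.emeasure_space_1)
  also have "\<dots> \<le> ennreal (C * (\<integral>s. (g s - ?m)\<^sup>2 \<partial>distr M borel (X 0)))"
    using C by (intro ennreal_leI mult_le_cancel_right1[THEN iffD2]) (simp add: not_less Bochner_Integration.integral_nonneg leD)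
  finally show "(\<integral>\<^sup>+p. ennreal ((sqrt n * (sample_mean n (\<lambda>i. g (X i (fst p))) - ?m))\<^sup>2) \<partial>(M \<Otimes>\<^sub>M R n))
      \<le> ennreal (C * (\<integral>s. (g s - ?m)\<^sup>2 \<partial>distr M borel (X 0)))" .
qed (use C in auto)

text \<open>The deviation from \<open>F\<close> splits into resampling and sampling error. Each has
  second moment at most the variance of \<open>g\<close>, and squaring a sum costs a factor 2 on
  each term, hence 4.\<close>

lemma approximates_cdf_boot:
  assumes M: "prob_space M" and X: "iid_cdf M X F"
  shows "approximates_cdf F 4 (\<lambda>n. M \<Otimes>\<^sub>M measure_pmf (resampling n)) (\<lambda>n p. emp_cdf n (\<lambda>j. X (snd p j) (fst p)))"
  unfolding iid_cdfD(3)[OF M X, of 0]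
proof (rule approximates_cdfI[where Y="\<lambda>n p j. X (snd p j) (fst p)"])
  have Xm [measurable]: "X i \<in> borel_measurable M" for i by (rule iid_cdfD(4)[OF M X])
  show "real_distribution (distr M borel (X 0))" by (rule iid_cdfD(1)[OF M X])
  show "(\<lambda>(p, t). emp_cdf n (\<lambda>j. X (snd p j) (fst p)) t) \<in> borel_measurable ((M \<Otimes>\<^sub>M measure_pmf (resampling n)) \<Otimes>\<^sub>M borel)" for n
    by (rule emp_cdf_joint_measurable[where X="\<lambda>j p. X (snd p j) (fst p)"]) (rule resampled_value_measurable[OF Xm])
  fix n :: nat and g :: "real \<Rightarrow> real"
  assume n: "n > 0" and g [measurable]: "g \<in> borel_measurable borel" and g1: "\<And>s. \<bar>g s\<bar> \<le> 1"
  let ?R = "measure_pmf (resampling n)"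
  let ?m = "\<integral>s. g s \<partial>distr M borel (X 0)" and ?v = "\<integral>s. (g s - (\<integral>s. g s \<partial>distr M borel (X 0)))\<^sup>2 \<partial>distr M borel (X 0)"
  let ?A = "\<lambda>\<omega> J. sqrt n * (sample_mean n (\<lambda>j. g (X (J j) \<omega>)) - sample_mean n (\<lambda>i. g (X i \<omega>)))"
  let ?B = "\<lambda>\<omega>. sqrt n * (sample_mean n (\<lambda>i. g (X i \<omega>)) - ?m)"
  note [measurable] = resampled_value_measurable[where p'="resampling n", OF Xm]
  have mA [measurable]: "(\<lambda>p. sample_mean n (\<lambda>j. g (X (snd p j) (fst p)))) \<in> borel_measurable (M \<Otimes>\<^sub>M ?R)"
    unfolding sample_mean_def by measurable
  have mB [measurable]: "(\<lambda>\<omega>. sample_mean n (\<lambda>i. g (X i \<omega>))) \<in> borel_measurable M"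
    unfolding sample_mean_def by measurable
  have v0: "0 \<le> ?v" by (rule Bochner_Integration.integral_nonneg) simp
  have "(\<integral>\<^sup>+p. ennreal ((sqrt n * (sample_mean n (\<lambda>j. g (X (snd p j) (fst p))) - ?m))\<^sup>2) \<partial>(M \<Otimes>\<^sub>M ?R))
      = (\<integral>\<^sup>+\<omega>. \<integral>\<^sup>+J. ennreal ((sqrt n * (sample_mean n (\<lambda>j. g (X (J j) \<omega>)) - ?m))\<^sup>2) \<partial>?R \<partial>M)"
    by (subst measure_pmf.nn_integral_fst[symmetric]) simp_all
  also have "\<dots> \<le> (\<integral>\<^sup>+\<omega>. \<integral>\<^sup>+J. 2 * ennreal ((?A \<omega> J)\<^sup>2) + 2 * ennreal ((?B \<omega>)\<^sup>2) \<partial>?R \<partial>M)"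
  proof (intro nn_integral_mono)
    fix \<omega> J
    have "sqrt n * (sample_mean n (\<lambda>j. g (X (J j) \<omega>)) - ?m) = ?A \<omega> J + ?B \<omega>" by (simp add: algebra_simps)
    moreover have "(s + t)\<^sup>2 \<le> 2 * s\<^sup>2 + 2 * t\<^sup>2" for s t :: real
      using sum_squares_ge_zero[of "s - t" 0] by (simp add: power2_eq_square algebra_simps)
    ultimately have "(sqrt n * (sample_mean n (\<lambda>j. g (X (J j) \<omega>)) - ?m))\<^sup>2 \<le> 2 * (?A \<omega> J)\<^sup>2 + 2 * (?B \<omega>)\<^sup>2" by metis
    from ennreal_leI[OF this]
    show "ennreal ((sqrt n * (sample_mean n (\<lambda>j. g (X (J j) \<omega>)) - ?m))\<^sup>2) \<le> 2 * ennreal ((?A \<omega> J)\<^sup>2) + 2 * ennreal ((?B \<omega>)\<^sup>2)"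
      by (simp add: ennreal_mult)
  qed
  also have "\<dots> = (\<integral>\<^sup>+\<omega>. 2 * ennreal (sample_var n (\<lambda>i. g (X i \<omega>))) + 2 * ennreal ((?B \<omega>)\<^sup>2) \<partial>M)"
  proof (rule nn_integral_cong)
    fix \<omega>
    show "(\<integral>\<^sup>+J. 2 * ennreal ((?A \<omega> J)\<^sup>2) + 2 * ennreal ((?B \<omega>)\<^sup>2) \<partial>?R)
        = 2 * ennreal (sample_var n (\<lambda>i. g (X i \<omega>))) + 2 * ennreal ((?B \<omega>)\<^sup>2)"
      using resampling_moments(1)[where g=g and A=1, OF n g1, where x="\<lambda>i. X i \<omega>"]
      by (simp add: nn_integral_add nn_integral_cmult measure_pmf.emeasure_space_1[simplified])
  qed
  also have "\<dots> = 2 * (\<integral>\<^sup>+\<omega>. ennreal (sample_var n (\<lambda>i. g (X i \<omega>))) \<partial>M) + 2 * (\<integral>\<^sup>+\<omega>. ennreal ((?B \<omega>)\<^sup>2) \<partial>M)"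
  proof -
    have [measurable]: "(\<lambda>\<omega>. sample_var n (\<lambda>i. g (X i \<omega>))) \<in> borel_measurable M"
      unfolding sample_var_def by (subst sample_mean_def) measurable
    show ?thesis by (simp add: nn_integral_add nn_integral_cmult)
  qed
  also have "\<dots> \<le> 2 * ennreal ?v + 2 * ennreal ?v"
    using sampling_sample_var[OF M X g g1 n] sampling_second_moment[OF M X n g g1]
    by (intro add_mono mult_left_mono) auto
  also have "\<dots> = ennreal (4 * ?v)"
    using v0 by (simp add: ennreal_mult[symmetric] ennreal_plus[symmetric] ennreal_numeral[symmetric] del: ennreal_plus ennreal_numeral)
  finally show "(\<integral>\<^sup>+p. ennreal ((sqrt n * (sample_mean n (\<lambda>j. g (X (snd p j) (fst p))) - ?m))\<^sup>2) \<partial>(M \<Otimes>\<^sub>M ?R))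
      \<le> ennreal (4 * ?v)" .
qed auto

section \<open>Brownian bridges\<close>

locale bridge = prob_space N for N :: "'c measure" +
  fixes B :: "'c \<Rightarrow> real \<Rightarrow> real"
  assumes bridge: "brownian_bridge N B"
begin

lemma gaussian_combination: "finite J \<Longrightarrow> J \<subseteq> {0..1} \<Longrightarrow> gaussian_rv N (\<lambda>y. \<Sum>t\<in>J. c t * B y t)"
  using bridge by (simp add: brownian_bridge_def)

lemma mean: "t \<in> {0..1} \<Longrightarrow> (\<integral>y. B y t \<partial>N) = 0"
  using bridge by (simp add: brownian_bridge_def)

lemma covariance: "s \<in> {0..1} \<Longrightarrow> t \<in> {0..1} \<Longrightarrow> (\<integral>y. B y s * B y t \<partial>N) = min s t - s * t"
  using bridge by (simp add: brownian_bridge_def)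

lemma continuous_path: "y \<in> space N \<Longrightarrow> continuous_on {0..1} (B y)"
  using bridge by (simp add: brownian_bridge_def)

lemma endpoints: "y \<in> space N \<Longrightarrow> B y 0 = 0" "y \<in> space N \<Longrightarrow> B y 1 = 0"
  using bridge by (simp_all add: brownian_bridge_def)

lemma value_measurable: "t \<in> {0..1} \<Longrightarrow> (\<lambda>y. B y t) \<in> borel_measurable N"
  using gaussian_combination[of "{t}" "\<lambda>_. 1"] by (simp add: gaussian_rv_def)

text \<open>The integral of \<open>B y t * B y t\<close> is nonzero for interior \<open>t\<close>, so it cannot be a junk value.\<close>

lemma integrable_square: "t \<in> {0..1} \<Longrightarrow> integrable N (\<lambda>y. (B y t)\<^sup>2)"
proof (cases "t = 0 \<or> t = 1")
  case True
  have "integrable N (\<lambda>y. 0 :: real)" by simp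
  then show ?thesis by (rule Bochner_Integration.integrable_cong[THEN iffD1, rotated 2]) (use True endpoints in auto)
next
  case False
  assume t: "t \<in> {0..1}"
  have "(\<integral>y. (B y t)\<^sup>2 \<partial>N) = t * (1 - t)" using covariance[OF t t] by (simp add: power2_eq_square algebra_simps)
  moreover have "t * (1 - t) \<noteq> 0" using False t by auto
  ultimately show ?thesis using not_integrable_integral_eq by metis
qed

lemma integrable_product:
  assumes "s \<in> {0..1}" "t \<in> {0..1}" shows "integrable N (\<lambda>y. B y s * B y t)"
proof (rule Bochner_Integration.integrable_bound)
  show "integrable N (\<lambda>y. (B y s)\<^sup>2 + (B y t)\<^sup>2)" using assms by (intro Bochner_Integration.integrable_add integrable_square)
  show "(\<lambda>y. B y s * B y t) \<in> borel_measurable N" using assms by (intro borel_measurable_times value_measurable)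
  have "\<bar>a * b\<bar> \<le> \<bar>a\<^sup>2 + b\<^sup>2\<bar>" for a b :: real
  proof -
    have "0 \<le> (\<bar>a\<bar> - \<bar>b\<bar>)\<^sup>2" by simp
    then have "2 * (\<bar>a\<bar> * \<bar>b\<bar>) \<le> a\<^sup>2 + b\<^sup>2" by (simp add: power2_diff mult.assoc)
    moreover have "0 \<le> \<bar>a\<bar> * \<bar>b\<bar>" by simp
    ultimately have "\<bar>a\<bar> * \<bar>b\<bar> \<le> a\<^sup>2 + b\<^sup>2" by linarith
    then show ?thesis by (simp add: abs_mult)
  qed
  then show "AE y in N. norm (B y s * B y t) \<le> norm ((B y s)\<^sup>2 + (B y t)\<^sup>2)" by simp
qed

lemma integrable_value: "t \<in> {0..1} \<Longrightarrow> integrable N (\<lambda>y. B y t)"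
  by (rule square_integrable_imp_integrable[OF value_measurable integrable_square])

lemma second_moment:
  assumes t: "t \<in> {0..1}" shows "(\<integral>\<^sup>+y. ennreal ((B y t)\<^sup>2) \<partial>N) = ennreal (t * (1 - t))"
  using nn_integral_eq_integral[OF integrable_square[OF t]] covariance[OF t t]
  by (simp add: power2_eq_square algebra_simps)

lemma increment_moment:
  assumes s: "s \<in> {0..1}" and t: "t \<in> {0..1}"
  shows "(\<integral>\<^sup>+y. ennreal ((B y s - B y t)\<^sup>2) \<partial>N) \<le> ennreal \<bar>s - t\<bar>"
proof -
  have eq: "(B y s - B y t)\<^sup>2 = B y s * B y s - 2 * (B y s * B y t) + B y t * B y t" for y
    by (simp add: power2_eq_square algebra_simps)
  have "integrable N (\<lambda>y. (B y s - B y t)\<^sup>2)"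
    unfolding eq using s t by (intro Bochner_Integration.integrable_add Bochner_Integration.integrable_diff integrable_mult_right integrable_product)
  then have "(\<integral>\<^sup>+y. ennreal ((B y s - B y t)\<^sup>2) \<partial>N) = ennreal (\<integral>y. (B y s - B y t)\<^sup>2 \<partial>N)"
    by (intro nn_integral_eq_integral) auto
  also have "(\<integral>y. (B y s - B y t)\<^sup>2 \<partial>N) = (s - s * s) - 2 * (min s t - s * t) + (t - t * t)"
    unfolding eq using s t integrable_product covariance by simp
  also have "\<dots> = \<bar>s - t\<bar> - (s - t)\<^sup>2" by (simp add: min_def abs_if power2_eq_square algebra_simps)
  also have "ennreal (\<bar>s - t\<bar> - (s - t)\<^sup>2) \<le> ennreal \<bar>s - t\<bar>" by (intro ennreal_leI) simp
  finally show ?thesis .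
qed

lemma left_continuous_path:
  assumes y: "y \<in> space N" and u: "u \<in> {0<..<1}"
  shows "(B y \<longlongrightarrow> B y u) (at_left u)"
proof -
  have "continuous_on {0<..<1} (B y)" using continuous_path[OF y] by (rule continuous_on_subset) auto
  then have "isCont (B y) u" using u by (simp add: continuous_on_eq_continuous_at)
  then show ?thesis by (auto simp: isCont_def filterlim_at_split)
qed

lemma bounded_path: "y \<in> space N \<Longrightarrow> \<exists>C. \<forall>u\<in>{0<..<1}. \<bar>B y u\<bar> \<le> C"
  using compact_imp_bounded[OF compact_continuous_image[OF continuous_path compact_Icc]]
  by (fastforce simp: bounded_iff)

text \<open>Nothing is known of the paths outside the closed interval, and step approximations
  vanish off the inner cells; the indicator makes the two agree in the limit. At the endpoints it
  loses nothing, since the bridge is zero there.\<close>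

lemma joint_measurable: "(\<lambda>(y, t). indicator {0<..<1} t * B y t) \<in> borel_measurable (N \<Otimes>\<^sub>M borel)"
proof (rule borel_measurable_LIMSEQ_metric)
  fix k
  have [measurable]: "(\<lambda>y. B y (knot k j)) \<in> borel_measurable N" if "j < k - 1" for j
  proof -
    have "j < k" using that by linarith
    then show ?thesis using knot_pos[of k j] knot_less_1[of j k] by (intro value_measurable) simp
  qed
  show "(\<lambda>(y, u). discretize k (B y) u) \<in> borel_measurable (N \<Otimes>\<^sub>M borel)"
    unfolding discretize_eq_sum case_prod_beta
    by (intro borel_measurable_sum borel_measurable_times) measurable
next
  fix p assume "p \<in> space (N \<Otimes>\<^sub>M (borel :: real measure))"
  then obtain y u where p: "p = (y, u)" "y \<in> space N" by (auto simp: space_pair_measure)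
  show "(\<lambda>k. case p of (y, u) \<Rightarrow> discretize k (B y) u) \<longlonglongrightarrow> (case p of (y, t) \<Rightarrow> indicator {0<..<1} t * B y t)"
  proof (cases "u \<in> {0<..<1}")
    case True
    then show ?thesis using discretize_tendsto[OF True left_continuous_path[OF p(2) True]] by (simp add: p)
  next
    case False
    then have "discretize k (B y) u = 0" for k using inner_cells_subset[of k] by (auto simp: discretize_def)
    then show ?thesis using False by (simp add: p)
  qed
qed

text \<open>The covariance of the bridge at the points \<open>F (x j)\<close> is that of the
  indicators of \<open>{..x j}\<close> under \<open>\<mu>\<close>. So the Gaussian combination has
  the variance of \<open>g\<close>, the same quantity that appears in the limit theorem for sample
  means.\<close>

lemma expectation_cos:
  fixes c x :: "nat \<Rightarrow> real" and m :: nat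
  assumes \<mu>: "real_distribution \<mu>"
  defines "g \<equiv> \<lambda>s. \<Sum>j<m. c j * indicator {..x j} s"
  shows "(\<integral>y. cos ((\<Sum>j<m. c j * B y (cdf \<mu> (x j))) + \<theta>) \<partial>N)
    = exp (- (\<integral>s. (g s - (\<integral>s. g s \<partial>\<mu>))\<^sup>2 \<partial>\<mu>) / 2) * cos \<theta>"
proof -
  interpret \<mu>: real_distribution \<mu> by (rule \<mu>)
  let ?F = "cdf \<mu>"
  have F: "?F s \<in> {0..1}" for s by (auto simp: \<mu>.cdf_nonneg \<mu>.cdf_bounded_prob)
  define Z where "Z y = (\<Sum>j<m. c j * B y (?F (x j)))" for y
  \<comment> \<open>The Gaussian property is stated for sets of times, while several
    \<open>x j\<close> may have the same value of \<open>F\<close>; their coefficients are added up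
    first.\<close>
  have "gaussian_rv N (\<lambda>y. \<Sum>t\<in>(\<lambda>j. ?F (x j)) ` {..<m}. (\<Sum>j\<in>{j\<in>{..<m}. ?F (x j) = t}. c j) * B y t)"
    using F by (intro gaussian_combination) auto
  also have "(\<lambda>y. \<Sum>t\<in>(\<lambda>j. ?F (x j)) ` {..<m}. (\<Sum>j\<in>{j\<in>{..<m}. ?F (x j) = t}. c j) * B y t) = Z"
  proof
    fix y
    have "Z y = (\<Sum>t\<in>(\<lambda>j. ?F (x j)) ` {..<m}. \<Sum>j\<in>{j\<in>{..<m}. ?F (x j) = t}. c j * B y (?F (x j)))"
      unfolding Z_def by (rule sum.image_gen) simp
    also have "\<dots> = (\<Sum>t\<in>(\<lambda>j. ?F (x j)) ` {..<m}. (\<Sum>j\<in>{j\<in>{..<m}. ?F (x j) = t}. c j) * B y t)"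
      by (intro sum.cong refl) (simp add: sum_distrib_right)
    finally show "(\<Sum>t\<in>(\<lambda>j. ?F (x j)) ` {..<m}. (\<Sum>j\<in>{j\<in>{..<m}. ?F (x j) = t}. c j) * B y t) = Z y" ..
  qed
  finally have Z: "gaussian_rv N Z" .
  then have Zm: "Z \<in> borel_measurable N" by (simp add: gaussian_rv_def)
  have Z0: "(\<integral>y. Z y \<partial>N) = 0"
    unfolding Z_def using F integrable_value mean by (subst Bochner_Integration.integral_sum) auto
  have "(Z y)\<^sup>2 = (\<Sum>i<m. \<Sum>j<m. (c i * c j) * (B y (?F (x i)) * B y (?F (x j))))" for y
    by (simp add: Z_def power2_eq_square sum_product mult_ac)
  then have ZV: "(\<integral>y. (Z y)\<^sup>2 \<partial>N) = (\<Sum>i<m. \<Sum>j<m. (c i * c j) * (min (?F (x i)) (?F (x j)) - ?F (x i) * ?F (x j)))"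
    using F integrable_product covariance by (simp add: Bochner_Integration.integral_sum)
  have ind: "(\<integral>s. indicator {..t} s \<partial>\<mu>) = ?F t" and iind: "integrable \<mu> (indicator {..t} :: real \<Rightarrow> real)" for t
    by (simp_all add: cdf_def \<mu>.emeasure_eq_measure)
  have ig: "integrable \<mu> g" unfolding g_def using iind by (intro Bochner_Integration.integrable_sum integrable_mult_right)
  have mg: "(\<integral>s. g s \<partial>\<mu>) = (\<Sum>j<m. c j * ?F (x j))"
    unfolding g_def using iind
    by (simp only: Bochner_Integration.integral_sum integrable_mult_right integral_mult_right_zero ind)
  have g2: "(g s)\<^sup>2 = (\<Sum>i<m. \<Sum>j<m. (c i * c j) * indicator {..min (x i) (x j)} s)" for s
    unfolding g_def power2_eq_square sum_product by (intro sum.cong refl) (auto simp: indicator_def)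
  have ig2: "integrable \<mu> (\<lambda>s. (g s)\<^sup>2)" unfolding g2 using iind by (intro Bochner_Integration.integrable_sum integrable_mult_right)
  have Fmin: "?F (min s t) = min (?F s) (?F t)" for s t
    using \<mu>.cdf_nondecreasing[of s t] \<mu>.cdf_nondecreasing[of t s] by (auto simp: min_def)
  have "(\<integral>s. (g s)\<^sup>2 \<partial>\<mu>) = (\<Sum>i<m. \<Sum>j<m. (c i * c j) * min (?F (x i)) (?F (x j)))"
    unfolding g2 using iind
    by (simp only: Bochner_Integration.integral_sum Bochner_Integration.integrable_sum integrable_mult_right integral_mult_right_zero ind Fmin)
  moreover have "(\<integral>s. g s \<partial>\<mu>)\<^sup>2 = (\<Sum>i<m. \<Sum>j<m. (c i * c j) * (?F (x i) * ?F (x j)))"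
    unfolding mg power2_eq_square sum_product by (intro sum.cong refl) (simp add: mult_ac)
  ultimately have v: "(\<integral>s. (g s - (\<integral>s. g s \<partial>\<mu>))\<^sup>2 \<partial>\<mu>) = (\<integral>y. (Z y)\<^sup>2 \<partial>N)"
    unfolding \<mu>.variance_eq[OF ig ig2] ZV by (simp add: sum_subtractf right_diff_distrib)
  have "(\<integral>y. cos (Z y + \<theta>) \<partial>N) = Re (iexp \<theta> * of_real (exp (- (\<integral>y. (Z y)\<^sup>2 \<partial>N) / 2)))"
    unfolding expectation_cos_shift[OF prob_space_axioms Zm] gaussian_iexp[OF prob_space_axioms Z Z0 refl] ..
  also have "\<dots> = exp (- (\<integral>y. (Z y)\<^sup>2 \<partial>N) / 2) * cos \<theta>" by (simp add: Re_exp)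
  finally show ?thesis unfolding v Z_def .
qed

end


section \<open>Convergence of finite-dimensional projections\<close>

lemma ennreal_squeeze:
  fixes f g :: "nat \<Rightarrow> ennreal"
  assumes "\<And>n. f n \<le> g n" "g \<longlonglongrightarrow> 0" shows "f \<longlonglongrightarrow> 0"
  using assms by (intro tendsto_sandwich[of "\<lambda>_. 0" f sequentially g 0] always_eventually allI) auto

lemma trig_span_bounded: "g \<in> trig_span m \<Longrightarrow> \<exists>b. \<forall>x. \<bar>g x\<bar> \<le> b"
proof (induction rule: trig_span.induct)
  case (cos c \<theta>)
  then show ?case by (intro exI[of _ 1]) simp
next
  case (add f g)
  then obtain a b where "\<And>x. \<bar>f x\<bar> \<le> a" "\<And>x. \<bar>g x\<bar> \<le> b" by blast
  then have "\<bar>f x + g x\<bar> \<le> a + b" for x by (meson abs_triangle_ineq add_mono order_trans)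
  then show ?case by blast
next
  case (scale f r)
  then obtain a where "\<And>x. \<bar>f x\<bar> \<le> a" by blast
  then have "\<bar>r * f x\<bar> \<le> \<bar>r\<bar> * a" for x by (simp add: abs_mult mult_left_mono)
  then show ?case by blast
qed

lemma trig_span_measurable:
  assumes "g \<in> trig_span m" and V: "\<And>j. j < m \<Longrightarrow> (\<lambda>\<omega>. V \<omega> j) \<in> borel_measurable M"
  shows "(\<lambda>\<omega>. g (V \<omega>)) \<in> borel_measurable M"
  using assms(1)
proof (induction rule: trig_span.induct)
  case (cos c \<theta>)
  have "(\<lambda>\<omega>. \<Sum>j<m. c j * V \<omega> j) \<in> borel_measurable M"
    using V by (intro borel_measurable_sum borel_measurable_times borel_measurable_const) auto
  then show ?case by measurable
qed auto

lemma (in prob_space) trig_span_integrable: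
  assumes "g \<in> trig_span m" and V: "\<And>j. j < m \<Longrightarrow> (\<lambda>\<omega>. V \<omega> j) \<in> borel_measurable M"
  shows "integrable M (\<lambda>\<omega>. g (V \<omega>))"
proof -
  obtain b where "\<And>x. \<bar>g x\<bar> \<le> b" using trig_span_bounded[OF assms(1)] by blast
  then show ?thesis using trig_span_measurable[OF assms] by (intro integrable_bounded_rv) auto
qed

text \<open>Cosines are supplied by the limit theorem; sums and multiples follow by linearity.
  Convergence is in mean over \<open>A\<close>, the space of the data.\<close>

lemma trig_span_expectation_tendsto:
  fixes A :: "'o measure" and R :: "nat \<Rightarrow> 'r measure" and N :: "'c measure"
    and V :: "nat \<Rightarrow> 'o \<Rightarrow> 'r \<Rightarrow> nat \<Rightarrow> real" and V' :: "'c \<Rightarrow> nat \<Rightarrow> real"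
  assumes R: "\<And>n. prob_space (R n)" and N: "prob_space N"
    and V: "\<And>n j. j < m \<Longrightarrow> (\<lambda>p. V n (fst p) (snd p) j) \<in> borel_measurable (A \<Otimes>\<^sub>M R n)"
    and V': "\<And>j. j < m \<Longrightarrow> (\<lambda>y. V' y j) \<in> borel_measurable N"
    and cos: "\<And>c \<theta>. (\<lambda>n. \<integral>\<^sup>+\<omega>. ennreal \<bar>(\<integral>\<omega>'. cos ((\<Sum>j<m. c j * V n \<omega> \<omega>' j) + \<theta>) \<partial>R n)
      - (\<integral>y. cos ((\<Sum>j<m. c j * V' y j) + \<theta>) \<partial>N)\<bar> \<partial>A) \<longlonglongrightarrow> 0"
    and g: "g \<in> trig_span m"
  shows "(\<lambda>n. \<integral>\<^sup>+\<omega>. ennreal \<bar>(\<integral>\<omega>'. g (V n \<omega> \<omega>') \<partial>R n) - (\<integral>y. g (V' y) \<partial>N)\<bar> \<partial>A) \<longlonglongrightarrow> 0"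
    and "(\<lambda>\<omega>. \<integral>\<omega>'. g (V n \<omega> \<omega>') \<partial>R n) \<in> borel_measurable A"
proof -
  interpret N: prob_space N by (rule N)
  have meas: "(\<lambda>\<omega>. \<integral>\<omega>'. g (V n \<omega> \<omega>') \<partial>R n) \<in> borel_measurable A" if "g \<in> trig_span m" for g n
  proof -
    interpret R: prob_space "R n" by (rule R)
    have "(\<lambda>p. g (V n (fst p) (snd p))) \<in> borel_measurable (A \<Otimes>\<^sub>M R n)"
      by (rule trig_span_measurable[OF that V])
    then have "(\<lambda>(\<omega>, \<omega>'). g (V n \<omega> \<omega>')) \<in> borel_measurable (A \<Otimes>\<^sub>M R n)" by (simp add: case_prod_beta')
    then show ?thesis by (rule R.borel_measurable_lebesgue_integral)
  qed
  then show "(\<lambda>\<omega>. \<integral>\<omega>'. g (V n \<omega> \<omega>') \<partial>R n) \<in> borel_measurable A" using g .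
  have sec: "(\<lambda>\<omega>'. V n \<omega> \<omega>' j) \<in> borel_measurable (R n)" if "\<omega> \<in> space A" "j < m" for n \<omega> j
    using measurable_Pair2[OF V[OF that(2), of n] that(1)] by simp
  have iR: "integrable (R n) (\<lambda>\<omega>'. h (V n \<omega> \<omega>'))" if "h \<in> trig_span m" "\<omega> \<in> space A" for h n \<omega>
    by (rule prob_space.trig_span_integrable[OF R that(1) sec[OF that(2)]])
  note iN = N.trig_span_integrable[OF _ V']
  show "(\<lambda>n. \<integral>\<^sup>+\<omega>. ennreal \<bar>(\<integral>\<omega>'. g (V n \<omega> \<omega>') \<partial>R n) - (\<integral>y. g (V' y) \<partial>N)\<bar> \<partial>A) \<longlonglongrightarrow> 0"
    using g
  proof (induction rule: trig_span.induct)
    case (add f g)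
    let ?D = "\<lambda>g n \<omega>. (\<integral>\<omega>'. g (V n \<omega> \<omega>') \<partial>R n) - (\<integral>y. g (V' y) \<partial>N)"
    have "(\<integral>\<^sup>+\<omega>. ennreal \<bar>?D (\<lambda>x. f x + g x) n \<omega>\<bar> \<partial>A)
        \<le> (\<integral>\<^sup>+\<omega>. ennreal \<bar>?D f n \<omega>\<bar> \<partial>A) + (\<integral>\<^sup>+\<omega>. ennreal \<bar>?D g n \<omega>\<bar> \<partial>A)" for n
    proof -
      have [measurable]: "(\<lambda>\<omega>. \<integral>\<omega>'. f (V n \<omega> \<omega>') \<partial>R n) \<in> borel_measurable A" "(\<lambda>\<omega>. \<integral>\<omega>'. g (V n \<omega> \<omega>') \<partial>R n) \<in> borel_measurable A"
        using meas add.hyps by auto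
      have "(\<integral>\<^sup>+\<omega>. ennreal \<bar>?D (\<lambda>x. f x + g x) n \<omega>\<bar> \<partial>A) \<le> (\<integral>\<^sup>+\<omega>. ennreal \<bar>?D f n \<omega>\<bar> + ennreal \<bar>?D g n \<omega>\<bar> \<partial>A)"
      proof (rule nn_integral_mono)
        fix \<omega> assume \<omega>: "\<omega> \<in> space A"
        have "?D (\<lambda>x. f x + g x) n \<omega> = ?D f n \<omega> + ?D g n \<omega>"
          using iR[OF add.hyps(1) \<omega>, of n] iR[OF add.hyps(2) \<omega>, of n] iN[OF add.hyps(1)] iN[OF add.hyps(2)] by simp
        then have "\<bar>?D (\<lambda>x. f x + g x) n \<omega>\<bar> \<le> \<bar>?D f n \<omega>\<bar> + \<bar>?D g n \<omega>\<bar>" by linarith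
        then show "ennreal \<bar>?D (\<lambda>x. f x + g x) n \<omega>\<bar> \<le> ennreal \<bar>?D f n \<omega>\<bar> + ennreal \<bar>?D g n \<omega>\<bar>"
          by (simp add: ennreal_plus[symmetric] ennreal_leI del: ennreal_plus)
      qed
      also have "\<dots> = (\<integral>\<^sup>+\<omega>. ennreal \<bar>?D f n \<omega>\<bar> \<partial>A) + (\<integral>\<^sup>+\<omega>. ennreal \<bar>?D g n \<omega>\<bar> \<partial>A)"
        by (rule nn_integral_add) measurable
      finally show ?thesis .
    qed
    from ennreal_squeeze[OF this tendsto_add[OF add.IH, unfolded add_0]] show ?case .
  next
    case (scale f r)
    have "(\<integral>\<^sup>+\<omega>. ennreal \<bar>(\<integral>\<omega>'. r * f (V n \<omega> \<omega>') \<partial>R n) - (\<integral>y. r * f (V' y) \<partial>N)\<bar> \<partial>A)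
        = ennreal \<bar>r\<bar> * (\<integral>\<^sup>+\<omega>. ennreal \<bar>(\<integral>\<omega>'. f (V n \<omega> \<omega>') \<partial>R n) - (\<integral>y. f (V' y) \<partial>N)\<bar> \<partial>A)" for n
    proof -
      have [measurable]: "(\<lambda>\<omega>. \<integral>\<omega>'. f (V n \<omega> \<omega>') \<partial>R n) \<in> borel_measurable A" using meas scale.hyps by auto
      show ?thesis
        by (subst nn_integral_cmult[symmetric])
          (auto intro!: nn_integral_cong simp: ennreal_mult[symmetric] abs_mult[symmetric] right_diff_distrib)
    qed
    then show ?case using ennreal_tendsto_cmult[OF _ scale.IH, of "ennreal \<bar>r\<bar>"] by simp
  qed (rule cos)
qed

text \<open>Errors that grow quadratically are paid for by second moments of the coordinates. These
  stay extended integrals because, conditionally on the data, only their mean will be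
  bounded.\<close>

lemma (in prob_space) expectation_approx:
  fixes f :: "(nat \<Rightarrow> real) \<Rightarrow> real" and V :: "'a \<Rightarrow> nat \<Rightarrow> real"
  assumes f: "(\<lambda>\<omega>. f (V \<omega>)) \<in> borel_measurable M" "\<And>x. \<bar>f x\<bar> \<le> 1"
    and h: "integrable M (\<lambda>\<omega>. h (V \<omega>))"
    and V: "\<And>j. j < m \<Longrightarrow> (\<lambda>\<omega>. V \<omega> j) \<in> borel_measurable M" and \<epsilon>: "0 \<le> \<epsilon>"
    and approx: "\<And>x. \<bar>f x - h x\<bar> \<le> \<epsilon> * (1 + (\<Sum>j<m. (x j)\<^sup>2))"
  shows "ennreal \<bar>expectation (\<lambda>\<omega>. f (V \<omega>)) - expectation (\<lambda>\<omega>. h (V \<omega>))\<bar>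
    \<le> ennreal \<epsilon> * (1 + (\<Sum>j<m. \<integral>\<^sup>+\<omega>. ennreal ((V \<omega> j)\<^sup>2) \<partial>M))"
proof -
  have fi: "integrable M (\<lambda>\<omega>. f (V \<omega>))" using f by (intro integrable_bounded_rv) auto
  have "\<bar>expectation (\<lambda>\<omega>. f (V \<omega>)) - expectation (\<lambda>\<omega>. h (V \<omega>))\<bar> = \<bar>expectation (\<lambda>\<omega>. f (V \<omega>) - h (V \<omega>))\<bar>"
    using fi h by simp
  also have "\<dots> \<le> expectation (\<lambda>\<omega>. \<bar>f (V \<omega>) - h (V \<omega>)\<bar>)" by (rule integral_abs_bound)
  finally have "ennreal \<bar>expectation (\<lambda>\<omega>. f (V \<omega>)) - expectation (\<lambda>\<omega>. h (V \<omega>))\<bar> \<le> (\<integral>\<^sup>+\<omega>. ennreal \<bar>f (V \<omega>) - h (V \<omega>)\<bar> \<partial>M)"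
    using fi h by (subst nn_integral_eq_integral) (auto intro: ennreal_leI)
  also have "\<dots> \<le> (\<integral>\<^sup>+\<omega>. ennreal \<epsilon> * (1 + (\<Sum>j<m. ennreal ((V \<omega> j)\<^sup>2))) \<partial>M)"
  proof (rule nn_integral_mono)
    fix \<omega>
    have "ennreal \<epsilon> * (1 + (\<Sum>j<m. ennreal ((V \<omega> j)\<^sup>2))) = ennreal (\<epsilon> * (1 + (\<Sum>j<m. (V \<omega> j)\<^sup>2)))"
      using \<epsilon> by (simp add: ennreal_mult ennreal_plus sum_nonneg sum_ennreal)
    then show "ennreal \<bar>f (V \<omega>) - h (V \<omega>)\<bar> \<le> ennreal \<epsilon> * (1 + (\<Sum>j<m. ennreal ((V \<omega> j)\<^sup>2)))"
      using approx[of "V \<omega>"] by (simp add: ennreal_leI)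
  qed
  also have "\<dots> = ennreal \<epsilon> * (\<integral>\<^sup>+\<omega>. (1 + (\<Sum>j<m. ennreal ((V \<omega> j)\<^sup>2))) \<partial>M)"
    using V by (intro nn_integral_cmult) auto
  also have "(\<integral>\<^sup>+\<omega>. (1 + (\<Sum>j<m. ennreal ((V \<omega> j)\<^sup>2))) \<partial>M) = 1 + (\<integral>\<^sup>+\<omega>. (\<Sum>j<m. ennreal ((V \<omega> j)\<^sup>2)) \<partial>M)"
    using V by (subst nn_integral_add) (auto simp: emeasure_space_1)
  also have "(\<integral>\<^sup>+\<omega>. (\<Sum>j<m. ennreal ((V \<omega> j)\<^sup>2)) \<partial>M) = (\<Sum>j<m. \<integral>\<^sup>+\<omega>. ennreal ((V \<omega> j)\<^sup>2) \<partial>M)"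
    using V by (intro nn_integral_sum) auto
  finally show ?thesis .
qed

text \<open>If the right side is finite, then \<open>f\<close> differs from an integrable function
  by an integrable one and is itself integrable; otherwise there is nothing to prove. So the default
  value of \<open>L1_of\<close> never interferes.\<close>

lemma dist_L1_of_le:
  assumes f: "f \<in> borel_measurable unit_borel" and g: "g \<in> borel_measurable unit_borel" "integrable unit_leb g"
  shows "ennreal (dist (L1_of f) (L1_of g)) \<le> (\<integral>\<^sup>+u. ennreal \<bar>f u - g u\<bar> \<partial>unit_borel)"
proof (cases "(\<integral>\<^sup>+u. ennreal \<bar>f u - g u\<bar> \<partial>unit_borel) < \<infinity>")
  case True
  have "integrable unit_leb (\<lambda>u. f u - g u)"
    using f g True by (intro integrable_unit_lebI borel_measurable_diff) auto
  then have "integrable unit_leb (\<lambda>u. (f u - g u) + g u)" using g(2) by (rule Bochner_Integration.integrable_add)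
  then have "integrable unit_leb f" by simp
  then show ?thesis using ennreal_dist_L1_of[OF _ g(2) f g(1)] by simp
next
  case False
  then show ?thesis by (simp add: not_less top.extremum_unique)
qed

lemma BL1_continuous: "\<psi> \<in> BL1 \<Longrightarrow> continuous_on UNIV \<psi>"
proof -
  assume "\<psi> \<in> BL1"
  then have "1-lipschitz_on UNIV \<psi>" by (auto simp: BL1_def dist_real_def intro!: lipschitz_onI)
  then show ?thesis by (rule lipschitz_on_continuous_on)
qed

lemma BL1_measurable: "\<psi> \<in> BL1 \<Longrightarrow> Z \<in> borel_measurable M \<Longrightarrow> (\<lambda>\<omega>. \<psi> (Z \<omega>)) \<in> borel_measurable M"
  using measurable_compose[OF _ borel_measurable_continuous_onI[OF BL1_continuous]] by blast

lemma BL1D: "\<psi> \<in> BL1 \<Longrightarrow> \<bar>\<psi> x\<bar> \<le> 1" "\<psi> \<in> BL1 \<Longrightarrow> \<bar>\<psi> x - \<psi> y\<bar> \<le> dist x y"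
  by (auto simp: BL1_def abs_le_iff minus_le_iff)

lemma (in prob_space) BL1_expectation_diff:
  assumes \<psi>: "\<psi> \<in> BL1" and Z: "Z \<in> borel_measurable M" "Y \<in> borel_measurable M"
    and h: "\<And>\<omega>. \<omega> \<in> space M \<Longrightarrow> ennreal (dist (Z \<omega>) (Y \<omega>)) \<le> h \<omega>"
  shows "ennreal \<bar>expectation (\<lambda>\<omega>. \<psi> (Z \<omega>)) - expectation (\<lambda>\<omega>. \<psi> (Y \<omega>))\<bar> \<le> (\<integral>\<^sup>+\<omega>. h \<omega> \<partial>M)"
proof -
  have i: "integrable M (\<lambda>\<omega>. \<psi> (Z \<omega>))" "integrable M (\<lambda>\<omega>. \<psi> (Y \<omega>))"
    using BL1D(1)[OF \<psi>] BL1_measurable[OF \<psi>] Z by (auto intro!: integrable_bounded_rv)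
  have "\<bar>expectation (\<lambda>\<omega>. \<psi> (Z \<omega>)) - expectation (\<lambda>\<omega>. \<psi> (Y \<omega>))\<bar> = \<bar>expectation (\<lambda>\<omega>. \<psi> (Z \<omega>) - \<psi> (Y \<omega>))\<bar>"
    using i by simp
  also have "\<dots> \<le> expectation (\<lambda>\<omega>. \<bar>\<psi> (Z \<omega>) - \<psi> (Y \<omega>)\<bar>)" by (rule integral_abs_bound)
  finally have "ennreal \<bar>expectation (\<lambda>\<omega>. \<psi> (Z \<omega>)) - expectation (\<lambda>\<omega>. \<psi> (Y \<omega>))\<bar> \<le> (\<integral>\<^sup>+\<omega>. ennreal \<bar>\<psi> (Z \<omega>) - \<psi> (Y \<omega>)\<bar> \<partial>M)"
    using i by (subst nn_integral_eq_integral) (auto intro: ennreal_leI)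
  also have "\<dots> \<le> (\<integral>\<^sup>+\<omega>. h \<omega> \<partial>M)"
    by (intro nn_integral_mono order.trans[OF ennreal_leI[OF BL1D(2)[OF \<psi>]] h])
  finally show ?thesis .
qed

context integrable_quantile
begin

definition density_cell :: "nat \<Rightarrow> nat \<Rightarrow> l1" where
  "density_cell k j = L1_of (\<lambda>u. q u * indicator (cell k j) u)"

text \<open>Bounds the root mean square of the discretization error up to \<open>sqrt C\<close>: on
  inner cells an increment over at most one mesh width, on the two outer cells the whole process,
  since the step path is zero there.\<close>

definition mesh_bound :: "nat \<Rightarrow> real \<Rightarrow> real" where
  "mesh_bound k u = (if u \<in> inner_cells k then 1 / sqrt (real (Suc k)) else sqrt (u * (1 - u)))"

definition mesh_error :: "nat \<Rightarrow> ennreal" where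
  "mesh_error k = (\<integral>\<^sup>+u. ennreal (q u * mesh_bound k u) \<partial>unit_borel)"

lemma inner_cells_measurable [measurable]: "inner_cells k \<in> sets borel"
  by (simp add: inner_cells_def)

lemma q_measurable_unit [measurable]: "q \<in> borel_measurable unit_borel"
  by (rule measurable_unit_borelI) simp

lemma mesh_bound_measurable: "mesh_bound k \<in> borel_measurable borel"
  unfolding mesh_bound_def[abs_def] by measurable

text \<open>Both distances to the endpoints are at least one mesh width; for the second bound, one
  of \<open>u\<close> and \<open>1 - u\<close> is at least one half.\<close>

lemma inner_cells_le:
  assumes "u \<in> inner_cells k"
  shows "1 / (real (Suc k))\<^sup>2 \<le> u * (1 - u)" "1 / real (Suc k) \<le> 2 * (u * (1 - u))"
proof -
  let ?r = "1 / real (Suc k)"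
  have r: "0 < ?r" "?r \<le> u" "?r \<le> 1 - u" using assms by (auto simp: inner_cells_def simp del: of_nat_Suc)
  then have "?r * ?r \<le> u * (1 - u)" by (intro mult_mono) linarith+
  then show "1 / (real (Suc k))\<^sup>2 \<le> u * (1 - u)" by (simp add: power2_eq_square)
  show "?r \<le> 2 * (u * (1 - u))"
  proof (cases "u \<le> 1 / 2")
    case True
    then have "u * (1 / 2) \<le> u * (1 - u)" using r by (intro mult_left_mono) linarith+
    then show ?thesis using r by linarith
  next
    case False
    then have "0 \<le> (2 * u - 1) * (1 - u)" using r by (intro mult_nonneg_nonneg) linarith+
    moreover have "(2 * u - 1) * (1 - u) = 2 * (u * (1 - u)) - (1 - u)" by (simp add: algebra_simps)
    ultimately show ?thesis using r by linarith
  qed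
qed

text \<open>Domination by the tail weight, uniform in \<open>k\<close>; it lets dominated
  convergence show that the mesh error vanishes.\<close>

lemma mesh_bound_le: "u \<in> {0<..<1} \<Longrightarrow> mesh_bound k u \<le> 2 * sqrt (u * (1 - u))"
proof (cases "u \<in> inner_cells k")
  case True
  have "1 / sqrt (real (Suc k)) = sqrt (1 / real (Suc k))" by (simp add: real_sqrt_divide)
  also have "\<dots> \<le> sqrt (2 * (u * (1 - u)))" by (rule real_sqrt_le_mono[OF inner_cells_le(2)[OF True]])
  also have "\<dots> = sqrt 2 * sqrt (u * (1 - u))" by (simp add: real_sqrt_mult)
  also have "\<dots> \<le> 2 * sqrt (u * (1 - u))"
    using inner_cells_le(1)[OF True] sqrt2_less_2 by (intro mult_right_mono) (auto intro: order_trans[rotated])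
  finally show ?thesis using True by (simp add: mesh_bound_def)
qed (simp add: mesh_bound_def)

lemma mesh_bound_nonneg: "u \<in> {0<..<1} \<Longrightarrow> 0 \<le> mesh_bound k u"
  by (simp add: mesh_bound_def)

lemma mesh_error_tendsto: "mesh_error \<longlonglongrightarrow> 0"
proof -
  have "(\<lambda>k. \<integral>\<^sup>+u. ennreal (q u * mesh_bound k u) \<partial>unit_borel) \<longlonglongrightarrow> (\<integral>\<^sup>+u. 0 \<partial>unit_borel)"
  proof (rule nn_integral_dominated_convergence)
    show "(\<lambda>u. ennreal (q u * mesh_bound k u)) \<in> borel_measurable unit_borel" for k
      using mesh_bound_measurable by (intro measurable_restrict_space1) simp
    show "(\<lambda>u. ennreal 2 * ennreal (q u * sqrt (u * (1 - u)))) \<in> borel_measurable unit_borel"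
      by (intro measurable_restrict_space1) simp
    show "AE u in unit_borel. ennreal (q u * mesh_bound k u) \<le> ennreal 2 * ennreal (q u * sqrt (u * (1 - u)))" for k
    proof (rule AE_I2)
      fix u assume "u \<in> space unit_borel"
      then have "q u * mesh_bound k u \<le> q u * (2 * sqrt (u * (1 - u)))"
        using q_nonneg mesh_bound_le by (intro mult_left_mono) auto
      from ennreal_leI[OF this] show "ennreal (q u * mesh_bound k u) \<le> ennreal 2 * ennreal (q u * sqrt (u * (1 - u)))"
        using q_nonneg by (simp add: ennreal_mult'[symmetric] mult_ac del: ennreal_numeral)
    qed
    have "(\<integral>\<^sup>+u. ennreal 2 * ennreal (q u * sqrt (u * (1 - u))) \<partial>unit_borel)
        = ennreal 2 * (\<integral>\<^sup>+u. ennreal (q u * sqrt (u * (1 - u))) \<partial>unit_borel)"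
      by (intro nn_integral_cmult measurable_restrict_space1) simp
    also have "\<dots> < \<infinity>" using tail_density by (simp add: ennreal_mult_less_top)
    finally show "(\<integral>\<^sup>+u. ennreal 2 * ennreal (q u * sqrt (u * (1 - u))) \<partial>unit_borel) < \<infinity>" .
    show "AE u in unit_borel. (\<lambda>k. ennreal (q u * mesh_bound k u)) \<longlonglongrightarrow> 0"
    proof (rule AE_I2)
      fix u assume "u \<in> space unit_borel"
      then have "\<forall>\<^sub>F k in sequentially. q u * (1 / sqrt (real (Suc k))) = q u * mesh_bound k u"
        using eventually_inner_cells[of u] by (auto elim: eventually_mono simp: mesh_bound_def)
      moreover have "(\<lambda>k. q u * (1 / sqrt (real (Suc k)))) \<longlonglongrightarrow> q u * 0"
        by (intro tendsto_mult tendsto_const LIMSEQ_Suc[OF tendsto_divide_sqrt])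
      ultimately have "(\<lambda>k. q u * mesh_bound k u) \<longlonglongrightarrow> 0" by (auto intro: Lim_transform_eventually)
      from tendsto_ennrealI[OF this] show "(\<lambda>k. ennreal (q u * mesh_bound k u)) \<longlonglongrightarrow> 0" by simp
    qed
  qed auto
  then show ?thesis by (simp add: mesh_error_def[abs_def])
qed

text \<open>On an inner cell \<open>sqrt (u * (1 - u))\<close> is at least one mesh width, so the
  tail condition bounds the integral of \<open>q\<close> there.\<close>

lemma integrable_density_cell: "j < k - 1 \<Longrightarrow> integrable unit_leb (\<lambda>u. q u * indicator (cell k j) u)"
proof (rule integrable_unit_lebI)
  assume j: "j < k - 1"
  show "(\<lambda>u. q u * indicator (cell k j) u) \<in> borel_measurable unit_borel"
    by (rule measurable_unit_borelI) measurable
  have "(\<integral>\<^sup>+u. ennreal \<bar>q u * indicator (cell k j) u\<bar> \<partial>unit_borel)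
      \<le> (\<integral>\<^sup>+u. ennreal (real (Suc k)) * ennreal (q u * sqrt (u * (1 - u))) \<partial>unit_borel)"
  proof (rule nn_integral_mono)
    fix u assume "u \<in> space unit_borel"
    have "\<bar>q u * indicator (cell k j) u\<bar> \<le> real (Suc k) * (q u * sqrt (u * (1 - u)))"
    proof (cases "u \<in> cell k j")
      case True
      then have "u \<in> inner_cells k" using cell_subset[OF j] by auto
      from real_sqrt_le_mono[OF inner_cells_le(1)[OF this]]
      have "1 / real (Suc k) \<le> sqrt (u * (1 - u))" by (simp add: real_sqrt_divide del: of_nat_Suc)
      then have "1 \<le> real (Suc k) * sqrt (u * (1 - u))" by (simp add: pos_divide_le_eq mult.commute del: of_nat_Suc)
      then have "q u * 1 \<le> q u * (real (Suc k) * sqrt (u * (1 - u)))" using q_nonneg by (intro mult_left_mono)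
      then show ?thesis using True q_nonneg by (simp add: mult_ac)
    qed (use q_nonneg \<open>u \<in> space unit_borel\<close> in simp)
    then show "ennreal \<bar>q u * indicator (cell k j) u\<bar> \<le> ennreal (real (Suc k)) * ennreal (q u * sqrt (u * (1 - u)))"
      by (simp add: ennreal_mult'[symmetric] ennreal_leI del: of_nat_Suc)
  qed
  also have "\<dots> = ennreal (real (Suc k)) * (\<integral>\<^sup>+u. ennreal (q u * sqrt (u * (1 - u))) \<partial>unit_borel)"
    by (intro nn_integral_cmult measurable_restrict_space1) simp
  also have "\<dots> < \<infinity>" using tail_density by (simp add: ennreal_mult_less_top)
  finally show "(\<integral>\<^sup>+u. ennreal \<bar>q u * indicator (cell k j) u\<bar> \<partial>unit_borel) < \<infinity>" .
qed

lemma discretized_density: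
  shows "integrable unit_leb (\<lambda>u. - (q u * discretize k h u))"
    and "L1_of (\<lambda>u. - (q u * discretize k h u)) = (\<Sum>j<k - 1. h (knot k j) *\<^sub>R - density_cell k j)"
    and "(\<lambda>u. - (q u * discretize k h u)) \<in> borel_measurable unit_borel"
proof -
  have eq: "- (q u * discretize k h u) = (\<Sum>j<k - 1. - h (knot k j) * (q u * indicator (cell k j) u))" for u
    unfolding discretize_eq_sum sum_distrib_left sum_negf[symmetric] by (intro sum.cong refl) (simp add: mult_ac)
  show "integrable unit_leb (\<lambda>u. - (q u * discretize k h u))"
    unfolding eq by (intro Bochner_Integration.integrable_sum integrable_mult_right integrable_density_cell) simp
  show "L1_of (\<lambda>u. - (q u * discretize k h u)) = (\<Sum>j<k - 1. h (knot k j) *\<^sub>R - density_cell k j)"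
    unfolding eq density_cell_def by (subst L1_of_sum) (auto intro: integrable_density_cell)
  show "(\<lambda>u. - (q u * discretize k h u)) \<in> borel_measurable unit_borel"
    by (rule measurable_unit_borelI) measurable
qed

lemma discretize_joint_measurable:
  fixes Z :: "'p \<Rightarrow> real \<Rightarrow> real"
  assumes "\<And>u. u \<in> {0<..<1} \<Longrightarrow> (\<lambda>\<omega>. Z \<omega> u) \<in> borel_measurable P"
  shows "(\<lambda>p. discretize k (Z (fst p)) (snd p)) \<in> borel_measurable (P \<Otimes>\<^sub>M unit_borel)"
proof -
  have [measurable]: "(\<lambda>\<omega>. Z \<omega> (knot k j)) \<in> borel_measurable P" if "j < k - 1" for j
  proof -
    have "j < k" using that by linarith
    then show ?thesis using knot_pos[of k j] knot_less_1[of j k] by (intro assms) simp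
  qed
  have [measurable]: "(\<lambda>u. indicator (cell k j) u :: real) \<in> borel_measurable unit_borel" for j
    by (rule measurable_unit_borelI) measurable
  show ?thesis
    unfolding discretize_eq_sum by (intro borel_measurable_sum borel_measurable_times) measurable
qed

text \<open>Where \<open>q\<close> is nonzero, \<open>F (Q u) = u\<close>. A grid point
  \<open>v\<close> below \<open>u\<close> satisfies \<open>v \<le> F (Q v) \<le> u\<close>, so the
  increment bound involves at most one mesh width even if \<open>F\<close> jumps at
  \<open>Q v\<close>.\<close>

lemma discretization_error:
  fixes P :: "'p measure" and Z :: "'p \<Rightarrow> real \<Rightarrow> real"
  assumes P: "prob_space P" and Z: "case_prod Z \<in> borel_measurable (P \<Otimes>\<^sub>M unit_borel)" and C: "0 \<le> C"
    and mom: "\<And>u. u \<in> {0<..<1} \<Longrightarrow> (\<integral>\<^sup>+\<omega>. ennreal ((Z \<omega> u)\<^sup>2) \<partial>P) \<le> ennreal (C * (F (Q u) * (1 - F (Q u))))"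
    and inc: "\<And>u v. u \<in> {0<..<1} \<Longrightarrow> v \<in> {0<..<1} \<Longrightarrow>
      (\<integral>\<^sup>+\<omega>. ennreal ((Z \<omega> u - Z \<omega> v)\<^sup>2) \<partial>P) \<le> ennreal (C * \<bar>F (Q u) - F (Q v)\<bar>)"
  shows "(\<integral>\<^sup>+\<omega>. \<integral>\<^sup>+u. ennreal \<bar>q u * Z \<omega> u - q u * discretize k (Z \<omega>) u\<bar> \<partial>unit_borel \<partial>P) \<le> ennreal (sqrt C) * mesh_error k"
proof -
  interpret P: prob_space P by (rule P)
  interpret pair_sigma_finite P unit_borel ..
  have Zu: "(\<lambda>\<omega>. Z \<omega> u) \<in> borel_measurable P" if "u \<in> {0<..<1}" for u
    using measurable_Pair1[OF Z, of u] that by simp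
  have [measurable]: "(\<lambda>p. Z (fst p) (snd p)) \<in> borel_measurable (P \<Otimes>\<^sub>M unit_borel)"
    using Z by (simp add: case_prod_beta')
  have [measurable]: "(\<lambda>p. q (snd p)) \<in> borel_measurable (P \<Otimes>\<^sub>M unit_borel)"
    by (rule measurable_compose[OF measurable_snd q_measurable_unit])
  note [measurable] = discretize_joint_measurable[where Z=Z, OF Zu]
  have "(\<integral>\<^sup>+\<omega>. \<integral>\<^sup>+u. ennreal \<bar>q u * Z \<omega> u - q u * discretize k (Z \<omega>) u\<bar> \<partial>unit_borel \<partial>P)
      = (\<integral>\<^sup>+u. \<integral>\<^sup>+\<omega>. ennreal \<bar>q u * Z \<omega> u - q u * discretize k (Z \<omega>) u\<bar> \<partial>P \<partial>unit_borel)"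
    by (rule Fubini'[symmetric]) (unfold case_prod_beta', measurable)
  also have "\<dots> \<le> (\<integral>\<^sup>+u. ennreal (sqrt C) * ennreal (q u * mesh_bound k u) \<partial>unit_borel)"
  proof (rule nn_integral_mono_AE)
    show "AE u in unit_borel. (\<integral>\<^sup>+\<omega>. ennreal \<bar>q u * Z \<omega> u - q u * discretize k (Z \<omega>) u\<bar> \<partial>P)
        \<le> ennreal (sqrt C) * ennreal (q u * mesh_bound k u)"
      using AE_flat AE_space
    proof eventually_elim
      case (elim u)
      then have u: "u \<in> {0<..<1}" by simp
      show ?case
      proof (cases "q u = 0")
        case False
        with elim have FQ: "F (Q u) = u" by simp
        have dm: "(\<lambda>\<omega>. Z \<omega> u - discretize k (Z \<omega>) u) \<in> borel_measurable P"
          using grid_in_unit[of u k] u by (cases "u \<in> inner_cells k") (auto simp: discretize_def intro!: borel_measurable_diff Zu)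
        have "(\<integral>\<^sup>+\<omega>. ennreal ((Z \<omega> u - discretize k (Z \<omega>) u)\<^sup>2) \<partial>P) \<le> ennreal ((sqrt C * mesh_bound k u)\<^sup>2)"
        proof (cases "u \<in> inner_cells k")
          case True
          let ?v = "grid k u"
          have v: "?v \<in> {0<..<1}" by (rule grid_in_unit[OF True])
          have "?v \<le> F (Q ?v)" using v by (intro le_F_Q) auto
          moreover have "F (Q ?v) \<le> F (Q u)" using v u grid_less[of k u] by (intro cdf_nondecreasing Q_mono) auto
          ultimately have "\<bar>F (Q u) - F (Q ?v)\<bar> \<le> 1 / real (Suc k)" using grid_ge[of u k] FQ by linarith
          then have "C * \<bar>F (Q u) - F (Q ?v)\<bar> \<le> C * (1 / real (Suc k))" using C by (rule mult_left_mono)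
          also have "\<dots> = (sqrt C * mesh_bound k u)\<^sup>2" using True C by (simp add: mesh_bound_def power_divide power_mult_distrib del: of_nat_Suc)
          finally show ?thesis using inc[OF u v] True by (simp add: discretize_def order.trans[OF _ ennreal_leI])
        next
          case False
          then have "(sqrt C * mesh_bound k u)\<^sup>2 = C * (F (Q u) * (1 - F (Q u)))"
            using C u by (simp add: mesh_bound_def FQ power_mult_distrib)
          then show ?thesis using mom[OF u] False by (simp add: discretize_def)
        qed
        then have "(\<integral>\<^sup>+\<omega>. ennreal \<bar>Z \<omega> u - discretize k (Z \<omega>) u\<bar> \<partial>P) \<le> ennreal (sqrt C * mesh_bound k u)"
          using C mesh_bound_nonneg[OF u] by (intro P.nn_integral_abs_le_second_moment dm) auto
        then have "ennreal (q u) * (\<integral>\<^sup>+\<omega>. ennreal \<bar>Z \<omega> u - discretize k (Z \<omega>) u\<bar> \<partial>P) \<le> ennreal (q u) * ennreal (sqrt C * mesh_bound k u)"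
          by (rule mult_left_mono) simp
        also have "ennreal (q u) * (\<integral>\<^sup>+\<omega>. ennreal \<bar>Z \<omega> u - discretize k (Z \<omega>) u\<bar> \<partial>P)
            = (\<integral>\<^sup>+\<omega>. ennreal \<bar>q u * Z \<omega> u - q u * discretize k (Z \<omega>) u\<bar> \<partial>P)"
          using dm q_nonneg[of u] by (subst nn_integral_cmult[symmetric])
            (auto simp: ennreal_mult'[symmetric] right_diff_distrib[symmetric] abs_mult)
        also have "ennreal (q u) * ennreal (sqrt C * mesh_bound k u) = ennreal (sqrt C) * ennreal (q u * mesh_bound k u)"
          using C q_nonneg[of u] by (simp add: ennreal_mult'[symmetric] mult_ac)
        finally show ?thesis .
      qed simp
    qed
  qed
  also have "\<dots> = ennreal (sqrt C) * mesh_error k"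
    unfolding mesh_error_def using mesh_bound_measurable by (intro nn_integral_cmult measurable_restrict_space1) simp
  finally show ?thesis .
qed

end

section \<open>Conditional convergence in distribution\<close>

lemma ennreal_tendsto_0I:
  fixes f :: "nat \<Rightarrow> ennreal"
  assumes "\<And>r::real. 0 < r \<Longrightarrow> \<forall>\<^sub>F n in sequentially. f n \<le> ennreal r"
  shows "f \<longlonglongrightarrow> 0"
proof (rule order_tendstoI)
  fix e :: ennreal assume "0 < e"
  then obtain r :: real where r: "0 < r" "ennreal r < e"
    by (metis ennreal_cases ennreal_less_zero_iff ennreal_zero_less_top dense less_ennreal.abs_eq
      ennreal_enn2real enn2real_positive_iff less_top order_less_trans top.not_eq_extremum)
  then show "\<forall>\<^sub>F n in sequentially. f n < e"
    using assms[OF r(1)] by (auto elim: eventually_mono)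
qed simp

text \<open>\<open>Y\<close> will be a supremum over uncountably many test functions and need not be
  measurable; the outer measure is controlled through a measurable majorant
  \<open>G\<close>.\<close>

lemma outer_measure_Markov:
  assumes G: "G \<in> borel_measurable A" and e: "0 < e" and le: "\<And>\<omega>. \<omega> \<in> space A \<Longrightarrow> Y \<omega> \<le> G \<omega>"
  shows "outer_measure_of A {\<omega> \<in> space A. Y \<omega> > ennreal e} \<le> ennreal (1 / e) * (\<integral>\<^sup>+\<omega>. G \<omega> \<partial>A)"
proof -
  let ?S = "{\<omega> \<in> space A. 1 \<le> ennreal (1 / e) * G \<omega>}"
  have S: "?S \<in> sets A" using G by measurable
  have "{\<omega> \<in> space A. Y \<omega> > ennreal e} \<subseteq> ?S"
  proof safe
    fix \<omega> assume "\<omega> \<in> space A" "Y \<omega> > ennreal e"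
    then have "ennreal e \<le> G \<omega>" using le[of \<omega>] by auto
    then have "ennreal (1 / e) * ennreal e \<le> ennreal (1 / e) * G \<omega>" by (rule mult_left_mono) simp
    then show "1 \<le> ennreal (1 / e) * G \<omega>" using e by (simp add: ennreal_mult'[symmetric])
  qed
  then have "outer_measure_of A {\<omega> \<in> space A. Y \<omega> > ennreal e} \<le> outer_measure_of A ?S"
    by (rule outer_measure_of_mono)
  also have "\<dots> = emeasure A ?S" using S by (rule outer_measure_of_eq)
  also have "\<dots> \<le> ennreal (1 / e) * (\<integral>\<^sup>+\<omega>. G \<omega> * indicator (space A) \<omega> \<partial>A)"
    using G by (intro nn_integral_Markov_inequality) auto
  also have "(\<integral>\<^sup>+\<omega>. G \<omega> * indicator (space A) \<omega> \<partial>A) = (\<integral>\<^sup>+\<omega>. G \<omega> \<partial>A)" by (intro nn_integral_cong) simp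
  finally show ?thesis .
qed

context integrable_quantile
begin

context
  fixes N :: "'c measure" and B :: "'c \<Rightarrow> real \<Rightarrow> real"
  assumes bridge: "bridge N B"
begin

interpretation N: bridge N B by (rule bridge)

lemma F_Q_unit: "F (Q u) \<in> {0..1}" by simp

text \<open>\<open>F (Q u)\<close> may equal 1 for interior \<open>u\<close>; there the bridge
  vanishes, and so does the cut-off version whose measurability is known.\<close>

lemma bridge_transformed_measurable: "(\<lambda>(y, u). B y (F (Q u))) \<in> borel_measurable (N \<Otimes>\<^sub>M unit_borel)"
proof -
  have "(\<lambda>u. F (Q u)) \<in> borel_measurable unit_borel" by (rule measurable_compose[OF Q_measurable F_measurable])
  then have "(\<lambda>p. (fst p, F (Q (snd p)))) \<in> measurable (N \<Otimes>\<^sub>M unit_borel) (N \<Otimes>\<^sub>M borel)"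
    by (intro measurable_Pair measurable_fst measurable_compose[OF measurable_snd]) auto
  from measurable_compose[OF this N.joint_measurable]
  have "(\<lambda>p. indicator {0<..<1} (F (Q (snd p))) * B (fst p) (F (Q (snd p)))) \<in> borel_measurable (N \<Otimes>\<^sub>M unit_borel)"
    by simp
  then show ?thesis
  proof (rule measurable_cong[THEN iffD1, rotated])
    fix p assume "p \<in> space (N \<Otimes>\<^sub>M unit_borel)"
    then have y: "fst p \<in> space N" by (auto simp: space_pair_measure)
    consider "F (Q (snd p)) = 0" | "F (Q (snd p)) = 1" | "F (Q (snd p)) \<in> {0<..<1}"
      using F_bounds[of "Q (snd p)"] by (auto simp: order.order_iff_strict)
    then show "indicator {0<..<1} (F (Q (snd p))) * B (fst p) (F (Q (snd p))) = (case p of (y, u) \<Rightarrow> B y (F (Q u)))"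
      by cases (auto simp: case_prod_beta' N.endpoints[OF y])
  qed
qed

lemma bridge_measurable: "(\<lambda>(y, u). B y u) \<in> borel_measurable (N \<Otimes>\<^sub>M unit_borel)"
  by (rule left_continuous_process_measurable) (auto intro: N.value_measurable N.left_continuous_path)

lemma bridge_path_measurable: "y \<in> space N \<Longrightarrow> B y \<in> borel_measurable unit_borel"
  using measurable_Pair2[OF bridge_measurable] by simp

text \<open>The path sampled on the grid is \<open>B y (F (Q u))\<close>, to match the empirical
  side. Multiplied by \<open>q\<close> it agrees with \<open>B y u\<close> almost everywhere, so the
  general error bound applies with constant 1.\<close>

lemma bridge_discretization_error:
  "(\<integral>\<^sup>+y. \<integral>\<^sup>+u. ennreal \<bar>- (q u * B y u) - - (q u * discretize k (\<lambda>u. B y (F (Q u))) u)\<bar> \<partial>unit_borel \<partial>N) \<le> mesh_error k"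
proof -
  have "(\<integral>\<^sup>+y. \<integral>\<^sup>+u. ennreal \<bar>- (q u * B y u) - - (q u * discretize k (\<lambda>u. B y (F (Q u))) u)\<bar> \<partial>unit_borel \<partial>N)
      = (\<integral>\<^sup>+y. \<integral>\<^sup>+u. ennreal \<bar>q u * B y (F (Q u)) - q u * discretize k (\<lambda>u. B y (F (Q u))) u\<bar> \<partial>unit_borel \<partial>N)"
  proof (rule nn_integral_cong, rule nn_integral_cong_AE)
    fix y
    show "AE u in unit_borel. ennreal \<bar>- (q u * B y u) - - (q u * discretize k (\<lambda>u. B y (F (Q u))) u)\<bar>
        = ennreal \<bar>q u * B y (F (Q u)) - q u * discretize k (\<lambda>u. B y (F (Q u))) u\<bar>"
      using AE_flat
    proof eventually_elim
      case (elim u)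
      then have eq: "q u * B y u = q u * B y (F (Q u))" by auto
      have neg: "\<bar>- c - - b\<bar> = \<bar>c - b\<bar>" for b c :: real by simp
      show ?case unfolding eq neg ..
    qed
  qed
  also have "\<dots> \<le> ennreal (sqrt 1) * mesh_error k"
    using N.second_moment[OF F_Q_unit] N.increment_moment[OF F_Q_unit F_Q_unit]
    by (intro discretization_error[OF N.prob_space_axioms bridge_transformed_measurable]) auto
  finally show ?thesis by simp
qed

text \<open>The expected norm is at most the integral in the tail condition, because the bridge has
  standard deviation \<open>sqrt (u * (1 - u))\<close>.\<close>

lemma bridge_norm_finite: "AE y in N. (\<integral>\<^sup>+u. ennreal \<bar>q u * B y u\<bar> \<partial>unit_borel) < \<infinity>"
proof -
  interpret pair_sigma_finite N unit_borel ..
  have [measurable]: "(\<lambda>p. B (fst p) (snd p)) \<in> borel_measurable (N \<Otimes>\<^sub>M unit_borel)"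
    using bridge_measurable by (simp add: case_prod_beta')
  have [measurable]: "(\<lambda>p. q (snd p)) \<in> borel_measurable (N \<Otimes>\<^sub>M unit_borel)"
    by (rule measurable_compose[OF measurable_snd q_measurable_unit])
  have m: "(\<lambda>(y, u). ennreal \<bar>q u * B y u\<bar>) \<in> borel_measurable (N \<Otimes>\<^sub>M unit_borel)"
    unfolding case_prod_beta' by measurable
  have "(\<integral>\<^sup>+y. \<integral>\<^sup>+u. ennreal \<bar>q u * B y u\<bar> \<partial>unit_borel \<partial>N) = (\<integral>\<^sup>+u. \<integral>\<^sup>+y. ennreal \<bar>q u * B y u\<bar> \<partial>N \<partial>unit_borel)"
    by (rule Fubini'[OF m, symmetric])
  also have "\<dots> \<le> (\<integral>\<^sup>+u. ennreal (q u * sqrt (u * (1 - u))) \<partial>unit_borel)"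
  proof (rule nn_integral_mono)
    fix u assume "u \<in> space unit_borel"
    then have u: "u \<in> {0..1}" by auto
    have "(\<integral>\<^sup>+y. ennreal \<bar>B y u\<bar> \<partial>N) \<le> ennreal (sqrt (u * (1 - u)))"
      using N.second_moment[OF u] u by (intro N.nn_integral_abs_le_second_moment N.value_measurable) auto
    then have "ennreal (q u) * (\<integral>\<^sup>+y. ennreal \<bar>B y u\<bar> \<partial>N) \<le> ennreal (q u) * ennreal (sqrt (u * (1 - u)))"
      by (rule mult_left_mono) simp
    then show "(\<integral>\<^sup>+y. ennreal \<bar>q u * B y u\<bar> \<partial>N) \<le> ennreal (q u * sqrt (u * (1 - u)))"
      using q_nonneg[of u] N.value_measurable[OF u]
      by (subst (asm) nn_integral_cmult[symmetric]) (auto simp: ennreal_mult'[symmetric] abs_mult)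
  qed
  also have "\<dots> < \<infinity>" by (rule tail_density)
  finally have "(\<integral>\<^sup>+y. \<integral>\<^sup>+u. ennreal \<bar>q u * B y u\<bar> \<partial>unit_borel \<partial>N) \<noteq> \<infinity>" by simp
  moreover have "(\<lambda>y. \<integral>\<^sup>+u. ennreal \<bar>q u * B y u\<bar> \<partial>unit_borel) \<in> borel_measurable N"
    using m by (rule unit_borel.borel_measurable_nn_integral)
  ultimately have "AE y in N. (\<integral>\<^sup>+u. ennreal \<bar>q u * B y u\<bar> \<partial>unit_borel) \<noteq> \<infinity>" by (intro nn_integral_PInf_AE)
  then show ?thesis by (simp add: less_top[symmetric])
qed

lemma limit_path_measurable: "y \<in> space N \<Longrightarrow> (\<lambda>u. - (q u * B y u)) \<in> borel_measurable unit_borel"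
  using bridge_path_measurable by (intro borel_measurable_uminus borel_measurable_times) auto

lemma AE_limit_integrable: "AE y in N. integrable unit_leb (\<lambda>u. - (q u * B y u))"
  using bridge_norm_finite AE_space
  by eventually_elim (rule integrable_unit_lebI[OF limit_path_measurable], simp_all)

text \<open>On inner cells \<open>q\<close> is integrable and paths are bounded, so the truncated
  process is measurable; it converges in norm on paths with finite norm. On the other paths the
  approximants are set to zero, to match the default value of \<open>L1_of\<close>.\<close>

lemma limit_measurable: "(\<lambda>y. L1_of (\<lambda>u. - (q u * B y u))) \<in> borel_measurable N"
proof (rule borel_measurable_LIMSEQ_metric)
  fix k
  define w where "w u = (\<Sum>j<k - 1. - q u * indicator (cell k j) u)" for u
  have w: "integrable unit_leb w"
    unfolding w_def using integrable_density_cell by (intro Bochner_Integration.integrable_sum) simp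
  have "(\<lambda>y. L1_of (\<lambda>u. w u * B y u)) \<in> borel_measurable N"
    by (rule measurable_L1_of_left_continuous[OF w])
      (auto intro: N.value_measurable N.left_continuous_path N.bounded_path)
  then show "(\<lambda>y. if (\<integral>\<^sup>+u. ennreal \<bar>q u * B y u\<bar> \<partial>unit_borel) < \<infinity> then L1_of (\<lambda>u. (\<Sum>j<k - 1. - q u * indicator (cell k j) u) * B y u) else 0)
      \<in> borel_measurable N"
  proof (intro measurable_If)
    have [measurable]: "(\<lambda>p. B (fst p) (snd p)) \<in> borel_measurable (N \<Otimes>\<^sub>M unit_borel)"
      using bridge_measurable by (simp add: case_prod_beta')
    have [measurable]: "(\<lambda>p. q (snd p)) \<in> borel_measurable (N \<Otimes>\<^sub>M unit_borel)"
      by (rule measurable_compose[OF measurable_snd q_measurable_unit])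
    have "(\<lambda>(y, u). ennreal \<bar>q u * B y u\<bar>) \<in> borel_measurable (N \<Otimes>\<^sub>M unit_borel)"
      unfolding case_prod_beta' by measurable
    then have [measurable]: "(\<lambda>y. \<integral>\<^sup>+u. ennreal \<bar>q u * B y u\<bar> \<partial>unit_borel) \<in> borel_measurable N"
      by (rule unit_borel.borel_measurable_nn_integral)
    show "{y \<in> space N. (\<integral>\<^sup>+u. ennreal \<bar>q u * B y u\<bar> \<partial>unit_borel) < \<infinity>} \<in> sets N" by measurable
  qed (simp_all add: w_def)
next
  fix y assume y: "y \<in> space N"
  show "(\<lambda>k. if (\<integral>\<^sup>+u. ennreal \<bar>q u * B y u\<bar> \<partial>unit_borel) < \<infinity> then L1_of (\<lambda>u. (\<Sum>j<k - 1. - q u * indicator (cell k j) u) * B y u) else 0)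
      \<longlonglongrightarrow> L1_of (\<lambda>u. - (q u * B y u))"
  proof (cases "(\<integral>\<^sup>+u. ennreal \<bar>q u * B y u\<bar> \<partial>unit_borel) < \<infinity>")
    case False
    then have "\<not> integrable unit_leb (\<lambda>u. - (q u * B y u))"
      using limit_path_measurable[OF y] by (subst integrable_unit_leb_iff) auto
    then show ?thesis using False by (simp add: L1_of_not_integrable)
  next
    case True
    have int: "integrable unit_leb (\<lambda>u. - (q u * B y u))"
      using limit_path_measurable[OF y] True by (subst integrable_unit_leb_iff) auto
    have cells: "(\<Sum>j<k - 1. - q u * indicator (cell k j) u) * B y u = indicator (inner_cells k) u * - (q u * B y u)" for k u
    proof -
      have "(\<Sum>j<k - 1. indicator (cell k j) u :: real) = indicator (inner_cells k) u"
        using discretize_eq_sum[of k "\<lambda>_. 1" u]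
        by (cases "u \<in> inner_cells k") (simp_all add: discretize_def)
      then show ?thesis by (simp only: sum_distrib_left[symmetric]) simp
    qed
    have m: "(\<lambda>u. indicator (inner_cells k) u * - (q u * B y u)) \<in> borel_measurable unit_borel" for k
      by (intro borel_measurable_times limit_path_measurable[OF y] measurable_unit_borelI) measurable
    have int': "integrable unit_leb (\<lambda>u. indicator (inner_cells k) u * - (q u * B y u))" for k
      by (rule Bochner_Integration.integrable_bound[OF int measurable_unit_leb[OF m]]) (auto simp: indicator_def)
    have "(\<lambda>k. \<integral>u. \<bar>indicator (inner_cells k) u * - (q u * B y u) - - (q u * B y u)\<bar> \<partial>unit_leb) \<longlonglongrightarrow> (\<integral>u. 0 \<partial>unit_leb)"
    proof (rule integral_dominated_convergence)
      show "(\<lambda>u. \<bar>indicator (inner_cells k) u * - (q u * B y u) - - (q u * B y u)\<bar>) \<in> borel_measurable unit_leb" for k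
        using int int' by (intro borel_measurable_abs borel_measurable_diff) auto
      show "integrable unit_leb (\<lambda>u. \<bar>- (q u * B y u)\<bar>)" using int by (rule integrable_abs)
      show "AE u in unit_leb. norm \<bar>indicator (inner_cells k) u * - (q u * B y u) - - (q u * B y u)\<bar> \<le> \<bar>- (q u * B y u)\<bar>" for k
        by (auto simp: indicator_def)
      show "AE u in unit_leb. (\<lambda>k. \<bar>indicator (inner_cells k) u * - (q u * B y u) - - (q u * B y u)\<bar>) \<longlonglongrightarrow> 0"
      proof (rule AE_I2)
        fix u assume "u \<in> space unit_leb"
        then have "u \<in> {0<..<1}" by (auto simp: space_restrict_space)
        from eventually_inner_cells[OF this]
        show "(\<lambda>k. \<bar>indicator (inner_cells k) u * - (q u * B y u) - - (q u * B y u)\<bar>) \<longlonglongrightarrow> 0"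
          by (rule tendsto_eventually[OF eventually_mono]) simp
      qed
    qed simp
    then have "(\<lambda>k. L1_of (\<lambda>u. indicator (inner_cells k) u * - (q u * B y u))) \<longlonglongrightarrow> L1_of (\<lambda>u. - (q u * B y u))"
      unfolding tendsto_dist_iff[of _ "L1_of (\<lambda>u. - (q u * B y u))"] dist_L1_of[OF int' int] by simp
    then show ?thesis using True unfolding cells by simp
  qed
qed

text \<open>\<open>R n\<close> carries the randomness over which conditional expectations are taken; the data live on \<open>A\<close>.
  The sampling case is recovered with a process that does not depend on \<open>A\<close>.\<close>

lemma conditional_convergence:
  fixes A :: "'o measure" and R :: "nat \<Rightarrow> 'r measure" and a D :: "nat \<Rightarrow> 'o \<Rightarrow> 'r \<Rightarrow> real \<Rightarrow> real"
  assumes A: "prob_space A" and R: "\<And>n. prob_space (R n)"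
    and am: "\<And>n. (\<lambda>(p, u). a n (fst p) (snd p) u) \<in> borel_measurable ((A \<Otimes>\<^sub>M R n) \<Otimes>\<^sub>M unit_borel)"
    and aL: "\<And>n \<omega>. \<omega> \<in> space A \<Longrightarrow> (\<lambda>\<omega>'. L1_of (a n \<omega> \<omega>')) \<in> borel_measurable (R n)"
    and Dm: "\<And>n. (\<lambda>(p, x). D n (fst p) (snd p) x) \<in> borel_measurable ((A \<Otimes>\<^sub>M R n) \<Otimes>\<^sub>M borel)"
    and lin: "(\<lambda>n. \<integral>\<^sup>+p. \<integral>\<^sup>+u. ennreal \<bar>a n (fst p) (snd p) u + q u * D n (fst p) (snd p) (Q u)\<bar> \<partial>unit_borel \<partial>(A \<Otimes>\<^sub>M R n)) \<longlonglongrightarrow> 0"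
    and C: "0 \<le> C"
    and mom: "\<And>n x. n > 0 \<Longrightarrow> (\<integral>\<^sup>+p. ennreal ((D n (fst p) (snd p) x)\<^sup>2) \<partial>(A \<Otimes>\<^sub>M R n)) \<le> ennreal (C * (F x * (1 - F x)))"
    and inc: "\<And>n x x'. n > 0 \<Longrightarrow> (\<integral>\<^sup>+p. ennreal ((D n (fst p) (snd p) x - D n (fst p) (snd p) x')\<^sup>2) \<partial>(A \<Otimes>\<^sub>M R n)) \<le> ennreal (C * \<bar>F x - F x'\<bar>)"
    and cos: "\<And>(m::nat) c x \<theta>. (\<lambda>n. \<integral>\<^sup>+\<omega>. ennreal \<bar>(\<integral>\<omega>'. cos ((\<Sum>j<m. c j * D n \<omega> \<omega>' (x j)) + \<theta>) \<partial>R n)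
      - (\<integral>y. cos ((\<Sum>j<m. c j * B y (F (x j))) + \<theta>) \<partial>N)\<bar> \<partial>A) \<longlonglongrightarrow> 0"
  shows "tendsto_0_in_prob A (\<lambda>n \<omega>. SUP \<psi>\<in>BL1. ennreal \<bar>(\<integral>\<omega>'. \<psi> (L1_of (a n \<omega> \<omega>')) \<partial>R n)
    - (\<integral>y. \<psi> (L1_of (\<lambda>u. - (q u * B y u))) \<partial>N)\<bar>)" (is "tendsto_0_in_prob A ?S")
  unfolding tendsto_0_in_prob_def
proof (intro allI impI)
  fix e :: real assume e: "0 < e"
  interpret A: prob_space A by (rule A)
  have secp: "(\<omega>, \<omega>') \<in> space (A \<Otimes>\<^sub>M R n)" if "\<omega> \<in> space A" "\<omega>' \<in> space (R n)" for \<omega> \<omega>' n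
    using that by (simp add: space_pair_measure)
  have a_path: "a n \<omega> \<omega>' \<in> borel_measurable unit_borel" if "\<omega> \<in> space A" "\<omega>' \<in> space (R n)" for n \<omega> \<omega>'
    using measurable_Pair2[OF am secp[OF that]] by simp
  have D_path: "(\<lambda>u. D n \<omega> \<omega>' (Q u)) \<in> borel_measurable unit_borel" if "\<omega> \<in> space A" "\<omega>' \<in> space (R n)" for n \<omega> \<omega>'
    using measurable_compose[OF Q_measurable measurable_Pair2[OF Dm secp[OF that]]] by simp
  have Dx: "(\<lambda>p. D n (fst p) (snd p) x) \<in> borel_measurable (A \<Otimes>\<^sub>M R n)" for n x
    using measurable_Pair1[OF Dm, of x] by simp
  have DQ: "(\<lambda>p. D n (fst (fst p)) (snd (fst p)) (Q (snd p))) \<in> borel_measurable ((A \<Otimes>\<^sub>M R n) \<Otimes>\<^sub>M unit_borel)" for n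
  proof -
    have "(\<lambda>p. (fst p, Q (snd p))) \<in> measurable ((A \<Otimes>\<^sub>M R n) \<Otimes>\<^sub>M unit_borel) ((A \<Otimes>\<^sub>M R n) \<Otimes>\<^sub>M borel)"
      by (intro measurable_Pair measurable_fst measurable_compose[OF measurable_snd Q_measurable])
    from measurable_compose[OF this Dm] show ?thesis by simp
  qed
  have qm: "(\<lambda>p. q (snd p)) \<in> borel_measurable ((A \<Otimes>\<^sub>M R n) \<Otimes>\<^sub>M unit_borel)" for n
    by (rule measurable_compose[OF measurable_snd q_measurable_unit])
  \<comment> \<open>\<open>h1\<close> is the linearization error and \<open>h2\<close> the
    discretization error of the linearized process, both as random norms.\<close>
  define h1 where "h1 n p = (\<integral>\<^sup>+u. ennreal \<bar>a n (fst p) (snd p) u + q u * D n (fst p) (snd p) (Q u)\<bar> \<partial>unit_borel)" for n p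
  define h2 where "h2 k n p = (\<integral>\<^sup>+u. ennreal \<bar>q u * D n (fst p) (snd p) (Q u) - q u * discretize k (\<lambda>u. D n (fst p) (snd p) (Q u)) u\<bar> \<partial>unit_borel)" for k n p
  have h1m [measurable]: "h1 n \<in> borel_measurable (A \<Otimes>\<^sub>M R n)" for n
    unfolding h1_def
  proof (rule unit_borel.borel_measurable_nn_integral)
    note [measurable] = DQ qm
    have [measurable]: "(\<lambda>p. a n (fst (fst p)) (snd (fst p)) (snd p)) \<in> borel_measurable ((A \<Otimes>\<^sub>M R n) \<Otimes>\<^sub>M unit_borel)"
      using am[of n] by (simp add: case_prod_beta')
    show "(\<lambda>(p, u). ennreal \<bar>a n (fst p) (snd p) u + q u * D n (fst p) (snd p) (Q u)\<bar>) \<in> borel_measurable ((A \<Otimes>\<^sub>M R n) \<Otimes>\<^sub>M unit_borel)"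
      unfolding case_prod_beta' by measurable
  qed
  have h2m [measurable]: "h2 k n \<in> borel_measurable (A \<Otimes>\<^sub>M R n)" for k n
    unfolding h2_def
  proof (rule unit_borel.borel_measurable_nn_integral)
    note [measurable] = DQ qm discretize_joint_measurable[where Z="\<lambda>p u. D n (fst p) (snd p) (Q u)", OF Dx]
    show "(\<lambda>(p, u). ennreal \<bar>q u * D n (fst p) (snd p) (Q u) - q u * discretize k (\<lambda>u. D n (fst p) (snd p) (Q u)) u\<bar>)
        \<in> borel_measurable ((A \<Otimes>\<^sub>M R n) \<Otimes>\<^sub>M unit_borel)"
      unfolding case_prod_beta' by measurable
  qed
  have h2_bound: "(\<integral>\<^sup>+p. h2 k n p \<partial>(A \<Otimes>\<^sub>M R n)) \<le> ennreal (sqrt C) * mesh_error k" if "n > 0" for k n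
  proof -
    interpret R: prob_space "R n" by (rule R)
    interpret AR: pair_prob_space A "R n" ..
    show ?thesis unfolding h2_def
      using DQ mom[OF that] inc[OF that] C
      by (intro discretization_error[where Z="\<lambda>p u. D n (fst p) (snd p) (Q u)"] AR.prob_space_axioms) (auto simp: case_prod_beta')
  qed
  show "(\<lambda>n. outer_measure_of A {\<omega> \<in> space A. ennreal e < ?S n \<omega>}) \<longlonglongrightarrow> 0"
  proof (rule ennreal_tendsto_0I)
    fix r :: real assume r: "0 < r"
    \<comment> \<open>Three groups of errors will each have mean at most \<open>d\<close>; Markov's
      inequality at level \<open>e\<close> then gives \<open>3 * d / e = r\<close>.\<close>
    define d where "d = e * r / 3"
    have d: "0 < d" using e r by (simp add: d_def)
    have "(\<lambda>k. ennreal (sqrt C) * mesh_error k + mesh_error k) \<longlonglongrightarrow> ennreal (sqrt C) * 0 + 0"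
      by (intro tendsto_add ennreal_tendsto_cmult mesh_error_tendsto) simp
    then have "\<forall>\<^sub>F k in sequentially. ennreal (sqrt C) * mesh_error k + mesh_error k < ennreal d"
      using d by (intro order_tendstoD) auto
    \<comment> \<open>The grid is fixed here, before \<open>n\<close>: the mesh errors are uniform
      in \<open>n\<close>, and everything that follows lives in the fixed dimension
      \<open>m\<close>.\<close>
    then obtain k where k: "ennreal (sqrt C) * mesh_error k + mesh_error k < ennreal d"
      by (auto dest: eventually_happens)
    define m where "m = k - 1"
    \<comment> \<open>Chosen so that the quadratic approximation errors on both sides, with second
      moments of each coordinate at most \<open>C\<close> in mean and at most 1 for the bridge, add
      up to \<open>d\<close>.\<close>
    define \<epsilon> where "\<epsilon> = d / (2 + m * (C + 1))"
    have \<epsilon>: "0 < \<epsilon>" using d C by (simp add: \<epsilon>_def add_pos_nonneg)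
    define E where "E j = - density_cell k j" for j
    \<comment> \<open>Lipschitz constant of a test function written in coordinates; it depends on
      the grid only, not on the test function.\<close>
    define L where "L = (\<Sum>j<m. norm (E j))"
    have L: "0 \<le> L" by (simp add: L_def sum_nonneg)
    obtain I :: "nat list set" and g where I: "finite I" "\<And>i. i \<in> I \<Longrightarrow> g i \<in> trig_span m"
      and approx: "\<And>f. f \<in> coordinate_lipschitz m L \<Longrightarrow> \<exists>c. (\<forall>i\<in>I. \<bar>c i\<bar> \<le> 1) \<and>
        (\<forall>x. \<bar>f x - (\<Sum>i\<in>I. c i * g i x)\<bar> \<le> \<epsilon> * (1 + (\<Sum>j<m. (x j)\<^sup>2)))"
      using uniform_trig_approximation[OF L \<epsilon>, of m] by blast
    define V where "V n \<omega> \<omega>' j = D n \<omega> \<omega>' (Q (knot k j))" for n \<omega> \<omega>' j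
    define V' where "V' y j = B y (F (Q (knot k j)))" for y j
    have Vm: "(\<lambda>p. V n (fst p) (snd p) j) \<in> borel_measurable (A \<Otimes>\<^sub>M R n)" for n j
      unfolding V_def by (rule Dx)
    have Vs: "(\<lambda>\<omega>'. V n \<omega> \<omega>' j) \<in> borel_measurable (R n)" if "\<omega> \<in> space A" for n \<omega> j
      using measurable_Pair2[OF Vm that] by simp
    have V'm: "(\<lambda>y. V' y j) \<in> borel_measurable N" for j
      unfolding V'_def by (rule N.value_measurable[OF F_Q_unit])
    have V'2: "(\<integral>\<^sup>+y. ennreal ((V' y j)\<^sup>2) \<partial>N) \<le> 1" for j
    proof -
      have "F (Q (knot k j)) * (1 - F (Q (knot k j))) \<le> 1" by (intro mult_le_one) auto
      then show ?thesis unfolding V'_def N.second_moment[OF F_Q_unit] by (simp add: ennreal_le_1)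
    qed
    define \<Delta> where "\<Delta> n i \<omega> = ennreal \<bar>(\<integral>\<omega>'. g i (V n \<omega> \<omega>') \<partial>R n) - (\<integral>y. g i (V' y) \<partial>N)\<bar>" for n i \<omega>
    have trig: "(\<lambda>n. \<integral>\<^sup>+\<omega>. \<Delta> n i \<omega> \<partial>A) \<longlonglongrightarrow> 0" "\<Delta> n i \<in> borel_measurable A" if "i \<in> I" for i n
    proof -
      have "(\<lambda>n. \<integral>\<^sup>+\<omega>. ennreal \<bar>(\<integral>\<omega>'. cos ((\<Sum>j<m. c j * V n \<omega> \<omega>' j) + \<theta>) \<partial>R n)
          - (\<integral>y. cos ((\<Sum>j<m. c j * V' y j) + \<theta>) \<partial>N)\<bar> \<partial>A) \<longlonglongrightarrow> 0" for c \<theta>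
        unfolding V_def V'_def by (rule cos)
      note * = trig_span_expectation_tendsto[where V=V and V'=V', OF R N.prob_space_axioms Vm V'm this I(2)[OF that]]
      show "(\<lambda>n. \<integral>\<^sup>+\<omega>. \<Delta> n i \<omega> \<partial>A) \<longlonglongrightarrow> 0" unfolding \<Delta>_def by (rule *(1))
      have "(\<lambda>\<omega>. \<integral>\<omega>'. g i (V n \<omega> \<omega>') \<partial>R n) \<in> borel_measurable A" by (rule *(2))
      then show "\<Delta> n i \<in> borel_measurable A" unfolding \<Delta>_def by measurable
    qed
    \<comment> \<open>Measurable majorant of the supremum, free of the test function: only the
      coefficients of the trigonometric approximation depend on it, and they are bounded by
      1.\<close>
    define G where "G n \<omega> = (\<integral>\<^sup>+\<omega>'. h1 n (\<omega>, \<omega>') + h2 k n (\<omega>, \<omega>') \<partial>R n) +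
      ((ennreal \<epsilon> * (1 + (\<Sum>j<m. \<integral>\<^sup>+\<omega>'. ennreal ((V n \<omega> \<omega>' j)\<^sup>2) \<partial>R n)) + ennreal \<epsilon> * (1 + of_nat m)) + (\<Sum>i\<in>I. \<Delta> n i \<omega>)) + mesh_error k" for n \<omega>
    have Gm: "G n \<in> borel_measurable A" for n
    proof -
      interpret R: prob_space "R n" by (rule R)
      have "(\<lambda>(\<omega>, \<omega>'). h1 n (\<omega>, \<omega>') + h2 k n (\<omega>, \<omega>')) \<in> borel_measurable (A \<Otimes>\<^sub>M R n)"
        by (simp add: case_prod_beta')
      then have [measurable]: "(\<lambda>\<omega>. \<integral>\<^sup>+\<omega>'. h1 n (\<omega>, \<omega>') + h2 k n (\<omega>, \<omega>') \<partial>R n) \<in> borel_measurable A"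
        by (rule R.borel_measurable_nn_integral)
      have [measurable]: "(\<lambda>\<omega>. \<integral>\<^sup>+\<omega>'. ennreal ((V n \<omega> \<omega>' j)\<^sup>2) \<partial>R n) \<in> borel_measurable A" for j
        using Vm[of n j] by (intro R.borel_measurable_nn_integral) (simp add: case_prod_beta')
      note [measurable] = trig(2)
      show ?thesis unfolding G_def by measurable
    qed
    have S_le: "?S n \<omega> \<le> G n \<omega>" if \<omega>: "\<omega> \<in> space A" for n \<omega>
    proof (rule SUP_least)
      fix \<psi> :: "l1 \<Rightarrow> real" assume \<psi>: "\<psi> \<in> BL1"
      interpret R: prob_space "R n" by (rule R)
      define f where "f x = \<psi> (\<Sum>j<m. x j *\<^sub>R E j)" for x
      have YR: "(\<lambda>\<omega>'. \<Sum>j<m. V n \<omega> \<omega>' j *\<^sub>R E j) \<in> borel_measurable (R n)"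
        by (rule measurable_finite_combination[OF Vs[OF \<omega>]])
      have YN: "(\<lambda>y. \<Sum>j<m. V' y j *\<^sub>R E j) \<in> borel_measurable N"
        by (rule measurable_finite_combination[OF V'm])
      have fl: "f \<in> coordinate_lipschitz m L"
        unfolding coordinate_lipschitz_def
      proof (intro CollectI conjI allI)
        show "\<bar>f x\<bar> \<le> 1" for x unfolding f_def by (rule BL1D(1)[OF \<psi>])
        fix x y
        have "\<bar>f x - f y\<bar> \<le> norm ((\<Sum>j<m. x j *\<^sub>R E j) - (\<Sum>j<m. y j *\<^sub>R E j))"
          unfolding f_def using BL1D(2)[OF \<psi>] by (simp add: dist_norm)
        also have "(\<Sum>j<m. x j *\<^sub>R E j) - (\<Sum>j<m. y j *\<^sub>R E j) = (\<Sum>j<m. (x j - y j) *\<^sub>R E j)"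
          by (simp add: sum_subtractf scaleR_left_diff_distrib)
        also have "norm \<dots> \<le> (\<Sum>j<m. \<bar>x j - y j\<bar> * norm (E j))"
          by (rule order.trans[OF norm_sum]) simp
        also have "\<dots> \<le> (\<Sum>j<m. \<bar>x j - y j\<bar> * L)"
          unfolding L_def by (intro sum_mono mult_left_mono member_le_sum) auto
        finally show "\<bar>f x - f y\<bar> \<le> L * (\<Sum>j<m. \<bar>x j - y j\<bar>)" by (simp add: sum_distrib_left mult.commute)
      qed
      obtain c where c: "\<And>i. i \<in> I \<Longrightarrow> \<bar>c i\<bar> \<le> 1"
        "\<And>x. \<bar>f x - (\<Sum>i\<in>I. c i * g i x)\<bar> \<le> \<epsilon> * (1 + (\<Sum>j<m. (x j)\<^sup>2))"
        using approx[OF fl] by blast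
      define h where "h x = (\<Sum>i\<in>I. c i * g i x)" for x
      have gR: "integrable (R n) (\<lambda>\<omega>'. g i (V n \<omega> \<omega>'))" if "i \<in> I" for i
        by (rule R.trig_span_integrable[OF I(2)[OF that] Vs[OF \<omega>]])
      have gN: "integrable N (\<lambda>y. g i (V' y))" if "i \<in> I" for i
        by (rule N.trig_span_integrable[OF I(2)[OF that] V'm])
      have t1: "ennreal \<bar>(\<integral>\<omega>'. \<psi> (L1_of (a n \<omega> \<omega>')) \<partial>R n) - (\<integral>\<omega>'. f (V n \<omega> \<omega>') \<partial>R n)\<bar>
          \<le> (\<integral>\<^sup>+\<omega>'. h1 n (\<omega>, \<omega>') + h2 k n (\<omega>, \<omega>') \<partial>R n)"
        unfolding f_def
      proof (rule R.BL1_expectation_diff[OF \<psi> aL[OF \<omega>] YR])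
        fix \<omega>' assume \<omega>': "\<omega>' \<in> space (R n)"
        let ?b = "\<lambda>u. - (q u * discretize k (\<lambda>u. D n \<omega> \<omega>' (Q u)) u)"
        have b: "(\<Sum>j<m. V n \<omega> \<omega>' j *\<^sub>R E j) = L1_of ?b"
          by (simp add: discretized_density(2) V_def E_def m_def)
        have "ennreal (dist (L1_of (a n \<omega> \<omega>')) (L1_of ?b)) \<le> (\<integral>\<^sup>+u. ennreal \<bar>a n \<omega> \<omega>' u - ?b u\<bar> \<partial>unit_borel)"
          by (rule dist_L1_of_le[OF a_path[OF \<omega> \<omega>'] discretized_density(3) discretized_density(1)])
        also have "\<dots> \<le> (\<integral>\<^sup>+u. ennreal \<bar>a n \<omega> \<omega>' u + q u * D n \<omega> \<omega>' (Q u)\<bar>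
            + ennreal \<bar>q u * D n \<omega> \<omega>' (Q u) - q u * discretize k (\<lambda>u. D n \<omega> \<omega>' (Q u)) u\<bar> \<partial>unit_borel)"
          by (intro nn_integral_mono) (simp add: ennreal_plus[symmetric] ennreal_leI del: ennreal_plus)
        also have "\<dots> = h1 n (\<omega>, \<omega>') + h2 k n (\<omega>, \<omega>')"
          unfolding h1_def h2_def fst_conv snd_conv
        proof (rule nn_integral_add)
          have dm: "discretize k (\<lambda>u. D n \<omega> \<omega>' (Q u)) \<in> borel_measurable unit_borel" by (rule measurable_unit_borelI) measurable
          show "(\<lambda>u. ennreal \<bar>a n \<omega> \<omega>' u + q u * D n \<omega> \<omega>' (Q u)\<bar>) \<in> borel_measurable unit_borel"
            by (intro measurable_compose[OF _ measurable_ennreal] borel_measurable_abs borel_measurable_add borel_measurable_times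
              a_path[OF \<omega> \<omega>'] D_path[OF \<omega> \<omega>'] q_measurable_unit)
          show "(\<lambda>u. ennreal \<bar>q u * D n \<omega> \<omega>' (Q u) - q u * discretize k (\<lambda>u. D n \<omega> \<omega>' (Q u)) u\<bar>) \<in> borel_measurable unit_borel"
            by (intro measurable_compose[OF _ measurable_ennreal] borel_measurable_abs borel_measurable_diff borel_measurable_times
              dm D_path[OF \<omega> \<omega>'] q_measurable_unit)
        qed
        finally show "ennreal (dist (L1_of (a n \<omega> \<omega>')) (\<Sum>j<m. V n \<omega> \<omega>' j *\<^sub>R E j)) \<le> h1 n (\<omega>, \<omega>') + h2 k n (\<omega>, \<omega>')"
          unfolding b .
      qed
      have t2: "ennreal \<bar>(\<integral>y. f (V' y) \<partial>N) - (\<integral>y. \<psi> (L1_of (\<lambda>u. - (q u * B y u))) \<partial>N)\<bar> \<le> mesh_error k"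
      proof -
        have "ennreal \<bar>(\<integral>y. \<psi> (L1_of (\<lambda>u. - (q u * B y u))) \<partial>N) - (\<integral>y. f (V' y) \<partial>N)\<bar>
            \<le> (\<integral>\<^sup>+y. \<integral>\<^sup>+u. ennreal \<bar>- (q u * B y u) - - (q u * discretize k (\<lambda>u. B y (F (Q u))) u)\<bar> \<partial>unit_borel \<partial>N)"
          unfolding f_def
        proof (rule N.BL1_expectation_diff[OF \<psi> limit_measurable YN])
          fix y assume y: "y \<in> space N"
          let ?b = "\<lambda>u. - (q u * discretize k (\<lambda>u. B y (F (Q u))) u)"
          have b: "(\<Sum>j<m. V' y j *\<^sub>R E j) = L1_of ?b"
            by (simp add: discretized_density(2) V'_def E_def m_def)
          show "ennreal (dist (L1_of (\<lambda>u. - (q u * B y u))) (\<Sum>j<m. V' y j *\<^sub>R E j))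
              \<le> (\<integral>\<^sup>+u. ennreal \<bar>- (q u * B y u) - ?b u\<bar> \<partial>unit_borel)"
            unfolding b by (rule dist_L1_of_le[OF limit_path_measurable[OF y] discretized_density(3) discretized_density(1)])
        qed
        also have "\<dots> \<le> mesh_error k" by (rule bridge_discretization_error)
        finally show ?thesis by (simp add: abs_minus_commute)
      qed
      have fR: "(\<lambda>\<omega>'. f (V n \<omega> \<omega>')) \<in> borel_measurable (R n)" and fN: "(\<lambda>y. f (V' y)) \<in> borel_measurable N"
        unfolding f_def by (rule BL1_measurable[OF \<psi> YR] BL1_measurable[OF \<psi> YN])+
      have fb: "\<bar>f x\<bar> \<le> 1" for x unfolding f_def by (rule BL1D(1)[OF \<psi>])
      have t3: "ennreal \<bar>(\<integral>\<omega>'. f (V n \<omega> \<omega>') \<partial>R n) - (\<integral>\<omega>'. h (V n \<omega> \<omega>') \<partial>R n)\<bar>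
          \<le> ennreal \<epsilon> * (1 + (\<Sum>j<m. \<integral>\<^sup>+\<omega>'. ennreal ((V n \<omega> \<omega>' j)\<^sup>2) \<partial>R n))"
        unfolding h_def using gR \<epsilon>
        by (intro R.expectation_approx[OF fR fb _ Vs[OF \<omega>] _ c(2)]) auto
      have "ennreal \<bar>(\<integral>y. f (V' y) \<partial>N) - (\<integral>y. h (V' y) \<partial>N)\<bar> \<le> ennreal \<epsilon> * (1 + (\<Sum>j<m. \<integral>\<^sup>+y. ennreal ((V' y j)\<^sup>2) \<partial>N))"
        unfolding h_def using gN \<epsilon>
        by (intro N.expectation_approx[OF fN fb _ V'm _ c(2)]) auto
      also have "\<dots> \<le> ennreal \<epsilon> * (1 + (\<Sum>j<m. 1))" by (intro mult_left_mono add_left_mono sum_mono V'2) simp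
      finally have t4: "ennreal \<bar>(\<integral>y. h (V' y) \<partial>N) - (\<integral>y. f (V' y) \<partial>N)\<bar> \<le> ennreal \<epsilon> * (1 + of_nat m)"
        by (simp add: abs_minus_commute)
      have t5: "ennreal \<bar>(\<integral>\<omega>'. h (V n \<omega> \<omega>') \<partial>R n) - (\<integral>y. h (V' y) \<partial>N)\<bar> \<le> (\<Sum>i\<in>I. \<Delta> n i \<omega>)"
      proof -
        have "(\<integral>\<omega>'. h (V n \<omega> \<omega>') \<partial>R n) - (\<integral>y. h (V' y) \<partial>N)
            = (\<Sum>i\<in>I. c i * ((\<integral>\<omega>'. g i (V n \<omega> \<omega>') \<partial>R n) - (\<integral>y. g i (V' y) \<partial>N)))"
          unfolding h_def using gR gN by (simp add: Bochner_Integration.integral_sum right_diff_distrib sum_subtractf)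
        also have "\<bar>\<dots>\<bar> \<le> (\<Sum>i\<in>I. \<bar>(\<integral>\<omega>'. g i (V n \<omega> \<omega>') \<partial>R n) - (\<integral>y. g i (V' y) \<partial>N)\<bar>)"
          using c(1) by (intro order.trans[OF sum_abs] sum_mono) (simp add: abs_mult mult_left_le_one_le)
        finally show ?thesis unfolding \<Delta>_def by (simp add: ennreal_leI)
      qed
      have tri: "ennreal \<bar>s - t\<bar> \<le> ennreal \<bar>s - x\<bar> + ennreal \<bar>x - t\<bar>" for s t x :: real
        by (simp add: ennreal_plus[symmetric] ennreal_leI del: ennreal_plus)
      have "ennreal \<bar>(\<integral>\<omega>'. f (V n \<omega> \<omega>') \<partial>R n) - (\<integral>y. f (V' y) \<partial>N)\<bar>
          \<le> (ennreal \<epsilon> * (1 + (\<Sum>j<m. \<integral>\<^sup>+\<omega>'. ennreal ((V n \<omega> \<omega>' j)\<^sup>2) \<partial>R n)) + ennreal \<epsilon> * (1 + of_nat m)) + (\<Sum>i\<in>I. \<Delta> n i \<omega>)"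
        (is "?l \<le> ?a + ?b + ?c")
      proof -
        have "?l \<le> ?a + (ennreal \<bar>(\<integral>\<omega>'. h (V n \<omega> \<omega>') \<partial>R n) - (\<integral>y. f (V' y) \<partial>N)\<bar>)"
          by (rule order.trans[OF tri[of _ _ "\<integral>\<omega>'. h (V n \<omega> \<omega>') \<partial>R n"] add_right_mono[OF t3]])
        also have "\<dots> \<le> ?a + (?c + ?b)"
          by (rule add_left_mono[OF order.trans[OF tri[of _ _ "\<integral>y. h (V' y) \<partial>N"] add_mono[OF t5 t4]]])
        finally show ?thesis by (simp add: add_ac)
      qed
      from order.trans[OF tri[of _ _ "\<integral>y. f (V' y) \<partial>N"] add_mono[OF this t2]]
      have "ennreal \<bar>(\<integral>\<omega>'. f (V n \<omega> \<omega>') \<partial>R n) - (\<integral>y. \<psi> (L1_of (\<lambda>u. - (q u * B y u))) \<partial>N)\<bar>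
          \<le> ((ennreal \<epsilon> * (1 + (\<Sum>j<m. \<integral>\<^sup>+\<omega>'. ennreal ((V n \<omega> \<omega>' j)\<^sup>2) \<partial>R n)) + ennreal \<epsilon> * (1 + of_nat m)) + (\<Sum>i\<in>I. \<Delta> n i \<omega>)) + mesh_error k" .
      from order.trans[OF tri[of _ _ "\<integral>\<omega>'. f (V n \<omega> \<omega>') \<partial>R n"] add_mono[OF t1 this]]
      show "ennreal \<bar>(\<integral>\<omega>'. \<psi> (L1_of (a n \<omega> \<omega>')) \<partial>R n) - (\<integral>y. \<psi> (L1_of (\<lambda>u. - (q u * B y u))) \<partial>N)\<bar> \<le> G n \<omega>"
        unfolding G_def by (simp only: add.assoc)
    qed
    define rest where "rest n = (\<integral>\<^sup>+p. h1 n p \<partial>(A \<Otimes>\<^sub>M R n)) + (\<Sum>i\<in>I. \<integral>\<^sup>+\<omega>. \<Delta> n i \<omega> \<partial>A)" for n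
    have G_int: "(\<integral>\<^sup>+\<omega>. G n \<omega> \<partial>A) \<le> rest n + ennreal d + ennreal d" if n: "n > 0" for n
    proof -
      interpret R: prob_space "R n" by (rule R)
      have fub: "(\<integral>\<^sup>+\<omega>. \<integral>\<^sup>+\<omega>'. h (\<omega>, \<omega>') \<partial>R n \<partial>A) = (\<integral>\<^sup>+p. h p \<partial>(A \<Otimes>\<^sub>M R n))"
        if "h \<in> borel_measurable (A \<Otimes>\<^sub>M R n)" for h
        by (rule R.nn_integral_fst[OF that])
      have h12: "(\<lambda>p. h1 n p + h2 k n p) \<in> borel_measurable (A \<Otimes>\<^sub>M R n)" by measurable
      have V2: "(\<integral>\<^sup>+\<omega>. \<integral>\<^sup>+\<omega>'. ennreal ((V n \<omega> \<omega>' j)\<^sup>2) \<partial>R n \<partial>A) \<le> ennreal C" for j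
      proof -
        have "(\<integral>\<^sup>+\<omega>. \<integral>\<^sup>+\<omega>'. ennreal ((V n \<omega> \<omega>' j)\<^sup>2) \<partial>R n \<partial>A) = (\<integral>\<^sup>+p. ennreal ((V n (fst p) (snd p) j)\<^sup>2) \<partial>(A \<Otimes>\<^sub>M R n))"
          using Vm[of n j] by (subst fub[symmetric]) auto
        also have "\<dots> \<le> ennreal (C * (F (Q (knot k j)) * (1 - F (Q (knot k j)))))" unfolding V_def by (rule mom[OF n])
        also have "\<dots> \<le> ennreal (C * 1)" using C by (intro ennreal_leI mult_left_mono mult_le_one) auto
        finally show ?thesis by simp
      qed
      have V2m [measurable]: "(\<lambda>\<omega>. \<integral>\<^sup>+\<omega>'. ennreal ((V n \<omega> \<omega>' j)\<^sup>2) \<partial>R n) \<in> borel_measurable A" for j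
        using Vm[of n j] by (intro R.borel_measurable_nn_integral) (simp add: case_prod_beta')
      have h12m [measurable]: "(\<lambda>\<omega>. \<integral>\<^sup>+\<omega>'. h1 n (\<omega>, \<omega>') + h2 k n (\<omega>, \<omega>') \<partial>R n) \<in> borel_measurable A"
        using h12 by (intro R.borel_measurable_nn_integral) (simp add: case_prod_beta')
      note [measurable] = trig(2)
      have "(\<integral>\<^sup>+\<omega>. G n \<omega> \<partial>A) = (\<integral>\<^sup>+p. h1 n p + h2 k n p \<partial>(A \<Otimes>\<^sub>M R n)) +
        ((ennreal \<epsilon> * (1 + (\<Sum>j<m. \<integral>\<^sup>+\<omega>. \<integral>\<^sup>+\<omega>'. ennreal ((V n \<omega> \<omega>' j)\<^sup>2) \<partial>R n \<partial>A)) + ennreal \<epsilon> * (1 + of_nat m)) + (\<Sum>i\<in>I. \<integral>\<^sup>+\<omega>. \<Delta> n i \<omega> \<partial>A)) + mesh_error k"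
        unfolding G_def fub[OF h12, symmetric]
        by (simp add: nn_integral_add nn_integral_cmult nn_integral_sum A.emeasure_space_1)
      also have "\<dots> \<le> ((\<integral>\<^sup>+p. h1 n p \<partial>(A \<Otimes>\<^sub>M R n)) + ennreal (sqrt C) * mesh_error k) +
        ((ennreal \<epsilon> * (1 + (\<Sum>j<m. ennreal C)) + ennreal \<epsilon> * (1 + of_nat m)) + (\<Sum>i\<in>I. \<integral>\<^sup>+\<omega>. \<Delta> n i \<omega> \<partial>A)) + mesh_error k"
        using V2 h2_bound[OF n, of k]
        by (intro add_mono order_refl mult_left_mono sum_mono) (auto simp: nn_integral_add intro!: add_left_mono)
      also have "ennreal \<epsilon> * (1 + (\<Sum>j<m. ennreal C)) + ennreal \<epsilon> * (1 + of_nat m) = ennreal d"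
      proof -
        have "ennreal \<epsilon> * (1 + (\<Sum>j<m. ennreal C)) + ennreal \<epsilon> * (1 + of_nat m) = ennreal (\<epsilon> * (1 + m * C) + \<epsilon> * (1 + m))"
          using \<epsilon> C by (simp add: ennreal_mult ennreal_plus ennreal_of_nat_eq_real_of_nat)
        also have "\<epsilon> * (1 + m * C) + \<epsilon> * (1 + m) = \<epsilon> * (2 + m * (C + 1))" by (simp add: algebra_simps)
        also have "\<dots> = d" using C by (simp add: \<epsilon>_def add_pos_nonneg less_imp_neq[symmetric])
        finally show ?thesis .
      qed
      also have "((\<integral>\<^sup>+p. h1 n p \<partial>(A \<Otimes>\<^sub>M R n)) + ennreal (sqrt C) * mesh_error k) + (ennreal d + (\<Sum>i\<in>I. \<integral>\<^sup>+\<omega>. \<Delta> n i \<omega> \<partial>A)) + mesh_error k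
          = rest n + ennreal d + (ennreal (sqrt C) * mesh_error k + mesh_error k)"
        by (simp add: rest_def add_ac)
      also have "\<dots> \<le> rest n + ennreal d + ennreal d" using k by (intro add_left_mono) simp
      finally show ?thesis .
    qed
    have "rest \<longlonglongrightarrow> 0 + (\<Sum>i\<in>I. 0)"
      unfolding rest_def h1_def using trig(1) lin by (intro tendsto_add tendsto_sum) auto
    then have "\<forall>\<^sub>F n in sequentially. rest n < ennreal d" using d by (intro order_tendstoD) auto
    then show "\<forall>\<^sub>F n in sequentially. outer_measure_of A {\<omega> \<in> space A. ennreal e < ?S n \<omega>} \<le> ennreal r"
      using eventually_gt_at_top[of 0]
    proof eventually_elim
      case (elim n)
      have "outer_measure_of A {\<omega> \<in> space A. ennreal e < ?S n \<omega>} \<le> ennreal (1 / e) * (\<integral>\<^sup>+\<omega>. G n \<omega> \<partial>A)"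
        by (rule outer_measure_Markov[OF Gm e S_le])
      also have "\<dots> \<le> ennreal (1 / e) * (ennreal d + ennreal d + ennreal d)"
        using G_int[OF elim(2)] elim(1) by (intro mult_left_mono) (auto intro: order.trans add_mono)
      also have "\<dots> = ennreal r"
        using d e by (simp add: ennreal_plus[symmetric] ennreal_mult'[symmetric] d_def del: ennreal_plus)
      finally show ?case .
    qed
  qed
qed

end

end

section \<open>Convergence in distribution from bounded Lipschitz functions\<close>

lemma lipschitz_expectation_tendsto:
  fixes Z :: "nat \<Rightarrow> 'a \<Rightarrow> 's::metric_space"
  assumes BL: "\<And>\<psi>. \<psi> \<in> BL1 \<Longrightarrow> (\<lambda>n. \<integral>x. \<psi> (Z n x) \<partial>M) \<longlonglongrightarrow> (\<integral>y. \<psi> (T y) \<partial>N)"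
    and b: "\<And>x. \<bar>f x\<bar> \<le> K" and lip: "\<And>x y. \<bar>f x - f y\<bar> \<le> K * dist x y" and K: "0 < K"
  shows "(\<lambda>n. \<integral>x. f (Z n x) \<partial>M) \<longlonglongrightarrow> (\<integral>y. f (T y) \<partial>N)"
proof -
  have "(\<lambda>s. f s / K) \<in> BL1"
    using b lip K by (auto simp: BL1_def abs_le_iff minus_le_iff field_simps diff_divide_distrib[symmetric])
  from tendsto_mult_left[OF BL[OF this], of K] show ?thesis using K by simp
qed

text \<open>A bounded continuous function is a limit from below of bounded Lipschitz functions,
  which gives an asymptotic lower bound for its expectations; applied to the negative as well, this
  gives convergence.\<close>

lemma conv_in_distrI_BL1:
  fixes Z :: "nat \<Rightarrow> 'a \<Rightarrow> 's::metric_space"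
  assumes M: "prob_space M" and N: "prob_space N"
    and Z: "\<And>n. Z n \<in> borel_measurable M" and T: "T \<in> borel_measurable N"
    and BL: "\<And>\<psi>. \<psi> \<in> BL1 \<Longrightarrow> (\<lambda>n. \<integral>x. \<psi> (Z n x) \<partial>M) \<longlonglongrightarrow> (\<integral>y. \<psi> (T y) \<partial>N)"
  shows "conv_in_distr M Z N T"
  unfolding conv_in_distr_def
proof (intro conjI allI impI Z T)
  interpret M: prob_space M by (rule M)
  interpret N: prob_space N by (rule N)
  fix \<phi> :: "'s \<Rightarrow> real" assume \<phi>: "continuous_on UNIV \<phi> \<and> bounded (range \<phi>)"
  have cm: "(\<lambda>x. f (Y x)) \<in> borel_measurable S" if "continuous_on UNIV f" "Y \<in> borel_measurable S" for f :: "'s \<Rightarrow> real" and Y :: "'x \<Rightarrow> 's" and S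
    using measurable_compose[OF that(2) borel_measurable_continuous_onI[OF that(1)]] .
  have lower: "\<forall>\<^sub>F n in sequentially. (\<integral>x. f (Z n x) \<partial>M) > (\<integral>y. f (T y) \<partial>N) - e"
    if f: "continuous_on UNIV f" "bounded (range f)" and e: "0 < e" for f :: "'s \<Rightarrow> real" and e
  proof -
    obtain K0 where "\<And>x. \<bar>f x\<bar> \<le> K0" using f(2) by (auto simp: bounded_iff)
    then obtain K where K: "\<And>x. \<bar>f x\<bar> \<le> K" "0 < K"
      by (metis abs_le_iff le_max_iff_disj less_max_iff_disj max.cobounded1 zero_less_one)
    \<comment> \<open>Infimal convolution with \<open>k\<close> times the distance: it is Lipschitz
      with constant \<open>k\<close>, lies below \<open>f\<close>, and keeps the bounds of
      \<open>f\<close>.\<close>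
    define h where "h k x = (INF z. f z + real k * dist x z)" for k x
    have bdd: "bdd_below (range (\<lambda>z. f z + real k * dist x z))" for k x
      using K(1) by (intro bdd_belowI2[of _ "- K"]) (smt (verit) mult_nonneg_nonneg of_nat_0_le_iff zero_le_dist)
    have le: "h k x \<le> f z + real k * dist x z" for k x z
      unfolding h_def by (rule cINF_lower[OF bdd]) simp
    have hf: "h k x \<le> f x" for k x using le[of k x x] by simp
    have hK: "- K \<le> h k x" for k x
      unfolding h_def using K(1) by (intro cINF_greatest) (auto, smt (verit) mult_nonneg_nonneg of_nat_0_le_iff zero_le_dist)
    have lip1: "h k x \<le> h k y + real k * dist x y" for k x y
    proof -
      have "h k x - real k * dist x y \<le> h k y" unfolding h_def[of k y]
      proof (rule cINF_greatest)
        fix z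
        have "real k * dist x z \<le> real k * (dist x y + dist y z)" by (intro mult_left_mono dist_triangle) simp
        then show "h k x - real k * dist x y \<le> f z + real k * dist y z" using le[of k x z] by (simp add: algebra_simps)
      qed simp
      then show ?thesis by simp
    qed
    have habs: "\<bar>h k x\<bar> \<le> K" for k x using hf[of k x] hK[of k x] K(1)[of x] by auto
    have lip: "\<bar>h k x - h k y\<bar> \<le> real k * dist x y" for k x y
      using lip1[of k x y] lip1[of k y x] by (simp add: dist_commute abs_le_iff)
    have hc: "continuous_on UNIV (h k)" for k
    proof -
      have "(real k)-lipschitz_on UNIV (h k)" using lip by (auto simp: dist_real_def intro!: lipschitz_onI)
      then show ?thesis by (rule lipschitz_on_continuous_on)
    qed
    have conv: "(\<lambda>k. h k x) \<longlonglongrightarrow> f x" for x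
    proof (rule LIMSEQ_I)
      fix r :: real assume r: "0 < r"
      have "isCont f x" using f(1) by (simp add: continuous_on_eq_continuous_at)
      then obtain d where d: "0 < d" "\<And>z. dist z x < d \<Longrightarrow> dist (f z) (f x) < r / 2"
        using r unfolding continuous_at_eps_delta by (metis half_gt_zero)
      \<comment> \<open>Beyond distance \<open>d\<close> the penalty exceeds \<open>2 * K\<close>,
        the largest possible gain, so only nearby points compete in the infimum.\<close>
      obtain k0 :: nat where k0: "2 * K / d < k0" using reals_Archimedean2 by blast
      show "\<exists>k0. \<forall>k\<ge>k0. norm (h k x - f x) < r"
      proof (intro exI allI impI)
        fix k assume "k0 \<le> k"
        then have k: "2 * K < real k * d" using k0 d(1) by (simp add: field_simps) (smt (verit) mult_right_mono of_nat_le_iff mult.commute)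
        have "f x - r / 2 \<le> h k x" unfolding h_def
        proof (rule cINF_greatest)
          fix z
          show "f x - r / 2 \<le> f z + real k * dist x z"
          proof (cases "dist z x < d")
            case True
            then have "\<bar>f z - f x\<bar> < r / 2" using d(2)[of z] by (simp only: dist_real_def)
          then have "f x - r / 2 \<le> f z" by linarith
            moreover have "0 \<le> real k * dist x z" by simp
            ultimately show ?thesis by linarith
          next
            case False
            then have "real k * d \<le> real k * dist x z" by (intro mult_left_mono) (auto simp: dist_commute)
            then show ?thesis using k K(1)[of x] K(1)[of z] r by linarith
          qed
        qed simp
        then show "norm (h k x - f x) < r" using hf[of k x] r by auto
      qed
    qed
    have hT: "(\<lambda>k. \<integral>y. h k (T y) \<partial>N) \<longlonglongrightarrow> (\<integral>y. f (T y) \<partial>N)"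
      by (rule integral_dominated_convergence[where w="\<lambda>_. K"]) (use f hc T conv habs in \<open>auto intro: cm\<close>)
    then have "\<forall>\<^sub>F k in sequentially. (\<integral>y. h k (T y) \<partial>N) > (\<integral>y. f (T y) \<partial>N) - e"
      using e by (intro order_tendstoD) auto
    then obtain k where k: "(\<integral>y. h k (T y) \<partial>N) > (\<integral>y. f (T y) \<partial>N) - e" by (auto dest: eventually_happens)
    have "(\<lambda>n. \<integral>x. h k (Z n x) \<partial>M) \<longlonglongrightarrow> (\<integral>y. h k (T y) \<partial>N)"
    proof (rule lipschitz_expectation_tendsto[where f="h k" and Z=Z and T=T and K="K + real k"])
      show "\<bar>h k x\<bar> \<le> K + real k" for x using habs[of k x] by simp
      show "\<bar>h k x - h k y\<bar> \<le> (K + real k) * dist x y" for x y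
        using lip[of k x y] K(2) by (simp add: distrib_right add_increasing)
    qed (use K(2) BL in auto)
    then have "\<forall>\<^sub>F n in sequentially. (\<integral>x. h k (Z n x) \<partial>M) > (\<integral>y. f (T y) \<partial>N) - e"
      using k by (rule order_tendstoD)
    then show ?thesis
    proof eventually_elim
      case (elim n)
      have "(\<integral>x. h k (Z n x) \<partial>M) \<le> (\<integral>x. f (Z n x) \<partial>M)"
        by (intro integral_mono M.integrable_const_bound[where B=K] cm hc f Z hf) (use habs K(1) in auto)
      with elim show ?case by simp
    qed
  qed
  show "(\<lambda>n. \<integral>x. \<phi> (Z n x) \<partial>M) \<longlonglongrightarrow> (\<integral>y. \<phi> (T y) \<partial>N)"
  proof (rule order_tendstoI)
    fix a assume "a < (\<integral>y. \<phi> (T y) \<partial>N)"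
    then show "\<forall>\<^sub>F n in sequentially. a < (\<integral>x. \<phi> (Z n x) \<partial>M)"
      using lower[of \<phi> "(\<integral>y. \<phi> (T y) \<partial>N) - a"] \<phi> by simp
  next
    fix a assume a: "(\<integral>y. \<phi> (T y) \<partial>N) < a"
    have "bounded (range (\<lambda>x. - \<phi> x))" using \<phi> by (auto simp: bounded_iff)
    then show "\<forall>\<^sub>F n in sequentially. (\<integral>x. \<phi> (Z n x) \<partial>M) < a"
      using lower[of "\<lambda>x. - \<phi> x" "a - (\<integral>y. \<phi> (T y) \<partial>N)"] \<phi> a by (auto intro: continuous_on_minus)
  qed
qed

lemma tendsto_0_in_prob_cong:
  assumes "\<And>n \<omega>. n > 0 \<Longrightarrow> \<omega> \<in> space M \<Longrightarrow> Y n \<omega> = Z n \<omega>"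
  shows "tendsto_0_in_prob M Y \<longleftrightarrow> tendsto_0_in_prob M Z"
proof -
  have "\<forall>\<^sub>F n in sequentially. outer_measure_of M {\<omega> \<in> space M. Y n \<omega> > ennreal e} = outer_measure_of M {\<omega> \<in> space M. Z n \<omega> > ennreal e}" for e
    using eventually_gt_at_top[of 0]
  proof eventually_elim
    case (elim n)
    then have "{\<omega> \<in> space M. Y n \<omega> > ennreal e} = {\<omega> \<in> space M. Z n \<omega> > ennreal e}" using assms by auto
    then show ?case by simp
  qed
  then have "(\<lambda>n. outer_measure_of M {\<omega> \<in> space M. Y n \<omega> > ennreal e}) \<longlonglongrightarrow> 0
      \<longleftrightarrow> (\<lambda>n. outer_measure_of M {\<omega> \<in> space M. Z n \<omega> > ennreal e}) \<longlonglongrightarrow> 0" for e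
    by (rule tendsto_cong)
  then show ?thesis unfolding tendsto_0_in_prob_def by simp
qed

text \<open>For a deterministic sequence the exceptional event is empty or the whole space, so a
  probability below 1 makes it empty.\<close>

lemma (in prob_space) tendsto_0_in_prob_const:
  assumes "tendsto_0_in_prob M (\<lambda>n _. c n)" and "0 < e"
  shows "\<forall>\<^sub>F n in sequentially. c n \<le> ennreal e"
proof -
  have "(\<lambda>n. outer_measure_of M {x \<in> space M. c n > ennreal e}) \<longlonglongrightarrow> 0"
    using assms by (simp add: tendsto_0_in_prob_def)
  then have "\<forall>\<^sub>F n in sequentially. outer_measure_of M {x \<in> space M. c n > ennreal e} < 1"
    by (rule order_tendstoD) simp
  then show ?thesis
  proof eventually_elim
    case (elim n)
    show ?case
    proof (rule ccontr)
      assume "\<not> c n \<le> ennreal e"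
      then have "{x \<in> space M. c n > ennreal e} = space M" by auto
      then show False using elim by (simp add: outer_measure_of_eq emeasure_space_1)
    qed
  qed
qed

section \<open>Empirical quantile processes\<close>

lemma quantile_emp_cdf_joint_measurable:
  assumes "\<And>i. X i \<in> borel_measurable M"
  shows "(\<lambda>(\<omega>, u). quantile (emp_cdf n (\<lambda>i. X i \<omega>)) u) \<in> borel_measurable (M \<Otimes>\<^sub>M unit_borel)"
  unfolding emp_cdf_eq_boot_cdf using assms
  by (intro left_continuous_process_measurable quantile_left_continuous_finite_range finite_range_boot_cdf quantile_boot_cdf_measurable) auto

lemma L1_of_quantile_emp_cdf_measurable:
  assumes X: "\<And>i. X i \<in> borel_measurable M"
  shows "(\<lambda>\<omega>. L1_of (\<lambda>u. c * quantile (emp_cdf n (\<lambda>i. X i \<omega>)) u)) \<in> borel_measurable M"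
  unfolding emp_cdf_eq_boot_cdf
proof (rule measurable_L1_of_left_continuous)
  show "\<exists>C. \<forall>u\<in>{0<..<1}. \<bar>quantile (boot_cdf n (\<lambda>_. 1) (\<lambda>i. X i \<omega>)) u\<bar> \<le> C" for \<omega>
    using quantile_bounded_finite_range[OF finite_range_boot_cdf] by blast
qed (use X in \<open>auto simp: unit_const_integrable intro: quantile_boot_cdf_measurable quantile_left_continuous_finite_range finite_range_boot_cdf\<close>)

text \<open>For fixed weights the difference is a left-continuous process with bounded paths; the
  weights are then put back as a countably valued parameter.\<close>

lemma L1_of_quantile_boot_cdf_diff_measurable:
  assumes X: "\<And>i. X i \<in> borel_measurable M" and W: "\<And>i. i < n \<Longrightarrow> W i \<in> measurable M (count_space UNIV)"
  shows "(\<lambda>\<omega>. L1_of (\<lambda>u. c * (quantile (boot_cdf n (\<lambda>i. W i \<omega>) (\<lambda>i. X i \<omega>)) u - quantile (emp_cdf n (\<lambda>i. X i \<omega>)) u))) \<in> borel_measurable M"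
proof -
  have "(\<lambda>\<omega>. L1_of (\<lambda>u. c * (quantile (boot_cdf n w (\<lambda>i. X i \<omega>)) u - quantile (boot_cdf n (\<lambda>_. 1) (\<lambda>i. X i \<omega>)) u))) \<in> borel_measurable M" for w
  proof (rule measurable_L1_of_left_continuous)
    show "\<exists>C. \<forall>u\<in>{0<..<1}. \<bar>quantile (boot_cdf n w (\<lambda>i. X i \<omega>)) u - quantile (boot_cdf n (\<lambda>_. 1) (\<lambda>i. X i \<omega>)) u\<bar> \<le> C" for \<omega>
    proof -
      obtain C1 where C1: "\<And>u. \<bar>quantile (boot_cdf n w (\<lambda>i. X i \<omega>)) u\<bar> \<le> C1" using quantile_bounded_finite_range[OF finite_range_boot_cdf] by blast
      obtain C2 where C2: "\<And>u. \<bar>quantile (boot_cdf n (\<lambda>_. 1) (\<lambda>i. X i \<omega>)) u\<bar> \<le> C2" using quantile_bounded_finite_range[OF finite_range_boot_cdf] by blast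
      show ?thesis by (intro exI[of _ "C1 + C2"] ballI order_trans[OF abs_triangle_ineq4] add_mono C1 C2)
    qed
  qed (use X in \<open>auto simp: unit_const_integrable intro!: quantile_boot_cdf_measurable quantile_left_continuous_finite_range finite_range_boot_cdf borel_measurable_diff tendsto_diff\<close>)
  then have "(\<lambda>\<omega>. (\<lambda>xs \<omega>. L1_of (\<lambda>u. c * (quantile (boot_cdf n (\<lambda>i. xs ! i) (\<lambda>i. X i \<omega>)) u - quantile (boot_cdf n (\<lambda>_. 1) (\<lambda>i. X i \<omega>)) u)))
      (map (\<lambda>i. W i \<omega>) [0..<n]) \<omega>) \<in> borel_measurable M"
    by (rule measurable_compose_countable[OF _ measurable_map_upt[OF W]])
  moreover have "boot_cdf n (\<lambda>i. map (\<lambda>i. W i \<omega>) [0..<n] ! i) x = boot_cdf n (\<lambda>i. W i \<omega>) x" for \<omega> x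
    by (auto simp: boot_cdf_def fun_eq_iff intro!: sum.cong)
  ultimately show ?thesis by (simp add: emp_cdf_eq_boot_cdf)
qed

lemma linear_combination_emp_cdf:
  "(\<Sum>j<m. c j * emp_cdf n y (x j)) = sample_mean n (\<lambda>i. \<Sum>j<(m::nat). c j * indicator {..x j} (y i))"
  by (simp only: emp_cdf_eq_sample_mean sample_mean_sum sample_mean_cmult)

lemma nn_integral_square_diff_le:
  assumes [measurable]: "f \<in> borel_measurable M" "g \<in> borel_measurable M"
    and f: "(\<integral>\<^sup>+x. ennreal ((f x)\<^sup>2) \<partial>M) \<le> ennreal c" and g: "(\<integral>\<^sup>+x. ennreal ((g x)\<^sup>2) \<partial>M) \<le> ennreal c" and c: "0 \<le> c"
  shows "(\<integral>\<^sup>+x. ennreal ((f x - g x)\<^sup>2) \<partial>M) \<le> ennreal (4 * c)"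
proof -
  have "(\<integral>\<^sup>+x. ennreal ((f x - g x)\<^sup>2) \<partial>M) \<le> (\<integral>\<^sup>+x. 2 * ennreal ((f x)\<^sup>2) + 2 * ennreal ((g x)\<^sup>2) \<partial>M)"
  proof (rule nn_integral_mono)
    fix x
    have "0 \<le> (f x + g x)\<^sup>2" by simp
    then have "(f x - g x)\<^sup>2 \<le> 2 * (f x)\<^sup>2 + 2 * (g x)\<^sup>2" by (simp add: power2_sum power2_diff)
    then have "ennreal ((f x - g x)\<^sup>2) \<le> ennreal (2 * (f x)\<^sup>2 + 2 * (g x)\<^sup>2)" by (rule ennreal_leI)
    then show "ennreal ((f x - g x)\<^sup>2) \<le> 2 * ennreal ((f x)\<^sup>2) + 2 * ennreal ((g x)\<^sup>2)"
      by (simp add: ennreal_mult)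
  qed
  also have "\<dots> = 2 * (\<integral>\<^sup>+x. ennreal ((f x)\<^sup>2) \<partial>M) + 2 * (\<integral>\<^sup>+x. ennreal ((g x)\<^sup>2) \<partial>M)"
    by (subst nn_integral_add) (auto simp: nn_integral_cmult)
  also have "\<dots> \<le> 2 * ennreal c + 2 * ennreal c" by (intro add_mono mult_left_mono f g) auto
  also have "\<dots> = 4 * ennreal c" by (simp flip: distrib_right)
  also have "\<dots> = ennreal (4 * c)" using c by (simp add: ennreal_mult)
  finally show ?thesis by simp
qed

lemma (in prob_space) nn_integral_pair_snd:
  assumes "sigma_finite_measure R" "h \<in> borel_measurable R"
  shows "(\<integral>\<^sup>+p. h (snd p) \<partial>(M \<Otimes>\<^sub>M R)) = (\<integral>\<^sup>+x. h x \<partial>R)"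
proof -
  interpret R: sigma_finite_measure R by fact
  have "(\<lambda>p. h (snd p)) \<in> borel_measurable (M \<Otimes>\<^sub>M R)" by (rule measurable_compose[OF measurable_snd assms(2)])
  from R.nn_integral_fst[OF this, symmetric] show ?thesis by (simp add: emeasure_space_1)
qed

context integrable_quantile
begin

text \<open>\<open>F\<close> counts as an approximation of itself, so that comparing the sample with
  the population is an instance of \<open>linearization\<close>.\<close>

lemma approximates_cdf_F: "approximates_cdf F 1 P (\<lambda>_ _. F)"
  unfolding approximates_cdf_def using quantile_adjoint_cdf[OF \<mu>] by (auto intro: mult_nonneg_nonneg)

context
  fixes M :: "'a measure" and X :: "nat \<Rightarrow> 'a \<Rightarrow> real"
  assumes M: "prob_space M" and X: "iid_cdf M X F"
begin

interpretation M: prob_space M by (rule M)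

lemma sample_measurable [measurable]: "X i \<in> borel_measurable M"
  by (rule iid_cdfD(4)[OF M X])

text \<open>A sample of size one suffices: the tail condition bounds the expected area between its
  cdf and \<open>F\<close>, so almost surely \<open>Q\<close> has finite distance from an integrable
  quantile function. The conclusion is deterministic, hence it holds outright.\<close>

lemma Q_integrable: "integrable unit_leb Q"
proof -
  interpret pair_sigma_finite M lborel ..
  note G = approximates_cdfD[OF approximates_cdf_emp[OF M X], of 1, simplified]
  have Gm: "(\<lambda>(\<omega>, x). emp_cdf 1 (\<lambda>i. X i \<omega>) x - F x) \<in> borel_measurable (M \<Otimes>\<^sub>M lborel)"
  proof -
    have [measurable]: "(\<lambda>p. emp_cdf 1 (\<lambda>i. X i (fst p)) (snd p)) \<in> borel_measurable (M \<Otimes>\<^sub>M lborel)"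
      using emp_cdf_joint_measurable[of X M 1] by (simp add: case_prod_beta' measurable_cong_sets[OF sets_pair_measure_cong[OF refl sets_lborel] refl])
    show ?thesis unfolding case_prod_beta' by measurable
  qed
  have "(\<integral>\<^sup>+\<omega>. \<integral>\<^sup>+x. ennreal \<bar>emp_cdf 1 (\<lambda>i. X i \<omega>) x - F x\<bar> \<partial>lborel \<partial>M)
      = (\<integral>\<^sup>+x. \<integral>\<^sup>+\<omega>. ennreal \<bar>emp_cdf 1 (\<lambda>i. X i \<omega>) x - F x\<bar> \<partial>M \<partial>lborel)"
    using Gm by (intro Fubini'[symmetric]) (simp add: case_prod_beta')
  also have "\<dots> \<le> (\<integral>\<^sup>+x. ennreal (sqrt (F x * (1 - F x))) \<partial>lborel)"
  proof (rule nn_integral_mono)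
    fix x
    show "(\<integral>\<^sup>+\<omega>. ennreal \<bar>emp_cdf 1 (\<lambda>i. X i \<omega>) x - F x\<bar> \<partial>M) \<le> ennreal (sqrt (F x * (1 - F x)))"
      using G(5)[of x] G(7)[of x] by (intro M.nn_integral_abs_le_second_moment) auto
  qed
  also have "\<dots> < \<infinity>" by (rule tail_cdf)
  finally have "AE \<omega> in M. (\<integral>\<^sup>+x. ennreal \<bar>emp_cdf 1 (\<lambda>i. X i \<omega>) x - F x\<bar> \<partial>lborel) \<noteq> \<infinity>"
    using Gm by (intro nn_integral_PInf_AE lborel.borel_measurable_nn_integral) (auto simp: case_prod_beta')
  then have "AE \<omega> in M. integrable unit_leb Q"
  proof eventually_elim
    case (elim \<omega>)
    let ?G = "emp_cdf 1 (\<lambda>i. X i \<omega>)"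
    have "(\<integral>\<^sup>+u. ennreal \<bar>quantile ?G u - Q u\<bar> \<partial>unit_borel) = (\<integral>\<^sup>+x. ennreal \<bar>?G x - F x\<bar> \<partial>lborel)"
      unfolding Q_def
      by (rule nn_integral_abs_diff_quantile) (auto simp: emp_cdf_measurable emp_cdf_bounds quantile_adjoint_emp_cdf quantile_adjoint_cdf \<mu>)
    then have "integrable unit_leb (\<lambda>u. quantile ?G u - Q u)"
      using elim by (intro integrable_unit_lebI borel_measurable_diff Q_measurable quantile_finite_range_measurable finite_range_emp_cdf)
        (simp add: less_top)
    from Bochner_Integration.integrable_diff[OF quantile_finite_range_integrable[OF finite_range_emp_cdf[of 1 "\<lambda>i. X i \<omega>"]] this]
    show ?case by simp
  qed
  then show ?thesis by simp
qed

lemma emp_process_integrable: "integrable unit_leb (\<lambda>u. sqrt n * (quantile (emp_cdf n x) u - Q u))"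
  by (intro integrable_mult_right Bochner_Integration.integrable_diff quantile_finite_range_integrable finite_range_emp_cdf Q_integrable)

lemma emp_process_L1_measurable: "(\<lambda>\<omega>. L1_of (\<lambda>u. sqrt n * (quantile (emp_cdf n (\<lambda>i. X i \<omega>)) u - Q u))) \<in> borel_measurable M"
proof -
  have "L1_of (\<lambda>u. sqrt n * (quantile (emp_cdf n x) u - Q u)) = L1_of (\<lambda>u. sqrt n * quantile (emp_cdf n x) u) - L1_of (\<lambda>u. sqrt n * Q u)" for x
    by (subst L1_of_diff[symmetric])
      (auto simp: right_diff_distrib Q_integrable intro!: integrable_mult_right quantile_finite_range_integrable finite_range_emp_cdf)
  moreover have "(\<lambda>x :: l1. x - L1_of (\<lambda>u. sqrt n * Q u)) \<in> borel_measurable borel"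
    by (intro borel_measurable_continuous_onI continuous_intros)
  ultimately show ?thesis
    using measurable_compose[OF L1_of_quantile_emp_cdf_measurable[where X=X and M=M and n=n, OF sample_measurable]] by simp
qed

lemma emp_linearization_measurable:
  "(\<lambda>\<omega>. \<integral>\<^sup>+u. ennreal \<bar>sqrt n * (quantile (emp_cdf n (\<lambda>i. X i \<omega>)) u - Q u)
    + q u * (sqrt n * (emp_cdf n (\<lambda>i. X i \<omega>) (Q u) - F (Q u)))\<bar> \<partial>unit_borel) \<in> borel_measurable M"
proof (rule unit_borel.borel_measurable_nn_integral)
  have [measurable]: "(\<lambda>p. quantile (emp_cdf n (\<lambda>i. X i (fst p))) (snd p)) \<in> borel_measurable (M \<Otimes>\<^sub>M unit_borel)"
    using quantile_emp_cdf_joint_measurable[of X M n] by (simp add: case_prod_beta')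
  have [measurable]: "Q \<in> borel_measurable unit_borel" "q \<in> borel_measurable unit_borel" by (auto intro: Q_measurable)
  have [measurable]: "(\<lambda>p. emp_cdf n (\<lambda>i. X i (fst p)) (Q (snd p))) \<in> borel_measurable (M \<Otimes>\<^sub>M unit_borel)"
    using measurable_compose[OF _ emp_cdf_joint_measurable[of X M n], of "\<lambda>p. (fst p, Q (snd p))"] by simp
  show "(\<lambda>(\<omega>, u). ennreal \<bar>sqrt n * (quantile (emp_cdf n (\<lambda>i. X i \<omega>)) u - Q u)
      + q u * (sqrt n * (emp_cdf n (\<lambda>i. X i \<omega>) (Q u) - F (Q u)))\<bar>) \<in> borel_measurable (M \<Otimes>\<^sub>M unit_borel)"
    unfolding case_prod_beta' by measurable
qed

lemma emp_linearization: "(\<lambda>n. \<integral>\<^sup>+\<omega>. \<integral>\<^sup>+u. ennreal \<bar>sqrt n * (quantile (emp_cdf n (\<lambda>i. X i \<omega>)) u - Q u)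
    + q u * (sqrt n * (emp_cdf n (\<lambda>i. X i \<omega>) (Q u) - F (Q u)))\<bar> \<partial>unit_borel \<partial>M) \<longlonglongrightarrow> 0"
  using linearization[where P="\<lambda>_. M" and C=1, OF M approximates_cdf_emp[OF M X] approximates_cdf_F] by (simp add: Q_def)

lemma emp_linearization_in_prob: "tendsto_0_in_prob M (\<lambda>n \<omega>. \<integral>\<^sup>+u. ennreal \<bar>sqrt n * (quantile (emp_cdf n (\<lambda>i. X i \<omega>)) u - Q u)
    + q u * (sqrt n * (emp_cdf n (\<lambda>i. X i \<omega>) (Q u) - F (Q u)))\<bar> \<partial>unit_borel)" (is "tendsto_0_in_prob M ?Y")
  unfolding tendsto_0_in_prob_def
proof (intro allI impI)
  fix e :: real assume e: "0 < e"
  have "(\<lambda>n. ennreal (1 / e) * (\<integral>\<^sup>+\<omega>. ?Y n \<omega> \<partial>M)) \<longlonglongrightarrow> ennreal (1 / e) * 0"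
    by (intro ennreal_tendsto_cmult emp_linearization) simp
  then show "(\<lambda>n. outer_measure_of M {\<omega> \<in> space M. ?Y n \<omega> > ennreal e}) \<longlonglongrightarrow> 0"
    unfolding mult_zero_right
    by (rule ennreal_squeeze[rotated]) (rule outer_measure_Markov[OF emp_linearization_measurable e order_refl])
qed

context
  fixes N :: "'c measure" and B :: "'c \<Rightarrow> real \<Rightarrow> real"
  assumes bridge: "bridge N B"
begin

interpretation N: bridge N B by (rule bridge)

text \<open>Both spaces of the conditional statement are taken to be \<open>M\<close> and the
  process ignores the first, so the supremum is a deterministic sequence.\<close>

lemma emp_BL1_uniform: "tendsto_0_in_prob M (\<lambda>n _. SUP \<psi>\<in>BL1. ennreal \<bar>(\<integral>\<omega>. \<psi> (L1_of (\<lambda>u. sqrt n * (quantile (emp_cdf n (\<lambda>i. X i \<omega>)) u - Q u))) \<partial>M)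
    - (\<integral>y. \<psi> (L1_of (\<lambda>u. - (q u * B y u))) \<partial>N)\<bar>)"
proof (rule conditional_convergence[OF bridge, where R="\<lambda>_. M" and C=1
      and D="\<lambda>n _ \<omega> x. sqrt n * (emp_cdf n (\<lambda>i. X i \<omega>) x - F x)"])
  have sf: "sigma_finite_measure M" by unfold_locales
  have Xs [measurable]: "(\<lambda>p. X i (snd p)) \<in> borel_measurable (M \<Otimes>\<^sub>M M)" for i
    by (rule measurable_compose[OF measurable_snd sample_measurable])
  note G = approximates_cdfD[OF approximates_cdf_emp[OF M X]]
  show "(\<lambda>(p, u). sqrt n * (quantile (emp_cdf n (\<lambda>i. X i (snd p))) u - Q u)) \<in> borel_measurable ((M \<Otimes>\<^sub>M M) \<Otimes>\<^sub>M unit_borel)" for n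
  proof -
    have [measurable]: "(\<lambda>p. quantile (emp_cdf n (\<lambda>i. X i (snd (fst p)))) (snd p)) \<in> borel_measurable ((M \<Otimes>\<^sub>M M) \<Otimes>\<^sub>M unit_borel)"
      using quantile_emp_cdf_joint_measurable[of "\<lambda>i p. X i (snd p)" "M \<Otimes>\<^sub>M M" n] by (simp add: case_prod_beta')
    have [measurable]: "Q \<in> borel_measurable unit_borel" by (rule Q_measurable)
    show ?thesis unfolding case_prod_beta' by measurable
  qed
  show "(\<lambda>(p, x). sqrt n * (emp_cdf n (\<lambda>i. X i (snd p)) x - F x)) \<in> borel_measurable ((M \<Otimes>\<^sub>M M) \<Otimes>\<^sub>M borel)" for n
  proof -
    have [measurable]: "(\<lambda>p. emp_cdf n (\<lambda>i. X i (snd (fst p))) (snd p)) \<in> borel_measurable ((M \<Otimes>\<^sub>M M) \<Otimes>\<^sub>M borel)"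
      using emp_cdf_joint_measurable[of "\<lambda>i p. X i (snd p)" "M \<Otimes>\<^sub>M M" n] by (simp add: case_prod_beta')
    show ?thesis unfolding case_prod_beta' by measurable
  qed
  show "(\<lambda>n. \<integral>\<^sup>+p. \<integral>\<^sup>+u. ennreal \<bar>sqrt n * (quantile (emp_cdf n (\<lambda>i. X i (snd p))) u - Q u)
      + q u * (sqrt n * (emp_cdf n (\<lambda>i. X i (snd p)) (Q u) - F (Q u)))\<bar> \<partial>unit_borel \<partial>(M \<Otimes>\<^sub>M M)) \<longlonglongrightarrow> 0"
    unfolding M.nn_integral_pair_snd[OF sf emp_linearization_measurable] by (rule emp_linearization)
  show "(\<integral>\<^sup>+p. ennreal ((sqrt n * (emp_cdf n (\<lambda>i. X i (snd p)) x - F x))\<^sup>2) \<partial>(M \<Otimes>\<^sub>M M)) \<le> ennreal (1 * (F x * (1 - F x)))"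
    if n: "0 < n" for n x
  proof -
    have [measurable]: "(\<lambda>\<omega>. emp_cdf n (\<lambda>i. X i \<omega>) x) \<in> borel_measurable M" by (rule G(5)[OF n])
    show ?thesis using G(7)[OF n, of x] by (subst M.nn_integral_pair_snd[OF sf, where h="\<lambda>\<omega>. ennreal ((sqrt n * (emp_cdf n (\<lambda>i. X i \<omega>) x - F x))\<^sup>2)"]) auto
  qed
  show "(\<integral>\<^sup>+p. ennreal ((sqrt n * (emp_cdf n (\<lambda>i. X i (snd p)) x - F x) - sqrt n * (emp_cdf n (\<lambda>i. X i (snd p)) y - F y))\<^sup>2) \<partial>(M \<Otimes>\<^sub>M M))
      \<le> ennreal (1 * \<bar>F x - F y\<bar>)" if n: "0 < n" for n x y
  proof -
    have [measurable]: "(\<lambda>\<omega>. emp_cdf n (\<lambda>i. X i \<omega>) x) \<in> borel_measurable M" for x by (rule G(5)[OF n])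
    show ?thesis using G(8)[OF n, of x y]
      by (subst M.nn_integral_pair_snd[OF sf, where h="\<lambda>\<omega>. ennreal ((sqrt n * (emp_cdf n (\<lambda>i. X i \<omega>) x - F x) - sqrt n * (emp_cdf n (\<lambda>i. X i \<omega>) y - F y))\<^sup>2)"]) auto
  qed
  show "(\<lambda>n. \<integral>\<^sup>+_. ennreal \<bar>(\<integral>\<omega>. cos ((\<Sum>j<m. c j * (sqrt n * (emp_cdf n (\<lambda>i. X i \<omega>) (x j) - F (x j)))) + \<theta>) \<partial>M)
      - (\<integral>y. cos ((\<Sum>j<m. c j * B y (F (x j))) + \<theta>) \<partial>N)\<bar> \<partial>M) \<longlonglongrightarrow> 0" for m :: nat and c x \<theta>
  proof -
    let ?\<nu> = "distr M borel (X 0)"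
    interpret \<nu>: real_distribution ?\<nu> by (rule iid_cdfD(1)[OF M X])
    define g where "g s = (\<Sum>j<m. c j * indicator {..x j} s)" for s :: real
    have g [measurable]: "g \<in> borel_measurable borel" unfolding g_def by measurable
    have gA: "\<bar>g s\<bar> \<le> (\<Sum>j<m. \<bar>c j\<bar>)" for s unfolding g_def
      by (intro order.trans[OF sum_abs] sum_mono) (simp add: indicator_def)
    have "(\<integral>s. g s \<partial>?\<nu>) = (\<Sum>j<m. c j * F (x j))"
    proof -
      have "integrable ?\<nu> (\<lambda>s. c j * indicator {..x j} s)" for j
        by (rule \<nu>.integrable_const_bound[where B="\<bar>c j\<bar>"]) (auto simp: abs_mult indicator_def)
      then have "(\<integral>s. g s \<partial>?\<nu>) = (\<Sum>j<m. \<integral>s. c j * indicator {..x j} s \<partial>?\<nu>)"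
        unfolding g_def by (rule Bochner_Integration.integral_sum)
      then show ?thesis unfolding iid_cdfD(3)[OF M X, of 0] by (simp add: cdf_def)
    qed
    then have comb: "(\<Sum>j<m. c j * (sqrt n * (emp_cdf n y (x j) - F (x j)))) = sqrt n * (sample_mean n (\<lambda>i. g (y i)) - (\<integral>s. g s \<partial>?\<nu>))" for n y
      unfolding g_def linear_combination_emp_cdf[symmetric] by (simp add: algebra_simps sum_subtractf sum_distrib_left)
    define r where "r = exp (- (\<integral>s. (g s - (\<integral>s. g s \<partial>?\<nu>))\<^sup>2 \<partial>?\<nu>) / 2)"
    have lim: "(\<integral>y. cos ((\<Sum>j<m. c j * B y (F (x j))) + \<theta>) \<partial>N) = r * cos \<theta>"
      unfolding iid_cdfD(3)[OF M X, of 0] r_def g_def by (rule N.expectation_cos[OF \<nu>.real_distribution_axioms])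
    have [measurable]: "(\<lambda>\<omega>. sqrt n * (sample_mean n (\<lambda>i. g (X i \<omega>)) - (\<integral>s. g s \<partial>?\<nu>))) \<in> borel_measurable M" for n
      unfolding sample_mean_def by measurable
    have char: "(\<lambda>n. ennreal (cmod ((\<integral>\<omega>. iexp (sqrt n * (sample_mean n (\<lambda>i. g (X i \<omega>)) - (\<integral>s. g s \<partial>?\<nu>))) \<partial>M) - of_real r))) \<longlonglongrightarrow> ennreal 0"
      unfolding r_def by (intro tendsto_ennrealI sampling_char_tendsto[OF M X g gA])
    show ?thesis unfolding comb lim nn_integral_const M.emeasure_space_1 mult_1_right
      by (rule ennreal_squeeze[OF _ char[unfolded ennreal_0]]) (intro ennreal_leI expectation_cos_diff_le M, measurable)
  qed
qed (use M emp_process_L1_measurable in auto)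

lemma emp_conv_in_distr: "conv_in_distr M (\<lambda>n \<omega>. L1_of (\<lambda>u. sqrt n * (quantile (emp_cdf n (\<lambda>i. X i \<omega>)) u - Q u))) N (\<lambda>y. L1_of (\<lambda>u. - (q u * B y u)))"
proof (rule conv_in_distrI_BL1[OF M N.prob_space_axioms emp_process_L1_measurable limit_measurable[OF bridge]])
  fix \<psi> :: "l1 \<Rightarrow> real" assume \<psi>: "\<psi> \<in> BL1"
  let ?d = "\<lambda>\<psi> n. (\<integral>\<omega>. \<psi> (L1_of (\<lambda>u. sqrt n * (quantile (emp_cdf n (\<lambda>i. X i \<omega>)) u - Q u))) \<partial>M) - (\<integral>y. \<psi> (L1_of (\<lambda>u. - (q u * B y u))) \<partial>N)"
  show "(\<lambda>n. \<integral>\<omega>. \<psi> (L1_of (\<lambda>u. sqrt n * (quantile (emp_cdf n (\<lambda>i. X i \<omega>)) u - Q u))) \<partial>M) \<longlonglongrightarrow> (\<integral>y. \<psi> (L1_of (\<lambda>u. - (q u * B y u))) \<partial>N)"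
  proof (rule LIMSEQ_I)
    fix e :: real assume e: "0 < e"
    from M.tendsto_0_in_prob_const[OF emp_BL1_uniform, of "e / 2"] e
    have "\<forall>\<^sub>F n in sequentially. (SUP \<psi>\<in>BL1. ennreal \<bar>?d \<psi> n\<bar>) \<le> ennreal (e / 2)" by simp
    then have "\<forall>\<^sub>F n in sequentially. norm (?d \<psi> n) < e"
    proof eventually_elim
      case (elim n)
      have "ennreal \<bar>?d \<psi> n\<bar> \<le> (SUP \<psi>\<in>BL1. ennreal \<bar>?d \<psi> n\<bar>)" using \<psi> by (rule SUP_upper)
      also note elim
      finally show ?case using e by (simp add: ennreal_le_iff)
    qed
    then show "\<exists>n0. \<forall>n\<ge>n0. norm (?d \<psi> n) < e" by (simp add: eventually_sequentially)
  qed
qed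

end

end

end

context integrable_quantile
begin

text \<open>Resample and sample deviate from \<open>F\<close> with constant 4 each; subtracting the
  two multiplies the bound by another 4, hence \<open>C = 16\<close>.\<close>

lemma boot_BL1_uniform:
  fixes M :: "'a measure" and X :: "nat \<Rightarrow> 'a \<Rightarrow> real" and N :: "'c measure" and B :: "'c \<Rightarrow> real \<Rightarrow> real"
  assumes M: "prob_space M" and X: "iid_cdf M X F" and bridge: "bridge N B"
  shows "tendsto_0_in_prob M (\<lambda>n \<omega>. SUP \<psi>\<in>BL1.
    ennreal \<bar>(\<integral>J. \<psi> (L1_of (\<lambda>u. sqrt n * (quantile (emp_cdf n (\<lambda>j. X (J j) \<omega>)) u - quantile (emp_cdf n (\<lambda>i. X i \<omega>)) u))) \<partial>resampling n)
      - (\<integral>y. \<psi> (L1_of (\<lambda>u. - (q u * B y u))) \<partial>N)\<bar>)"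
proof (rule conditional_convergence[OF bridge, where R="\<lambda>n. measure_pmf (resampling n)" and C=16
      and D="\<lambda>n \<omega> J x. sqrt n * (emp_cdf n (\<lambda>j. X (J j) \<omega>) x - emp_cdf n (\<lambda>i. X i \<omega>) x)"])
  interpret M: prob_space M by (rule M)
  interpret N: bridge N B by (rule bridge)
  let ?R = "\<lambda>n. measure_pmf (resampling n)"
  have Xm: "X i \<in> borel_measurable M" for i by (rule iid_cdfD(4)[OF M X])
  have Xf: "(\<lambda>p. X i (fst p)) \<in> borel_measurable (M \<Otimes>\<^sub>M ?R n)" for i n
    by (rule measurable_compose[OF measurable_fst Xm])
  note Xr = resampled_value_measurable[of X M, OF Xm]
  have Gapp: "approximates_cdf F 4 (\<lambda>n. M \<Otimes>\<^sub>M ?R n) (\<lambda>n p. emp_cdf n (\<lambda>j. X (snd p j) (fst p)))"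
    by (rule approximates_cdf_boot[OF M X])
  have Happ: "approximates_cdf F 4 (\<lambda>n. M \<Otimes>\<^sub>M ?R n) (\<lambda>n p. emp_cdf n (\<lambda>i. X i (fst p)))"
    by (rule approximates_cdf_pullback[OF M X]) (simp_all add: measure_pmf.prob_space_axioms)
  note G = approximates_cdfD[OF Gapp] and H = approximates_cdfD[OF Happ]
  show "(\<lambda>(p, u). sqrt n * (quantile (emp_cdf n (\<lambda>j. X (snd p j) (fst p))) u - quantile (emp_cdf n (\<lambda>i. X i (fst p))) u))
      \<in> borel_measurable ((M \<Otimes>\<^sub>M ?R n) \<Otimes>\<^sub>M unit_borel)" for n
    using quantile_emp_cdf_joint_measurable[of "\<lambda>j p. X (snd p j) (fst p)" "M \<Otimes>\<^sub>M ?R n" n, OF Xr]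
      quantile_emp_cdf_joint_measurable[of "\<lambda>i p. X i (fst p)" "M \<Otimes>\<^sub>M ?R n" n, OF Xf]
    unfolding case_prod_beta' by (intro borel_measurable_times borel_measurable_diff) auto
  show "(\<lambda>(p, x). sqrt n * (emp_cdf n (\<lambda>j. X (snd p j) (fst p)) x - emp_cdf n (\<lambda>i. X i (fst p)) x))
      \<in> borel_measurable ((M \<Otimes>\<^sub>M ?R n) \<Otimes>\<^sub>M borel)" for n
    using emp_cdf_joint_measurable[of "\<lambda>j p. X (snd p j) (fst p)" "M \<Otimes>\<^sub>M ?R n" n, OF Xr]
      emp_cdf_joint_measurable[of "\<lambda>i p. X i (fst p)" "M \<Otimes>\<^sub>M ?R n" n, OF Xf]
    unfolding case_prod_beta' by (intro borel_measurable_times borel_measurable_diff) auto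
  show "(\<lambda>n. \<integral>\<^sup>+p. \<integral>\<^sup>+u. ennreal \<bar>sqrt n * (quantile (emp_cdf n (\<lambda>j. X (snd p j) (fst p))) u - quantile (emp_cdf n (\<lambda>i. X i (fst p))) u)
      + q u * (sqrt n * (emp_cdf n (\<lambda>j. X (snd p j) (fst p)) (Q u) - emp_cdf n (\<lambda>i. X i (fst p)) (Q u)))\<bar> \<partial>unit_borel \<partial>(M \<Otimes>\<^sub>M ?R n)) \<longlonglongrightarrow> 0"
  proof (rule linearization[OF _ Gapp Happ])
    fix n
    interpret MR: pair_prob_space M "?R n" ..
    show "prob_space (M \<Otimes>\<^sub>M ?R n)" by (rule MR.prob_space_axioms)
  qed simp
  show "(\<integral>\<^sup>+p. ennreal ((sqrt n * (emp_cdf n (\<lambda>j. X (snd p j) (fst p)) x - emp_cdf n (\<lambda>i. X i (fst p)) x))\<^sup>2) \<partial>(M \<Otimes>\<^sub>M ?R n))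
      \<le> ennreal (16 * (F x * (1 - F x)))" if n: "0 < n" for n x
  proof -
    note [measurable] = G(5)[OF n] H(5)[OF n]
    have "(\<integral>\<^sup>+p. ennreal ((sqrt n * (emp_cdf n (\<lambda>j. X (snd p j) (fst p)) x - F x) - sqrt n * (emp_cdf n (\<lambda>i. X i (fst p)) x - F x))\<^sup>2) \<partial>(M \<Otimes>\<^sub>M ?R n))
        \<le> ennreal (4 * (4 * (F x * (1 - F x))))"
      by (intro nn_integral_square_diff_le G(7)[OF n] H(7)[OF n]) auto
    then show ?thesis by (simp add: right_diff_distrib)
  qed
  show "(\<integral>\<^sup>+p. ennreal ((sqrt n * (emp_cdf n (\<lambda>j. X (snd p j) (fst p)) x - emp_cdf n (\<lambda>i. X i (fst p)) x)
        - sqrt n * (emp_cdf n (\<lambda>j. X (snd p j) (fst p)) y - emp_cdf n (\<lambda>i. X i (fst p)) y))\<^sup>2) \<partial>(M \<Otimes>\<^sub>M ?R n))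
      \<le> ennreal (16 * \<bar>F x - F y\<bar>)" if n: "0 < n" for n x y
  proof -
    note [measurable] = G(5)[OF n] H(5)[OF n]
    have "(\<integral>\<^sup>+p. ennreal (((sqrt n * (emp_cdf n (\<lambda>j. X (snd p j) (fst p)) x - F x) - sqrt n * (emp_cdf n (\<lambda>j. X (snd p j) (fst p)) y - F y))
          - (sqrt n * (emp_cdf n (\<lambda>i. X i (fst p)) x - F x) - sqrt n * (emp_cdf n (\<lambda>i. X i (fst p)) y - F y)))\<^sup>2) \<partial>(M \<Otimes>\<^sub>M ?R n))
        \<le> ennreal (4 * (4 * \<bar>F x - F y\<bar>))"
      by (intro nn_integral_square_diff_le G(8)[OF n] H(8)[OF n]) auto
    moreover have "(s * (a - f) - s * (b - g)) - (s * (c - f) - s * (d - g)) = s * (a - c) - s * (b - d)" for s a b c d f g :: real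
      by (simp add: algebra_simps)
    ultimately show ?thesis by simp
  qed
  show "(\<lambda>n. \<integral>\<^sup>+\<omega>. ennreal \<bar>(\<integral>J. cos ((\<Sum>j<m. c j * (sqrt n * (emp_cdf n (\<lambda>j. X (J j) \<omega>) (x j) - emp_cdf n (\<lambda>i. X i \<omega>) (x j)))) + \<theta>) \<partial>resampling n)
      - (\<integral>y. cos ((\<Sum>j<m. c j * B y (F (x j))) + \<theta>) \<partial>N)\<bar> \<partial>M) \<longlonglongrightarrow> 0" for m :: nat and c x \<theta>
  proof -
    let ?\<nu> = "distr M borel (X 0)"
    interpret \<nu>: real_distribution ?\<nu> by (rule iid_cdfD(1)[OF M X])
    define g where "g s = (\<Sum>j<m. c j * indicator {..x j} s)" for s :: real
    have g [measurable]: "g \<in> borel_measurable borel" unfolding g_def by measurable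
    have gA: "\<bar>g s\<bar> \<le> (\<Sum>j<m. \<bar>c j\<bar>)" for s unfolding g_def
      by (intro order.trans[OF sum_abs] sum_mono) (simp add: indicator_def)
    have comb: "(\<Sum>j<m. c j * (sqrt n * (emp_cdf n z (x j) - emp_cdf n y (x j)))) = sqrt n * (sample_mean n (\<lambda>i. g (z i)) - sample_mean n (\<lambda>i. g (y i)))" for n z y
      unfolding g_def linear_combination_emp_cdf[symmetric] by (simp add: algebra_simps sum_subtractf sum_distrib_left)
    define r where "r = exp (- (\<integral>s. (g s - (\<integral>s. g s \<partial>?\<nu>))\<^sup>2 \<partial>?\<nu>) / 2)"
    have lim: "(\<integral>y. cos ((\<Sum>j<m. c j * B y (F (x j))) + \<theta>) \<partial>N) = r * cos \<theta>"
      unfolding iid_cdfD(3)[OF M X, of 0] r_def g_def by (rule N.expectation_cos[OF \<nu>.real_distribution_axioms])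
    show ?thesis unfolding comb lim
    proof (rule ennreal_squeeze)
      show "(\<lambda>n. \<integral>\<^sup>+\<omega>. ennreal (cmod ((\<integral>J. iexp (sqrt n * (sample_mean n (\<lambda>j. g (X (J j) \<omega>)) - sample_mean n (\<lambda>i. g (X i \<omega>))))
          \<partial>resampling n) - of_real r)) \<partial>M) \<longlonglongrightarrow> 0"
        unfolding r_def by (rule resampling_char_tendsto[OF M X g gA])
    qed (intro nn_integral_mono ennreal_leI expectation_cos_diff_le measure_pmf.prob_space_axioms, simp)
  qed
qed (auto simp: M measure_pmf.prob_space_axioms)

end

text \<open>For fixed data the expectation over the weights becomes one over index draws, where the
  bootstrap cdf is the empirical cdf of the drawn values.\<close>

lemma boot_transfer:
  assumes M': "prob_space M'" and n: "n > 0" and W: "multinomial_distributed M' n {..<n} (\<lambda>_. 1 / real n) W"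
  shows "(\<integral>x'. \<psi> (L1_of (\<lambda>u. c * (quantile (boot_cdf n (\<lambda>i. W i x') x) u - quantile (emp_cdf n x) u))) \<partial>M')
    = (\<integral>J. (\<psi> :: l1 \<Rightarrow> real) (L1_of (\<lambda>u. c * (quantile (emp_cdf n (\<lambda>j. x (J j))) u - quantile (emp_cdf n x) u))) \<partial>resampling n)"
proof -
  define h where "h w = \<psi> (L1_of (\<lambda>u. c * (quantile (boot_cdf n w x) u - quantile (emp_cdf n x) u)))" for w
  have "(\<integral>x'. h (\<lambda>i. W i x') \<partial>M') = (\<integral>J. h (draw_counts n J) \<partial>resampling n)"
  proof (rule multinomial_expectation[OF M' n W])
    fix k l :: "nat \<Rightarrow> nat" assume "\<And>i. i < n \<Longrightarrow> k i = l i"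
    then have "boot_cdf n k x = boot_cdf n l x" by (simp add: boot_cdf_def fun_eq_iff)
    then show "h k = h l" by (simp add: h_def)
  qed
  also have "\<dots> = (\<integral>J. \<psi> (L1_of (\<lambda>u. c * (quantile (emp_cdf n (\<lambda>j. x (J j))) u - quantile (emp_cdf n x) u))) \<partial>resampling n)"
  proof (rule integral_cong_AE)
    show "AE J in resampling n. h (draw_counts n J) = \<psi> (L1_of (\<lambda>u. c * (quantile (emp_cdf n (\<lambda>j. x (J j))) u - quantile (emp_cdf n x) u)))"
    proof (rule AE_pmfI)
      fix J assume "J \<in> set_pmf (resampling n)"
      then have "boot_cdf n (draw_counts n J) x = emp_cdf n (\<lambda>j. x (J j))"
        by (intro ext boot_cdf_draw_counts) (rule resampling_less[OF n])
      then show "h (draw_counts n J) = \<psi> (L1_of (\<lambda>u. c * (quantile (emp_cdf n (\<lambda>j. x (J j))) u - quantile (emp_cdf n x) u)))"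
        by (simp add: h_def)
    qed
  qed simp_all
  finally show ?thesis by (simp add: h_def)
qed

section \<open>Transfer to the given density and weights\<close>

theorem theorem3p1:
  fixes M :: "'a measure" and M' :: "'b measure" and N :: "'c measure"
    and X :: "nat \<Rightarrow> 'a \<Rightarrow> real" and W :: "nat \<Rightarrow> nat \<Rightarrow> 'b \<Rightarrow> nat"
    and B :: "'c \<Rightarrow> real \<Rightarrow> real" and F Q q :: "real \<Rightarrow> real"
    and Qn :: "nat \<Rightarrow> 'a \<Rightarrow> real \<Rightarrow> real" and Qn_star :: "nat \<Rightarrow> 'a \<times> 'b \<Rightarrow> real \<Rightarrow> real"
  assumes "prob_space M" and "prob_space M'" and "prob_space N"
    and "iid_cdf M X F"
    and "Q = quantile F"
    and "locally_abs_continuous Q"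
    and "(\<integral>\<^sup>+u. ennreal (sqrt (u * (1 - u))) \<partial>stieltjes_measure Q) < \<infinity>"
    and "is_density Q q"
    and "brownian_bridge N B"
    and "\<And>n. n \<ge> 1 \<Longrightarrow> multinomial_distributed M' n {..<n} (\<lambda>_. 1 / n) (W n)"
    and "\<And>n x. Qn n x = quantile (emp_cdf n (\<lambda>i. X i x))"
    and "\<And>n x x'. Qn_star n (x, x') =
      quantile (boot_cdf n (\<lambda>i. W n i x') (\<lambda>i. X i x))"
  shows "conv_in_distr_L1 M (\<lambda>n x u. sqrt n * (Qn n x u - Q u)) N (\<lambda>y u. - (q u * B y u)) \<and>
    tendsto_0_in_prob M (\<lambda>n x. \<integral>\<^sup>+u. ennreal \<bar>sqrt n * (Qn n x u - Q u)
      + q u * (sqrt n * (emp_cdf n (\<lambda>i. X i x) (Q u) - F (Q u)))\<bar> \<partial>unit_leb) \<and>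
    cond_conv_in_prob_L1 M M' (\<lambda>n (x, x') u. sqrt n * (Qn_star n (x, x') u - Qn n x u))
      N (\<lambda>y u. - (q u * B y u))"
proof -
  note M = assms(1) and X = assms(4) and W = assms(10)
  note Qn [simp] = assms(11) and Qn_star [simp] = assms(12)
  define \<mu> where "\<mu> = distr M borel (X 0)"
  have F: "F = cdf \<mu>" unfolding \<mu>_def by (rule iid_cdfD(3)[OF M X])
  \<comment> \<open>The given density is exchanged for an everywhere nonnegative Borel version; the
    two agree almost everywhere, so classes in \<open>l1\<close> and integrals are
    unaffected.\<close>
  obtain q' where q': "q' \<in> borel_measurable borel" "\<And>u. 0 \<le> q' u" "AE u in unit_leb. q u = q' u" "is_density Q q'"
    using is_density_borel[OF assms(8)] by blast
  interpret integrable_quantile \<mu> Q q'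
  proof (intro integrable_quantile.intro smooth_quantile.intro integrable_quantile_axioms.intro)
    show "real_distribution \<mu>" unfolding \<mu>_def by (rule iid_cdfD(1)[OF M X])
  qed (use assms F q' in auto)
  have X: "iid_cdf M X (cdf \<mu>)" using X F by simp
  have bridge: "bridge N B" using assms(3,9) by (simp add: bridge_def bridge_axioms_def)
  interpret N: bridge N B by (rule bridge)
  have Xm: "X i \<in> borel_measurable M" for i by (rule iid_cdfD(4)[OF M X])
  have q'_unit: "q' \<in> borel_measurable unit_leb" by (intro measurable_unit_leb measurable_unit_borelI q')
  have q_unit: "q \<in> borel_measurable unit_leb"
    by (rule unit_leb_measurable_AE[OF q'_unit]) (use q'(3) in eventually_elim, simp)
  have B_unit: "B y \<in> borel_measurable unit_leb" if "y \<in> space N" for y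
    by (rule measurable_unit_leb[OF bridge_path_measurable[OF bridge that]])
  have eq: "AE u in unit_leb. - (q u * B y u) = - (q' u * B y u)" for y using q'(3) by eventually_elim simp
  have limit_eq: "L1_of (\<lambda>u. - (q u * B y u)) = L1_of (\<lambda>u. - (q' u * B y u))" if y: "y \<in> space N" for y
    by (intro L1_of_cong_AE[OF eq] borel_measurable_uminus borel_measurable_times q_unit q'_unit B_unit[OF y])
  have limit_int: "AE y in N. integrable unit_leb (\<lambda>u. - (q u * B y u))"
    using AE_limit_integrable[OF bridge] AE_space
  proof eventually_elim
    case (elim y)
    have "integrable unit_leb (\<lambda>u. - (q u * B y u)) \<longleftrightarrow> integrable unit_leb (\<lambda>u. - (q' u * B y u))"
      by (intro integrable_cong_AE[OF _ _ eq] borel_measurable_uminus borel_measurable_times q_unit q'_unit B_unit elim(2))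
    with elim(1) show ?case by simp
  qed
  have limit_meas: "(\<lambda>y. L1_of (\<lambda>u. - (q u * B y u))) \<in> borel_measurable N"
    using limit_measurable[OF bridge] by (rule measurable_cong[THEN iffD2, rotated]) (rule limit_eq)
  have limit_expectation: "(\<integral>y. \<psi> (L1_of (\<lambda>u. - (q u * B y u))) \<partial>N) = (\<integral>y. \<psi> (L1_of (\<lambda>u. - (q' u * B y u))) \<partial>N)" for \<psi> :: "l1 \<Rightarrow> real"
    by (rule Bochner_Integration.integral_cong) (simp_all add: limit_eq)

  have 1: "conv_in_distr_L1 M (\<lambda>n x u. sqrt n * (Qn n x u - Q u)) N (\<lambda>y u. - (q u * B y u))"
    using emp_conv_in_distr[OF M X bridge] limit_int limit_meas emp_process_integrable[OF M X]
    by (simp add: conv_in_distr_L1_def conv_in_distr_def limit_expectation)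

  have "(\<integral>\<^sup>+u. ennreal \<bar>sqrt n * (Qn n x u - Q u) + q u * (sqrt n * (emp_cdf n (\<lambda>i. X i x) (Q u) - F (Q u)))\<bar> \<partial>unit_leb)
      = (\<integral>\<^sup>+u. ennreal \<bar>sqrt n * (Qn n x u - Q u) + q' u * (sqrt n * (emp_cdf n (\<lambda>i. X i x) (Q u) - F (Q u)))\<bar> \<partial>unit_borel)"
    for n x
  proof -
    have [measurable]: "Qn n x \<in> borel_measurable unit_borel" "Q \<in> borel_measurable unit_borel" "q' \<in> borel_measurable unit_borel"
      by (auto intro: Q_measurable quantile_finite_range_measurable finite_range_emp_cdf q')
    have [measurable]: "(\<lambda>u. emp_cdf n (\<lambda>i. X i x) (Q u)) \<in> borel_measurable unit_borel" "(\<lambda>u. F (Q u)) \<in> borel_measurable unit_borel"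
      using measurable_compose[OF Q_measurable emp_cdf_measurable] measurable_compose[OF Q_measurable F_measurable] by (simp_all add: F)
    have "(\<integral>\<^sup>+u. ennreal \<bar>sqrt n * (Qn n x u - Q u) + q u * (sqrt n * (emp_cdf n (\<lambda>i. X i x) (Q u) - F (Q u)))\<bar> \<partial>unit_leb)
        = (\<integral>\<^sup>+u. ennreal \<bar>sqrt n * (Qn n x u - Q u) + q' u * (sqrt n * (emp_cdf n (\<lambda>i. X i x) (Q u) - F (Q u)))\<bar> \<partial>unit_leb)"
      by (rule nn_integral_cong_AE) (use q'(3) in eventually_elim, simp)
    also have "\<dots> = (\<integral>\<^sup>+u. ennreal \<bar>sqrt n * (Qn n x u - Q u) + q' u * (sqrt n * (emp_cdf n (\<lambda>i. X i x) (Q u) - F (Q u)))\<bar> \<partial>unit_borel)"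
      by (rule nn_integral_unit_leb) measurable
    finally show ?thesis .
  qed
  then have 2: "tendsto_0_in_prob M (\<lambda>n x. \<integral>\<^sup>+u. ennreal \<bar>sqrt n * (Qn n x u - Q u)
      + q u * (sqrt n * (emp_cdf n (\<lambda>i. X i x) (Q u) - F (Q u)))\<bar> \<partial>unit_leb)"
    using emp_linearization_in_prob[OF M X] by (simp add: F)

  have "(\<lambda>p. L1_of (\<lambda>u. sqrt n * (quantile (boot_cdf n (\<lambda>i. W n i (snd p)) (\<lambda>i. X i (fst p))) u - quantile (emp_cdf n (\<lambda>i. X i (fst p))) u)))
      \<in> borel_measurable (M \<Otimes>\<^sub>M M')" for n
  proof (rule L1_of_quantile_boot_cdf_diff_measurable)
    show "(\<lambda>p. X i (fst p)) \<in> borel_measurable (M \<Otimes>\<^sub>M M')" for i by (rule measurable_compose[OF measurable_fst Xm])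
    fix i assume "i < n"
    then have "W n i \<in> measurable M' (count_space UNIV)" using W[of n] by (simp add: multinomial_distributed_def)
    then show "(\<lambda>p. W n i (snd p)) \<in> measurable (M \<Otimes>\<^sub>M M') (count_space UNIV)" by (rule measurable_compose[OF measurable_snd])
  qed
  then have boot_meas: "(\<lambda>p. L1_of (case p of (x, x') \<Rightarrow> \<lambda>u. sqrt n * (Qn_star n (x, x') u - Qn n x u))) \<in> borel_measurable (M \<Otimes>\<^sub>M M')" for n
    by (subst measurable_cong[where g="\<lambda>p. L1_of (\<lambda>u. sqrt n * (quantile (boot_cdf n (\<lambda>i. W n i (snd p)) (\<lambda>i. X i (fst p))) u - quantile (emp_cdf n (\<lambda>i. X i (fst p))) u))"])
      (auto simp: split_paired_all)
  have boot_int: "integrable unit_leb (case p of (x, x') \<Rightarrow> \<lambda>u. sqrt n * (Qn_star n (x, x') u - Qn n x u))" for n p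
    by (cases p) (auto intro!: integrable_mult_right Bochner_Integration.integrable_diff quantile_finite_range_integrable finite_range_emp_cdf finite_range_boot_cdf)
  have "tendsto_0_in_prob M (\<lambda>n x. SUP \<psi>\<in>BL1. ennreal \<bar>(\<integral>x'. \<psi> (L1_of (\<lambda>u. sqrt n * (Qn_star n (x, x') u - Qn n x u))) \<partial>M')
      - (\<integral>y. \<psi> (L1_of (\<lambda>u. - (q u * B y u))) \<partial>N)\<bar>)"
  \<comment> \<open>The weights are known to be multinomial only for \<open>n > 0\<close>, and a
    single index does not affect the limit.\<close>
  proof (rule tendsto_0_in_prob_cong[THEN iffD2, OF _ boot_BL1_uniform[OF M X bridge]])
    fix n :: nat and x assume "n > 0"
    then show "(SUP \<psi>\<in>BL1. ennreal \<bar>(\<integral>x'. \<psi> (L1_of (\<lambda>u. sqrt n * (Qn_star n (x, x') u - Qn n x u))) \<partial>M')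
        - (\<integral>y. \<psi> (L1_of (\<lambda>u. - (q u * B y u))) \<partial>N)\<bar>)
      = (SUP \<psi>\<in>BL1. ennreal \<bar>(\<integral>J. \<psi> (L1_of (\<lambda>u. sqrt n * (quantile (emp_cdf n (\<lambda>j. X (J j) x)) u - quantile (emp_cdf n (\<lambda>i. X i x)) u))) \<partial>resampling n)
        - (\<integral>y. \<psi> (L1_of (\<lambda>u. - (q' u * B y u))) \<partial>N)\<bar>)"
      using boot_transfer[OF assms(2) _ W[of n]] by (simp add: limit_expectation)
  qed
  then have "cond_conv_in_prob_L1 M M' (\<lambda>n (x, x') u. sqrt n * (Qn_star n (x, x') u - Qn n x u)) N (\<lambda>y u. - (q u * B y u))"
    using boot_meas boot_int limit_int limit_meas
    unfolding cond_conv_in_prob_L1_def cond_conv_in_prob_def by (simp only: prod.case) simp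
  with 1 2 show ?thesis by blast
qed

end
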